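(* Let $n\ge 1$ and let $K\subset\mathbb{R}^n$ be a convex body. Let $d$ be either the Hausdorff distance or the Banach–Mazur distance on convex bodies in $\mathbb{R}^n$. Then $K$ is a local maximizer, with respect to $d$, of the volume product $L\mapsto \Pi(L)$ on the convex bodies of $\mathbb{R}^n$ if and only if $K$ is an ellipsoid. (The assertion is made for each of the two choices of $d$.)
   Context: A convex body in $\mathbb{R}^n$ is a compact convex set with non-empty interior. $\langle\cdot,\cdot\rangle$ is the standard scalar product on $\mathbb{R}^n$ and $|A|$ denotes the Lebesgue measure of a Borel set $A\subset\mathbb{R}^n$. For a convex body $K$ and $z\in\mathrm{int}(K)$, the polar of $K$ with respect to $z$ is $$K^z=\{y\in\mathbb{R}^n : \langle y-z,x-z\rangle\le 1 \text{ for every } x\in K\}.$$ The volume product of $K$ is $$\Pi(K)=\min_{z\in\mathrm{int}(K)} |K|\,|K^z|$$ (the minimum is attained, at a unique point called the Santaló point of $K$). An ellipsoid is the image of the Euclidean unit ball $B_2^n=\{x\in\mathbb{R}^n:\langle x,x\rangle\le 1\}$ under an invertible affine map of $\mathbb{R}^n$ (not necessarily centered at the origin). The Hausdorff distance between convex bodies $K,L$ is $d_H(K,L)=\inf\{r\ge 0: K\subset L+rB_2^n,\ L\subset K+rB_2^n\}$. The Banach–Mazur distance between (not necessarily symmetric) convex bodies $K,L$ is $d_{BM}(K,L)=\inf\{\lambda\ge 1: K-x\subset T(L-y)\subset\lambda (K-x) \text{ for some } x,y\in\mathbb{R}^n \text{ and some invertible linear map } T\}$. $K$ is a local maximizer of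 the volume product with respect to the Hausdorff distance (resp. the Banach–Mazur distance) if there is $\varepsilon>0$ such that $\Pi(L)\le\Pi(K)$ for every convex body $L\subset\mathbb{R}^n$ with $d_H(K,L)<\varepsilon$ (resp. $d_{BM}(K,L)<1+\varepsilon$). *)

theory Defs
  imports "HOL-Analysis.Analysis" "HOL-Library.Set_Algebras"
begin

definition convex_body :: "'a::euclidean_space set \<Rightarrow> bool" where
  "convex_body K \<longleftrightarrow> compact K \<and> convex K \<and> interior K \<noteq> {}"

definition polar_at :: "'a::euclidean_space \<Rightarrow> 'a set \<Rightarrow> 'a set" where
  "polar_at z K = {y. \<forall>x\<in>K. (y - z) \<bullet> (x - z) \<le> 1}"

(* For a convex body the set of values is nonempty and bounded below by 0, so this infimum is a
   proper one; it is attained (at the Santalo point), hence it is the minimum. *)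
definition volume_product :: "'a::euclidean_space set \<Rightarrow> real" where
  "volume_product K =
     (INF z\<in>interior K. measure lebesgue K * measure lebesgue (polar_at z K))"

lemma volume_product_eq_minimum:
  assumes "s \<in> interior K"
    and "\<And>z. z \<in> interior K \<Longrightarrow>
           measure lebesgue K * measure lebesgue (polar_at s K)
             \<le> measure lebesgue K * measure lebesgue (polar_at z K)"
  shows "volume_product K = measure lebesgue K * measure lebesgue (polar_at s K)"
  unfolding volume_product_def by (rule cInf_eq_minimum) (use assms in auto)

definition ellipsoid :: "'a::euclidean_space set \<Rightarrow> bool" where
  "ellipsoid E \<longleftrightarrow>
     (\<exists>(T :: 'a \<Rightarrow> 'a) c. linear T \<and> bij T \<and> E = (\<lambda>x. T x + c) ` cball 0 1)"

(* The sum of sets is the Minkowski sum. *)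
definition hausdorff_distance :: "'a::euclidean_space set \<Rightarrow> 'a set \<Rightarrow> real" where
  "hausdorff_distance K L = Inf {r. 0 \<le> r \<and> K \<subseteq> L + cball 0 r \<and> L \<subseteq> K + cball 0 r}"

(* For convex bodies the set is nonempty: take x and y interior points and T a homothety. *)
definition banach_mazur_distance :: "'a::euclidean_space set \<Rightarrow> 'a set \<Rightarrow> real" where
  "banach_mazur_distance K L =
     Inf {t. 1 \<le> t \<and> (\<exists>x y T. linear T \<and> bij T \<and>
            (\<lambda>u. u - x) ` K \<subseteq> T ` (\<lambda>v. v - y) ` L \<and>
            T ` (\<lambda>v. v - y) ` L \<subseteq> (\<lambda>u. t *\<^sub>R (u - x)) ` K)}"

definition hausdorff_local_maximizer :: "'a::euclidean_space set \<Rightarrow> bool" where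
  "hausdorff_local_maximizer K \<longleftrightarrow>
     (\<exists>\<epsilon>>0. \<forall>L. convex_body L \<and> hausdorff_distance K L < \<epsilon>
        \<longrightarrow> volume_product L \<le> volume_product K)"

(* The Banach-Mazur distance is multiplicative: banach_mazur_distance K K = 1. *)
definition banach_mazur_local_maximizer :: "'a::euclidean_space set \<Rightarrow> bool" where
  "banach_mazur_local_maximizer K \<longleftrightarrow>
     (\<exists>\<epsilon>>0. \<forall>L. convex_body L \<and> banach_mazur_distance K L < 1 + \<epsilon>
        \<longrightarrow> volume_product L \<le> volume_product K)"

end

theory Submission
  imports Defs
begin

text \<open>Move along one direction \<open>u\<close>. The fibrewise midpoint of two bodies with the same shadow has minimal
  polar volume at least the harmonic mean of the two minimal polar volumes: shifting the two centres along \<open>u\<close>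
  in opposite directions, one can arrange that both polars are cut by the hyperplane orthogonal to \<open>u\<close> in the
  same proportion, and then a harmonic version of the Prekopa-Leindler inequality applies to each half.
  Start with the Steiner symmetral of \<open>K\<close> and take the midpoint with \<open>K\<close> again and again. These bodies have
  at least the volume of \<open>K\<close> and converge to \<open>K\<close>. If \<open>K\<close> is a local maximizer, the late ones therefore have minimal
  polar volume at most that of \<open>K\<close>, and the harmonic mean inequality carries this back, step by step, to the
  symmetral. There equality holds, which makes the polar of \<open>K\<close> a shear of that of its mirror image. So \<open>K\<close> is
  invariant under an affine reflection along every direction; in the coordinates of its inertia form these are all the
  orthogonal reflections, whence \<open>K\<close> is an ellipsoid.

  Conversely, the same midpoint inequality shows that Steiner symmetrisation along the coordinate axes does not
  decrease the volume product; for the resulting unconditional body the multiplicative form of Prekopa-Leindler bounds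
  it by that of the ball, so ellipsoids are even global maximizers.\<close>

section \<open>Log-concave functions on the line\<close>

text \<open>The harmonic mean is superadditive: harmonic bounds for the two halves of the polars add
  up to less than the harmonic mean of the totals unless the halves are proportional. Hence the
  centres must be balanced before the halves are added. The harmonic mean also makes a local
  hypothesis strong: for positive numbers \<open>2 * P * Q / (P + Q) \<le> P\<close> holds exactly
  when \<open>Q \<le> P\<close>, so a bound near \<open>K\<close> goes back to the symmetral without
  loss, however far away that is.

  The integral inequalities are reduced to one variable, where points at equal quantiles are joined
  and only the derivative along the resulting curve is estimated; this gives the equality cases
  along with the inequalities. Equality is then exploited weakly: for each vector, only planar
  images of the volume on one half of the polars are compared. Half-planes as test sets show which
  linear functionals are bounded by 1 there, and separation leads back to the bodies. As one half is
  missing, each body is recovered only up to a push along \<open>u\<close>; for \<open>K\<close> and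
  its mirror image the two pushes point in opposite directions, and convexity closes the
  gap.\<close>

definition profile :: "(real \<Rightarrow> real) \<Rightarrow> bool" where
  "profile f \<longleftrightarrow> (\<forall>x. 0 \<le> f x)
     \<and> (\<forall>x y a b. 0 < a \<longrightarrow> 0 < b \<longrightarrow> a + b = 1 \<longrightarrow> f x powr a * f y powr b \<le> f (a * x + b * y))
     \<and> (\<exists>C. \<forall>x. f x \<le> C) \<and> (\<exists>R. \<forall>x. R < \<bar>x\<bar> \<longrightarrow> f x = 0)"

text \<open>The interior is taken because log-concavity gives continuity only there. What is lost
  are the end points of the support interval, a null set.\<close>

definition pos :: "(real \<Rightarrow> real) \<Rightarrow> real set" where
  "pos f = interior {x. 0 < f x}"

definition cdf :: "(real \<Rightarrow> real) \<Rightarrow> real \<Rightarrow> real" where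
  "cdf f x = (LINT t|lborel. indicator {..x} t * f t)"

text \<open>After division by the arithmetic mean \<open>m\<close> the claim is the weighted sum of
  two instances of \<open>ln t \<le> t - 1\<close>, whose right-hand sides cancel. Equality there
  holds only at 1, which settles the equality case.\<close>

lemma weighted_am_gm:
  fixes x y a b :: real
  assumes "0 < a" "0 < b" "a + b = 1" "0 < x" "0 < y"
  shows "x powr a * y powr b \<le> a * x + b * y"
    and "x powr a * y powr b = a * x + b * y \<Longrightarrow> x = y"
proof -
  define m where "m = a * x + b * y"
  have m: "m > 0" using assms by (simp add: m_def add_pos_pos)
  have e: "x powr a * y powr b = m * exp (a * ln (x/m) + b * ln (y/m))"
  proof -
    have "m * exp (a * ln (x/m) + b * ln (y/m)) = m * exp (a * ln x + b * ln y - (a+b) * ln m)"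
      using assms(4,5) m by (simp only: ln_div distrib_right right_diff_distrib) (simp add: algebra_simps)
    also have "\<dots> = exp (a * ln x + b * ln y)" using m assms by (simp add: exp_diff)
    finally show ?thesis using assms by (simp add: powr_def exp_add)
  qed
  have s: "a * (x/m - 1) + b * (y/m - 1) = 0"
  proof -
    have "a * (x/m - 1) + b * (y/m - 1) = (a * x + b * y)/m - (a+b)" by (simp add: add_divide_distrib algebra_simps)
    thus ?thesis using m assms(3) by (simp add: m_def[symmetric])
  qed
  have l1: "a * ln (x/m) \<le> a * (x/m - 1)" "b * ln (y/m) \<le> b * (y/m - 1)"
    using assms m by (auto intro!: mult_left_mono ln_le_minus_one)
  hence "a * ln (x/m) + b * ln (y/m) \<le> 0" using s by linarith
  thus "x powr a * y powr b \<le> a * x + b * y" unfolding e m_def[symmetric] using m by simp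
  show "x = y" if "x powr a * y powr b = a * x + b * y"
  proof -
    have "exp (a * ln (x/m) + b * ln (y/m)) = 1" using that m unfolding e m_def[symmetric] by simp
    hence "a * ln (x/m) + b * ln (y/m) = 0" by simp
    hence "a * ln (x/m) = a * (x/m - 1)" "b * ln (y/m) = b * (y/m - 1)" using l1 s by linarith+
    hence "ln (x/m) = x/m - 1" "ln (y/m) = y/m - 1" using assms by auto
    hence "x/m = 1" "y/m = 1" using assms(4,5) m ln_eq_minus_one[of "x/m"] ln_eq_minus_one[of "y/m"] by simp_all
    thus ?thesis using m by simp
  qed
qed

section \<open>One profile: regularity, distribution function, quantiles\<close>

context
  fixes f :: "real \<Rightarrow> real"
  assumes f: "profile f"
begin

lemma profile_nonneg: "0 \<le> f x"
  using f by (simp add: profile_def)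

lemma profile_logconcave:
  "\<lbrakk>0 < a; 0 < b; a + b = 1\<rbrakk> \<Longrightarrow> f x powr a * f y powr b \<le> f (a * x + b * y)"
  using f by (simp add: profile_def)

lemma profile_superlevel_convex:
  assumes "0 \<le> t"
  shows "convex {x. t < f x}"
proof (rule convexI)
  fix x y u v :: real
  assume xy: "x \<in> {x. t < f x}" "y \<in> {x. t < f x}" and uv: "0 \<le> u" "0 \<le> v" "u + v = 1"
  show "u *\<^sub>R x + v *\<^sub>R y \<in> {x. t < f x}"
  proof (cases "u = 0 \<or> v = 0")
    case True then show ?thesis using xy uv by auto
  next
    case False
    hence uv': "0 < u" "0 < v" using uv by auto
    have "t = t powr u * t powr v" using assms uv by (simp add: powr_add[symmetric])
    also have "\<dots> < f x powr u * f y powr v"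
      using xy assms uv' by (intro mult_strict_mono' powr_less_mono2) auto
    also have "\<dots> \<le> f (u * x + v * y)" using profile_logconcave uv' uv by simp
    finally show ?thesis by simp
  qed
qed

lemma pos_convex: "convex (pos f)"
  unfolding pos_def using profile_superlevel_convex[of 0] by (simp add: convex_interior)

lemma pos_open: "open (pos f)"
  by (simp add: pos_def)

lemma pos_gt0: "x \<in> pos f \<Longrightarrow> 0 < f x"
  unfolding pos_def using interior_subset by blast

lemma pos_interval: "\<lbrakk>x \<in> pos f; y \<in> pos f; x \<le> t; t \<le> y\<rbrakk> \<Longrightarrow> t \<in> pos f"
  using pos_convex is_interval_convex_1 mem_is_interval_1_I by metis

text \<open>Superlevel sets are intervals, so measurability need not be a part of
  \<open>profile\<close>, and marginals, which are again profiles, get it for free.\<close>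

lemma profile_measurable: "f \<in> borel_measurable borel"
proof (subst borel_measurable_iff_greater, intro allI)
  fix a
  have "{w \<in> space borel. a < f w} = (if a < 0 then UNIV else {w. a < f w})"
    using profile_nonneg by (auto intro: less_le_trans)
  moreover have "a \<ge> 0 \<Longrightarrow> {w. a < f w} \<in> sets borel"
    using profile_superlevel_convex[of a] is_interval_convex_1 real_interval_borel_measurable by blast
  ultimately show "{w \<in> space borel. a < f w} \<in> sets borel" by (cases "a < 0") simp_all
qed

lemma profile_integrable: "integrable lborel f"
proof -
  obtain C R where C: "\<And>x. f x \<le> C" and R: "\<And>x. R < \<bar>x\<bar> \<Longrightarrow> f x = 0"
    using f by (auto simp: profile_def)
  show ?thesis
  proof (rule Bochner_Integration.integrable_bound[of lborel "\<lambda>x. C * indicator {-R..R} x"])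
    show "integrable lborel (\<lambda>x. C * indicator {-R..R} x :: real)"
      by (intro integrable_mult_right integrable_real_indicator) (auto simp: emeasure_lborel_Icc_eq)
    show "f \<in> borel_measurable lborel" using profile_measurable by simp
    show "AE x in lborel. norm (f x) \<le> norm (C * indicator {- R..R} x)"
    proof (rule AE_I2)
      fix x
      have "0 \<le> f x" "f x \<le> C" by (auto simp: C profile_nonneg)
      thus "norm (f x) \<le> norm (C * indicator {- R..R} x)"
        using R[of x] by (cases "x \<in> {-R..R}") auto
    qed
  qed
qed

lemma profile_int_indicator:
  assumes "A \<in> sets borel" shows "integrable lborel (\<lambda>t. indicator A t * f t)"
  using integrable_mult_indicator[OF _ profile_integrable, of A] assms by simp

lemma profile_continuous: "continuous_on (pos f) f"
proof -
  have "convex_on (pos f) (\<lambda>x. - ln (f x))"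
  proof (rule convex_onI)
    fix t x y :: real assume t: "0 < t" "t < 1" and xy: "x \<in> pos f" "y \<in> pos f"
    have p: "0 < f x" "0 < f y" using xy pos_gt0 by auto
    have "(1 - t) * x + t * y \<in> pos f" using pos_convex xy t by (simp add: convex_def)
    hence p2: "0 < f ((1-t)*x+t*y)" using pos_gt0 by blast
    have "f x powr (1-t) * f y powr t \<le> f ((1-t)*x+t*y)" using profile_logconcave t by simp
    hence "ln (f x powr (1-t) * f y powr t) \<le> ln (f ((1-t)*x+t*y))" using p p2 by simp
    hence "(1-t) * ln (f x) + t * ln (f y) \<le> ln (f ((1-t)*x+t*y))" using p by (simp add: ln_mult ln_powr)
    thus "- ln (f ((1 - t) *\<^sub>R x + t *\<^sub>R y)) \<le> (1 - t) * - ln (f x) + t * - ln (f y)" by simp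
  qed (rule pos_convex)
  hence "continuous_on (pos f) (\<lambda>x. - ln (f x))" by (rule convex_on_continuous[OF pos_open])
  from continuous_on_exp[OF continuous_on_minus[OF this]] show ?thesis
    by (rule continuous_on_eq) (simp add: pos_gt0)
qed

lemma profile_AE_zero: "AE x in lborel. x \<notin> pos f \<longrightarrow> f x = 0"
proof -
  have c: "convex {x. 0 < f x}" using profile_superlevel_convex[of 0] by simp
  have "negligible (frontier {x. 0 < f x})" using negligible_convex_frontier[OF c] .
  moreover have "closed (frontier {x. 0 < f x})" by simp
  ultimately have n: "frontier {x. 0 < f x} \<in> null_sets lborel"
    by (simp add: negligible_iff_null_sets null_sets_completion_iff borel_closed)
  show ?thesis
  proof (rule AE_I'[OF n], rule)
    fix x assume "x \<in> {x \<in> space lborel. \<not> (x \<notin> pos f \<longrightarrow> f x = 0)}"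
    hence "x \<notin> pos f" "0 < f x" using profile_nonneg[of x] by auto
    thus "x \<in> frontier {x. 0 < f x}" using closure_subset[of "{x. 0 < f x}"] by (auto simp: frontier_def pos_def)
  qed
qed

lemma cdf_diff:
  assumes "x \<le> y"
  shows "cdf f y - cdf f x = (LINT t|lborel. indicator {x<..y} t * f t)"
proof -
  have "indicator {..y} t * f t - indicator {..x} t * f t = indicator {x<..y} t * f t" for t
    using assms by (auto simp: indicator_def)
  thus ?thesis unfolding cdf_def
    by (subst Bochner_Integration.integral_diff[symmetric]) (auto intro!: profile_int_indicator)
qed

lemma cdf_mono: "x \<le> y \<Longrightarrow> cdf f x \<le> cdf f y"
proof -
  assume "x \<le> y"
  moreover have "0 \<le> (LINT t|lborel. indicator {x<..y} t * f t)"
    by (intro integral_nonneg_AE) (auto simp: profile_nonneg)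
  ultimately show ?thesis using cdf_diff by force
qed

lemma cdf_nonneg: "0 \<le> cdf f x"
  unfolding cdf_def by (intro integral_nonneg_AE) (auto simp: profile_nonneg)

lemma cdf_le: "cdf f x \<le> (LINT t|lborel. f t)"
  unfolding cdf_def
  by (intro integral_mono profile_int_indicator profile_integrable) (auto simp: profile_nonneg indicator_def)

lemma cdf_deriv:
  assumes "x \<in> pos f"
  shows "(cdf f has_real_derivative f x) (at x)"
proof -
  obtain e where e: "e > 0" "cball x e \<subseteq> pos f" using assms pos_open open_contains_cball by metis
  have sub: "{x-e..x+e} \<subseteq> pos f" using e by (simp add: cball_eq_atLeastAtMost)
  have c: "continuous_on {x-e..x+e} f" using profile_continuous continuous_on_subset sub by blast
  have d: "((\<lambda>u. integral {x-e..u} f) has_real_derivative f x) (at x within {x-e..x+e})"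
    by (rule integral_has_real_derivative[OF c]) (use e in auto)
  have eq: "cdf f u = cdf f (x-e) + integral {x-e..u} f" if "u \<in> {x-e..x+e}" for u
  proof -
    have cu: "continuous_on {x-e..u} f" using c that continuous_on_subset by fastforce
    have "(LINT t|lborel. indicator {x-e<..u} t * f t) = (LINT t:{x-e..u}|lborel. f t)"
      unfolding set_lebesgue_integral_def
    proof (intro integral_cong_AE)
      show "AE t in lborel. indicator {x - e<..u} t * f t = indicat_real {x - e..u} t *\<^sub>R f t"
        using AE_lborel_singleton[of "x-e"] by eventually_elim (auto simp: indicator_def)
    qed (use profile_measurable in auto)
    also have "\<dots> = integral {x-e..u} f"
      by (intro set_borel_integral_eq_integral borel_integrable_atLeastAtMost') (rule cu)
    finally show ?thesis using cdf_diff[of "x-e" u] that by simp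
  qed
  have "((\<lambda>u. cdf f (x-e) + integral {x-e..u} f) has_real_derivative f x) (at x within {x-e..x+e})"
    using DERIV_add[OF DERIV_const[of "cdf f (x-e)"] d] by simp
  hence "(cdf f has_real_derivative f x) (at x within {x-e..x+e})"
    by (rule has_field_derivative_transform_within[where d=1]) (use e in \<open>simp_all only: eq[symmetric], auto\<close>)
  moreover have "at x within {x-e..x+e} = at x"
    by (rule at_within_interior) (use e in \<open>auto simp: interior_atLeastAtMost_real\<close>)
  ultimately show ?thesis by simp
qed

lemma cdf_continuous: "continuous_on UNIV (cdf f)"
proof -
  obtain C where C: "\<And>x. f x \<le> C" using f by (auto simp: profile_def)
  have C0: "C \<ge> 0" using C[of 0] profile_nonneg[of 0] by simp
  have l: "\<bar>cdf f y - cdf f x\<bar> \<le> C * \<bar>y - x\<bar>" if "x \<le> y" for x y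
  proof -
    have "cdf f y - cdf f x \<le> (LINT t|lborel. indicator {x<..y} t * C)"
      unfolding cdf_diff[OF that]
      by (intro integral_mono profile_int_indicator integrable_mult_left integrable_real_indicator)
        (auto simp: indicator_def C emeasure_lborel_Ioc[OF that])
    also have "\<dots> = C * (y - x)" using that by simp
    finally show ?thesis using cdf_mono[OF that] that by simp
  qed
  have "C-lipschitz_on UNIV (cdf f)"
  proof (rule lipschitz_onI)
    fix x y show "dist (cdf f x) (cdf f y) \<le> C * dist x y"
      using l[of x y] l[of y x] by (cases "x \<le> y") (auto simp: dist_real_def abs_minus_commute)
  qed (rule C0)
  thus ?thesis by (rule lipschitz_on_continuous_on)
qed

lemma cdf_strict:
  assumes "x \<in> pos f" "y \<in> pos f" "x < y" shows "cdf f x < cdf f y"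
proof (rule DERIV_pos_imp_increasing[OF assms(3)])
  fix t assume "x \<le> t" "t \<le> y"
  hence "t \<in> pos f" using pos_interval assms by blast
  thus "\<exists>y. (cdf f has_real_derivative y) (at t) \<and> 0 < y" using cdf_deriv pos_gt0 by blast
qed

text \<open>The intermediate value theorem gives some \<open>x\<close>. A point outside the interval
  \<open>pos f\<close> has all of \<open>pos f\<close> on one side, so the distribution function
  there is 0 or the full integral and never a value strictly between.\<close>

lemma quantile_exists:
  assumes q: "0 < q" "q < (LINT t|lborel. f t)"
  shows "\<exists>x\<in>pos f. cdf f x = q"
proof -
  let ?I = "LINT t|lborel. f t"
  obtain R where R: "\<And>x. R < \<bar>x\<bar> \<Longrightarrow> f x = 0" using f by (auto simp: profile_def)
  \<comment> \<open>The vanishing condition needs \<open>R < \<bar>x\<bar>\<close> strictly, also at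
    the end points \<open>S\<close> and \<open>- S\<close>; the absolute value allows for a negative
    \<open>R\<close>.\<close>
  define S where "S = \<bar>R\<bar> + 1"
  have "(\<lambda>t. indicator {..-S} t * f t) = (\<lambda>t. 0)"
    using R by (intro ext) (auto simp: indicator_def S_def)
  hence 0: "cdf f (-S) = 0" unfolding cdf_def by simp
  have "(\<lambda>t. indicator {..S} t * f t) = f"
    using R by (intro ext) (auto simp: indicator_def S_def)
  hence 1: "cdf f S = ?I" unfolding cdf_def by simp
  have "\<exists>x. -S \<le> x \<and> x \<le> S \<and> cdf f x = q"
    by (rule IVT') (use q 0 1 cdf_continuous continuous_on_subset in \<open>auto simp: S_def\<close>)
  then obtain x where x: "cdf f x = q" by blast
  have "x \<in> pos f"
  proof (rule ccontr)
    assume n: "x \<notin> pos f"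
    have "(\<forall>y\<in>pos f. x < y) \<or> (\<forall>y\<in>pos f. y < x)"
    proof (rule ccontr)
      assume "\<not> ?thesis"
      then obtain y z where "y \<in> pos f" "z \<in> pos f" "y \<le> x" "x \<le> z" by force
      thus False using pos_interval n by blast
    qed
    thus False
    proof
      assume a: "\<forall>y\<in>pos f. x < y"
      have "AE t in lborel. indicator {..x} t * f t = 0"
        using profile_AE_zero by eventually_elim (auto simp: indicator_def dest: a[rule_format])
      hence "cdf f x = 0" unfolding cdf_def by (rule integral_eq_zero_AE)
      thus False using x q by simp
    next
      assume a: "\<forall>y\<in>pos f. y < x"
      have "AE t in lborel. indicator {..x} t * f t = f t"
        using profile_AE_zero by eventually_elim (auto simp: indicator_def dest: a[rule_format])
      hence "cdf f x = ?I" unfolding cdf_def using profile_measurable by (intro integral_cong_AE) auto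
      thus False using x q by simp
    qed
  qed
  thus ?thesis using x by blast
qed

text \<open>Parametrises \<open>pos f\<close> by the fraction of mass to the left. The derivative
  \<open>I / f (x q)\<close>, obtained by inverting \<open>cdf f\<close>, is what later turns a
  pointwise inequality between functions into one between integrals.\<close>

lemma quantile:
  assumes I: "I = (LINT t|lborel. f t)" "0 < I"
  obtains x where "\<And>q. 0 < q \<Longrightarrow> q < 1 \<Longrightarrow> x q \<in> pos f"
    "\<And>q. 0 < q \<Longrightarrow> q < 1 \<Longrightarrow> cdf f (x q) = q * I"
    "\<And>q. 0 < q \<Longrightarrow> q < 1 \<Longrightarrow> (x has_real_derivative I / f (x q)) (at q)"
    "\<And>y. y \<in> pos f \<Longrightarrow> \<exists>q. 0 < q \<and> q < 1 \<and> x q = y"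
proof -
  define x where "x q = (SOME y. y \<in> pos f \<and> cdf f y = q * I)" for q
  have x: "x q \<in> pos f \<and> cdf f (x q) = q * I" if "0 < q" "q < 1" for q
    unfolding x_def by (rule someI_ex) (use quantile_exists[of "q*I"] that I in auto)
  have inj: "y = z" if "y \<in> pos f" "z \<in> pos f" "cdf f y = cdf f z" for y z
    using cdf_strict that by (metis less_irrefl linorder_neqE_linordered_idom)
  have rng: "0 < cdf f y \<and> cdf f y < I" if "y \<in> pos f" for y
  proof -
    obtain e where e: "e > 0" "cball y e \<subseteq> pos f" using \<open>y \<in> pos f\<close> pos_open open_contains_cball_eq by blast
    hence "y - e \<in> pos f" "y + e \<in> pos f" by (auto simp: cball_def dist_real_def subset_iff)
    hence "cdf f (y-e) < cdf f y" "cdf f y < cdf f (y+e)" using cdf_strict e that by auto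
    thus ?thesis using cdf_nonneg[of "y-e"] cdf_le[of "y+e"] I by linarith
  qed
  have xinv: "x (cdf f y / I) = y" if "y \<in> pos f" for y
    using x[of "cdf f y / I"] rng[OF that] I inj that by (simp add: field_simps)
  have d: "(x has_real_derivative I / f (x q)) (at q)" if q: "0 < q" "q < 1" for q
  proof -
    have g0: "f (x q) > 0" using x[OF q] pos_gt0 by blast
    have "(x has_derivative (*) (I / f (x q))) (at (cdf f (x q) / I))"
    proof (rule has_derivative_inverse_strong[where S = "pos f" and f = "\<lambda>y. cdf f y / I" and x = "x q" and f' = "(*) (f (x q) / I)"])
      show "continuous_on (pos f) (\<lambda>y. cdf f y / I)"
        using cdf_continuous by (intro continuous_intros) (auto intro: continuous_on_subset simp: I(2) less_imp_neq[OF I(2), symmetric])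
      show "((\<lambda>y. cdf f y / I) has_derivative (*) (f (x q) / I)) (at (x q))"
        using cdf_deriv[of "x q"] x[OF q] DERIV_cdivide unfolding has_field_derivative_def[symmetric] by blast
    qed (use x[OF q] xinv pos_open I g0 in \<open>auto simp: fun_eq_iff\<close>)
    thus ?thesis using x[OF q] I by (simp add: has_field_derivative_def)
  qed
  have s: "\<exists>q. 0 < q \<and> q < 1 \<and> x q = y" if "y \<in> pos f" for y
    using xinv[OF that] rng[OF that] I by (intro exI[of _ "cdf f y / I"]) auto
  show ?thesis
    by (rule that[of x]) (use x d s in blast)+
qed

text \<open>A change of variables along a curve that need not be the quantile curve of
  \<open>f\<close>. The derivative of \<open>cdf f (S q) - c * q\<close> is
  \<open>f (S q) * S' q - c\<close>, so this function does not decrease, while it lies between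
  \<open>- c * q\<close> and the integral minus \<open>c * q\<close>; letting \<open>q\<close> tend
  to 0 and to 1 gives the inequality. If the integral is \<open>c\<close>, the lower bound tends to
  0 at the left end and the upper bound at the right end. The function then vanishes identically,
  and \<open>S\<close> is the quantile curve of \<open>f\<close> after all.\<close>

lemma transport:
  assumes S: "\<And>q. 0 < q \<Longrightarrow> q < 1 \<Longrightarrow> (S has_real_derivative S' q) (at q)"
    "\<And>q. 0 < q \<Longrightarrow> q < 1 \<Longrightarrow> S q \<in> pos f"
    "\<And>q. 0 < q \<Longrightarrow> q < 1 \<Longrightarrow> c \<le> f (S q) * S' q"
  shows "c \<le> (LINT t|lborel. f t)"
    and "\<lbrakk>(LINT t|lborel. f t) = c; 0 < q; q < 1\<rbrakk> \<Longrightarrow> f (S q) * S' q = c"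
    and "\<lbrakk>(LINT t|lborel. f t) = c; 0 < q; q < 1\<rbrakk> \<Longrightarrow> cdf f (S q) = q * c"
proof -
  define g where "g q = cdf f (S q) - c * q" for q
  have dg: "(g has_real_derivative f (S q) * S' q - c) (at q)" if "0 < q" "q < 1" for q
  proof -
    have "((\<lambda>q. cdf f (S q)) has_real_derivative f (S q) * S' q) (at q)"
      using DERIV_chain2[OF cdf_deriv[OF S(2)] S(1)] that by blast
    thus ?thesis unfolding g_def by (auto intro!: derivative_eq_intros)
  qed
  have mono: "g p \<le> g q" if "0 < p" "p \<le> q" "q < 1" for p q
  proof (rule DERIV_nonneg_imp_nondecreasing[OF that(2)])
    fix t assume "p \<le> t" "t \<le> q"
    hence t: "0 < t" "t < 1" using that by auto
    show "\<exists>y. (g has_real_derivative y) (at t) \<and> 0 \<le> y"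
      using dg[OF t] S(3)[OF t] by (intro exI[of _ "f (S t) * S' t - c"]) simp
  qed
  have b1: "g q \<le> (LINT t|lborel. f t) - c * q" "- c * q \<le> g q" for q
    using cdf_le cdf_nonneg by (auto simp: g_def)
  show main: "c \<le> (LINT t|lborel. f t)"
  proof (rule field_le_epsilon)
    fix e :: real assume e: "e > 0"
    \<comment> \<open>Comparing \<open>g p\<close> with \<open>g (1 - p)\<close> loses
      \<open>2 * p * c\<close>, and this choice keeps the loss below \<open>e\<close>.\<close>
    define p where "p = min (1/2) (e / (2 * (\<bar>c\<bar> + 1)))"
    have p: "0 < p" "p \<le> 1/2" "p \<le> e / (2 * (\<bar>c\<bar> + 1))"
      unfolding p_def using e by (simp_all only: min.cobounded1 min.cobounded2) (auto simp: min_def)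
    have p3: "2 * p * (\<bar>c\<bar> + 1) \<le> e" using p(3) by (simp add: pos_le_divide_eq mult_ac)
    have "g p \<le> g (1 - p)" using p by (intro mono) auto
    hence "- c * p \<le> (LINT t|lborel. f t) - c * (1 - p)" using b1[of p] b1[of "1-p"] by linarith
    hence "c \<le> (LINT t|lborel. f t) + 2 * p * c" by (simp add: algebra_simps)
    moreover have "2 * p * c \<le> 2 * p * (\<bar>c\<bar> + 1)" using p by (intro mult_left_mono) auto
    ultimately show "c \<le> (LINT t|lborel. f t) + e" using p3 by linarith
  qed
  assume eq: "(LINT t|lborel. f t) = c"
  have c0: "c \<ge> 0" using eq cdf_nonneg cdf_le order_trans by blast
  have g0: "g q = 0" if q: "0 < q" "q < 1" for q
  proof (rule antisym)
    show "g q \<le> 0"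
    proof (rule field_le_epsilon)
      fix e :: real assume e: "e > 0"
      \<comment> \<open>The divisor is \<open>c + 1\<close> because \<open>c\<close> may be
        0.\<close>
      define p where "p = max q (1 - e / (c + 1))"
      have p: "q \<le> p" "p < 1" "1 - p \<le> e / (c+1)" using q e c0 by (auto simp: p_def)
      have "g q \<le> c - c * p" using mono[of q p] b1(1)[of p] p q eq by auto
      also have "\<dots> \<le> (c + 1) * (1 - p)" using p by (simp add: algebra_simps)
      also have "\<dots> \<le> (c+1) * (e / (c+1))" using p c0 by (intro mult_left_mono) auto
      also have "\<dots> = e" using c0 by simp
      finally show "g q \<le> 0 + e" by simp
    qed
    show "0 \<le> g q"
    proof (rule field_le_epsilon)
      fix e :: real assume e: "e > 0"
      define p where "p = min q (e / (c + 1))"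
      have p: "p \<le> q" "0 < p" "p \<le> e / (c+1)" using q e c0 by (auto simp: p_def)
      have "- g q \<le> c * p" using mono[of p q] b1(2)[of p] p q by auto
      also have "\<dots> \<le> (c + 1) * p" using p by (simp add: algebra_simps)
      also have "\<dots> \<le> (c+1) * (e / (c+1))" using p c0 by (intro mult_left_mono) auto
      also have "\<dots> = e" using c0 by simp
      finally show "0 \<le> g q + e" by simp
    qed
  qed
  assume q: "0 < q" "q < 1"
  show "cdf f (S q) = q * c" using g0[OF q] by (simp add: g_def mult.commute)
  have "(g has_real_derivative 0) (at q)"
    by (rule has_field_derivative_transform_within_open[of "\<lambda>_. 0" _ _ "{0<..<1}"]) (use q g0 in auto)
  hence "f (S q) * S' q - c = 0" using dg[OF q] DERIV_unique by blast
  thus "f (S q) * S' q = c" by simp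
qed

end

section \<open>Prekopa-Leindler on the line and its equality case\<close>

lemma pos_between:
  assumes "profile f" "0 < f u" "0 < f v" "u < s" "s < v"
  shows "s \<in> pos f"
proof -
  have "convex {x. 0 < f x}" using profile_superlevel_convex[OF assms(1), of 0] by simp
  hence "{u<..<v} \<subseteq> {x. 0 < f x}"
    using assms(2,3) is_interval_convex_1 mem_is_interval_1_I[of "{x. 0 < f x}" u v] by fastforce
  hence "{u<..<v} \<subseteq> pos f" unfolding pos_def by (intro interior_maximal) auto
  thus ?thesis using assms by auto
qed

lemma pos_neighbours:
  assumes "x \<in> pos f"
  obtains e where "e > 0" "\<And>t. \<bar>t - x\<bar> \<le> e \<Longrightarrow> t \<in> pos f"
proof -
  have "open (pos f)" by (simp add: pos_def)
  then obtain e where e: "e > 0" "cball x e \<subseteq> pos f" using assms open_contains_cball by blast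
  show ?thesis by (rule that[OF e(1)]) (use e(2) in \<open>auto simp: cball_def dist_real_def abs_minus_commute subset_iff\<close>)
qed

lemma cdf_inj:
  assumes "profile f" "y \<in> pos f" "z \<in> pos f" "cdf f y = cdf f z" shows "y = z"
  using cdf_strict[OF assms(1)] assms by (metis less_irrefl linorder_neqE_linordered_idom)

lemma profile_integral_nonneg: "profile f \<Longrightarrow> 0 \<le> (LINT t|lborel. f t)"
  by (intro integral_nonneg_AE) (auto simp: profile_nonneg)

text \<open>\<open>I / f\<close> and \<open>J / g\<close> are the speeds of two quantile curves.
  Splitting off \<open>f powr a * g powr b\<close> from \<open>I powr a * J powr b\<close> leaves
  the weighted geometric mean of these speeds.\<close>

lemma am_gm_integrals:
  fixes a b I J f g h :: real
  assumes "0 < a" "0 < b" "a + b = 1" "0 < I" "0 < J" "0 < f" "0 < g" "f powr a * g powr b \<le> h"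
  shows "I powr a * J powr b \<le> h * (a * (I / f) + b * (J / g))"
proof -
  have "I powr a * J powr b = f powr a * g powr b * ((I/f) powr a * (J/g) powr b)"
    using assms by (simp add: powr_divide)
  also have "\<dots> \<le> h * (a * (I / f) + b * (J / g))"
  proof (intro mult_mono weighted_am_gm(1))
    show "0 \<le> h" using assms(8) by (rule order_trans[rotated]) simp
  qed (use assms in auto)
  finally show ?thesis .
qed

text \<open>Points at equal quantiles of \<open>f\<close> and \<open>g\<close> are combined, and
  \<open>transport\<close> runs along \<open>a * x q + b * y q\<close>. A vanishing integral is
  split off because then there are no quantiles.\<close>

lemma prekopa_leindler_1:
  assumes f: "profile f" and g: "profile g" and h: "profile h"
    and ab: "0 < a" "0 < b" "a + b = 1"
    and le: "\<And>x y. f x powr a * g y powr b \<le> h (a * x + b * y)"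
  shows "(LINT t|lborel. f t) powr a * (LINT t|lborel. g t) powr b \<le> (LINT t|lborel. h t)"
proof (cases "(LINT t|lborel. f t) = 0 \<or> (LINT t|lborel. g t) = 0")
  case True
  then show ?thesis using profile_integral_nonneg[OF h] by auto
next
  case False
  define I J where IJ: "I = (LINT t|lborel. f t)" "J = (LINT t|lborel. g t)"
  have p: "0 < I" "0 < J" using False profile_integral_nonneg[OF f] profile_integral_nonneg[OF g] IJ by auto
  obtain x where x: "\<And>q. 0 < q \<Longrightarrow> q < 1 \<Longrightarrow> x q \<in> pos f"
    "\<And>q. 0 < q \<Longrightarrow> q < 1 \<Longrightarrow> (x has_real_derivative I / f (x q)) (at q)"
    using quantile[OF f IJ(1) p(1)] by metis
  obtain y where y: "\<And>q. 0 < q \<Longrightarrow> q < 1 \<Longrightarrow> y q \<in> pos g"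
    "\<And>q. 0 < q \<Longrightarrow> q < 1 \<Longrightarrow> (y has_real_derivative J / g (y q)) (at q)"
    using quantile[OF g IJ(2) p(2)] by metis
  have "I powr a * J powr b \<le> (LINT t|lborel. h t)"
  proof (rule transport(1)[OF h, where S="\<lambda>q. a * x q + b * y q" and S'="\<lambda>q. a * (I / f (x q)) + b * (J / g (y q))"])
    fix q :: real assume q: "0 < q" "q < 1"
    show "((\<lambda>q. a * x q + b * y q) has_real_derivative a * (I / f (x q)) + b * (J / g (y q))) (at q)"
      by (intro DERIV_add DERIV_cmult x(2)[OF q] y(2)[OF q])
    have fg: "0 < f (x q)" "0 < g (y q)" using x(1)[OF q] y(1)[OF q] pos_gt0 f g by blast+
    show "I powr a * J powr b \<le> h (a * x q + b * y q) * (a * (I / f (x q)) + b * (J / g (y q)))"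
      by (rule am_gm_integrals) (use ab p fg le in auto)
    obtain e where e: "e > 0" "\<And>t. \<bar>t - x q\<bar> \<le> e \<Longrightarrow> t \<in> pos f" using pos_neighbours x(1)[OF q] by metis
    have hp: "0 < h (a * s + b * y q)" if "s \<in> pos f" for s
    proof -
      have "0 < f s powr a * g (y q) powr b" using pos_gt0[OF f that] fg by simp
      thus ?thesis using le[of s "y q"] by linarith
    qed
    \<comment> \<open>Positivity of \<open>h\<close> at the point is not enough, since
      \<open>pos h\<close> is an interior. Moving \<open>x q\<close> by \<open>e\<close> to either
      side gives positive values on both sides of the point.\<close>
    show "a * x q + b * y q \<in> pos h"
    proof (rule pos_between[OF h])
      show "0 < h (a * (x q - e) + b * y q)" by (rule hp) (use e in auto)
      show "0 < h (a * (x q + e) + b * y q)" by (rule hp) (use e in auto)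
    qed (use e(1) ab in \<open>auto simp: algebra_simps\<close>)
  qed
  thus ?thesis by (simp add: IJ)
qed

lemma pos_eq_range:
  assumes h: "profile h" "I = (LINT t|lborel. h t)" "0 < I"
    and S: "\<And>q. 0 < q \<Longrightarrow> q < 1 \<Longrightarrow> S q \<in> pos h" "\<And>q. 0 < q \<Longrightarrow> q < 1 \<Longrightarrow> cdf h (S q) = q * I"
  shows "pos h = S ` {0<..<1}"
proof -
  obtain z where z: "\<And>q. 0 < q \<Longrightarrow> q < 1 \<Longrightarrow> z q \<in> pos h"
    "\<And>q. 0 < q \<Longrightarrow> q < 1 \<Longrightarrow> cdf h (z q) = q * I"
    "\<And>y. y \<in> pos h \<Longrightarrow> \<exists>q. 0 < q \<and> q < 1 \<and> z q = y"
    using quantile[OF h] by metis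
  have "z q = S q" if "0 < q" "q < 1" for q
    by (rule cdf_inj[OF h(1)]) (use z S that in auto)
  thus ?thesis using z(3) S(1) by (force simp: image_iff)
qed

text \<open>Equality in \<open>transport\<close> forces equality between the arithmetic and
  geometric means of the two speeds, so \<open>f (x q) = g (y q)\<close>. The quantile curves then
  have the same derivative and differ by a constant.\<close>

lemma prekopa_leindler_1_equality:
  assumes f: "profile f" and g: "profile g" and h: "profile h"
    and le: "\<And>x y. sqrt (f x * g y) \<le> h ((x + y) / 2)"
    and I: "(LINT t|lborel. f t) = I" "(LINT t|lborel. g t) = I" "(LINT t|lborel. h t) = I" "0 < I"
  obtains c where "pos g = (\<lambda>x. x + c) ` pos f" "pos h = (\<lambda>x. x + c / 2) ` pos f" "\<And>x. x \<in> pos f \<Longrightarrow> g (x + c) = f x"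
proof -
  obtain x where x: "\<And>q. 0 < q \<Longrightarrow> q < 1 \<Longrightarrow> x q \<in> pos f"
    "\<And>q. 0 < q \<Longrightarrow> q < 1 \<Longrightarrow> cdf f (x q) = q * I"
    "\<And>q. 0 < q \<Longrightarrow> q < 1 \<Longrightarrow> (x has_real_derivative I / f (x q)) (at q)"
    using quantile[OF f I(1)[symmetric] I(4)] by metis
  obtain y where y: "\<And>q. 0 < q \<Longrightarrow> q < 1 \<Longrightarrow> y q \<in> pos g"
    "\<And>q. 0 < q \<Longrightarrow> q < 1 \<Longrightarrow> cdf g (y q) = q * I"
    "\<And>q. 0 < q \<Longrightarrow> q < 1 \<Longrightarrow> (y has_real_derivative I / g (y q)) (at q)"
    using quantile[OF g I(2)[symmetric] I(4)] by metis
  define S S' where S: "S q = (x q + y q) / 2" "S' q = (I / f (x q) + I / g (y q)) / 2" for q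
  have fg: "0 < f (x q)" "0 < g (y q)" if "0 < q" "q < 1" for q
    using x(1)[OF that] y(1)[OF that] pos_gt0 f g by blast+
  have 1: "(S has_real_derivative S' q) (at q)" if q: "0 < q" "q < 1" for q
    unfolding S using x(3)[OF q] y(3)[OF q] by (intro DERIV_cdivide DERIV_add)
  have am: "I \<le> sqrt (u * v) * ((I / u + I / v) / 2)" if "0 < u" "0 < v" for u v
  proof -
    have "I = sqrt (u * v) * sqrt (I/u * (I/v))" using that I(4) by (simp add: real_sqrt_mult real_sqrt_divide)
    also have "\<dots> \<le> sqrt (u * v) * ((I / u + I / v) / 2)"
      using that I(4) by (intro mult_left_mono arith_geo_mean_sqrt) auto
    finally show ?thesis .
  qed
  have 3: "I \<le> h (S q) * S' q" if q: "0 < q" "q < 1" for q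
  proof -
    have "sqrt (f (x q) * g (y q)) * S' q \<le> h (S q) * S' q"
      using le[of "x q" "y q"] fg[OF q] I(4) by (intro mult_right_mono) (auto simp: S)
    thus ?thesis using am[OF fg[OF q]] by (simp add: S)
  qed
  have 2: "S q \<in> pos h" if q: "0 < q" "q < 1" for q
  proof -
    obtain e where e: "e > 0" "\<And>t. \<bar>t - x q\<bar> \<le> e \<Longrightarrow> t \<in> pos f" using pos_neighbours x(1)[OF q] by metis
    have hp: "0 < h ((s + y q) / 2)" if "s \<in> pos f" for s
    proof -
      have "0 < sqrt (f s * g (y q))" using pos_gt0[OF f that] fg q by simp
      thus ?thesis using le[of s "y q"] by linarith
    qed
    show ?thesis unfolding S
    proof (rule pos_between[OF h])
      show "0 < h ((x q - e + y q) / 2)" by (rule hp) (use e in auto)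
      show "0 < h ((x q + e + y q) / 2)" by (rule hp) (use e in auto)
    qed (use e(1) in auto)
  qed
  have fgeq: "f (x q) = g (y q)" if q: "0 < q" "q < 1" for q
  proof -
    have eq: "h (S q) * S' q = I" using transport(2)[OF h 1 2 3 I(3) q] by blast
    have "sqrt (f (x q) * g (y q)) * S' q \<le> h (S q) * S' q"
      using le[of "x q" "y q"] fg[OF q] I(4) by (intro mult_right_mono) (auto simp: S)
    then have l: "sqrt (f (x q) * g (y q)) * (1 / f (x q) + 1 / g (y q)) \<le> 2"
    proof -
      assume *: "sqrt (f (x q) * g (y q)) * S' q \<le> h (S q) * S' q"
      have "I * (sqrt (f (x q) * g (y q)) * (1 / f (x q) + 1 / g (y q))) = 2 * (sqrt (f (x q) * g (y q)) * S' q)"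
        by (simp add: S algebra_simps)
      also have "\<dots> \<le> I * 2" using * eq by simp
      finally show ?thesis using I(4) by simp
    qed
    \<comment> \<open>In the square roots the bound becomes
      \<open>u^2 + v^2 \<le> 2 * (u * v)\<close>, which leaves only \<open>u = v\<close>.\<close>
    define u v where uv: "u = sqrt (f (x q))" "v = sqrt (g (y q))"
    have p: "u > 0" "v > 0" "f (x q) = u^2" "g (y q) = v^2" using fg[OF q] uv by auto
    have "sqrt (u\<^sup>2 * v\<^sup>2) = u * v" using p by (simp add: real_sqrt_mult)
    hence "u * v * (1/u^2 + 1/v^2) \<le> 2" using l p by simp
    moreover have "u * v * (1/u^2 + 1/v^2) * (u * v) = u^2 + v^2" using p(1,2) by (simp add: field_simps power2_eq_square)
    moreover have "u * v * (1/u^2 + 1/v^2) * (u * v) \<le> 2 * (u * v)"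
      if "u * v * (1/u^2 + 1/v^2) \<le> 2" using that p(1,2) by (intro mult_right_mono) auto
    ultimately have "u^2 + v^2 \<le> 2 * (u * v)" by simp
    hence "(u - v)^2 \<le> 0" by (simp add: power2_diff)
    hence "u = v" by simp
    thus ?thesis using p by simp
  qed
  have cdfS: "cdf h (S q) = q * I" if q: "0 < q" "q < 1" for q
    using transport(3)[OF h 1 2 3 I(3) q] by blast
  define c where "c = y (1/2) - x (1/2)"
  have c: "y q = x q + c" if q: "0 < q" "q < 1" for q
  proof -
    have "((\<lambda>q. y q - x q) has_real_derivative 0) (at t)" if "0 < t" "t < 1" for t
      using DERIV_diff[OF y(3)[OF that] x(3)[OF that]] fgeq[OF that] by simp
    hence "\<exists>k. \<forall>t\<in>{0<..<1}. y t - x t = k"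
      by (intro has_field_derivative_zero_constant) (auto intro: has_field_derivative_at_within)
    then obtain k where "\<And>t. 0 < t \<Longrightarrow> t < 1 \<Longrightarrow> y t - x t = k" by auto
    from this[OF q] this[of "1/2"] show ?thesis by (simp add: c_def)
  qed
  have pf: "pos f = x ` {0<..<1}" by (rule pos_eq_range[OF f I(1)[symmetric] I(4) x(1,2)])
  have pg: "pos g = y ` {0<..<1}" by (rule pos_eq_range[OF g I(2)[symmetric] I(4) y(1,2)])
  have ph: "pos h = S ` {0<..<1}" by (rule pos_eq_range[OF h I(3)[symmetric] I(4) 2 cdfS])
  show ?thesis
  proof (rule that[of c])
    show "pos g = (\<lambda>x. x + c) ` pos f" unfolding pf pg image_image by (rule image_cong) (auto simp: c)
    show "pos h = (\<lambda>x. x + c / 2) ` pos f" unfolding pf ph image_image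
      by (rule image_cong) (auto simp: c S field_simps)
    fix t assume "t \<in> pos f"
    then obtain q where "0 < q" "q < 1" "t = x q" unfolding pf by auto
    thus "g (t + c) = f t" using fgeq[of q] c[of q] by simp
  qed
qed

section \<open>Prekopa-Leindler for harmonic means on the half-line\<close>

lemma harmonic_transport:
  fixes x y u v w I J :: real
  assumes "0 < x" "0 < y" "0 < u" "0 < v" "0 < I" "0 < J"
    and w: "u powr (y/(x+y)) * v powr (x/(x+y)) \<le> w"
  shows "2*I*J/(I+J) \<le> w * (2 * (I/u * y^2 + J/v * x^2) / (x+y)^2)"
    and "\<lbrakk>I = J; w * (2 * (I/u * y^2 + J/v * x^2) / (x+y)^2) = I\<rbrakk> \<Longrightarrow> x = y \<and> u = v \<and> w = u"
proof -
  \<comment> \<open>With these weights the harmonic mean \<open>2 * x * y / (x + y)\<close> is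
    \<open>a * x + b * y\<close>. The bracket in the statement is its derivative along curves with
    speeds \<open>I / u\<close> and \<open>J / v\<close>; \<open>e1\<close> writes it as
    \<open>2 / (x + y)\<close> times a mean with the same weights, now of \<open>I * y / u\<close>
    and \<open>J * x / v\<close>.\<close>
  define a b where ab: "a = y/(x+y)" "b = x/(x+y)"
  have p: "0 < a" "0 < b" "a + b = 1" using assms by (auto simp: ab add_divide_distrib[symmetric])
  have nz: "x + y \<noteq> 0" using assms by simp
  have e1: "2 * (I/u * y^2 + J/v * x^2) / (x+y)^2 = (2/(x+y)) * (a * (I*y/u) + b * (J*x/v))"
    using nz by (simp add: ab power2_eq_square add_divide_distrib algebra_simps)
  have s1: "(I*y) powr a * (J*x) powr b \<le> w * (a * (I*y/u) + b * (J*x/v))"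
    by (rule am_gm_integrals) (use assms p w in \<open>auto simp: ab\<close>)
  have h0: "(1/(I*y)) powr a * (1/(J*x)) powr b = 1 / ((I*y) powr a * (J*x) powr b)"
    using assms by (simp add: powr_divide)
  have hs: "a * (1/(I*y)) + b * (1/(J*x)) = (I+J)/(I*J)/(x+y)"
    using assms by (simp add: ab divide_simps)
  \<comment> \<open>A second mean inequality, for the reciprocals, bounds the weighted geometric
    mean of \<open>I * y\<close> and \<open>J * x\<close> from below by the harmonic one. There the
    weights cancel \<open>y\<close> and \<open>x\<close>, and apart from the factor
    \<open>x + y\<close> only \<open>I\<close> and \<open>J\<close> remain.\<close>
  have h1: "1 / ((I*y) powr a * (J*x) powr b) \<le> (I+J)/(I*J)/(x+y)"
    using weighted_am_gm(1)[OF p, of "1/(I*y)" "1/(J*x)"] assms unfolding h0 hs by simp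
  have pp: "0 < (I*y) powr a * (J*x) powr b" using assms by simp
  have s2: "I*J/(I+J) * (x+y) \<le> (I*y) powr a * (J*x) powr b"
  proof -
    have M: "0 < I*J/(I+J) * (x+y)" using assms by simp
    have "(I+J)/(I*J)/(x+y) = 1 / (I*J/(I+J) * (x+y))" by simp
    thus ?thesis using h1 pp M inverse_le_iff_le[OF pp M] by (simp add: inverse_eq_divide)
  qed
  have c: "2*I*J/(I+J) = (2/(x+y)) * (I*J/(I+J) * (x+y))" using nz by simp
  show "2*I*J/(I+J) \<le> w * (2 * (I/u * y^2 + J/v * x^2) / (x+y)^2)"
  proof -
    have "(2/(x+y)) * (I*J/(I+J) * (x+y)) \<le> (2/(x+y)) * (w * (a * (I*y/u) + b * (J*x/v)))"
      using s1 s2 assms by (intro mult_left_mono) auto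
    thus ?thesis unfolding c e1 by (simp add: mult_ac)
  qed
  \<comment> \<open>Equality in the second estimate gives \<open>x = y\<close>. The weights are then
    1/2, and equality in the first one gives \<open>u = v\<close>.\<close>
  assume eq: "I = J" "w * (2 * (I/u * y^2 + J/v * x^2) / (x+y)^2) = I"
  have c2: "I*J/(I+J) * (x+y) = I * (x + y) / 2" using eq(1) assms by (simp add: field_simps)
  have e3: "w * (a * (I*y/u) + b * (J*x/v)) = I * (x + y) / 2"
    using eq(2) nz unfolding e1 by (simp add: field_simps)
  have "(I*y) powr a * (J*x) powr b = I * (x + y) / 2" using s1 s2 c2 e3 by linarith
  hence "(1/(I*y)) powr a * (1/(J*x)) powr b = a * (1/(I*y)) + b * (1/(J*x))"
    unfolding h0 hs using eq(1) assms add_pos_pos[of "J*x" "J*y"] by (simp add: field_simps)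
  hence "1/(I*y) = 1/(J*x)" using weighted_am_gm(2)[OF p, of "1/(I*y)" "1/(J*x)"] assms by simp
  hence xy: "x = y" using eq(1) assms by simp
  have ah: "a = 1/2" "b = 1/2" using xy assms by (auto simp: ab)
  have w': "sqrt u * sqrt v \<le> w" using w unfolding ab[symmetric] ah using assms by (simp add: powr_half_sqrt)
  have "(J * y) * (w * (u + v)) = (J * y) * (2 * (u * v))" using e3 xy ah eq(1) assms by (simp add: field_simps)
  hence wuv: "w * (u + v) = 2 * (u * v)" using assms by (simp only: mult_cancel_left) auto
  define r t where rt: "r = sqrt u" "t = sqrt v"
  have r: "u = r * r" "v = t * t" "0 < r" "0 < t" using assms by (auto simp: rt)
  have "r * t * (r * r + t * t) \<le> w * (r * r + t * t)" using w' r(3,4) by (intro mult_right_mono) (auto simp: rt)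
  also have "\<dots> = r * t * (2 * (r * t))" using wuv by (simp add: r algebra_simps)
  finally have "r * r + t * t \<le> 2 * (r * t)" using r by (simp add: mult_le_cancel_left_pos)
  hence "(r - t) * (r - t) \<le> 0" by (simp add: algebra_simps)
  hence "r = t" by (auto simp: mult_le_0_iff)
  hence "u = v" using r by simp
  thus "x = y \<and> u = v \<and> w = u" using xy wuv assms by simp
qed

text \<open>Vanishing at nonpositive arguments keeps all quantiles positive, which the harmonic mean
  of two of them requires.\<close>

locale harmonic_profiles =
  fixes f g h :: "real \<Rightarrow> real"
  assumes f: "profile f" and g: "profile g" and h: "profile h"
    and f0: "\<And>x. x \<le> 0 \<Longrightarrow> f x = 0" and g0: "\<And>x. x \<le> 0 \<Longrightarrow> g x = 0"
    and le: "\<And>x y. 0 < x \<Longrightarrow> 0 < y \<Longrightarrow> f x powr (y/(x+y)) * g y powr (x/(x+y)) \<le> h (2*x*y/(x+y))"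
begin

lemma curve:
  assumes IJ: "(LINT t|lborel. f t) = I" "(LINT t|lborel. g t) = J" "0 < I" "0 < J"
  obtains x y S S' where
    "\<And>q. 0 < q \<Longrightarrow> q < 1 \<Longrightarrow> x q \<in> pos f \<and> cdf f (x q) = q * I \<and> y q \<in> pos g \<and> cdf g (y q) = q * J"
    "\<And>q. S q = 2 * x q * y q / (x q + y q)"
    "\<And>q. 0 < q \<Longrightarrow> q < 1 \<Longrightarrow> (S has_real_derivative S' q) (at q)"
    "\<And>q. 0 < q \<Longrightarrow> q < 1 \<Longrightarrow> S q \<in> pos h"
    "\<And>q. 0 < q \<Longrightarrow> q < 1 \<Longrightarrow> 2*I*J/(I+J) \<le> h (S q) * S' q"
    "\<And>q. 0 < q \<Longrightarrow> q < 1 \<Longrightarrow> I = J \<Longrightarrow> h (S q) * S' q = I \<Longrightarrow> x q = y q \<and> f (x q) = g (y q) \<and> h (S q) = f (x q)"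
proof -
  obtain x where x: "\<And>q. 0 < q \<Longrightarrow> q < 1 \<Longrightarrow> x q \<in> pos f"
    "\<And>q. 0 < q \<Longrightarrow> q < 1 \<Longrightarrow> cdf f (x q) = q * I"
    "\<And>q. 0 < q \<Longrightarrow> q < 1 \<Longrightarrow> (x has_real_derivative I / f (x q)) (at q)"
    using quantile[OF f IJ(1)[symmetric] IJ(3)] by metis
  obtain y where y: "\<And>q. 0 < q \<Longrightarrow> q < 1 \<Longrightarrow> y q \<in> pos g"
    "\<And>q. 0 < q \<Longrightarrow> q < 1 \<Longrightarrow> cdf g (y q) = q * J"
    "\<And>q. 0 < q \<Longrightarrow> q < 1 \<Longrightarrow> (y has_real_derivative J / g (y q)) (at q)"
    using quantile[OF g IJ(2)[symmetric] IJ(4)] by metis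
  have xy0: "0 < x q" "0 < y q" "0 < f (x q)" "0 < g (y q)" if q: "0 < q" "q < 1" for q
  proof -
    show "0 < f (x q)" "0 < g (y q)" using x(1)[OF q] y(1)[OF q] pos_gt0 f g by blast+
    thus "0 < x q" "0 < y q" using f0[of "x q"] g0[of "y q"] by (auto simp: not_le[symmetric])
  qed
  define S where "S q = 2 * x q * y q / (x q + y q)" for q
  define S' where "S' q = 2 * (I/f (x q) * (y q)^2 + J/g (y q) * (x q)^2) / (x q + y q)^2" for q
  show ?thesis
  proof (rule that[of x y S S'])
    fix q :: real assume q: "0 < q" "q < 1"
    note xy = xy0[OF q]
    show "x q \<in> pos f \<and> cdf f (x q) = q * I \<and> y q \<in> pos g \<and> cdf g (y q) = q * J"
      using x y q by blast
    show "(S has_real_derivative S' q) (at q)"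
    proof -
      have "((\<lambda>q. 2 * x q * y q / (x q + y q)) has_real_derivative
        ((2 * (I/f (x q)) * y q + J/g (y q) * (2 * x q)) * (x q + y q) - 2 * x q * y q * (I/f (x q) + J/g (y q))) / ((x q + y q) * (x q + y q))) (at q)"
        using x(3)[OF q] y(3)[OF q] xy by (intro DERIV_divide DERIV_mult DERIV_add DERIV_cmult) auto
      moreover have "(2 * (I/f (x q)) * y q + J/g (y q) * (2 * x q)) * (x q + y q) - 2 * x q * y q * (I/f (x q) + J/g (y q))
         = 2 * (I/f (x q) * (y q)^2 + J/g (y q) * (x q)^2)"
        unfolding power2_eq_square by (simp only: distrib_left distrib_right times_divide_eq_left times_divide_eq_right) (simp add: mult_ac)
      ultimately show ?thesis unfolding S_def[abs_def] S'_def by (simp add: power2_eq_square)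
    qed
    have w: "f (x q) powr (y q/(x q + y q)) * g (y q) powr (x q / (x q + y q)) \<le> h (S q)"
      using le[OF xy(1,2)] by (simp add: S_def)
    show "2*I*J/(I+J) \<le> h (S q) * S' q" unfolding S'_def
      by (rule harmonic_transport(1)[OF xy IJ(3,4) w])
    show "I = J \<Longrightarrow> h (S q) * S' q = I \<Longrightarrow> x q = y q \<and> f (x q) = g (y q) \<and> h (S q) = f (x q)"
      unfolding S'_def by (rule harmonic_transport(2)[OF xy IJ(3,4) w])
    obtain e' where e': "e' > 0" "\<And>t. \<bar>t - x q\<bar> \<le> e' \<Longrightarrow> t \<in> pos f" using pos_neighbours x(1)[OF q] by metis
    \<comment> \<open>At most half of \<open>x q\<close>, so that the shifted argument stays
      positive and \<open>le\<close> applies to it.\<close>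
    define e where "e = min e' (x q / 2)"
    have e: "e > 0" "x q - e > 0" "x q - e \<in> pos f" "x q + e \<in> pos f" using e' xy by (auto simp: e_def)
    have hp: "0 < h (2 * s * y q / (s + y q))" if "s \<in> pos f" "s > 0" for s
    proof -
      have "0 < f s powr (y q / (s + y q)) * g (y q) powr (s / (s + y q))" using pos_gt0[OF f that(1)] xy by simp
      thus ?thesis using le[of s "y q"] that xy by simp
    qed
    have mono: "2 * s * y q / (s + y q) < 2 * t * y q / (t + y q)" if "0 < s" "s < t" for s t
      using that xy by (simp add: divide_simps) (simp add: algebra_simps)
    show "S q \<in> pos h" unfolding S_def
    proof (rule pos_between[OF h])
      show "0 < h (2 * (x q - e) * y q / (x q - e + y q))" by (rule hp) (use e in auto)
      show "0 < h (2 * (x q + e) * y q / (x q + e + y q))" by (rule hp) (use e xy in auto)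
      show "2 * (x q - e) * y q / (x q - e + y q) < 2 * x q * y q / (x q + y q)" by (rule mono) (use e in auto)
      show "2 * x q * y q / (x q + y q) < 2 * (x q + e) * y q / (x q + e + y q)" by (rule mono) (use e xy in auto)
    qed
  qed (simp add: S_def)
qed

lemma integral_ge:
  assumes IJ: "(LINT t|lborel. f t) = I" "(LINT t|lborel. g t) = J" "0 < I" "0 < J"
  shows "2*I*J/(I+J) \<le> (LINT t|lborel. h t)"
proof -
  obtain x y S S' where "\<And>q. 0 < q \<Longrightarrow> q < 1 \<Longrightarrow> (S has_real_derivative S' q) (at q)"
    "\<And>q. 0 < q \<Longrightarrow> q < 1 \<Longrightarrow> S q \<in> pos h"
    "\<And>q. 0 < q \<Longrightarrow> q < 1 \<Longrightarrow> 2*I*J/(I+J) \<le> h (S q) * S' q"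
    using curve[OF IJ] by metis
  from transport(1)[OF h this] show ?thesis .
qed

text \<open>Harmonic means are not invariant under translations. Equality therefore makes the
  quantile curves coincide and leaves no free shift, in contrast to
  \<open>prekopa_leindler_1_equality\<close>.\<close>

lemma equality:
  assumes I: "(LINT t|lborel. f t) = I" "(LINT t|lborel. g t) = I" "(LINT t|lborel. h t) = I" "0 < I"
  shows "pos g = pos f" "pos h = pos f" "\<And>x. x \<in> pos f \<Longrightarrow> g x = f x \<and> h x = f x"
proof -
  obtain x y S S' where
    x: "\<And>q. 0 < q \<Longrightarrow> q < 1 \<Longrightarrow> x q \<in> pos f \<and> cdf f (x q) = q * I \<and> y q \<in> pos g \<and> cdf g (y q) = q * I"
    and S: "\<And>q. S q = 2 * x q * y q / (x q + y q)"
    and 1: "\<And>q. 0 < q \<Longrightarrow> q < 1 \<Longrightarrow> (S has_real_derivative S' q) (at q)"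
    and 2: "\<And>q. 0 < q \<Longrightarrow> q < 1 \<Longrightarrow> S q \<in> pos h"
    and 3: "\<And>q. 0 < q \<Longrightarrow> q < 1 \<Longrightarrow> 2*I*I/(I+I) \<le> h (S q) * S' q"
    and 4: "\<And>q. 0 < q \<Longrightarrow> q < 1 \<Longrightarrow> I = I \<Longrightarrow> h (S q) * S' q = I \<Longrightarrow> x q = y q \<and> f (x q) = g (y q) \<and> h (S q) = f (x q)"
    by (rule curve[OF I(1,2,4,4)]) blast
  have II: "2*I*I/(I+I) = I" using I(4) by simp
  have eq: "h (S q) * S' q = I" "cdf h (S q) = q * I" if q: "0 < q" "q < 1" for q
    using transport(2,3)[OF h 1 2 3 _ q] II I(3) by auto
  have all: "x q = y q \<and> f (x q) = g (y q) \<and> h (S q) = f (x q) \<and> S q = x q" if q: "0 < q" "q < 1" for q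
  proof -
    have "0 < f (x q)" using x[OF q] pos_gt0 f by blast
    hence "x q > 0" using f0[of "x q"] by (auto simp: not_le[symmetric])
    thus ?thesis using 4[OF q refl eq(1)[OF q]] S[of q] by auto
  qed
  have pf: "pos f = x ` {0<..<1}" by (rule pos_eq_range[OF f I(1)[symmetric] I(4)]) (use x in auto)
  have pg: "pos g = y ` {0<..<1}" by (rule pos_eq_range[OF g I(2)[symmetric] I(4)]) (use x in auto)
  have ph: "pos h = S ` {0<..<1}" by (rule pos_eq_range[OF h I(3)[symmetric] I(4) 2 eq(2)])
  show "pos g = pos f" unfolding pf pg by (rule image_cong) (use all in auto)
  show "pos h = pos f" unfolding pf ph by (rule image_cong) (use all in auto)
  fix t assume "t \<in> pos f"
  then obtain q where "0 < q" "q < 1" "t = x q" unfolding pf by auto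
  thus "g t = f t \<and> h t = f t" using all[of q] by auto
qed

end

section \<open>The multiplicative version for even functions\<close>

lemma profile_indicator:
  assumes f: "profile f" and A: "convex A"
  shows "profile (\<lambda>x. indicator A x * f x)"
  unfolding profile_def
proof (intro conjI allI impI)
  fix x show "0 \<le> indicator A x * f x" using profile_nonneg[OF f] by simp
next
  fix x y a b :: real assume ab: "0 < a" "0 < b" "a + b = 1"
  show "(indicator A x * f x) powr a * (indicator A y * f y) powr b \<le> indicator A (a * x + b * y) * f (a * x + b * y)"
  proof (cases "x \<in> A \<and> y \<in> A")
    case True
    hence "a * x + b * y \<in> A" using A ab by (simp add: convex_def)
    thus ?thesis using True profile_logconcave[OF f ab] by simp
  next
    case False
    thus ?thesis using profile_nonneg[OF f] by (auto simp: indicator_def)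
  qed
next
  obtain C where C: "\<And>x. f x \<le> C" using f by (auto simp: profile_def)
  have "indicator A x * f x \<le> C" for x
    using C[of x] profile_nonneg[OF f, of x] by (auto simp: indicator_def)
  thus "\<exists>C. \<forall>x. indicator A x * f x \<le> C" by blast
  obtain R where "\<forall>x. R < \<bar>x\<bar> \<longrightarrow> f x = 0" using f by (auto simp: profile_def)
  thus "\<exists>R. \<forall>x. R < \<bar>x\<bar> \<longrightarrow> indicator A x * f x = 0" by (intro exI[of _ R]) auto
qed

text \<open>The same transport along \<open>sqrt (x q * y q)\<close>. Its speed is estimated by the
  arithmetic-geometric mean inequality for \<open>I / f (x q) * y q\<close> and
  \<open>J / g (y q) * x q\<close>, the two terms in the derivative of the product.\<close>

lemma geometric_profiles:
  assumes f: "profile f" and g: "profile g" and h: "profile h"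
    and f0: "\<And>x. x \<le> 0 \<Longrightarrow> f x = 0" and g0: "\<And>x. x \<le> 0 \<Longrightarrow> g x = 0"
    and le: "\<And>x y. 0 < x \<Longrightarrow> 0 < y \<Longrightarrow> sqrt (f x * g y) \<le> h (sqrt (x * y))"
  shows "sqrt ((LINT t|lborel. f t) * (LINT t|lborel. g t)) \<le> (LINT t|lborel. h t)"
proof (cases "(LINT t|lborel. f t) = 0 \<or> (LINT t|lborel. g t) = 0")
  case True
  then show ?thesis using profile_integral_nonneg[OF h] by auto
next
  case False
  define I J where IJ: "I = (LINT t|lborel. f t)" "J = (LINT t|lborel. g t)"
  have p: "0 < I" "0 < J" using False profile_integral_nonneg[OF f] profile_integral_nonneg[OF g] IJ by auto
  obtain x where x: "\<And>q. 0 < q \<Longrightarrow> q < 1 \<Longrightarrow> x q \<in> pos f"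
    "\<And>q. 0 < q \<Longrightarrow> q < 1 \<Longrightarrow> (x has_real_derivative I / f (x q)) (at q)"
    using quantile[OF f IJ(1) p(1)] by metis
  obtain y where y: "\<And>q. 0 < q \<Longrightarrow> q < 1 \<Longrightarrow> y q \<in> pos g"
    "\<And>q. 0 < q \<Longrightarrow> q < 1 \<Longrightarrow> (y has_real_derivative J / g (y q)) (at q)"
    using quantile[OF g IJ(2) p(2)] by metis
  have "sqrt (I * J) \<le> (LINT t|lborel. h t)"
  proof (rule transport(1)[OF h, where S="\<lambda>q. sqrt (x q * y q)" and S'="\<lambda>q. (I / f (x q) * y q + J / g (y q) * x q) / (2 * sqrt (x q * y q))"])
    fix q :: real assume q: "0 < q" "q < 1"
    have fg: "0 < f (x q)" "0 < g (y q)" using x(1)[OF q] y(1)[OF q] pos_gt0 f g by blast+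
    hence xy: "0 < x q" "0 < y q" using f0[of "x q"] g0[of "y q"] by (auto simp: not_le[symmetric])
    have "((\<lambda>q. x q * y q) has_real_derivative (I / f (x q) * y q + J / g (y q) * x q)) (at q)"
      using DERIV_mult[OF x(2)[OF q] y(2)[OF q]] .
    from DERIV_chain2[OF DERIV_real_sqrt this] xy
    show "((\<lambda>q. sqrt (x q * y q)) has_real_derivative (I / f (x q) * y q + J / g (y q) * x q) / (2 * sqrt (x q * y q))) (at q)"
      by (simp add: field_simps)
    show "sqrt (I * J) \<le> h (sqrt (x q * y q)) * ((I / f (x q) * y q + J / g (y q) * x q) / (2 * sqrt (x q * y q)))"
    proof -
      define u v X Y where uv: "u = f (x q)" "v = g (y q)" "X = x q" "Y = y q"
      have pp: "0 < u" "0 < v" "0 < X" "0 < Y" using fg xy uv by auto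
      have "sqrt (I * J) = sqrt (u * v) * (sqrt ((I / u * Y) * (J / v * X)) / sqrt (X * Y))"
        using pp by (simp add: real_sqrt_mult real_sqrt_divide)
      also have "\<dots> \<le> sqrt (u * v) * (((I / u * Y) + (J / v * X)) / 2 / sqrt (X * Y))"
        using pp p by (intro mult_left_mono divide_right_mono arith_geo_mean_sqrt) auto
      also have "\<dots> \<le> h (sqrt (X * Y)) * (((I / u * Y) + (J / v * X)) / 2 / sqrt (X * Y))"
        using pp p le[OF xy] uv by (intro mult_right_mono) auto
      finally show ?thesis by (simp add: uv)
    qed
    obtain e' where e': "e' > 0" "\<And>t. \<bar>t - x q\<bar> \<le> e' \<Longrightarrow> t \<in> pos f" using pos_neighbours x(1)[OF q] by metis
    define e where "e = min e' (x q / 2)"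
    have e: "e > 0" "x q - e > 0" "x q - e \<in> pos f" "x q + e \<in> pos f" using e' xy by (auto simp: e_def)
    have hp: "0 < h (sqrt (s * y q))" if "s \<in> pos f" "s > 0" for s
    proof -
      have "0 < sqrt (f s * g (y q))" using pos_gt0[OF f that(1)] fg by simp
      thus ?thesis using le[OF that(2) xy(2)] by linarith
    qed
    show "sqrt (x q * y q) \<in> pos h"
    proof (rule pos_between[OF h])
      show "0 < h (sqrt ((x q - e) * y q))" by (rule hp) (use e in auto)
      show "0 < h (sqrt ((x q + e) * y q))" by (rule hp) (use e xy in auto)
    qed (use e xy in auto)
  qed
  thus ?thesis by (simp add: IJ)
qed

lemma even_integral:
  assumes f: "profile f" and ev: "\<And>x. f (- x) = f x"
  shows "(LINT t|lborel. f t) = 2 * (LINT t|lborel. indicator {0<..} t * f t)"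
proof -
  have "(LINT t|lborel. f t) = (LINT t|lborel. indicator {0<..} t * f t + indicator {..<0} t * f t)"
  proof (rule integral_cong_AE)
    show "AE t in lborel. f t = indicat_real {0<..} t * f t + indicat_real {..<0} t * f t"
      using AE_lborel_singleton[of 0] by eventually_elim (auto simp: indicator_def)
  qed (use profile_measurable[OF f] in auto)
  also have "\<dots> = (LINT t|lborel. indicator {0<..} t * f t) + (LINT t|lborel. indicator {..<0} t * f t)"
    by (intro Bochner_Integration.integral_add profile_int_indicator[OF f]) auto
  also have "(LINT t|lborel. indicator {..<0} t * f t) = (LINT t|lborel. indicator {..<0} (0 + (-1) * t) * f (0 + (-1) * t))"
    by (subst lborel_integral_real_affine[where c="-1" and t=0]) auto
  also have "\<dots> = (LINT t|lborel. indicator {0<..} t * f t)"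
    by (rule Bochner_Integration.integral_cong[OF refl]) (auto simp: indicator_def ev)
  finally show ?thesis by simp
qed

lemma geometric_profiles_even:
  assumes f: "profile f" and g: "profile g" and h: "profile h"
    and ev: "\<And>x. f (- x) = f x" "\<And>x. g (- x) = g x" "\<And>x. h (- x) = h x"
    and le: "\<And>x y. 0 < x \<Longrightarrow> 0 < y \<Longrightarrow> sqrt (f x * g y) \<le> h (sqrt (x * y))"
  shows "sqrt ((LINT t|lborel. f t) * (LINT t|lborel. g t)) \<le> (LINT t|lborel. h t)"
proof -
  let ?p = "\<lambda>f t. indicator {0<..} t * (f t :: real)"
  have "sqrt ((LINT t|lborel. ?p f t) * (LINT t|lborel. ?p g t)) \<le> (LINT t|lborel. ?p h t)"
  proof (rule geometric_profiles)
    show "profile (?p f)" "profile (?p g)" "profile (?p h)" by (rule profile_indicator; use f g h in simp)+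
    fix x y :: real assume "0 < x" "0 < y"
    thus "sqrt (?p f x * ?p g y) \<le> ?p h (sqrt (x * y))" using le by simp
  qed simp_all
  moreover have "sqrt ((2 * a) * (2 * b)) = 2 * sqrt (a * b)" for a b :: real
    using real_sqrt_mult[of 4 "a*b"] by (simp add: mult_ac)
  ultimately show ?thesis
    using even_integral[OF f ev(1)] even_integral[OF g ev(2)] even_integral[OF h ev(3)] by simp
qed

section \<open>Marginals and convex sets\<close>

text \<open>Points are coordinate functions, so integrating out a variable by \<open>fun_upd\<close>
  leaves the type unchanged. Bounded support is required only in the coordinates from
  \<open>I\<close>, and each marginal removes one of these from \<open>I\<close>.\<close>

definition lcfun :: "'i set \<Rightarrow> (('i \<Rightarrow> real) \<Rightarrow> real) \<Rightarrow> bool" where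
  "lcfun I f \<longleftrightarrow> (\<forall>w. 0 \<le> f w)
     \<and> (\<forall>w w' a b. 0 < a \<longrightarrow> 0 < b \<longrightarrow> a + b = 1 \<longrightarrow>
           f w powr a * f w' powr b \<le> f (\<lambda>i. a * w i + b * w' i))
     \<and> (\<exists>C. \<forall>w. f w \<le> C) \<and> (\<exists>R. \<forall>w. \<forall>i\<in>I. R < \<bar>w i\<bar> \<longrightarrow> f w = 0)"

definition marg1 :: "'i \<Rightarrow> (('i \<Rightarrow> real) \<Rightarrow> real) \<Rightarrow> ('i \<Rightarrow> real) \<Rightarrow> real" where
  "marg1 i f w = (LINT t|lborel. f (w(i := t)))"

primrec marg :: "'i list \<Rightarrow> (('i \<Rightarrow> real) \<Rightarrow> real) \<Rightarrow> ('i \<Rightarrow> real) \<Rightarrow> real" where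
  "marg [] f = f"
| "marg (i # is) f = marg is (marg1 i f)"

text \<open>The same iteration with values in \<open>ennreal\<close>, where Fubini's theorem applies
  without integrability. \<open>nmarg_marg\<close> passes to the real marginals, for which
  log-concavity makes sense.\<close>

primrec nmarg :: "'i list \<Rightarrow> (('i \<Rightarrow> real) \<Rightarrow> ennreal) \<Rightarrow> ('i \<Rightarrow> real) \<Rightarrow> ennreal" where
  "nmarg [] f = f"
| "nmarg (i # is) f = nmarg is (\<lambda>w. \<integral>\<^sup>+t. f (w(i := t)) \<partial>lborel)"

lemma marg_append: "marg (xs @ ys) f = marg ys (marg xs f)"
  by (induction xs arbitrary: f) auto

lemma nmarg_append: "nmarg (xs @ ys) f = nmarg ys (nmarg xs f)"
  by (induction xs arbitrary: f) auto

lemma upd_combination: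
  fixes w w' :: "'i \<Rightarrow> real"
  shows "(\<lambda>j. a * (w(i := x)) j + b * (w'(i := y)) j) = (\<lambda>j. a * w j + b * w' j)(i := a * x + b * y)"
  by (intro ext) simp

lemma lcfun_slice:
  assumes "lcfun I f" "i \<in> I"
  shows "profile (\<lambda>t. f (w(i := t)))"
  unfolding profile_def
proof (intro conjI allI impI)
  show "0 \<le> f (w(i := x))" for x using assms by (auto simp: lcfun_def)
  fix x y a b :: real assume ab: "0 < a" "0 < b" "a + b = 1"
  have "(\<lambda>j. a * w j + b * w j) = w" using ab by (simp add: distrib_right[symmetric])
  hence "(\<lambda>j. a * (w(i := x)) j + b * (w(i := y)) j) = w(i := a * x + b * y)"
    by (simp only: upd_combination)
  thus "f (w(i := x)) powr a * f (w(i := y)) powr b \<le> f (w(i := a * x + b * y))"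
    using assms(1) ab unfolding lcfun_def by metis
next
  show "\<exists>C. \<forall>x. f (w(i := x)) \<le> C" using assms by (auto simp: lcfun_def)
  show "\<exists>R. \<forall>x. R < \<bar>x\<bar> \<longrightarrow> f (w(i := x)) = 0" using assms unfolding lcfun_def by (metis fun_upd_same)
qed

lemma marg1_prekopa_leindler:
  assumes "lcfun I f" "lcfun I g" "lcfun I h" "i \<in> I" "0 < a" "0 < b" "a + b = 1"
    and le: "\<And>w w'. f w powr a * g w' powr b \<le> h (\<lambda>j. a * w j + b * w' j)"
  shows "marg1 i f w powr a * marg1 i g w' powr b \<le> marg1 i h (\<lambda>j. a * w j + b * w' j)"
  unfolding marg1_def
proof (rule prekopa_leindler_1[OF lcfun_slice[OF assms(1,4)] lcfun_slice[OF assms(2,4)] lcfun_slice[OF assms(3,4)] assms(5-7)])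
  show "f (w(i := x)) powr a * g (w'(i := y)) powr b \<le> h ((\<lambda>j. a * w j + b * w' j)(i := a * x + b * y))" for x y
    using le[of "w(i := x)" "w'(i := y)"] by (simp only: upd_combination)
qed

text \<open>Log-concavity of the marginal is Prekopa-Leindler with three copies of \<open>f\<close>.
  It supplies the profile hypotheses for the next variable in every induction over the
  coordinates.\<close>

lemma lcfun_marg1:
  assumes f: "lcfun I f" and i: "i \<in> I"
  shows "lcfun (I - {i}) (marg1 i f)"
  unfolding lcfun_def
proof (intro conjI allI impI)
  show "0 \<le> marg1 i f w" for w
    unfolding marg1_def by (rule profile_integral_nonneg[OF lcfun_slice[OF f i]])
  show "marg1 i f w powr a * marg1 i f w' powr b \<le> marg1 i f (\<lambda>j. a * w j + b * w' j)"
    if "0 < a" "0 < b" "a + b = 1" for w w' a b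
    by (rule marg1_prekopa_leindler[OF f f f i that]) (use f that in \<open>auto simp: lcfun_def\<close>)
  obtain C where C: "\<And>w. f w \<le> C" using f by (auto simp: lcfun_def)
  obtain R where "\<forall>w. \<forall>j\<in>I. R < \<bar>w j\<bar> \<longrightarrow> f w = 0" using f unfolding lcfun_def by blast
  hence R: "f w = 0" if "j \<in> I" "R < \<bar>w j\<bar>" for w j using that by blast
  have "marg1 i f w \<le> (LINT t|lborel. C * indicator {-\<bar>R\<bar>..\<bar>R\<bar>} t)" for w
    unfolding marg1_def
  proof (rule integral_mono[OF profile_integrable[OF lcfun_slice[OF f i]]])
    show "integrable lborel (\<lambda>t. C * indicator {-\<bar>R\<bar>..\<bar>R\<bar>} t :: real)"
      by (intro integrable_mult_right integrable_real_indicator) (auto simp: emeasure_lborel_Icc_eq)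
    fix t show "f (w(i := t)) \<le> C * indicator {- \<bar>R\<bar>..\<bar>R\<bar>} t"
      using C[of "w(i := t)"] R[OF i, of "w(i := t)"] by (cases "t \<in> {- \<bar>R\<bar>..\<bar>R\<bar>}") auto
  qed
  thus "\<exists>C. \<forall>w. marg1 i f w \<le> C" by blast
  have "marg1 i f w = 0" if "j \<in> I - {i}" "R < \<bar>w j\<bar>" for w j
  proof -
    have "f (w(i := t)) = 0" for t by (rule R[of j]) (use that in auto)
    thus ?thesis by (simp add: marg1_def)
  qed
  thus "\<exists>R. \<forall>w. \<forall>j\<in>I - {i}. R < \<bar>w j\<bar> \<longrightarrow> marg1 i f w = 0" by blast
qed

lemma lcfun_marg: "lcfun I f \<Longrightarrow> distinct is \<Longrightarrow> set is \<subseteq> I \<Longrightarrow> lcfun (I - set is) (marg is f)"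
proof (induction "is" arbitrary: I f)
  case (Cons i "is")
  have "lcfun (I - {i} - set is) (marg is (marg1 i f))"
    by (rule Cons.IH[OF lcfun_marg1]) (use Cons.prems in auto)
  moreover have "I - set (i # is) = I - {i} - set is" by auto
  ultimately show ?case by simp
qed simp

lemma marg_prekopa_leindler:
  assumes "lcfun I f" "lcfun I g" "lcfun I h" "distinct is" "set is \<subseteq> I" "0 < a" "0 < b" "a + b = 1"
    and "\<And>w w'. f w powr a * g w' powr b \<le> h (\<lambda>j. a * w j + b * w' j)"
  shows "marg is f w powr a * marg is g w' powr b \<le> marg is h (\<lambda>j. a * w j + b * w' j)"
  using assms
proof (induction "is" arbitrary: I f g h w w')
  case (Cons i "is")
  have i: "i \<in> I" using Cons.prems by auto
  show ?case unfolding marg.simps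
    by (rule Cons.IH[OF lcfun_marg1[OF Cons.prems(1) i] lcfun_marg1[OF Cons.prems(2) i] lcfun_marg1[OF Cons.prems(3) i]])
      (use Cons.prems marg1_prekopa_leindler[OF Cons.prems(1-3) i Cons.prems(6-9)] in auto)
qed simp

definition even_in :: "'i set \<Rightarrow> (('i \<Rightarrow> real) \<Rightarrow> real) \<Rightarrow> bool" where
  "even_in I f \<longleftrightarrow> (\<forall>i\<in>I. \<forall>w t. f (w(i := - t)) = f (w(i := t)))"

lemma even_in_marg1: "even_in I f \<Longrightarrow> even_in (I - {i}) (marg1 i f)"
  unfolding even_in_def marg1_def
proof (intro ballI allI)
  fix j w t assume a: "\<forall>i\<in>I. \<forall>w t. f (w(i := - t)) = f (w(i := t))" and j: "j \<in> I - {i}"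
  have "f (w(j := - t, i := s)) = f (w(j := t, i := s))" for s
    using a[rule_format, of j "w(i := s)" t] j by (simp add: fun_upd_twist)
  thus "(LINT s|lborel. f (w(j := - t, i := s))) = (LINT s|lborel. f (w(j := t, i := s)))" by simp
qed

text \<open>Evenness in each variable allows every integral to be compared on the positive
  half-line, where square roots of products of coordinates are available. Positivity of the base
  points is thus needed only in the coordinates not yet integrated.\<close>

lemma marg_geometric:
  assumes "lcfun I f" "lcfun I g" "lcfun I h" "even_in I f" "even_in I g" "even_in I h" "distinct is" "set is \<subseteq> I"
    and "\<And>w w'. (\<And>i. i \<in> I \<Longrightarrow> 0 < w i \<and> 0 < w' i) \<Longrightarrow> sqrt (f w * g w') \<le> h (\<lambda>i. sqrt (w i * w' i))"
    and "\<And>i. i \<in> I - set is \<Longrightarrow> 0 < w i \<and> 0 < w' i"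
  shows "sqrt (marg is f w * marg is g w') \<le> marg is h (\<lambda>i. sqrt (w i * w' i))"
  using assms
proof (induction "is" arbitrary: I f g h w w')
  case Nil
  then show ?case by simp
next
  case (Cons i "is")
  have i: "i \<in> I" using Cons.prems by auto
  have step: "sqrt (marg1 i f w * marg1 i g w') \<le> marg1 i h (\<lambda>i. sqrt (w i * w' i))"
    if p: "\<And>j. j \<in> I - {i} \<Longrightarrow> 0 < w j \<and> 0 < w' j" for w w'
    unfolding marg1_def
  proof (rule geometric_profiles_even)
    show "profile (\<lambda>t. f (w(i := t)))" "profile (\<lambda>t. g (w'(i := t)))"
      "profile (\<lambda>t. h ((\<lambda>i. sqrt (w i * w' i))(i := t)))"
      using lcfun_slice[OF _ i] Cons.prems(1-3) by blast+
    show "f (w(i := - x)) = f (w(i := x))" "g (w'(i := - x)) = g (w'(i := x))"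
      "h ((\<lambda>i. sqrt (w i * w' i))(i := - x)) = h ((\<lambda>i. sqrt (w i * w' i))(i := x))" for x
      using Cons.prems(4-6) i unfolding even_in_def by blast+
    fix x y :: real assume xy: "0 < x" "0 < y"
    have "sqrt (f (w(i := x)) * g (w'(i := y))) \<le> h (\<lambda>j. sqrt ((w(i := x)) j * (w'(i := y)) j))"
      by (rule Cons.prems(9)) (use p xy in auto)
    also have "(\<lambda>j. sqrt ((w(i := x)) j * (w'(i := y)) j)) = (\<lambda>j. sqrt (w j * w' j))(i := sqrt (x * y))"
      by (intro ext) simp
    finally show "sqrt (f (w(i := x)) * g (w'(i := y))) \<le> h ((\<lambda>j. sqrt (w j * w' j))(i := sqrt (x * y)))" .
  qed
  show ?case unfolding marg.simps
  proof (rule Cons.IH[OF lcfun_marg1[OF Cons.prems(1) i] lcfun_marg1[OF Cons.prems(2) i] lcfun_marg1[OF Cons.prems(3) i]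
      even_in_marg1[OF Cons.prems(4)] even_in_marg1[OF Cons.prems(5)] even_in_marg1[OF Cons.prems(6)]])
    show "distinct is" "set is \<subseteq> I - {i}" using Cons.prems(7,8) by auto
  qed (use Cons.prems(10) step in auto)
qed

lemma marg1_upd: "e \<noteq> i \<Longrightarrow> marg1 i (\<lambda>w. f (w(e := c))) = (\<lambda>w. marg1 i f (w(e := c)))"
  by (intro ext) (simp add: marg1_def fun_upd_twist)

lemma marg_upd: "e \<notin> set is \<Longrightarrow> marg is (\<lambda>w. f (w(e := c))) = (\<lambda>w. marg is f (w(e := c)))"
  by (induction "is" arbitrary: f) (auto simp: marg1_upd)

lemma lcfun_upd:
  assumes f: "lcfun I f" shows "lcfun (I - {e}) (\<lambda>w. f (w(e := c)))"
  unfolding lcfun_def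
proof (intro conjI allI impI)
  show "0 \<le> f (w(e := c))" for w using f by (auto simp: lcfun_def)
  fix w w' and a b :: real assume ab: "0 < a" "0 < b" "a + b = 1"
  have "a * c + b * c = c" using ab by (simp add: distrib_right[symmetric])
  hence "(\<lambda>j. a * (w(e := c)) j + b * (w'(e := c)) j) = (\<lambda>j. a * w j + b * w' j)(e := c)"
    by (simp only: upd_combination)
  thus "f (w(e := c)) powr a * f (w'(e := c)) powr b \<le> f ((\<lambda>j. a * w j + b * w' j)(e := c))"
    using f ab unfolding lcfun_def by metis
next
  show "\<exists>C. \<forall>w. f (w(e := c)) \<le> C" using f by (auto simp: lcfun_def)
  obtain R where "\<forall>w. \<forall>j\<in>I. R < \<bar>w j\<bar> \<longrightarrow> f w = 0" using f unfolding lcfun_def by blast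
  hence R: "f w = 0" if "j \<in> I" "R < \<bar>w j\<bar>" for w j using that by blast
  have "f (w(e := c)) = 0" if "j \<in> I - {e}" "R < \<bar>w j\<bar>" for w j
    by (rule R[of j]) (use that in auto)
  thus "\<exists>R. \<forall>w. \<forall>i\<in>I - {e}. R < \<bar>w i\<bar> \<longrightarrow> f (w(e := c)) = 0" by blast
qed

section \<open>Lebesgue measure as an iterated marginal\<close>

lemma nmarg_marg:
  assumes "lcfun I f" "distinct is" "set is \<subseteq> I" "\<And>w i t. i \<in> set is \<Longrightarrow> \<phi> (w(i := t)) = \<phi> w"
  shows "nmarg is (\<lambda>w. \<phi> w * ennreal (f w)) = (\<lambda>w. \<phi> w * ennreal (marg is f w))"
  using assms
proof (induction "is" arbitrary: I f)
  case (Cons i "is")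
  have i: "i \<in> I" using Cons.prems by auto
  have "(\<integral>\<^sup>+t. \<phi> (w(i := t)) * ennreal (f (w(i := t))) \<partial>lborel) = \<phi> w * ennreal (marg1 i f w)" for w
  proof -
    have p: "profile (\<lambda>t. f (w(i := t)))" by (rule lcfun_slice[OF Cons.prems(1) i])
    have "(\<integral>\<^sup>+t. \<phi> (w(i := t)) * ennreal (f (w(i := t))) \<partial>lborel) = (\<integral>\<^sup>+t. \<phi> w * ennreal (f (w(i := t))) \<partial>lborel)"
      by (intro nn_integral_cong) (subst Cons.prems(4), auto)
    also have "\<dots> = \<phi> w * (\<integral>\<^sup>+t. ennreal (f (w(i := t))) \<partial>lborel)"
      using profile_measurable[OF p] by (intro nn_integral_cmult) simp
    also have "(\<integral>\<^sup>+t. ennreal (f (w(i := t))) \<partial>lborel) = ennreal (marg1 i f w)"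
      unfolding marg1_def by (rule nn_integral_eq_integral[OF profile_integrable[OF p]]) (simp add: profile_nonneg[OF p])
    finally show ?thesis .
  qed
  hence "nmarg (i # is) (\<lambda>w. \<phi> w * ennreal (f w)) = nmarg is (\<lambda>w. \<phi> w * ennreal (marg1 i f w))" by simp
  also have "\<dots> = (\<lambda>w. \<phi> w * ennreal (marg is (marg1 i f) w))"
    by (rule Cons.IH[OF lcfun_marg1[OF Cons.prems(1) i]]) (use Cons.prems in auto)
  finally show ?case by simp
qed simp

text \<open>The base point \<open>\<lambda>_. undefined\<close> is the single point of the empty
  product, at which the iteration ends.\<close>

lemma nn_integral_PiM_nmarg:
  fixes F :: "('i \<Rightarrow> real) \<Rightarrow> ennreal"
  assumes "distinct is" "F \<in> borel_measurable (Pi\<^sub>M (set is) (\<lambda>_. lborel))"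
  shows "(\<integral>\<^sup>+w. F w \<partial>Pi\<^sub>M (set is) (\<lambda>_. lborel)) = nmarg is F (\<lambda>_. undefined)"
  using assms
proof (induction "is" arbitrary: F)
  interpret product_sigma_finite "\<lambda>_::'i. lborel :: real measure" ..
  case Nil
  then show ?case using nn_integral_empty[of F] by simp
next
  interpret product_sigma_finite "\<lambda>_::'i. lborel :: real measure" ..
  case (Cons i "is")
  have m: "F \<in> borel_measurable (Pi\<^sub>M (insert i (set is)) (\<lambda>_. lborel))" using Cons.prems by simp
  have "(\<integral>\<^sup>+w. F w \<partial>Pi\<^sub>M (set (i # is)) (\<lambda>_. lborel)) =
      (\<integral>\<^sup>+w. (\<integral>\<^sup>+t. F (w(i := t)) \<partial>lborel) \<partial>Pi\<^sub>M (set is) (\<lambda>_. lborel))"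
    using product_nn_integral_insert[of "set is" i F] Cons.prems(1) m by simp
  also have "\<dots> = nmarg is (\<lambda>w. \<integral>\<^sup>+t. F (w(i := t)) \<partial>lborel) (\<lambda>_. undefined)"
  proof (rule Cons.IH)
    show "distinct is" using Cons.prems by simp
    have "(\<lambda>(w, t). F (w(i := t))) \<in> borel_measurable (Pi\<^sub>M (set is) (\<lambda>_. lborel) \<Otimes>\<^sub>M lborel)"
      using measurable_compose[OF measurable_add_dim m] by (simp add: case_prod_beta' comp_def)
    thus "(\<lambda>w. \<integral>\<^sup>+t. F (w(i := t)) \<partial>lborel) \<in> borel_measurable (Pi\<^sub>M (set is) (\<lambda>_. lborel))"
      by (intro sigma_finite_measure.borel_measurable_nn_integral sigma_finite_lborel)
  qed
  finally show ?case by simp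
qed

definition vec :: "('a::euclidean_space \<Rightarrow> real) \<Rightarrow> 'a" where
  "vec w = (\<Sum>b\<in>Basis. w b *\<^sub>R b)"

definition bfun :: "'a::euclidean_space set \<Rightarrow> ('a \<Rightarrow> real) \<Rightarrow> real" where
  "bfun D w = indicator D (vec w)"

lemma vec_inner: "b \<in> Basis \<Longrightarrow> vec w \<bullet> b = w b"
  unfolding vec_def by (simp add: inner_sum_left inner_Basis if_distrib sum.delta cong: if_cong)

lemma vec_combination: "vec (\<lambda>i. a * w i + b * w' i) = a *\<^sub>R vec w + b *\<^sub>R vec w'"
  by (simp add: vec_def scaleR_sum_right sum.distrib scaleR_add_left)

lemma nn_integral_lborel_nmarg:
  fixes F :: "'a::euclidean_space \<Rightarrow> ennreal"
  assumes "distinct is" "set is = Basis" "F \<in> borel_measurable borel"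
  shows "(\<integral>\<^sup>+x. F x \<partial>lborel) = nmarg is (\<lambda>w. F (vec w)) (\<lambda>_. undefined)"
proof -
  have m: "vec \<in> measurable (Pi\<^sub>M Basis (\<lambda>_. lborel)) (borel :: 'a measure)"
    unfolding vec_def[abs_def] by measurable
  have "(\<integral>\<^sup>+x. F x \<partial>lborel) = (\<integral>\<^sup>+w. F (vec w) \<partial>Pi\<^sub>M Basis (\<lambda>_. lborel))"
    unfolding lborel_eq[where 'a='a] vec_def[symmetric, abs_def]
    using m assms(3) by (subst nn_integral_distr) (auto simp: vec_def[abs_def])
  also have "\<dots> = nmarg is (\<lambda>w. F (vec w)) (\<lambda>_. undefined)"
    unfolding assms(2)[symmetric]
    by (rule nn_integral_PiM_nmarg[OF assms(1)]) (use m assms in simp)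
  finally show ?thesis .
qed

lemma lcfun_bfun:
  fixes D :: "'a::euclidean_space set"
  assumes "convex D" "bounded D" shows "lcfun Basis (bfun D)"
  unfolding lcfun_def
proof (intro conjI allI impI)
  show "0 \<le> bfun D w" for w by (simp add: bfun_def)
  show "bfun D w powr a * bfun D w' powr b \<le> bfun D (\<lambda>i. a * w i + b * w' i)"
    if "0 < a" "0 < b" "a + b = 1" for w w' a b
    using assms(1) that unfolding bfun_def vec_combination
    by (auto simp: indicator_def convex_def)
  show "\<exists>C. \<forall>w. bfun D w \<le> C" by (intro exI[of _ 1]) (auto simp: bfun_def indicator_def)
  obtain R where R: "\<And>x. x \<in> D \<Longrightarrow> norm x \<le> R" using assms(2) bounded_iff by metis
  have "bfun D w = 0" if "i \<in> Basis" "R < \<bar>w i\<bar>" for w i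
  proof -
    have "\<bar>w i\<bar> \<le> norm (vec w)" using Basis_le_norm[OF that(1), of "vec w"] vec_inner[OF that(1)] by simp
    thus ?thesis using R[of "vec w"] that by (auto simp: bfun_def indicator_def)
  qed
  thus "\<exists>R. \<forall>w. \<forall>i\<in>Basis. R < \<bar>w i\<bar> \<longrightarrow> bfun D w = 0" by blast
qed

text \<open>The coordinate \<open>e\<close> comes last in the list, hence is integrated last, and
  the marginal over \<open>L\<close> is the volume of the slice of \<open>D\<close> at height
  \<open>t\<close>.\<close>

lemma integral_over_slices:
  fixes D :: "'a::euclidean_space set"
  assumes D: "convex D" "bounded D" "D \<in> sets borel"
    and L: "distinct (L @ [e])" "set (L @ [e]) = Basis" and \<phi>: "\<phi> \<in> borel_measurable borel"
  shows "(\<integral>\<^sup>+x\<in>D. \<phi> (x \<bullet> e) \<partial>lborel) =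
    (\<integral>\<^sup>+t. \<phi> t * ennreal (marg L (bfun D) ((\<lambda>_. undefined)(e := t))) \<partial>lborel)"
proof -
  have e: "e \<in> Basis" using L by auto
  have "(\<integral>\<^sup>+x\<in>D. \<phi> (x \<bullet> e) \<partial>lborel) = nmarg (L @ [e]) (\<lambda>w. \<phi> (vec w \<bullet> e) * indicator D (vec w)) (\<lambda>_. undefined)"
    by (rule nn_integral_lborel_nmarg[OF L]) (use D \<phi> in measurable)
  also have "(\<lambda>w. \<phi> (vec w \<bullet> e) * indicator D (vec w)) = (\<lambda>w. \<phi> (w e) * ennreal (bfun D w))"
    by (intro ext) (simp add: vec_inner[OF e] bfun_def ennreal_indicator)
  also have "nmarg (L @ [e]) \<dots> = nmarg [e] (\<lambda>w. \<phi> (w e) * ennreal (marg L (bfun D) w))"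
    unfolding nmarg_append by (subst nmarg_marg[OF lcfun_bfun[OF D(1,2)]]) (use L in auto)
  finally show ?thesis by simp
qed

lemma integral_over_slices2:
  fixes D :: "'a::euclidean_space set"
  assumes D: "convex D" "bounded D" "D \<in> sets borel"
    and L: "distinct (L @ [v, e])" "set (L @ [v, e]) = Basis"
    and \<phi>: "(\<lambda>(s, t). \<phi> s t) \<in> borel_measurable (borel \<Otimes>\<^sub>M borel)"
  shows "(\<integral>\<^sup>+x\<in>D. \<phi> (x \<bullet> e) (x \<bullet> v) \<partial>lborel) =
    (\<integral>\<^sup>+t. (\<integral>\<^sup>+s. \<phi> t s * ennreal (marg L (bfun D) ((\<lambda>_. undefined)(e := t, v := s))) \<partial>lborel) \<partial>lborel)"
proof -
  have e: "e \<in> Basis" "v \<in> Basis" "e \<noteq> v" using L by auto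
  have [measurable]: "(\<lambda>x. \<phi> (f x) (g x)) \<in> borel_measurable M"
    if "f \<in> borel_measurable M" "g \<in> borel_measurable M" for f g and M :: "'b measure"
    using measurable_compose[OF measurable_Pair[OF that] \<phi>] by simp
  have "(\<integral>\<^sup>+x\<in>D. \<phi> (x \<bullet> e) (x \<bullet> v) \<partial>lborel) = nmarg (L @ [v, e]) (\<lambda>w. \<phi> (vec w \<bullet> e) (vec w \<bullet> v) * indicator D (vec w)) (\<lambda>_. undefined)"
    by (rule nn_integral_lborel_nmarg[OF L]) (use D in measurable)
  also have "(\<lambda>w. \<phi> (vec w \<bullet> e) (vec w \<bullet> v) * indicator D (vec w)) = (\<lambda>w. \<phi> (w e) (w v) * ennreal (bfun D w))"
    by (intro ext) (simp add: vec_inner e bfun_def ennreal_indicator)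
  also have "nmarg (L @ [v, e]) \<dots> = nmarg [v, e] (\<lambda>w. \<phi> (w e) (w v) * ennreal (marg L (bfun D) w))"
    unfolding nmarg_append by (subst nmarg_marg[OF lcfun_bfun[OF D(1,2)]]) (use L in auto)
  finally show ?thesis using e by simp
qed

section \<open>Slices of three bodies linked by harmonic combinations\<close>

locale harmonic_triple =
  fixes e :: "'a::euclidean_space" and D0 D1 Dh :: "'a set"
  assumes convex: "convex D0" "convex D1" "convex Dh"
    and compact: "compact D0" "compact D1" "compact Dh"
    and e: "e \<in> Basis"
    and harmonic: "\<And>x y. \<lbrakk>x \<in> D0; y \<in> D1; 0 < x \<bullet> e; 0 < y \<bullet> e\<rbrakk> \<Longrightarrow>
       (y \<bullet> e / (x \<bullet> e + y \<bullet> e)) *\<^sub>R x + (x \<bullet> e / (x \<bullet> e + y \<bullet> e)) *\<^sub>R y \<in> Dh"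
begin

lemma bounded: "bounded D0" "bounded D1" "bounded Dh"
  and borel: "D0 \<in> sets borel" "D1 \<in> sets borel" "Dh \<in> sets borel"
  using compact by (auto simp: compact_imp_bounded compact_imp_closed borel_closed)

lemmas lcfuns = lcfun_bfun[OF convex(1) bounded(1)] lcfun_bfun[OF convex(2) bounded(2)] lcfun_bfun[OF convex(3) bounded(3)]

text \<open>The weights in the harmonic condition depend on the heights \<open>s\<close> and
  \<open>t\<close> only, not on the points of the slices. Between two fixed slices the condition is
  an ordinary convex combination, so Prekopa-Leindler with constant weights applies.\<close>

lemma slice_inequality:
  assumes L: "distinct L" "set L \<subseteq> Basis - {e}" and s: "0 < s" "0 < t"
    and a: "a = t / (s + t)" "b = s / (s + t)"
  shows "marg L (bfun D0) (w(e := s)) powr a * marg L (bfun D1) (w'(e := t)) powr b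
     \<le> marg L (bfun Dh) ((\<lambda>j. a * w j + b * w' j)(e := 2 * s * t / (s + t)))"
proof -
  have ab: "0 < a" "0 < b" "a + b = 1" using s by (auto simp: a add_divide_distrib[symmetric])
  have st: "a * s + b * t = 2 * s * t / (s + t)" by (simp add: a add_divide_distrib[symmetric])
  have eL: "e \<notin> set L" using L by auto
  have *: "bfun D0 (w(e := s)) powr a * bfun D1 (w'(e := t)) powr b
     \<le> bfun Dh ((\<lambda>j. a * w j + b * w' j)(e := 2 * s * t / (s + t)))" for w w'
  proof (cases "vec (w(e := s)) \<in> D0 \<and> vec (w'(e := t)) \<in> D1")
    case True
    have "a *\<^sub>R vec (w(e := s)) + b *\<^sub>R vec (w'(e := t)) \<in> Dh"
      using harmonic[of "vec (w(e := s))" "vec (w'(e := t))"] True s by (simp add: vec_inner[OF e] a)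
    hence "vec ((\<lambda>j. a * w j + b * w' j)(e := 2 * s * t / (s + t))) \<in> Dh"
      unfolding vec_combination[symmetric] upd_combination st .
    thus ?thesis using True ab by (simp add: bfun_def)
  qed (use ab in \<open>auto simp: bfun_def\<close>)
  have "marg L (\<lambda>w. bfun D0 (w(e := s))) w powr a * marg L (\<lambda>w. bfun D1 (w(e := t))) w' powr b
     \<le> marg L (\<lambda>w. bfun Dh (w(e := 2 * s * t / (s + t)))) (\<lambda>j. a * w j + b * w' j)"
    by (rule marg_prekopa_leindler[OF lcfun_upd[OF lcfuns(1)] lcfun_upd[OF lcfuns(2)] lcfun_upd[OF lcfuns(3)] L ab *])
  thus ?thesis using marg_upd[OF eL, of "bfun D0"] marg_upd[OF eL, of "bfun D1"] marg_upd[OF eL, of "bfun Dh"] by simp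
qed

end

definition slice_vol :: "'a::euclidean_space list \<Rightarrow> 'a \<Rightarrow> 'a set \<Rightarrow> real \<Rightarrow> real" where
  "slice_vol L e D t = indicator {0<..} t * marg L (bfun D) ((\<lambda>_. undefined)(e := t))"

lemma profile_slice_vol:
  fixes D :: "'a::euclidean_space set"
  assumes "convex D" "bounded D" "distinct (L @ [e])" "set (L @ [e]) = Basis"
  shows "profile (\<lambda>t. marg L (bfun D) ((\<lambda>_. undefined)(e := t)))" "profile (slice_vol L e D)"
proof -
  show p: "profile (\<lambda>t. marg L (bfun D) ((\<lambda>_. undefined)(e := t)))"
    by (rule lcfun_slice[OF lcfun_marg[OF lcfun_bfun[OF assms(1,2)]]]) (use assms in auto)
  show "profile (slice_vol L e D)" unfolding slice_vol_def[abs_def] by (rule profile_indicator[OF p]) simp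
qed

lemma measure_slice_vol:
  fixes D :: "'a::euclidean_space set"
  assumes D: "convex D" "compact D" and L: "distinct (L @ [e])" "set (L @ [e]) = Basis"
  shows "(LINT t|lborel. slice_vol L e D t) = measure lborel {x \<in> D. 0 < x \<bullet> e}"
proof -
  have b: "bounded D" "D \<in> sets borel" using D by (auto simp: compact_imp_bounded compact_imp_closed borel_closed)
  have e: "e \<in> Basis" using L by auto
  note p = profile_slice_vol[OF D(1) b(1) L]
  have s: "{x \<in> D. 0 < x \<bullet> e} = D \<inter> {x. 0 < x \<bullet> e}" by auto
  have "emeasure lborel {x \<in> D. 0 < x \<bullet> e} = (\<integral>\<^sup>+x\<in>D. indicator {0<..} (x \<bullet> e) \<partial>lborel)"
  proof -
    have "D \<inter> {x. 0 < x \<bullet> e} \<in> sets lborel"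
      using b by (auto intro!: sets.Int borel_open open_Collect_less continuous_intros)
    from nn_integral_indicator[OF this] show ?thesis
      unfolding s by (subst nn_integral_indicator[symmetric, OF \<open>D \<inter> {x. 0 < x \<bullet> e} \<in> sets lborel\<close>])
        (auto simp: indicator_def intro!: nn_integral_cong)
  qed
  also have "\<dots> = (\<integral>\<^sup>+t. indicator {0<..} t * ennreal (marg L (bfun D) ((\<lambda>_. undefined)(e := t))) \<partial>lborel)"
    by (rule integral_over_slices[OF D(1) b L]) simp
  also have "\<dots> = (\<integral>\<^sup>+t. ennreal (slice_vol L e D t) \<partial>lborel)"
    by (intro nn_integral_cong) (simp add: slice_vol_def indicator_def)
  also have "\<dots> = ennreal (LINT t|lborel. slice_vol L e D t)"
    by (rule nn_integral_eq_integral[OF profile_integrable[OF p(2)]]) (simp add: profile_nonneg[OF p(2)])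
  finally show ?thesis using profile_integral_nonneg[OF p(2)] by (simp add: measure_def)
qed

context harmonic_triple
begin

lemma harmonic_profiles_slices:
  assumes L: "distinct (L @ [e])" "set (L @ [e]) = Basis"
  shows "harmonic_profiles (slice_vol L e D0) (slice_vol L e D1) (slice_vol L e Dh)"
proof
  show "profile (slice_vol L e D0)" "profile (slice_vol L e D1)" "profile (slice_vol L e Dh)"
    using profile_slice_vol[OF _ _ L] convex bounded by blast+
  fix x y :: real assume xy: "0 < x" "0 < y"
  have ab: "0 < y/(x+y)" "0 < x/(x+y)" "y/(x+y) + x/(x+y) = 1" using xy by (auto simp: add_divide_distrib[symmetric])
  \<comment> \<open>All three slices are taken over the base value \<open>undefined\<close>; weights
    with sum 1 reproduce it.\<close>
  have "(\<lambda>j. (y/(x+y)) * ((\<lambda>_. undefined) j) + (x/(x+y)) * ((\<lambda>_. undefined) j)) = ((\<lambda>_. undefined) :: 'a \<Rightarrow> real)"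
    unfolding distrib_right[symmetric] ab(3) by simp
  moreover have "distinct L" "set L \<subseteq> Basis - {e}" using L by auto
  ultimately show "slice_vol L e D0 x powr (y/(x+y)) * slice_vol L e D1 y powr (x/(x+y)) \<le> slice_vol L e Dh (2*x*y/(x+y))"
    using slice_inequality[of L x y "y/(x+y)" "x/(x+y)" "\<lambda>_. undefined" "\<lambda>_. undefined"] xy
    by (simp add: slice_vol_def)
qed (auto simp: slice_vol_def)

lemma halfspace_inequality:
  assumes "measure lborel {x \<in> D0. 0 < x \<bullet> e} = I" "measure lborel {x \<in> D1. 0 < x \<bullet> e} = J" "0 < I" "0 < J"
  shows "2 * I * J / (I + J) \<le> measure lborel {x \<in> Dh. 0 < x \<bullet> e}"
proof -
  obtain L where "set L = Basis - {e}" "distinct L" using finite_distinct_list[of "Basis - {e}"] by auto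
  hence L: "distinct (L @ [e])" "set (L @ [e]) = Basis" using e by auto
  interpret s: harmonic_profiles "slice_vol L e D0" "slice_vol L e D1" "slice_vol L e Dh"
    by (rule harmonic_profiles_slices[OF L])
  show ?thesis
    using s.integral_ge[of I J] assms measure_slice_vol[OF _ _ L] convex compact by simp
qed

end

section \<open>Harmonic means of slices\<close>

lemma Sup_combination_le:
  fixes A B :: "real set"
  assumes "A \<noteq> {}" "B \<noteq> {}" "0 < a" "0 < b" "\<And>x y. x \<in> A \<Longrightarrow> y \<in> B \<Longrightarrow> a * x + b * y \<le> z"
  shows "a * Sup A + b * Sup B \<le> z"
proof -
  have 1: "Sup A \<le> (z - b * y) / a" if "y \<in> B" for y
  proof (rule cSup_least[OF assms(1)])
    fix x assume "x \<in> A"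
    from assms(5)[OF this that] show "x \<le> (z - b * y) / a" using assms(3) by (simp add: pos_le_divide_eq mult.commute)
  qed
  have "y \<le> (z - a * Sup A) / b" if "y \<in> B" for y
    using 1[OF that] assms(3,4) by (simp add: pos_le_divide_eq) (simp add: algebra_simps)
  hence "Sup B \<le> (z - a * Sup A) / b" using assms by (intro cSup_least) auto
  thus ?thesis using assms by (simp add: field_simps)
qed

text \<open>The second differences of \<open>\<rho>\<close> telescope, so only its continuity at the two end points matters.\<close>

lemma mono_of_midpoint_inequality:
  fixes \<rho> \<gamma> :: "real \<Rightarrow> real"
  assumes Q: "open Q" "is_interval Q" and cont: "continuous_on Q \<rho>"
    and le: "\<And>s t. s \<in> Q \<Longrightarrow> t \<in> Q \<Longrightarrow> \<rho> s + \<rho> t + \<gamma> t \<le> 2 * \<rho> ((s + t) / 2) + \<gamma> ((s + t) / 2)"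
    and p: "p \<in> Q" "q \<in> Q" "p < q"
  shows "\<gamma> p \<le> \<gamma> q"
proof (rule field_le_epsilon)
  fix \<epsilon> :: real assume \<epsilon>: "0 < \<epsilon>"
  have "\<exists>d>0. \<forall>s. \<bar>s - p\<bar> < d \<longrightarrow> \<bar>\<rho> s - \<rho> p\<bar> < \<epsilon>/2" "\<exists>d>0. \<forall>s. \<bar>s - q\<bar> < d \<longrightarrow> \<bar>\<rho> s - \<rho> q\<bar> < \<epsilon>/2"
    using cont p \<epsilon> unfolding continuous_on_eq_continuous_at[OF Q(1)] continuous_at_eps_delta dist_real_def
    by (simp_all only: half_gt_zero)
  then obtain d1 d2 where d: "0 < d1" "0 < d2" "\<And>s. \<bar>s - p\<bar> < d1 \<Longrightarrow> \<bar>\<rho> s - \<rho> p\<bar> < \<epsilon>/2"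
    "\<And>s. \<bar>s - q\<bar> < d2 \<Longrightarrow> \<bar>\<rho> s - \<rho> q\<bar> < \<epsilon>/2" by blast
  obtain d3 where d3: "0 < d3" "cball q d3 \<subseteq> Q" using Q p open_contains_cball by blast
  define d where "d = min d1 (min d2 d3)"
  have dp: "0 < d" using d d3 by (simp add: d_def)
  obtain N :: nat where N: "(q - p) / d < real N" using reals_Archimedean2 by blast
  have N0: "0 < real N" using N p dp by (meson diff_gt_0_iff_gt divide_pos_pos less_trans)
  define \<delta> where "\<delta> = (q - p) / real N"
  have \<delta>: "0 < \<delta>" "\<delta> < d" "real N * \<delta> = q - p" using N N0 p dp by (auto simp: \<delta>_def field_simps)
  \<comment> \<open>The telescoping sum reaches one step beyond \<open>q\<close>.\<close>
  have "q + \<delta> \<in> Q" using d3 \<delta> by (auto simp: d_def cball_def dist_real_def subset_iff)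
  hence Qk: "p + real k * \<delta> \<in> Q" if "k \<le> N + 1" for k
  proof -
    have "real k * \<delta> \<le> real (N + 1) * \<delta>" using that \<delta> by (intro mult_right_mono) auto
    hence "p + real k * \<delta> \<le> q + \<delta>" using \<delta>(3) by (simp add: distrib_right)
    moreover have "p \<le> p + real k * \<delta>" using \<delta> by simp
    ultimately show ?thesis using \<open>q + \<delta> \<in> Q\<close> p Q(2) mem_is_interval_1_I by blast
  qed
  define s where "s k = p + real k * \<delta>" for k :: nat
  have "\<rho> (s (k + 1)) - \<rho> (s k) - (\<rho> (s 1) - \<rho> (s 0)) \<le> \<gamma> (s k) - \<gamma> (s 0)" if "k \<le> N" for k
    using that
  proof (induction k)
    case (Suc k)
    have "s (k + 2) \<in> Q" "s k \<in> Q" using Qk[of "k+2"] Qk[of k] Suc.prems unfolding s_def by auto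
    from le[OF this] have "\<rho> (s (k + 2)) + \<rho> (s k) + \<gamma> (s k) \<le> 2 * \<rho> (s (k + 1)) + \<gamma> (s (k + 1))"
      by (simp add: s_def algebra_simps add_divide_distrib)
    thus ?case using Suc by simp
  qed (simp add: s_def)
  from this[of N] have "\<rho> (q + \<delta>) - \<rho> q - (\<rho> (p + \<delta>) - \<rho> p) \<le> \<gamma> q - \<gamma> p"
    using \<delta>(3) by (simp add: s_def algebra_simps)
  moreover have "\<bar>\<rho> (q + \<delta>) - \<rho> q\<bar> < \<epsilon>/2" "\<bar>\<rho> (p + \<delta>) - \<rho> p\<bar> < \<epsilon>/2"
    using d \<delta> by (auto simp: d_def)
  ultimately show "\<gamma> p \<le> \<gamma> q + \<epsilon>" by linarith
qed

text \<open>Here \<open>r t\<close> is the upper end of the section at height \<open>t\<close>, and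
  the second body has the sections moved by \<open>c t\<close>. In the variable \<open>1 / t\<close>
  harmonic means of heights become midpoints. With \<open>t * r (1/t)\<close> for
  \<open>\<rho>\<close> and \<open>t * c (1/t)\<close> for \<open>\<gamma>\<close>, hypothesis
  \<open>h1\<close> is the midpoint inequality, so \<open>c t / t\<close> does not increase.
  Continuity comes from \<open>h2\<close>, which makes \<open>r\<close> concave.\<close>

lemma shift_monotone:
  fixes A :: "real \<Rightarrow> real set" and c :: "real \<Rightarrow> real"
  assumes P: "open P" "is_interval P" "P \<subseteq> {0<..}"
    and A: "\<And>t. t \<in> P \<Longrightarrow> A t \<noteq> {}"
    and h1: "\<And>s t x y. \<lbrakk>s \<in> P; t \<in> P; x \<in> A s; y \<in> A t\<rbrakk> \<Longrightarrow>
      (t/(s+t)) * x + (s/(s+t)) * (y + c t) \<le> Sup (A (2 * s * t/(s+t))) + c (2 * s * t/(s+t)) / 2"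
    and h2: "\<And>s t x y a b. \<lbrakk>s \<in> P; t \<in> P; x \<in> A s; y \<in> A t; 0 < a; 0 < b; a + b = 1\<rbrakk> \<Longrightarrow>
      a * x + b * y \<le> Sup (A (a * s + b * t))"
    and p: "p \<in> P" "q \<in> P" "p < q"
  shows "c q / q \<le> c p / p"
proof -
  define r where "r t = Sup (A t)" for t
  have i1: "(t/(s+t)) * r s + (s/(s+t)) * r t + (s/(s+t)) * c t \<le> r (2 * s * t/(s+t)) + c (2 * s * t/(s+t)) / 2"
    if "s \<in> P" "t \<in> P" for s t
  proof -
    have st: "0 < s" "0 < t" using that P by auto
    have "(t/(s+t)) * r s + (s/(s+t)) * r t \<le> r (2 * s * t/(s+t)) + c (2 * s * t/(s+t)) / 2 - (s/(s+t)) * c t"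
      unfolding r_def
    proof (rule Sup_combination_le)
      fix x y assume "x \<in> A s" "y \<in> A t"
      from h1[OF that this] show "(t/(s+t)) * x + (s/(s+t)) * y \<le> Sup (A (2 * s * t/(s+t))) + c (2 * s * t/(s+t)) / 2 - (s/(s+t)) * c t"
        by (simp only: distrib_left)
    qed (use A that st in simp_all)
    thus ?thesis by linarith
  qed
  have i2: "a * r s + b * r t \<le> r (a * s + b * t)" if "s \<in> P" "t \<in> P" "0 < a" "0 < b" "a + b = 1" for s t a b
    unfolding r_def by (rule Sup_combination_le) (use A h2 that in auto)
  have "convex_on P (\<lambda>t. - r t)"
  proof (rule convex_onI)
    fix t x y :: real assume "0 < t" "t < 1" "x \<in> P" "y \<in> P"
    thus "- r ((1 - t) *\<^sub>R x + t *\<^sub>R y) \<le> (1 - t) * - r x + t * - r y"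
      using i2[of x y "1-t" t] by simp
  qed (use P is_interval_convex_1 in blast)
  hence "continuous_on P (\<lambda>t. - r t)" by (rule convex_on_continuous[OF P(1)])
  from continuous_on_minus[OF this] have rc: "continuous_on P r" by simp
  define Q where "Q = {t. 0 < t \<and> 1 / t \<in> P}"
  have Qeq: "Q = (\<lambda>t. 1 / t) -` P \<inter> {0<..}" by (auto simp: Q_def)
  have ci: "continuous_on {0<..} (\<lambda>t. 1 / t :: real)" by (intro continuous_intros) auto
  have Q1: "open Q" unfolding Qeq using continuous_on_open_vimage[of "{0<..}" "\<lambda>t. 1/t :: real"] ci P(1) by auto
  have Q2: "is_interval Q"
    unfolding is_interval_1
  proof (intro ballI allI impI)
    fix a b x assume a: "a \<in> Q" and b: "b \<in> Q" and "a \<le> x \<and> x \<le> b"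
    hence "0 < x" "1/b \<le> 1/x" "1/x \<le> 1/a" by (auto simp: Q_def frac_le)
    thus "x \<in> Q" using a b P(2) mem_is_interval_1_I unfolding Q_def by blast
  qed
  have pq: "1/q \<in> Q" "1/p \<in> Q" "1/q < 1/p" using p P(3) by (auto simp: Q_def frac_less2)
  have "(1/q) * c (1/(1/q)) \<le> (1/p) * c (1/(1/p))"
  proof (rule mono_of_midpoint_inequality[OF Q1 Q2 _ _ pq, where \<rho>="\<lambda>t. t * r (1/t)"])
    show "continuous_on Q (\<lambda>t. t * r (1/t))"
    proof (intro continuous_on_mult continuous_on_id)
      have "continuous_on ((\<lambda>t. 1/t) ` Q) r" by (rule continuous_on_subset[OF rc]) (auto simp: Q_def)
      moreover have "continuous_on Q (\<lambda>t. 1/t :: real)" by (rule continuous_on_subset[OF ci]) (auto simp: Q_def)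
      ultimately show "continuous_on Q (\<lambda>t. r (1/t))" using continuous_on_compose[of Q "\<lambda>t. 1/t" r] by (simp add: comp_def)
    qed
    fix s t assume st: "s \<in> Q" "t \<in> Q"
    hence pos: "0 < s" "0 < t" "1/s \<in> P" "1/t \<in> P" by (auto simp: Q_def)
    have e: "(1/t) / (1/s + 1/t) = s / (s + t)" "(1/s) / (1/s + 1/t) = t / (s + t)"
      "2 * (1/s) * (1/t) / (1/s + 1/t) = 2 / (s + t)" "1 / ((s + t) / 2) = 2 / (s + t)"
      using pos by (auto simp: divide_simps)
    have "(s/(s+t)) * r (1/s) + (t/(s+t)) * r (1/t) + (t/(s+t)) * c (1/t) \<le> r (2/(s+t)) + c (2/(s+t)) / 2"
      using i1[OF pos(3,4)] unfolding e .
    hence "(s+t) * ((s/(s+t)) * r (1/s) + (t/(s+t)) * r (1/t) + (t/(s+t)) * c (1/t)) \<le> (s+t) * (r (2/(s+t)) + c (2/(s+t)) / 2)"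
      using pos by (intro mult_left_mono) auto
    moreover have "(s+t) * ((s/(s+t)) * r (1/s) + (t/(s+t)) * r (1/t) + (t/(s+t)) * c (1/t)) = s * r (1/s) + t * r (1/t) + t * c (1/t)"
      using pos by (simp add: distrib_left)
    moreover have "(s+t) * (r (2/(s+t)) + c (2/(s+t)) / 2) = 2 * ((s+t)/2 * r (2/(s+t))) + (s+t)/2 * c (2/(s+t))"
      by (simp add: algebra_simps)
    ultimately show "s * r (1/s) + t * r (1/t) + t * c (1/t) \<le> 2 * ((s+t)/2 * r (1/((s+t)/2))) + (s+t)/2 * c (1/((s+t)/2))"
      unfolding e by linarith
  qed
  thus ?thesis by (simp add: mult.commute)
qed

text \<open>The upper ends of the sections show that \<open>c t / t\<close> does not increase. The
  lower ends, that is the sections \<open>- A t\<close> with the shift \<open>- c t\<close>, show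
  that it does not decrease. Closures appear because the combined point is only known to have
  positive density and may be an end point of its section.\<close>

lemma shift_linear:
  fixes A :: "real \<Rightarrow> real set" and c :: "real \<Rightarrow> real"
  assumes P: "open P" "is_interval P" "P \<subseteq> {0<..}"
    and A: "\<And>t. t \<in> P \<Longrightarrow> A t \<noteq> {}" "\<And>t. t \<in> P \<Longrightarrow> bounded (A t)"
    and h1: "\<And>s t x y. \<lbrakk>s \<in> P; t \<in> P; x \<in> A s; y \<in> A t\<rbrakk> \<Longrightarrow>
      (t/(s+t)) * x + (s/(s+t)) * (y + c t) - c (2 * s * t/(s+t)) / 2 \<in> closure (A (2 * s * t/(s+t)))"
    and h2: "\<And>s t x y a b. \<lbrakk>s \<in> P; t \<in> P; x \<in> A s; y \<in> A t; 0 < a; 0 < b; a + b = 1\<rbrakk> \<Longrightarrow>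
      a * x + b * y \<in> closure (A (a * s + b * t))"
  obtains k where "\<And>t. t \<in> P \<Longrightarrow> c t = k * t"
proof -
  have cP: "convex P" using P(2) is_interval_convex_1 by blast
  have hm: "2 * s * t/(s+t) \<in> P" if "s \<in> P" "t \<in> P" for s t
  proof -
    have st: "0 < s" "0 < t" using that P by auto
    have "(t/(s+t)) *\<^sub>R s + (s/(s+t)) *\<^sub>R t \<in> P"
      using cP that st by (intro convexD) (auto simp: add_divide_distrib[symmetric])
    thus ?thesis by (simp add: add_divide_distrib[symmetric] mult_ac)
  qed
  have am: "a * s + b * t \<in> P" if "s \<in> P" "t \<in> P" "0 < a" "0 < b" "a + b = 1" for s t a b
    using cP that by (simp add: convex_def)
  have le_Sup: "x \<le> Sup (A t)" if "x \<in> closure (A t)" "t \<in> P" for x t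
  proof -
    have "A t \<subseteq> {..Sup (A t)}" using A(2)[OF that(2)] by (auto intro!: cSup_upper bounded_imp_bdd_above)
    hence "closure (A t) \<subseteq> {..Sup (A t)}" by (intro closure_minimal) auto
    thus ?thesis using that by auto
  qed
  have le_Sup': "- x \<le> Sup (uminus ` A t)" if "x \<in> closure (A t)" "t \<in> P" for x t
  proof -
    have "bounded (uminus ` A t)" using A(2)[OF that(2)] by (rule bounded_linear_image[OF _ bounded_linear_minus[OF bounded_linear_ident]])
    hence "A t \<subseteq> {- Sup (uminus ` A t)..}"
      using cSup_upper[of _ "uminus ` A t"] bounded_imp_bdd_above by (fastforce simp: minus_le_iff)
    hence "closure (A t) \<subseteq> {- Sup (uminus ` A t)..}" by (intro closure_minimal) auto
    thus ?thesis using that by (auto simp: minus_le_iff)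
  qed
  have d: "c q / q \<le> c p / p" if "p \<in> P" "q \<in> P" "p < q" for p q
  proof (rule shift_monotone[OF P A(1) _ _ that])
    show "(t/(s+t)) * x + (s/(s+t)) * (y + c t) \<le> Sup (A (2 * s * t/(s+t))) + c (2 * s * t/(s+t)) / 2"
      if "s \<in> P" "t \<in> P" "x \<in> A s" "y \<in> A t" for s t x y
      using le_Sup[OF h1[OF that] hm] that by fastforce
    show "a * x + b * y \<le> Sup (A (a * s + b * t))"
      if "s \<in> P" "t \<in> P" "x \<in> A s" "y \<in> A t" "0 < a" "0 < b" "a + b = 1" for s t x y a b
      using le_Sup[OF h2[OF that] am] that by blast
  qed
  have u: "- c q / q \<le> - c p / p" if "p \<in> P" "q \<in> P" "p < q" for p q
  proof (rule shift_monotone[OF P _ _ _ that, where A="\<lambda>t. uminus ` A t" and c="\<lambda>t. - c t"])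
    show "(t/(s+t)) * x + (s/(s+t)) * (y + - c t) \<le> Sup (uminus ` A (2 * s * t/(s+t))) + - c (2 * s * t/(s+t)) / 2"
      if st: "s \<in> P" "t \<in> P" and xy: "x \<in> uminus ` A s" "y \<in> uminus ` A t" for s t x y
    proof -
      obtain x' y' where x': "x' \<in> A s" "y' \<in> A t" "x = - x'" "y = - y'" using xy by auto
      have "- ((t/(s+t)) * x' + (s/(s+t)) * (y' + c t) - c (2 * s * t/(s+t)) / 2) \<le> Sup (uminus ` A (2 * s * t/(s+t)))"
        by (rule le_Sup'[OF h1[OF st x'(1,2)] hm[OF st]])
      moreover have "(t/(s+t)) * x + (s/(s+t)) * (y + - c t) = - ((t/(s+t)) * x' + (s/(s+t)) * (y' + c t))"
        unfolding x'(3,4) by (simp only: mult_minus_right minus_add_distrib[symmetric])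
      ultimately show ?thesis by linarith
    qed
    show "a * x + b * y \<le> Sup (uminus ` A (a * s + b * t))"
      if st: "s \<in> P" "t \<in> P" and xy: "x \<in> uminus ` A s" "y \<in> uminus ` A t" and ab: "0 < a" "0 < b" "a + b = 1" for s t x y a b
    proof -
      obtain x' y' where x': "x' \<in> A s" "y' \<in> A t" "x = - x'" "y = - y'" using xy by auto
      have "- (a * x' + b * y') \<le> Sup (uminus ` A (a * s + b * t))"
        by (rule le_Sup'[OF h2[OF st x'(1,2) ab] am[OF st ab]])
      thus ?thesis unfolding x'(3,4) by (simp add: algebra_simps)
    qed
  qed (use A in auto)
  have const: "c q / q = c p / p" if "p \<in> P" "q \<in> P" for p q
    using d[of p q] d[of q p] u[of p q] u[of q p] that by (cases p q rule: linorder_cases) auto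
  show ?thesis
  proof (cases "P = {}")
    case True then show ?thesis using that by auto
  next
    case False
    then obtain p where p: "p \<in> P" by auto
    show ?thesis
    proof (rule that[of "c p / p"])
      fix t assume t: "t \<in> P"
      thus "c t = c p / p * t" using const[OF p t] P(3) by (auto simp: field_simps)
    qed
  qed
qed


section \<open>Equal half-space volumes: planar laws differ by a shear\<close>

context harmonic_triple
begin

text \<open>Two equality cases are combined. Along \<open>e\<close>, the harmonic one gives the
  three bodies equal slice volumes at the heights in \<open>P\<close>. For two equal heights the
  harmonic inequality is the ordinary midpoint inequality, and its equality case along
  \<open>v\<close> makes the marginals of \<open>D0\<close> and \<open>D1\<close> translates of each
  other by some \<open>c t\<close>. Comparing different heights shows that \<open>c\<close> meets
  the hypotheses of \<open>shift_linear\<close>, so these translations form a shear.\<close>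

lemma slices_translate:
  assumes L: "distinct (L @ [v, e])" "set (L @ [v, e]) = Basis"
    and I: "measure lborel {x \<in> D0. 0 < x \<bullet> e} = I" "measure lborel {x \<in> D1. 0 < x \<bullet> e} = I"
      "measure lborel {x \<in> Dh. 0 < x \<bullet> e} = I" "0 < I"
  defines "G \<equiv> \<lambda>D t s. marg L (bfun D) ((\<lambda>_. undefined)(e := t, v := s))"
  obtains P k where "AE t in lborel. 0 < t \<longrightarrow> t \<notin> P \<longrightarrow> (AE s in lborel. G D0 t s = 0 \<and> G D1 t s = 0)"
    "\<And>t. t \<in> P \<Longrightarrow> 0 < t \<and> (AE s in lborel. G D1 t (s + k * t) = G D0 t s)"
proof -
  let ?u = "(\<lambda>_. undefined) :: 'a \<Rightarrow> real"
  have ve: "v \<noteq> e" "v \<in> Basis" using L by auto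
  have L2: "distinct ((L @ [v]) @ [e])" "set ((L @ [v]) @ [e]) = Basis" using L by auto
  have L1: "distinct L" "set L \<subseteq> Basis - {e}" "set L \<subseteq> Basis" "v \<in> Basis - set L" "e \<in> Basis - set L" "v \<notin> set L" "e \<notin> set L"
    using L by auto
  define F where "F = slice_vol (L @ [v]) e"
  interpret s: harmonic_profiles "F D0" "F D1" "F Dh"
    unfolding F_def by (rule harmonic_profiles_slices[OF L2])
  have FI: "(LINT t|lborel. F D0 t) = I" "(LINT t|lborel. F D1 t) = I" "(LINT t|lborel. F Dh t) = I"
    unfolding F_def using I measure_slice_vol[OF _ _ L2] convex compact by auto
  note seq = s.equality[OF FI I(4)]
  define P where "P = pos (F D0)"
  have FG: "F D t = (LINT s|lborel. G D t s)" if "0 < t" for D t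
    using that by (simp add: F_def slice_vol_def marg_append marg1_def G_def)
  have P0: "0 < t" "0 < F D0 t" if "t \<in> P" for t
  proof -
    show "0 < F D0 t" using that pos_gt0[OF s.f] by (auto simp: P_def)
    thus "0 < t" using s.f0[of t] by (auto simp: not_le[symmetric])
  qed
  have lcL: "lcfun (Basis - set L) (marg L (bfun D0))" "lcfun (Basis - set L) (marg L (bfun D1))" "lcfun (Basis - set L) (marg L (bfun Dh))"
    using lcfun_marg lcfuns L1 by blast+
  have prof: "profile (G D0 t)" "profile (G D1 t)" "profile (G Dh t)" for t
    unfolding G_def using lcfun_slice[OF _ L1(4)] lcL by blast+
  have comb: "(\<lambda>j. a * (?u(e := s, v := x)) j + b * (?u(e := t, v := y)) j) = ?u(e := a * s + b * t, v := a * x + b * y)"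
    if "a + b = 1" for a b s t x y
  proof -
    have "a * undefined + b * undefined = (undefined :: real)" using that by (metis distrib_right mult_1)
    hence "(\<lambda>j. a * ?u j + b * ?u j) = ?u" by simp
    thus ?thesis by (simp only: upd_combination)
  qed
  have harm: "G D0 s x powr (t/(s+t)) * G D1 t y powr (s/(s+t)) \<le> G Dh (2 * s * t/(s+t)) ((t/(s+t)) * x + (s/(s+t)) * y)"
    if st: "0 < s" "0 < t" for s t x y
  proof -
    have ab: "t/(s+t) + s/(s+t) = 1" using st by (simp add: add_divide_distrib[symmetric])
    have tw: "?u(v := x, e := s) = ?u(e := s, v := x)" for x s using ve by (simp add: fun_upd_twist)
    have c0: "(\<lambda>j. t/(s+t) * (?u(v := x)) j + s/(s+t) * (?u(v := y)) j) = ?u(v := (t/(s+t)) * x + (s/(s+t)) * y)"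
    proof -
      have "(t/(s+t)) * undefined + (s/(s+t)) * undefined = (undefined :: real)" using ab by (metis distrib_right mult_1)
      hence "(\<lambda>j. t/(s+t) * ?u j + s/(s+t) * ?u j) = ?u" by simp
      thus ?thesis by (simp only: upd_combination)
    qed
    show ?thesis
      using slice_inequality[OF L1(1,2) st refl refl, of "?u(v := x)" "?u(v := y)"] unfolding G_def c0 tw .
  qed
  have PF: "F D0 t = F D1 t" "F D0 t = F Dh t" if "t \<in> P" for t using seq(3) that by (auto simp: P_def)
  have "\<exists>c. pos (G D1 t) = (\<lambda>x. x + c) ` pos (G D0 t) \<and> pos (G Dh t) = (\<lambda>x. x + c / 2) ` pos (G D0 t)
      \<and> (\<forall>x\<in>pos (G D0 t). G D1 t (x + c) = G D0 t x)" if t: "t \<in> P" for t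
  proof -
    have le: "sqrt (G D0 t x * G D1 t y) \<le> G Dh t ((x + y) / 2)" for x y
    proof -
      have e: "t/(t+t) = 1/2" "2 * t * t/(t+t) = t" using P0[OF t] by auto
      show ?thesis using harm[OF P0(1)[OF t] P0(1)[OF t], of x y] profile_nonneg[OF prof(1)] profile_nonneg[OF prof(2)]
        unfolding e by (simp add: powr_half_sqrt real_sqrt_mult add_divide_distrib)
    qed
    show ?thesis
      using prekopa_leindler_1_equality[OF prof[of t] le, of "F D0 t"] FG[OF P0(1)[OF t]] PF[OF t] P0[OF t] by metis
  qed
  then obtain c where c: "\<And>t. t \<in> P \<Longrightarrow> pos (G D1 t) = (\<lambda>x. x + c t) ` pos (G D0 t)"
    "\<And>t. t \<in> P \<Longrightarrow> pos (G Dh t) = (\<lambda>x. x + c t / 2) ` pos (G D0 t)"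
    "\<And>t x. t \<in> P \<Longrightarrow> x \<in> pos (G D0 t) \<Longrightarrow> G D1 t (x + c t) = G D0 t x"
    by metis
  have P: "open P" "is_interval P" "P \<subseteq> {0<..}"
    using pos_open[OF s.f] pos_convex[OF s.f] P0(1) is_interval_convex_1 by (auto simp: P_def)
  have ne: "pos (G D0 t) \<noteq> {}" if t: "t \<in> P" for t
    using quantile_exists[OF prof(1)[of t], of "F D0 t / 2"] FG[OF P0(1)[OF t]] P0(2)[OF t] by fastforce
  have bdd: "bounded (pos f)" if pf: "profile f" for f
  proof -
    obtain R where R: "\<And>x. R < \<bar>x\<bar> \<Longrightarrow> f x = 0" using pf by (auto simp: profile_def)
    have "\<bar>x\<bar> \<le> R" if "x \<in> pos f" for x using pos_gt0[OF pf that] R[of x] by force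
    thus ?thesis unfolding bounded_iff by (auto intro!: exI[of _ R])
  qed
  have clos: "x \<in> closure (pos f)" if "profile f" "0 < f x" "pos f \<noteq> {}" for f x
  proof -
    have "convex {x. 0 < f x}" using profile_superlevel_convex[OF that(1), of 0] by simp
    hence "closure (pos f) = closure {x. 0 < f x}" using convex_closure_interior[of "{x. 0 < f x}"] that(3) unfolding pos_def by simp
    thus ?thesis using that(2) closure_subset[of "{x. 0 < f x}"] by auto
  qed
  obtain k where k: "\<And>t. t \<in> P \<Longrightarrow> c t = k * t"
  proof (rule shift_linear[OF P, where A="\<lambda>t. pos (G D0 t)" and c=c])
    show "pos (G D0 t) \<noteq> {}" if "t \<in> P" for t by (rule ne[OF that])
    show "bounded (pos (G D0 t))" for t by (rule bdd[OF prof(1)])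
    fix s t x y assume st: "s \<in> P" "t \<in> P" and xy: "x \<in> pos (G D0 s)" "y \<in> pos (G D0 t)"
    have st0: "0 < s" "0 < t" using P0 st by auto
    have hP: "2 * s * t/(s+t) \<in> P"
    proof -
      have "(t/(s+t)) *\<^sub>R s + (s/(s+t)) *\<^sub>R t \<in> P"
        using st st0 P(2) is_interval_convex_1 by (intro convexD) (auto simp: add_divide_distrib[symmetric])
      thus ?thesis by (simp add: add_divide_distrib[symmetric] mult_ac)
    qed
    let ?t = "2 * s * t/(s+t)" and ?x = "(t/(s+t)) * x + (s/(s+t)) * (y + c t)"
    have "y + c t \<in> pos (G D1 t)" using c(1)[OF st(2)] xy by auto
    from pos_gt0[OF prof(2) this] pos_gt0[OF prof(1) xy(1)]
    have "0 < G D0 s x powr (t/(s+t)) * G D1 t (y + c t) powr (s/(s+t))" by simp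
    hence "0 < G Dh ?t ?x" using harm[OF st0, of x "y + c t"] by linarith
    hence "?x \<in> closure (pos (G Dh ?t))" by (rule clos[OF prof(3)]) (use c(2)[OF hP] ne[OF hP] in auto)
    \<comment> \<open>The section of \<open>Dh\<close> is that of \<open>D0\<close> moved by half of
      the shift; this is the origin of the subtracted \<open>c ?t / 2\<close>.\<close>
    also have "closure (pos (G Dh ?t)) = (\<lambda>x. c ?t / 2 + x) ` closure (pos (G D0 ?t))"
      unfolding c(2)[OF hP] closure_translation[symmetric] by (simp add: add.commute)
    finally show "?x - c ?t / 2 \<in> closure (pos (G D0 ?t))" by auto
  next
    fix s t x y a b assume st: "s \<in> P" "t \<in> P" and xy: "x \<in> pos (G D0 s)" "y \<in> pos (G D0 t)"
      and ab: "0 < a" "0 < b" "a + b = (1::real)"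
    have hP: "a * s + b * t \<in> P" using st ab P(2) is_interval_convex_1 unfolding convex_def by (metis less_imp_le real_scaleR_def)
    have "0 < G D0 s x powr a * G D0 t y powr b"
      using pos_gt0[OF prof(1) xy(1)] pos_gt0[OF prof(1) xy(2)] by simp
    also have "\<dots> \<le> G D0 (a * s + b * t) (a * x + b * y)"
      unfolding G_def comb[OF ab(3), symmetric] using lcL(1) ab unfolding lcfun_def by blast
    finally show "a * x + b * y \<in> closure (pos (G D0 (a * s + b * t)))"
      by (rule clos[OF prof(1)]) (use ne[OF hP] in auto)
  qed blast
  show ?thesis
  proof (rule that[of P k])
    fix t assume t: "t \<in> P"
    have "AE s in lborel. s \<notin> pos (G D1 t) \<longrightarrow> G D1 t s = 0" by (rule profile_AE_zero[OF prof(2)])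
    moreover have [measurable]: "G D1 t \<in> borel_measurable borel" "pos (G D1 t) \<in> sets borel"
      using profile_measurable[OF prof(2)] pos_open[OF prof(2)] by (auto simp: borel_open)
    have "Measurable.pred borel (\<lambda>s. s \<notin> pos (G D1 t) \<longrightarrow> G D1 t s = 0)" by measurable
    ultimately have "AE s in lborel. (k * t) + 1 * s \<notin> pos (G D1 t) \<longrightarrow> G D1 t ((k * t) + 1 * s) = 0"
      by (intro AE_borel_affine) auto
    moreover have "AE s in lborel. s \<notin> pos (G D0 t) \<longrightarrow> G D0 t s = 0" by (rule profile_AE_zero[OF prof(1)])
    ultimately have "AE s in lborel. G D1 t (s + k * t) = G D0 t s"
    proof eventually_elim
      case (elim s)
      show ?case
      proof (cases "s \<in> pos (G D0 t)")
        case True then show ?thesis using c(3)[OF t] k[OF t] by simp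
      next
        case False
        hence "k * t + s \<notin> pos (G D1 t)" unfolding c(1)[OF t] k[OF t] by auto
        thus ?thesis using elim False by (simp add: add.commute)
      qed
    qed
    thus "0 < t \<and> (AE s in lborel. G D1 t (s + k * t) = G D0 t s)" using P0[OF t] by simp
  next
    have z: "AE s in lborel. G D t s = 0" if "F D t = 0" "0 < t" "profile (G D t)" for D t
      using that FG[of t D] integral_nonneg_eq_0_iff_AE[OF profile_integrable[OF that(3)]] profile_nonneg[OF that(3)] by simp
    have "AE t in lborel. t \<notin> P \<longrightarrow> F D0 t = 0" "AE t in lborel. t \<notin> P \<longrightarrow> F D1 t = 0"
      using profile_AE_zero[OF s.f] profile_AE_zero[OF s.g] seq(1) by (auto simp: P_def)
    thus "AE t in lborel. 0 < t \<longrightarrow> t \<notin> P \<longrightarrow> (AE s in lborel. G D0 t s = 0 \<and> G D1 t s = 0)"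
      by eventually_elim (use z prof in \<open>auto simp: AE_conj_iff\<close>)
  qed
qed

text \<open>An identity between laws of the pair \<open>(x \<bullet> e, x \<bullet> v)\<close>
  rather than between sets, since only marginals of the bodies onto a plane have been
  compared.\<close>

lemma halfspace_laws:
  assumes v: "v \<in> Basis" "v \<noteq> e"
    and I: "measure lborel {x \<in> D0. 0 < x \<bullet> e} = I" "measure lborel {x \<in> D1. 0 < x \<bullet> e} = I"
      "measure lborel {x \<in> Dh. 0 < x \<bullet> e} = I" "0 < I"
  obtains k where "\<And>B. B \<in> sets (borel \<Otimes>\<^sub>M borel) \<Longrightarrow>
     emeasure lborel {x \<in> D1. 0 < x \<bullet> e \<and> (x \<bullet> e, x \<bullet> v) \<in> B}
     = emeasure lborel {x \<in> D0. 0 < x \<bullet> e \<and> (x \<bullet> e, x \<bullet> v + k * (x \<bullet> e)) \<in> B}"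
proof -
  obtain L where "set L = Basis - {e, v}" "distinct L" using finite_distinct_list[of "Basis - {e, v}"] by auto
  hence L: "distinct (L @ [v, e])" "set (L @ [v, e]) = Basis" using e v by auto
  define G where "G D t s = marg L (bfun D) ((\<lambda>_. undefined)(e := t, v := s))" for D t s
  show ?thesis
  proof (rule slices_translate[OF L I], fold G_def)
  fix P k assume P: "AE t in lborel. 0 < t \<longrightarrow> t \<notin> P \<longrightarrow> (AE s in lborel. G D0 t s = 0 \<and> G D1 t s = 0)"
    and k: "\<And>t. t \<in> P \<Longrightarrow> 0 < t \<and> (AE s in lborel. G D1 t (s + k * t) = G D0 t s)"
  have lcL: "lcfun (Basis - set L) (marg L (bfun D0))" "lcfun (Basis - set L) (marg L (bfun D1))"
    using lcfun_marg[OF lcfuns(1)] lcfun_marg[OF lcfuns(2)] L by auto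
  have prof: "profile (G D0 t)" "profile (G D1 t)" for t
  proof -
    have v: "v \<in> Basis - set L" using L by auto
    show "profile (G D0 t)" "profile (G D1 t)"
      unfolding G_def using lcfun_slice[OF _ v] lcL by blast+
  qed
  note [measurable] = profile_measurable[OF prof(1)] profile_measurable[OF prof(2)]
  show ?thesis
  proof (rule that[of k])
    fix B :: "(real \<times> real) set" assume B[measurable]: "B \<in> sets (borel \<Otimes>\<^sub>M borel)"
    have em: "emeasure lborel {x \<in> D. 0 < x \<bullet> e \<and> (x \<bullet> e, x \<bullet> v + m * (x \<bullet> e)) \<in> B}
       = (\<integral>\<^sup>+t. (\<integral>\<^sup>+s. indicator {0<..} t * indicator B (t, s + m * t) * ennreal (G D t s) \<partial>lborel) \<partial>lborel)"
      if "convex D" "bounded D" and D[measurable]: "D \<in> sets borel" for D m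
    proof -
      have "{x \<in> space lborel. x \<in> D \<and> 0 < x \<bullet> e \<and> (x \<bullet> e, x \<bullet> v + m * (x \<bullet> e)) \<in> B} \<in> sets lborel" by measurable
      hence "emeasure lborel {x \<in> D. 0 < x \<bullet> e \<and> (x \<bullet> e, x \<bullet> v + m * (x \<bullet> e)) \<in> B}
        = (\<integral>\<^sup>+x. indicator {x \<in> D. 0 < x \<bullet> e \<and> (x \<bullet> e, x \<bullet> v + m * (x \<bullet> e)) \<in> B} x \<partial>lborel)"
        by (intro nn_integral_indicator[symmetric]) simp
      also have "\<dots> = (\<integral>\<^sup>+x\<in>D. indicator {0<..} (x \<bullet> e) * indicator B (x \<bullet> e, x \<bullet> v + m * (x \<bullet> e)) \<partial>lborel)"
        by (intro nn_integral_cong) (auto simp: indicator_def)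
      also have "\<dots> = (\<integral>\<^sup>+t. (\<integral>\<^sup>+s. indicator {0<..} t * indicator B (t, s + m * t) * ennreal (G D t s) \<partial>lborel) \<partial>lborel)"
        unfolding G_def
        by (rule integral_over_slices2[OF that L, where \<phi>="\<lambda>t s. indicator {0<..} t * indicator B (t, s + m * t)"]) measurable
      finally show ?thesis .
    qed
    have "(\<integral>\<^sup>+t. (\<integral>\<^sup>+s. indicator {0<..} t * indicator B (t, s + 0 * t) * ennreal (G D1 t s) \<partial>lborel) \<partial>lborel)
      = (\<integral>\<^sup>+t. (\<integral>\<^sup>+s. indicator {0<..} t * indicator B (t, s + k * t) * ennreal (G D0 t s) \<partial>lborel) \<partial>lborel)"
    proof (rule nn_integral_cong_AE)
      show "AE t in lborel. (\<integral>\<^sup>+s. indicator {0<..} t * indicator B (t, s + 0 * t) * ennreal (G D1 t s) \<partial>lborel)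
        = (\<integral>\<^sup>+s. indicator {0<..} t * indicator B (t, s + k * t) * ennreal (G D0 t s) \<partial>lborel)"
        using P
      proof eventually_elim
        case (elim t)
        show ?case
        proof (cases "t \<in> P")
          case True
          have "(\<integral>\<^sup>+s. indicator {0<..} t * indicator B (t, s + 0 * t) * ennreal (G D1 t s) \<partial>lborel)
            = (\<integral>\<^sup>+s. indicator {0<..} t * indicator B (t, k * t + 1 * s) * ennreal (G D1 t (k * t + 1 * s)) \<partial>lborel)"
            by (subst nn_integral_real_affine[where c=1 and t="k * t"]) auto
          also have "\<dots> = (\<integral>\<^sup>+s. indicator {0<..} t * indicator B (t, s + k * t) * ennreal (G D0 t s) \<partial>lborel)"
          proof (rule nn_integral_cong_AE)
            have "AE s in lborel. G D1 t (s + k * t) = G D0 t s" using k[OF True] by blast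
            thus "AE s in lborel. indicator {0<..} t * indicator B (t, k * t + 1 * s) * ennreal (G D1 t (k * t + 1 * s))
              = indicator {0<..} t * indicator B (t, s + k * t) * ennreal (G D0 t s)"
              by eventually_elim (simp add: add.commute)
          qed
          finally show ?thesis .
        next
          case False
          show ?thesis
          proof (cases "0 < t")
            case True
            have "AE s in lborel. G D0 t s = 0 \<and> G D1 t s = 0" using elim True False by blast
            hence "AE s in lborel. indicator {0<..} t * indicator B (t, s + 0 * t) * ennreal (G D1 t s) = 0"
              "AE s in lborel. indicator {0<..} t * indicator B (t, s + k * t) * ennreal (G D0 t s) = 0"
              by (eventually_elim, simp)+
            thus ?thesis by (simp only: nn_integral_cong_AE[of _ "\<lambda>_. 0"])
          qed simp
        qed
      qed
    qed
    thus "emeasure lborel {x \<in> D1. 0 < x \<bullet> e \<and> (x \<bullet> e, x \<bullet> v) \<in> B}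
     = emeasure lborel {x \<in> D0. 0 < x \<bullet> e \<and> (x \<bullet> e, x \<bullet> v + k * (x \<bullet> e)) \<in> B}"
      using em[OF convex(2) bounded(2) borel(2), of 0] em[OF convex(1) bounded(1) borel(1), of k] by simp
  qed
  qed
qed

text \<open>The degenerate companion for a vector parallel to \<open>e\<close>, where the two
  coordinates do not span a plane.\<close>

lemma halfspace_law_axis:
  assumes I: "measure lborel {x \<in> D0. 0 < x \<bullet> e} = I" "measure lborel {x \<in> D1. 0 < x \<bullet> e} = I"
      "measure lborel {x \<in> Dh. 0 < x \<bullet> e} = I" "0 < I"
    and B: "B \<in> sets borel"
  shows "emeasure lborel {x \<in> D1. 0 < x \<bullet> e \<and> x \<bullet> e \<in> B} = emeasure lborel {x \<in> D0. 0 < x \<bullet> e \<and> x \<bullet> e \<in> B}"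
proof -
  obtain L where "set L = Basis - {e}" "distinct L" using finite_distinct_list[of "Basis - {e}"] by auto
  hence L: "distinct (L @ [e])" "set (L @ [e]) = Basis" using e by auto
  interpret s: harmonic_profiles "slice_vol L e D0" "slice_vol L e D1" "slice_vol L e Dh"
    by (rule harmonic_profiles_slices[OF L])
  have FI: "(LINT t|lborel. slice_vol L e D0 t) = I" "(LINT t|lborel. slice_vol L e D1 t) = I" "(LINT t|lborel. slice_vol L e Dh t) = I"
    using I measure_slice_vol[OF _ _ L] convex compact by auto
  note seq = s.equality[OF FI I(4)]
  have em: "emeasure lborel {x \<in> D. 0 < x \<bullet> e \<and> x \<bullet> e \<in> B} = (\<integral>\<^sup>+t. indicator B t * ennreal (slice_vol L e D t) \<partial>lborel)"
    if "convex D" "bounded D" and D[measurable]: "D \<in> sets borel" for D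
  proof -
    note [measurable] = B
    have "{x \<in> space lborel. x \<in> D \<and> 0 < x \<bullet> e \<and> x \<bullet> e \<in> B} \<in> sets lborel" by measurable
    hence "emeasure lborel {x \<in> D. 0 < x \<bullet> e \<and> x \<bullet> e \<in> B} = (\<integral>\<^sup>+x. indicator {x \<in> D. 0 < x \<bullet> e \<and> x \<bullet> e \<in> B} x \<partial>lborel)"
      by (intro nn_integral_indicator[symmetric]) simp
    also have "\<dots> = (\<integral>\<^sup>+x\<in>D. indicator {0<..} (x \<bullet> e) * indicator B (x \<bullet> e) \<partial>lborel)"
      by (intro nn_integral_cong) (auto simp: indicator_def)
    also have "\<dots> = (\<integral>\<^sup>+t. indicator {0<..} t * indicator B t * ennreal (marg L (bfun D) ((\<lambda>_. undefined)(e := t))) \<partial>lborel)"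
      by (rule integral_over_slices[OF that L, where \<phi>="\<lambda>t. indicator {0<..} t * indicator B t"]) measurable
    also have "\<dots> = (\<integral>\<^sup>+t. indicator B t * ennreal (slice_vol L e D t) \<partial>lborel)"
      by (intro nn_integral_cong) (simp add: slice_vol_def indicator_def)
    finally show ?thesis .
  qed
  have "(\<integral>\<^sup>+t. indicator B t * ennreal (slice_vol L e D1 t) \<partial>lborel) = (\<integral>\<^sup>+t. indicator B t * ennreal (slice_vol L e D0 t) \<partial>lborel)"
  proof (rule nn_integral_cong_AE)
    show "AE t in lborel. indicator B t * ennreal (slice_vol L e D1 t) = indicator B t * ennreal (slice_vol L e D0 t)"
      using profile_AE_zero[OF s.f] profile_AE_zero[OF s.g]
    proof eventually_elim
      case (elim t)
      thus ?case using seq by (cases "t \<in> pos (slice_vol L e D0)") auto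
    qed
  qed
  thus ?thesis unfolding em[OF convex(2) bounded(2) borel(2)] em[OF convex(1) bounded(1) borel(1)] .
qed

end

section \<open>Linear changes of variables and half-spaces\<close>

lemma linear_bij_extension:
  fixes f :: "'a::euclidean_space \<Rightarrow> 'a"
  assumes S: "S \<subseteq> Basis" "inj_on f S" "independent (f ` S)"
  shows "\<exists>g :: 'a \<Rightarrow> 'a. linear g \<and> bij g \<and> (\<forall>b\<in>S. g b = f b)"
proof -
  obtain C where C0: "f ` S \<subseteq> C" "independent C" "UNIV \<subseteq> span C"
    using maximal_independent_subset_extend[OF subset_UNIV S(3)] by metis
  hence C: "f ` S \<subseteq> C" "independent C" "span C = UNIV" by (simp_all add: top.extremum_unique)
  have fC: "finite C" "card C = DIM('a)"
    using independent_bound[OF C(2)] dim_eq_card_independent[OF C(2)] dim_span[of C] by (simp_all add: C(3))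
  have fS: "finite S" using finite_subset[OF S(1) finite_Basis] .
  have "card (Basis - S) = card (C - f ` S)"
    using fC C(1) S(1) fS by (simp add: card_Diff_subset card_image[OF S(2)])
  then obtain h0 where h0: "bij_betw h0 (Basis - S) (C - f ` S)"
    using finite_same_card_bij[of "Basis - S" "C - f ` S"] fC by auto
  define h where "h b = (if b \<in> S then f b else h0 b)" for b
  have "h ` Basis = h ` S \<union> h ` (Basis - S)" using S(1) by blast
  also have "h ` S = f ` S" by (rule image_cong) (simp_all add: h_def)
  also have "h ` (Basis - S) = h0 ` (Basis - S)" by (rule image_cong) (simp_all add: h_def)
  also have "\<dots> = C - f ` S" using h0 by (simp add: bij_betw_def)
  finally have hB: "h ` Basis = C" using C(1) by blast
  obtain g where g: "linear g" "\<And>b. b \<in> Basis \<Longrightarrow> g b = h b"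
    using linear_independent_extend[OF independent_Basis, of h] by metis
  have "range g = g ` span Basis" by simp
  also have "\<dots> = span (g ` Basis)" using linear_span_image[OF g(1)] by simp
  also have "g ` Basis = h ` Basis" by (rule image_cong[OF refl]) (rule g(2))
  finally have "surj g" by (simp add: hB C(3))
  hence "bij g" using linear_surjective_imp_injective[OF g(1)] by (simp add: bij_def)
  moreover have "g b = f b" if "b \<in> S" for b using g(2)[of b] S(1) that by (auto simp: h_def)
  ultimately show ?thesis using g(1) by (intro exI[of _ g]) simp
qed

text \<open>The factor \<open>c\<close> is the absolute value of the determinant, expressed through
  nonnegative integrals; in this form it passes directly through compositions.\<close>

definition scales :: "('a::euclidean_space \<Rightarrow> 'a) \<Rightarrow> real \<Rightarrow> bool" where
  "scales f c \<longleftrightarrow> linear f \<and> 0 < c \<and>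
     (\<forall>F\<in>borel_measurable borel. (\<integral>\<^sup>+x. F x \<partial>lborel) = ennreal c * (\<integral>\<^sup>+x. F (f x) \<partial>lborel))"

lemma linear_borel: "linear f \<Longrightarrow> f \<in> borel_measurable borel" for f :: "'a::euclidean_space \<Rightarrow> 'b::euclidean_space"
  by (simp add: borel_measurable_continuous_onI linear_continuous_on linear_conv_bounded_linear)

lemma scales_comp:
  assumes "scales f c" "scales g d" shows "scales (f \<circ> g) (c * d)"
proof -
  have "(\<integral>\<^sup>+x. F x \<partial>lborel) = ennreal (c * d) * (\<integral>\<^sup>+x. F (f (g x)) \<partial>lborel)" if F: "F \<in> borel_measurable borel" for F
  proof -
    have "(\<lambda>x. F (f x)) \<in> borel_measurable borel"
      using measurable_compose[OF linear_borel[of f] F] assms(1) by (simp add: scales_def)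
    hence "(\<integral>\<^sup>+x. F (f x) \<partial>lborel) = ennreal d * (\<integral>\<^sup>+x. F (f (g x)) \<partial>lborel)"
      using assms(2) by (auto simp: scales_def)
    moreover have "(\<integral>\<^sup>+x. F x \<partial>lborel) = ennreal c * (\<integral>\<^sup>+x. F (f x) \<partial>lborel)"
      using assms(1) F by (auto simp: scales_def)
    ultimately show ?thesis using assms by (simp add: scales_def ennreal_mult mult.assoc)
  qed
  thus ?thesis using assms linear_compose[of g f] by (auto simp: scales_def)
qed

lemma scales_if_distr:
  assumes "linear f" "distr lborel borel f = (lborel :: ('a::euclidean_space) measure)"
  shows "scales f 1"
  unfolding scales_def
proof (intro conjI ballI assms(1))
  fix F :: "'a \<Rightarrow> ennreal" assume F: "F \<in> borel_measurable borel"
  have "(\<integral>\<^sup>+x. F x \<partial>lborel) = (\<integral>\<^sup>+x. F x \<partial>distr lborel borel f)" using assms(2) by simp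
  also have "\<dots> = (\<integral>\<^sup>+x. F (f x) \<partial>lborel)" using F linear_borel[OF assms(1)] by (intro nn_integral_distr) auto
  finally show "(\<integral>\<^sup>+x. F x \<partial>lborel) = ennreal 1 * (\<integral>\<^sup>+x. F (f x) \<partial>lborel)" by simp
qed simp

lemma cart_Basis: "(Basis :: (real ^ 'n) set) = range (\<lambda>i. axis i 1)"
  by (auto simp: Basis_vec_def)

lemma scales_diagonal:
  fixes c :: "'n::finite \<Rightarrow> real"
  assumes "\<And>i. c i \<noteq> 0"
  shows "scales (\<lambda>x. \<chi> i. c i * x $ i) (\<Prod>j\<in>Basis. \<bar>(\<chi> i. c i) \<bullet> (j :: real ^ 'n)\<bar>)"
proof -
  let ?f = "\<lambda>x :: real ^ 'n. \<chi> i. c i * x $ i" and ?c = "\<lambda>j :: real ^ 'n. (\<chi> i. c i) \<bullet> j"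
  have lin: "linear ?f" by (rule linearI) (auto simp: vec_eq_iff algebra_simps)
  have nz: "?c j \<noteq> 0" if "j \<in> Basis" for j
    using that assms by (auto simp: cart_Basis inner_axis)
  have feq: "(\<lambda>x. 0 + (\<Sum>j\<in>Basis. (?c j * (x \<bullet> j)) *\<^sub>R j)) = ?f"
  proof
    fix x :: "real ^ 'n"
    show "0 + (\<Sum>j\<in>Basis. (?c j * (x \<bullet> j)) *\<^sub>R j) = ?f x"
    proof (rule euclidean_eqI)
      fix b :: "real ^ 'n" assume b: "b \<in> Basis"
      then obtain i where i: "b = axis i 1" by (auto simp: cart_Basis)
      have "(0 + (\<Sum>j\<in>Basis. (?c j * (x \<bullet> j)) *\<^sub>R j)) \<bullet> b = ?c b * (x \<bullet> b)"
        using b by (simp add: inner_sum_left inner_Basis if_distrib sum.delta cong: if_cong)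
      thus "(0 + (\<Sum>j\<in>Basis. (?c j * (x \<bullet> j)) *\<^sub>R j)) \<bullet> b = ?f x \<bullet> b" by (simp add: i inner_axis)
    qed
  qed
  have p: "0 < (\<Prod>j\<in>Basis. \<bar>?c j\<bar>)" using nz by (intro prod_pos) auto
  have "lborel = density (distr lborel borel ?f) (\<lambda>_. ennreal (\<Prod>j\<in>Basis. \<bar>?c j\<bar>))"
    using lborel_affine_euclidean[where c="?c" and t=0, OF nz] unfolding feq .
  hence "(\<integral>\<^sup>+x. F x \<partial>lborel) = ennreal (\<Prod>j\<in>Basis. \<bar>?c j\<bar>) * (\<integral>\<^sup>+x. F (?f x) \<partial>lborel)"
    if "F \<in> borel_measurable borel" for F :: "real ^ 'n \<Rightarrow> ennreal"
  proof -
    assume eq: "lborel = density (distr lborel borel ?f) (\<lambda>_. ennreal (\<Prod>j\<in>Basis. \<bar>?c j\<bar>))"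
    have "(\<integral>\<^sup>+x. F x \<partial>lborel) = (\<integral>\<^sup>+x. F x \<partial>density (distr lborel borel ?f) (\<lambda>_. ennreal (\<Prod>j\<in>Basis. \<bar>?c j\<bar>)))"
      by (subst eq) simp
    also have "\<dots> = ennreal (\<Prod>j\<in>Basis. \<bar>?c j\<bar>) * (\<integral>\<^sup>+x. F x \<partial>distr lborel borel ?f)"
      using that by (simp add: nn_integral_density nn_integral_cmult)
    also have "(\<integral>\<^sup>+x. F x \<partial>distr lborel borel ?f) = (\<integral>\<^sup>+x. F (?f x) \<partial>lborel)"
      using that linear_borel[OF lin] by (intro nn_integral_distr) auto
    finally show ?thesis .
  qed
  thus ?thesis using lin p by (simp add: scales_def)
qed

lemma scales_swap:
  fixes m n :: "'n::finite"
  shows "scales (\<lambda>x :: real ^ 'n. \<chi> i. x $ Transposition.transpose m n i) 1"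
proof -
  let ?s = "\<lambda>x :: real ^ 'n. \<chi> i. x $ Transposition.transpose m n i"
  have lin: "linear ?s" by (rule linearI) (auto simp: vec_eq_iff)
  have inv: "?s (?s x) = x" for x by (simp add: vec_eq_iff)
  have sax: "?s (axis i 1) = axis (Transposition.transpose m n i) 1" for i
    by (auto simp: vec_eq_iff axis_def)
  have bij: "bij_betw ?s Basis Basis"
    by (rule bij_betwI[where g="?s"]) (auto simp: cart_Basis sax inv simp del: vec_lambda_beta)
  have adj: "?s x \<bullet> b = x \<bullet> ?s b" if "b \<in> Basis" for x b
    using that by (auto simp: cart_Basis sax inner_axis simp del: vec_lambda_beta) (simp add: inner_axis)
  have "lborel = distr lborel borel ?s"
  proof (rule lborel_eqI)
    fix l u :: "real ^ 'n" assume le: "\<And>b. b \<in> Basis \<Longrightarrow> l \<bullet> b \<le> u \<bullet> b"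
    have bs: "?s b \<in> Basis" if "b \<in> Basis" for b using bij that by (auto simp: bij_betw_def)
    have "?s -` box l u = box (?s l) (?s u)"
    proof (intro set_eqI)
      fix x
      have "x \<in> ?s -` box l u \<longleftrightarrow> (\<forall>b\<in>Basis. l \<bullet> b < x \<bullet> ?s b \<and> x \<bullet> ?s b < u \<bullet> b)"
        by (simp add: mem_box adj cong: ball_cong)
      also have "\<dots> \<longleftrightarrow> (\<forall>b\<in>?s ` Basis. l \<bullet> ?s b < x \<bullet> b \<and> x \<bullet> b < u \<bullet> ?s b)"
        by (simp add: inv del: vec_lambda_beta)
      also have "?s ` Basis = Basis" using bij by (simp add: bij_betw_def)
      finally show "x \<in> ?s -` box l u \<longleftrightarrow> x \<in> box (?s l) (?s u)" by (simp add: mem_box adj cong: ball_cong)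
    qed
    hence "emeasure (distr lborel borel ?s) (box l u) = emeasure lborel (box (?s l) (?s u))"
      using linear_borel[OF lin] by (subst emeasure_distr) auto
    also have "\<dots> = (\<Prod>b\<in>Basis. (?s u - ?s l) \<bullet> b)"
      using le bs by (intro emeasure_lborel_box) (simp add: adj)
    also have "(\<Prod>b\<in>Basis. (?s u - ?s l) \<bullet> b) = (\<Prod>b\<in>Basis. (u - l) \<bullet> ?s b)"
      by (intro prod.cong refl) (simp add: inner_diff_left adj)
    also have "\<dots> = (\<Prod>b\<in>Basis. (u - l) \<bullet> b)" by (rule prod.reindex_bij_betw[OF bij])
    finally show "emeasure (distr lborel borel ?s) (box l u) = (\<Prod>b\<in>Basis. (u - l) \<bullet> b)" .
  qed simp
  thus ?thesis using scales_if_distr[OF lin] by simp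
qed

text \<open>The sheared coordinate is integrated first. On each line parallel to it the map is a
  translation, and the inner integral does not change.\<close>

lemma scales_shear:
  fixes m n :: "'n::finite"
  assumes mn: "m \<noteq> n"
  shows "scales (\<lambda>x :: real ^ 'n. \<chi> i. if i = m then x $ m + x $ n else x $ i) 1"
proof -
  let ?f = "\<lambda>x :: real ^ 'n. \<chi> i. if i = m then x $ m + x $ n else x $ i"
  let ?m = "axis m 1 :: real ^ 'n" and ?n = "axis n 1 :: real ^ 'n"
  have lin: "linear ?f" by (rule linearI) (auto simp: vec_eq_iff algebra_simps)
  have B: "?m \<in> Basis" "?n \<in> Basis" by (auto simp: cart_Basis)
  obtain L where "set L = Basis - {?m}" "distinct L" using finite_distinct_list[of "Basis - {?m}"] by auto
  hence L: "distinct (?m # L)" "set (?m # L) = Basis" using B by (simp_all add: insert_absorb)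
  have comp: "vec w $ i = w (axis i 1)" for w :: "real ^ 'n \<Rightarrow> real" and i
    using vec_inner[of "axis i 1" w] by (simp add: cart_Basis inner_axis)
  have ax: "axis i (1::real) = axis j 1 \<longleftrightarrow> i = j" for i j :: 'n by (simp add: axis_eq_axis)
  have fv: "?f (vec (w(?m := t))) = vec (w(?m := t + w ?n))" for w t
  proof (rule vec_eq_iff[THEN iffD2], rule allI)
    fix i show "?f (vec (w(?m := t))) $ i = vec (w(?m := t + w ?n)) $ i"
      using mn ax[of i m] ax[of n m] by (cases "i = m") (simp_all add: comp)
  qed
  have "(\<integral>\<^sup>+x. F x \<partial>lborel) = (\<integral>\<^sup>+x. F (?f x) \<partial>lborel)" if F: "F \<in> borel_measurable borel" for F :: "real ^ 'n \<Rightarrow> ennreal"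
  proof -
    have Ff: "(\<lambda>x. F (?f x)) \<in> borel_measurable borel" using measurable_compose[OF linear_borel[OF lin] F] .
    have "(\<integral>\<^sup>+t. F (vec (w(?m := t))) \<partial>lborel) = (\<integral>\<^sup>+t. F (?f (vec (w(?m := t)))) \<partial>lborel)" for w
    proof -
      have "vec (w(?m := t)) = vec (w(?m := 0)) + t *\<^sub>R ?m" for t
      proof (rule vec_eq_iff[THEN iffD2], rule allI)
        fix i show "vec (w(?m := t)) $ i = (vec (w(?m := 0)) + t *\<^sub>R ?m) $ i"
          using ax[of i m] by (cases "i = m") (simp_all add: comp, simp add: axis_def)
      qed
      hence e: "(\<lambda>t. vec (w(?m := t))) = (\<lambda>t. vec (w(?m := 0)) + t *\<^sub>R ?m)" by (rule ext)
      have "(\<lambda>t. vec (w(?m := t))) \<in> borel_measurable borel" unfolding e by measurable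
      from measurable_compose[OF this F] have "(\<integral>\<^sup>+t. F (vec (w(?m := t))) \<partial>lborel) = (\<integral>\<^sup>+t. F (vec (w(?m := w ?n + 1 * t))) \<partial>lborel)"
        by (subst nn_integral_real_affine[where c=1 and t="w ?n"]) auto
      thus ?thesis unfolding fv by (simp add: add.commute)
    qed
    thus ?thesis unfolding nn_integral_lborel_nmarg[OF L F] nn_integral_lborel_nmarg[OF L Ff] by simp
  qed
  thus ?thesis using lin by (simp add: scales_def)
qed

text \<open>Polar bodies transform by the adjoint, so map and adjoint must have a common factor.
  Decomposition into elementary maps gives both at once: the adjoint reverses the order of a
  composition, but the factors commute. Surjectivity is put into \<open>Q\<close> so that maps with
  a zero coordinate satisfy it vacuously.\<close>

theorem linear_scales:
  fixes f :: "real ^ 'n \<Rightarrow> real ^ 'n"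
  assumes "linear f" "surj f"
  shows "\<exists>c. scales f c \<and> scales (adjoint f) c"
proof -
  define Q where "Q h \<longleftrightarrow> (surj h \<longrightarrow> (\<exists>c. scales h c \<and> scales (adjoint h) c))" for h :: "real ^ 'n \<Rightarrow> real ^ 'n"
  have "Q f"
  proof (rule induct_linear_elementary[OF assms(1), where P=Q])
    fix f g :: "real ^ 'n \<Rightarrow> real ^ 'n"
    assume 1: "linear f" "linear g" "Q f" "Q g"
    show "Q (f \<circ> g)" unfolding Q_def
    proof
      assume s: "surj (f \<circ> g)"
      moreover have "range (f \<circ> g) \<subseteq> range f" by auto
      ultimately have sf: "surj f" by (simp add: top.extremum_unique)
      have "inj (f \<circ> g)" using linear_surjective_imp_injective[OF linear_compose[OF 1(2,1)] s] by simp
      hence "inj g" by (rule inj_on_imageI2)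
      hence sg: "surj g" using linear_injective_imp_surjective[OF 1(2)] by simp
      obtain c d where "scales f c" "scales (adjoint f) c" "scales g d" "scales (adjoint g) d"
        using 1 sf sg unfolding Q_def by blast
      moreover have "adjoint (f \<circ> g) = adjoint g \<circ> adjoint f"
        by (rule adjoint_unique) (simp add: adjoint_works 1)
      ultimately show "\<exists>c. scales (f \<circ> g) c \<and> scales (adjoint (f \<circ> g)) c"
        using scales_comp[of f c g d] scales_comp[of "adjoint g" d "adjoint f" c] by (auto simp: mult.commute)
    qed
  next
    fix f :: "real ^ 'n \<Rightarrow> real ^ 'n" and i assume 2: "linear f" "\<And>x. f x $ i = 0"
    show "Q f" unfolding Q_def
    proof
      assume "surj f"
      then obtain x where "f x = axis i 1" by (meson surj_f_inv_f)
      thus "\<exists>c. scales f c \<and> scales (adjoint f) c" using 2(2)[of x] by simp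
    qed
  next
    fix c :: "'n \<Rightarrow> real"
    show "Q (\<lambda>x. \<chi> i. c i * x $ i)" unfolding Q_def
    proof
      assume s: "surj (\<lambda>x :: real ^ 'n. \<chi> i. c i * x $ i)"
      have "c i \<noteq> 0" for i
      proof
        assume "c i = 0"
        obtain x :: "real ^ 'n" where "axis i 1 = (\<chi> i. c i * x $ i)" using surjD[OF s] by blast
        hence "axis i 1 $ i = (0 :: real)" using \<open>c i = 0\<close> by simp
        thus False by simp
      qed
      moreover have "adjoint (\<lambda>x :: real ^ 'n. \<chi> i. c i * x $ i) = (\<lambda>x. \<chi> i. c i * x $ i)"
        by (rule adjoint_unique) (simp add: inner_vec_def mult_ac)
      ultimately show "\<exists>d. scales (\<lambda>x :: real ^ 'n. \<chi> i. c i * x $ i) d \<and> scales (adjoint (\<lambda>x :: real ^ 'n. \<chi> i. c i * x $ i)) d"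
        using scales_diagonal[of c] by auto
    qed
  next
    fix m n :: 'n assume 4: "m \<noteq> n"
    have "adjoint (\<lambda>x :: real ^ 'n. \<chi> i. x $ Transposition.transpose m n i) = (\<lambda>x. \<chi> i. x $ Transposition.transpose m n i)"
    proof (rule adjoint_unique, intro allI)
      fix x y :: "real ^ 'n"
      have "bij_betw (Transposition.transpose m n) UNIV UNIV" by simp
      from sum.reindex_bij_betw[OF this, of "\<lambda>i. x $ Transposition.transpose m n i * y $ i"]
      show "(\<chi> i. x $ Transposition.transpose m n i) \<bullet> y = x \<bullet> (\<chi> i. y $ Transposition.transpose m n i)"
        by (simp add: inner_vec_def)
    qed
    thus "Q (\<lambda>x. \<chi> i. x $ Transposition.transpose m n i)" unfolding Q_def
      using scales_swap[of m n] by auto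
  next
    fix m n :: 'n assume 5: "m \<noteq> n"
    have "adjoint (\<lambda>x :: real ^ 'n. \<chi> i. if i = m then x $ m + x $ n else x $ i) = (\<lambda>x. \<chi> i. if i = n then x $ n + x $ m else x $ i)"
    proof (rule adjoint_unique, intro allI)
      fix x y :: "real ^ 'n"
      have "(\<chi> i. if i = m then x $ m + x $ n else x $ i) = x + (x $ n) *\<^sub>R axis m 1"
        by (auto simp: vec_eq_iff axis_def)
      moreover have "(\<chi> i. if i = n then y $ n + y $ m else y $ i) = y + (y $ m) *\<^sub>R axis n 1"
        by (auto simp: vec_eq_iff axis_def)
      ultimately show "(\<chi> i. if i = m then x $ m + x $ n else x $ i) \<bullet> y = x \<bullet> (\<chi> i. if i = n then y $ n + y $ m else y $ i)"
        by (simp add: inner_add_left inner_add_right inner_axis inner_axis')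
    qed
    thus "Q (\<lambda>x. \<chi> i. if i = m then x $ m + x $ n else x $ i)" unfolding Q_def
      using scales_shear[OF 5] scales_shear[OF 5[symmetric]] by auto
  qed
  thus ?thesis using assms(2) unfolding Q_def by blast
qed

lemma scales_image:
  fixes f :: "'a::euclidean_space \<Rightarrow> 'a"
  assumes f: "scales f c" "bij f" and S: "S \<in> sets borel"
  shows "f ` S \<in> sets borel" "emeasure lborel (f ` S) = ennreal c * emeasure lborel S"
    "measure lebesgue (f ` S) = c * measure lebesgue S"
proof -
  have lin: "linear f" "0 < c" using f by (auto simp: scales_def)
  define g where "g = inv f"
  have g: "linear g" "\<And>x. g (f x) = x" "\<And>x. f (g x) = x"
    using f(2) inj_linear_imp_inv_linear[OF lin(1)] by (auto simp: g_def bij_def surj_f_inv_f)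
  have im: "f ` S = g -` S"
  proof (intro set_eqI iffI)
    fix y assume "y \<in> g -` S"
    hence "f (g y) \<in> f ` S" by blast
    thus "y \<in> f ` S" by (simp add: g(3))
  qed (auto simp: g(2))
  show fS: "f ` S \<in> sets borel" unfolding im using measurable_sets[OF linear_borel[OF g(1)] S] by simp
  have "emeasure lborel (f ` S) = (\<integral>\<^sup>+x. indicator (f ` S) x \<partial>lborel)" using fS by simp
  also have "\<dots> = ennreal c * (\<integral>\<^sup>+x. indicator (f ` S) (f x) \<partial>lborel)" using f(1) fS unfolding scales_def by (blast intro: borel_measurable_indicator)
  also have "(\<lambda>x. indicator (f ` S) (f x)) = (indicator S :: 'a \<Rightarrow> ennreal)"
    using f(2) by (auto simp: fun_eq_iff indicator_def bij_def inj_image_mem_iff)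
  also have "(\<integral>\<^sup>+x. indicator S x \<partial>lborel) = emeasure lborel S" using S by simp
  finally show em: "emeasure lborel (f ` S) = ennreal c * emeasure lborel S" .
  show "measure lebesgue (f ` S) = c * measure lebesgue S"
    using fS S em lin(2) by (simp add: measure_def enn2real_mult)
qed

lemma measure_linear_set:
  fixes f :: "real ^ 'n \<Rightarrow> real ^ 'n"
  assumes f: "scales f c" "bij f" and D: "compact D" and S: "S \<in> sets borel"
  shows "emeasure lborel {x \<in> f ` D. x \<in> S} = ennreal (c * measure lebesgue {x \<in> D. f x \<in> S})"
proof -
  have lin: "linear f" "0 < c" using f by (auto simp: scales_def)
  have 1: "D \<inter> f -` S \<in> sets borel"
    using measurable_sets[OF linear_borel[OF lin(1)] S] D by (auto intro: borel_closed compact_imp_closed)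
  have "bounded (D \<inter> f -` S)" using D compact_imp_bounded bounded_Int by blast
  hence "emeasure lborel (D \<inter> f -` S) < \<infinity>" by (rule emeasure_bounded_finite)
  hence 2: "emeasure lborel (D \<inter> f -` S) = ennreal (measure lebesgue (D \<inter> f -` S))"
    using 1 by (simp add: emeasure_eq_ennreal_measure)
  have eq: "{x \<in> f ` D. x \<in> S} = f ` (D \<inter> f -` S)" "{x \<in> D. f x \<in> S} = D \<inter> f -` S" by auto
  show ?thesis unfolding eq scales_image(2)[OF f 1] 2 using lin(2) by (simp add: ennreal_mult)
qed

section \<open>The same results for an arbitrary direction\<close>

locale harmonic_bodies =
  fixes u :: "real ^ 'n" and D0 D1 Dh :: "(real ^ 'n) set"
  assumes convex: "convex D0" "convex D1" "convex Dh"
    and compact: "compact D0" "compact D1" "compact Dh"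
    and u: "u \<noteq> 0"
    and harmonic: "\<And>x y. \<lbrakk>x \<in> D0; y \<in> D1; 0 < x \<bullet> u; 0 < y \<bullet> u\<rbrakk> \<Longrightarrow>
       (y \<bullet> u / (x \<bullet> u + y \<bullet> u)) *\<^sub>R x + (x \<bullet> u / (x \<bullet> u + y \<bullet> u)) *\<^sub>R y \<in> Dh"
begin

lemma triple:
  assumes f: "linear f" and e: "e \<in> Basis" "\<And>x. f x \<bullet> e = x \<bullet> u"
  shows "harmonic_triple e (f ` D0) (f ` D1) (f ` Dh)"
proof
  show "convex (f ` D0)" "convex (f ` D1)" "convex (f ` Dh)" using convex_linear_image[OF f] convex by auto
  show "compact (f ` D0)" "compact (f ` D1)" "compact (f ` Dh)" using compact f by (auto intro!: compact_continuous_image linear_continuous_on simp: linear_conv_bounded_linear[symmetric])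
  fix x y assume "x \<in> f ` D0" "y \<in> f ` D1" and p: "0 < x \<bullet> e" "0 < y \<bullet> e"
  then obtain x' y' where x': "x' \<in> D0" "y' \<in> D1" "x = f x'" "y = f y'" by auto
  have "(y' \<bullet> u / (x' \<bullet> u + y' \<bullet> u)) *\<^sub>R x' + (x' \<bullet> u / (x' \<bullet> u + y' \<bullet> u)) *\<^sub>R y' \<in> Dh"
    using harmonic[of x' y'] x' p e by simp
  hence "f ((y' \<bullet> u / (x' \<bullet> u + y' \<bullet> u)) *\<^sub>R x' + (x' \<bullet> u / (x' \<bullet> u + y' \<bullet> u)) *\<^sub>R y') \<in> f ` Dh" by blast
  thus "(y \<bullet> e / (x \<bullet> e + y \<bullet> e)) *\<^sub>R x + (x \<bullet> e / (x \<bullet> e + y \<bullet> e)) *\<^sub>R y \<in> f ` Dh"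
    by (simp add: x' e linear_add[OF f] linear_scale[OF f])
qed (rule e(1))

end

context harmonic_bodies
begin

text \<open>\<open>f\<close> is the adjoint of a bijection sending a basis vector to
  \<open>u\<close>: the adjoint turns a prescribed image of a vector into a prescribed linear
  functional.\<close>

lemma coordinates:
  "\<exists>(f :: real ^ 'n \<Rightarrow> real ^ 'n) e. linear f \<and> bij f \<and> e \<in> Basis \<and> (\<forall>x. f x \<bullet> e = x \<bullet> u)"
proof -
  obtain e :: "real ^ 'n" where e: "e \<in> Basis" using nonempty_Basis by blast
  have "\<exists>g :: real ^ 'n \<Rightarrow> real ^ 'n. linear g \<and> bij g \<and> (\<forall>b\<in>{e}. g b = (\<lambda>_. u) b)"
    by (rule linear_bij_extension) (use e u in auto)
  then obtain g :: "real ^ 'n \<Rightarrow> real ^ 'n" where g: "linear g" "bij g" "g e = u" by auto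
  have "bij (adjoint g)"
    using g(1,2) surj_adjoint_iff_inj[OF g(1)] inj_adjoint_iff_surj[OF g(1)] by (simp add: bij_def)
  moreover have "adjoint g x \<bullet> e = x \<bullet> u" for x using adjoint_works[OF g(1), of e x] g(3) by (simp add: inner_commute)
  ultimately show ?thesis using adjoint_linear[OF g(1)] e by blast
qed

lemma coordinates2:
  assumes v: "v \<notin> span {u}"
  shows "\<exists>(f :: real ^ 'n \<Rightarrow> real ^ 'n) e e'. linear f \<and> bij f \<and> e \<in> Basis \<and> e' \<in> Basis \<and> e' \<noteq> e
    \<and> (\<forall>x. f x \<bullet> e = x \<bullet> u) \<and> (\<forall>x. f x \<bullet> e' = x \<bullet> v)"
proof -
  have ind: "independent {v, u}" using v u by (simp add: independent_insert)
  have uv: "v \<noteq> u" using v span_base by blast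
  have "card {v, u} \<le> DIM(real ^ 'n)" using independent_bound[OF ind] by blast
  hence "2 \<le> card (Basis :: (real ^ 'n) set)" using uv by simp
  then obtain T where "T \<subseteq> (Basis :: (real ^ 'n) set)" "card T = 2" by (meson obtain_subset_with_card_n)
  then obtain e e' :: "real ^ 'n" where e: "e \<in> Basis" "e' \<in> Basis" "e' \<noteq> e" by (auto simp: card_2_iff)
  define h where "h b = (if b = e then u else v)" for b
  have "\<exists>g :: real ^ 'n \<Rightarrow> real ^ 'n. linear g \<and> bij g \<and> (\<forall>b\<in>{e', e}. g b = h b)"
  proof (rule linear_bij_extension)
    show "inj_on h {e', e}" using e uv by (auto simp: h_def inj_on_def)
    have "h ` {e', e} = {v, u}" using e by (auto simp: h_def)
    thus "independent (h ` {e', e})" using ind by simp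
  qed (use e in auto)
  then obtain g :: "real ^ 'n \<Rightarrow> real ^ 'n" where g: "linear g" "bij g" "g e = h e" "g e' = h e'" by auto
  have ge: "g e = u" "g e' = v" using g(3,4) e by (auto simp: h_def)
  have "bij (adjoint g)"
    using g(1,2) surj_adjoint_iff_inj[OF g(1)] inj_adjoint_iff_surj[OF g(1)] by (simp add: bij_def)
  moreover have "adjoint g x \<bullet> e = x \<bullet> u" "adjoint g x \<bullet> e' = x \<bullet> v" for x
    using adjoint_works[OF g(1), of e x] adjoint_works[OF g(1), of e' x] ge by (simp_all add: inner_commute)
  ultimately show ?thesis using adjoint_linear[OF g(1)] e by blast
qed

lemma halfspace_measure:
  assumes "scales f c" "bij f" "compact D" "\<And>x. f x \<bullet> e = x \<bullet> u"
  shows "measure lborel {x \<in> f ` D. 0 < x \<bullet> e} = c * measure lebesgue {x \<in> D. 0 < x \<bullet> u}"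
proof -
  have "{x. 0 < x \<bullet> e} \<in> sets borel" by (auto intro!: borel_open open_Collect_less continuous_intros)
  from measure_linear_set[OF assms(1-3) this] show ?thesis using assms(1,4) by (simp add: measure_def scales_def)
qed

lemma halfspace_inequality:
  assumes I: "measure lebesgue {x \<in> D0. 0 < x \<bullet> u} = I" "measure lebesgue {x \<in> D1. 0 < x \<bullet> u} = J" "0 < I" "0 < J"
  shows "2 * I * J / (I + J) \<le> measure lebesgue {x \<in> Dh. 0 < x \<bullet> u}"
proof -
  obtain f :: "real ^ 'n \<Rightarrow> real ^ 'n" and e where f: "linear f" "bij f" "e \<in> Basis" "\<And>x. f x \<bullet> e = x \<bullet> u" using coordinates by auto
  interpret t: harmonic_triple e "f ` D0" "f ` D1" "f ` Dh" by (rule triple[OF f(1,3,4)])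
  obtain d where sc: "scales f d" using linear_scales[OF f(1)] f(2) by (auto simp: bij_def)
  hence d: "0 < d" by (simp add: scales_def)
  have m: "measure lborel {x \<in> f ` D. 0 < x \<bullet> e} = d * measure lebesgue {x \<in> D. 0 < x \<bullet> u}" if "compact D" for D
    by (rule halfspace_measure[OF sc f(2) that f(4)])
  have "2 * (d * I) * (d * J) / (d * I + d * J) \<le> d * measure lebesgue {x \<in> Dh. 0 < x \<bullet> u}"
    using t.halfspace_inequality[of "d * I" "d * J"] m compact I d by simp
  moreover have "2 * (d * I) * (d * J) / (d * I + d * J) = d * (2 * I * J / (I + J))"
    using d I by (simp add: distrib_left[symmetric])
  ultimately show ?thesis using d by (simp only: mult_le_cancel_left_pos)
qed

lemma law:
  assumes I: "measure lebesgue {x \<in> D0. 0 < x \<bullet> u} = I" "measure lebesgue {x \<in> D1. 0 < x \<bullet> u} = I"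
    "measure lebesgue {x \<in> Dh. 0 < x \<bullet> u} = I" "0 < I"
  shows "\<exists>k. \<forall>B\<in>sets (borel \<Otimes>\<^sub>M borel). measure lebesgue {x \<in> D1. 0 < x \<bullet> u \<and> (x \<bullet> u, x \<bullet> v) \<in> B}
      = measure lebesgue {x \<in> D0. 0 < x \<bullet> u \<and> (x \<bullet> u, x \<bullet> v + k * (x \<bullet> u)) \<in> B}"
proof (cases "v \<in> span {u}")
  case False
  obtain f :: "real ^ 'n \<Rightarrow> real ^ 'n" and e e' where f: "linear f" "bij f" "e \<in> Basis" "e' \<in> Basis" "e' \<noteq> e" "\<And>x. f x \<bullet> e = x \<bullet> u" "\<And>x. f x \<bullet> e' = x \<bullet> v"
    using coordinates2[OF False] by auto
  interpret t: harmonic_triple e "f ` D0" "f ` D1" "f ` Dh" by (rule triple[OF f(1,3,6)])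
  obtain d where sc: "scales f d" using linear_scales[OF f(1)] f(2) by (auto simp: bij_def)
  hence d: "0 < d" by (simp add: scales_def)
  have m: "measure lborel {x \<in> f ` D. 0 < x \<bullet> e} = d * measure lebesgue {x \<in> D. 0 < x \<bullet> u}" if "compact D" for D
    by (rule halfspace_measure[OF sc f(2) that f(6)])
  obtain k where k: "\<And>B. B \<in> sets (borel \<Otimes>\<^sub>M borel) \<Longrightarrow>
     emeasure lborel {x \<in> f ` D1. 0 < x \<bullet> e \<and> (x \<bullet> e, x \<bullet> e') \<in> B}
     = emeasure lborel {x \<in> f ` D0. 0 < x \<bullet> e \<and> (x \<bullet> e, x \<bullet> e' + k * (x \<bullet> e)) \<in> B}"
  proof -
    have "measure lborel {x \<in> f ` D0. 0 < x \<bullet> e} = d * I" "measure lborel {x \<in> f ` D1. 0 < x \<bullet> e} = d * I"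
      "measure lborel {x \<in> f ` Dh. 0 < x \<bullet> e} = d * I" "0 < d * I"
      using m compact I d by auto
    from t.halfspace_laws[OF f(4,5) this] that show ?thesis by blast
  qed
  have "measure lebesgue {x \<in> D1. 0 < x \<bullet> u \<and> (x \<bullet> u, x \<bullet> v) \<in> B}
      = measure lebesgue {x \<in> D0. 0 < x \<bullet> u \<and> (x \<bullet> u, x \<bullet> v + k * (x \<bullet> u)) \<in> B}"
    if B[measurable]: "B \<in> sets (borel \<Otimes>\<^sub>M borel)" for B
  proof -
    have "{x \<in> space borel. 0 < x \<bullet> e \<and> (x \<bullet> e, x \<bullet> e' + m * (x \<bullet> e)) \<in> B} \<in> sets (borel :: (real ^ 'n) measure)" for m
      by measurable
    hence S: "{x. 0 < x \<bullet> e \<and> (x \<bullet> e, x \<bullet> e' + m * (x \<bullet> e)) \<in> B} \<in> sets (borel :: (real ^ 'n) measure)" for m by simp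
    have "ennreal (d * measure lebesgue {x \<in> D1. 0 < x \<bullet> u \<and> (x \<bullet> u, x \<bullet> v) \<in> B})
      = ennreal (d * measure lebesgue {x \<in> D0. 0 < x \<bullet> u \<and> (x \<bullet> u, x \<bullet> v + k * (x \<bullet> u)) \<in> B})"
      using k[OF B] measure_linear_set[OF sc f(2) compact(2) S[of 0]] measure_linear_set[OF sc f(2) compact(1) S[of k]]
      by (simp add: f)
    thus ?thesis using d by (simp add: ennreal_inj)
  qed
  thus ?thesis by blast
next
  case True
  then obtain c where c: "v = c *\<^sub>R u" by (auto simp: span_singleton)
  obtain f :: "real ^ 'n \<Rightarrow> real ^ 'n" and e where f: "linear f" "bij f" "e \<in> Basis" "\<And>x. f x \<bullet> e = x \<bullet> u" using coordinates by auto
  interpret t: harmonic_triple e "f ` D0" "f ` D1" "f ` Dh" by (rule triple[OF f(1,3,4)])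
  obtain d where sc: "scales f d" using linear_scales[OF f(1)] f(2) by (auto simp: bij_def)
  hence d: "0 < d" by (simp add: scales_def)
  have m: "measure lborel {x \<in> f ` D. 0 < x \<bullet> e} = d * measure lebesgue {x \<in> D. 0 < x \<bullet> u}" if "compact D" for D
    by (rule halfspace_measure[OF sc f(2) that f(4)])
  have "measure lebesgue {x \<in> D1. 0 < x \<bullet> u \<and> (x \<bullet> u, x \<bullet> v) \<in> B}
      = measure lebesgue {x \<in> D0. 0 < x \<bullet> u \<and> (x \<bullet> u, x \<bullet> v) \<in> B}"
    if B[measurable]: "B \<in> sets (borel \<Otimes>\<^sub>M borel)" for B
  proof -
    define B' where "B' = {t. (t, c * t) \<in> B}"
    have "{t \<in> space borel. (t, c * t) \<in> B} \<in> sets borel" by measurable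
    hence B'[measurable]: "B' \<in> sets borel" by (simp add: B'_def)
    have "{x \<in> space borel. 0 < x \<bullet> e \<and> x \<bullet> e \<in> B'} \<in> sets (borel :: (real ^ 'n) measure)" by measurable
    hence S: "{x. 0 < x \<bullet> e \<and> x \<bullet> e \<in> B'} \<in> sets (borel :: (real ^ 'n) measure)" by simp
    have "emeasure lborel {x \<in> f ` D1. 0 < x \<bullet> e \<and> x \<bullet> e \<in> B'} = emeasure lborel {x \<in> f ` D0. 0 < x \<bullet> e \<and> x \<bullet> e \<in> B'}"
    proof (rule t.halfspace_law_axis[OF _ _ _ _ B'])
      show "measure lborel {x \<in> f ` D0. 0 < x \<bullet> e} = d * I" "measure lborel {x \<in> f ` D1. 0 < x \<bullet> e} = d * I"
        "measure lborel {x \<in> f ` Dh. 0 < x \<bullet> e} = d * I" "0 < d * I"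
        using m compact I d by auto
    qed
    hence "ennreal (d * measure lebesgue {x \<in> D1. 0 < x \<bullet> u \<and> x \<bullet> u \<in> B'})
      = ennreal (d * measure lebesgue {x \<in> D0. 0 < x \<bullet> u \<and> x \<bullet> u \<in> B'})"
      using measure_linear_set[OF sc f(2) compact(2) S] measure_linear_set[OF sc f(2) compact(1) S]
      by (simp add: f)
    hence "measure lebesgue {x \<in> D1. 0 < x \<bullet> u \<and> x \<bullet> u \<in> B'} = measure lebesgue {x \<in> D0. 0 < x \<bullet> u \<and> x \<bullet> u \<in> B'}"
      using d by (simp add: ennreal_inj)
    thus ?thesis by (simp add: B'_def c)
  qed
  thus ?thesis by (intro exI[of _ 0] ballI) simp
qed

lemma halves_measurable:
  "{x \<in> D0. 0 < x \<bullet> u} \<in> sets borel" "{x \<in> D1. 0 < x \<bullet> u} \<in> sets borel"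
  "{x \<in> D0. 0 < x \<bullet> u} \<in> lmeasurable" "{x \<in> D1. 0 < x \<bullet> u} \<in> lmeasurable"
proof -
  have o: "{x. 0 < x \<bullet> u} \<in> sets borel" by (auto intro!: borel_open open_Collect_less continuous_intros)
  have D: "D0 \<in> sets borel" "D1 \<in> sets borel" using compact by (auto intro: borel_closed compact_imp_closed)
  show s: "{x \<in> D0. 0 < x \<bullet> u} \<in> sets borel" "{x \<in> D1. 0 < x \<bullet> u} \<in> sets borel"
    using sets.Int[OF D(1) o] sets.Int[OF D(2) o] by (simp_all add: Int_def)
  have "bounded {x \<in> D0. 0 < x \<bullet> u}" "bounded {x \<in> D1. 0 < x \<bullet> u}"
    by (rule bounded_subset[OF compact_imp_bounded[OF compact(1)]], blast, rule bounded_subset[OF compact_imp_bounded[OF compact(2)]], blast)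
  thus "{x \<in> D0. 0 < x \<bullet> u} \<in> lmeasurable" "{x \<in> D1. 0 < x \<bullet> u} \<in> lmeasurable"
    using s by (auto intro!: bounded_set_imp_lmeasurable)
qed

text \<open>For each \<open>v\<close>, \<open>law\<close> yields a constant \<open>k\<close> with no
  stated dependence on \<open>v\<close>. Integrating the second coordinate over both laws determines
  it: \<open>k * m\<close> is the difference of the first moments of the two halves, tested against
  \<open>v\<close>. Hence \<open>k\<close> is linear in \<open>v\<close> and given by one vector
  \<open>p\<close>.\<close>

lemma law_shear:
  assumes I: "measure lebesgue {x \<in> D0. 0 < x \<bullet> u} = I" "measure lebesgue {x \<in> D1. 0 < x \<bullet> u} = I"
    "measure lebesgue {x \<in> Dh. 0 < x \<bullet> u} = I" "0 < I"
  obtains p where "p \<bullet> u = 0" "\<And>v B. B \<in> sets (borel \<Otimes>\<^sub>M borel) \<Longrightarrow>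
      measure lebesgue {x \<in> D1. 0 < x \<bullet> u \<and> (x \<bullet> u, x \<bullet> v) \<in> B}
      = measure lebesgue {x \<in> D0. 0 < x \<bullet> u \<and> (x \<bullet> u, x \<bullet> v + (p \<bullet> v) * (x \<bullet> u)) \<in> B}"
proof -
  define H where "H D = {x \<in> D. 0 < x \<bullet> u}" for D
  define R where "R D = restrict_space lborel (H D)" for D
  note hm = halves_measurable[folded H_def]
  have fin: "emeasure lborel (H D0) \<noteq> \<infinity>" "emeasure lborel (H D1) \<noteq> \<infinity>"
    using hm by (auto simp: fmeasurable_def)
  have spR: "space (R D) = H D" "sets (R D) = sets (restrict_space borel (H D))" for D
    by (simp_all add: R_def space_restrict_space sets_restrict_space)
  have bd: "\<exists>M. \<forall>x\<in>H D. norm x \<le> M" if "compact D" for D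
    using compact_imp_bounded[OF that] unfolding bounded_iff H_def by auto
  have intx: "integrable (R D) (\<lambda>x. x)" if D: "compact D" "H D \<in> sets borel" "emeasure lborel (H D) \<noteq> \<infinity>" for D
  proof -
    have "emeasure (R D) (space (R D)) = emeasure lborel (H D)"
      unfolding spR unfolding R_def using D by (subst emeasure_restrict_space) auto
    hence "finite_measure (R D)" using D by (intro finite_measureI) auto
    moreover obtain M where "\<And>x. x \<in> H D \<Longrightarrow> norm x \<le> M" using bd[OF D(1)] by blast
    moreover have "(\<lambda>x. x) \<in> borel_measurable (R D)" unfolding R_def by (intro measurable_restrict_space1) simp
    ultimately show ?thesis
      by (intro finite_measure.integrable_const_bound[where B=M]) (auto simp: spR)
  qed
  note int0 = intx[OF compact(1) hm(1) fin(1)] and int1 = intx[OF compact(2) hm(2) fin(2)]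
  have iin: "(LINT x|R D. x \<bullet> v) = (LINT x|R D. x) \<bullet> v" if "integrable (R D) (\<lambda>x. x)" for D v
    using integral_inner_left[OF that, of v] by simp
  \<comment> \<open>The first moment of the half of \<open>D0\<close> along \<open>u\<close>. It is
    the divisor in \<open>p\<close>, and positive because \<open>x \<bullet> u\<close> is positive
    on that half, which has positive measure.\<close>
  define m where "m = (LINT x|R D0. x) \<bullet> u"
  have m: "0 < m"
  proof -
    have i: "integrable (R D0) (\<lambda>x. x \<bullet> u)" using int0 by (rule integrable_inner_left)
    have "m \<noteq> 0"
    proof
      assume "m = 0"
      hence "(LINT x|R D0. x \<bullet> u) = 0" using iin[OF int0] by (simp add: m_def)
      moreover have "AE x in R D0. 0 \<le> x \<bullet> u" by (rule AE_I2) (auto simp: spR H_def)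
      ultimately have "AE x in R D0. x \<bullet> u = 0" using integral_nonneg_eq_0_iff_AE[OF i] by simp
      moreover have "AE x in R D0. x \<bullet> u \<noteq> 0" by (rule AE_I2) (auto simp: spR H_def)
      ultimately have "AE x in R D0. False" by eventually_elim simp
      then obtain N where "space (R D0) \<subseteq> N" "emeasure (R D0) N = 0" "N \<in> sets (R D0)" by (auto elim: AE_E)
      hence "emeasure (R D0) (space (R D0)) = 0" using emeasure_mono[of "space (R D0)" N "R D0"] by simp
      moreover have "emeasure (R D0) (space (R D0)) = emeasure lborel (H D0)"
        unfolding spR unfolding R_def using hm by (subst emeasure_restrict_space) auto
      ultimately have "measure lborel (H D0) = 0" by (simp add: measure_def)
      thus False using I(1,4) hm by (simp add: H_def[symmetric])
    qed
    moreover have "0 \<le> m" unfolding m_def iin[OF int0, symmetric]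
      by (intro integral_nonneg_AE AE_I2) (auto simp: spR H_def)
    ultimately show ?thesis by simp
  qed
  define p where "p = (1/m) *\<^sub>R ((LINT x|R D1. x) - (LINT x|R D0. x))"
  have kp: "k = p \<bullet> v" if k: "\<forall>B\<in>sets (borel \<Otimes>\<^sub>M borel). measure lebesgue {x \<in> D1. 0 < x \<bullet> u \<and> (x \<bullet> u, x \<bullet> v) \<in> B}
      = measure lebesgue {x \<in> D0. 0 < x \<bullet> u \<and> (x \<bullet> u, x \<bullet> v + k * (x \<bullet> u)) \<in> B}" for k v
  proof -
    have me: "(\<lambda>x. (x \<bullet> u, x \<bullet> v + j * (x \<bullet> u))) \<in> measurable (R D) (borel \<Otimes>\<^sub>M borel)" for j D
      unfolding R_def by (intro measurable_restrict_space1) measurable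
    have dist: "emeasure (distr (R D) (borel \<Otimes>\<^sub>M borel) (\<lambda>x. (x \<bullet> u, x \<bullet> v + j * (x \<bullet> u)))) B
       = ennreal (measure lebesgue {x \<in> D. 0 < x \<bullet> u \<and> (x \<bullet> u, x \<bullet> v + j * (x \<bullet> u)) \<in> B})"
      if B[measurable]: "B \<in> sets (borel \<Otimes>\<^sub>M borel)" and D: "H D \<in> sets borel" "emeasure lborel (H D) \<noteq> \<infinity>" for B j D
    proof -
      have "{x \<in> space borel. (x \<bullet> u, x \<bullet> v + j * (x \<bullet> u)) \<in> B} \<in> sets (borel :: (real^'n) measure)" by measurable
      hence S: "H D \<inter> {x. (x \<bullet> u, x \<bullet> v + j * (x \<bullet> u)) \<in> B} \<in> sets borel" using D by (simp add: sets.Int)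
      have e: "{x \<in> D. 0 < x \<bullet> u \<and> (x \<bullet> u, x \<bullet> v + j * (x \<bullet> u)) \<in> B} = H D \<inter> {x. (x \<bullet> u, x \<bullet> v + j * (x \<bullet> u)) \<in> B}"
        by (auto simp: H_def)
      have e2: "(\<lambda>x. (x \<bullet> u, x \<bullet> v + j * (x \<bullet> u))) -` B \<inter> space (R D) = H D \<inter> {x. (x \<bullet> u, x \<bullet> v + j * (x \<bullet> u)) \<in> B}"
        by (auto simp: spR)
      have "emeasure lborel (H D \<inter> {x. (x \<bullet> u, x \<bullet> v + j * (x \<bullet> u)) \<in> B}) \<le> emeasure lborel (H D)"
        using D by (intro emeasure_mono) auto
      hence f: "emeasure lborel (H D \<inter> {x. (x \<bullet> u, x \<bullet> v + j * (x \<bullet> u)) \<in> B}) \<noteq> \<infinity>" using D(2) by (auto simp: top_unique)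
      have "emeasure (distr (R D) (borel \<Otimes>\<^sub>M borel) (\<lambda>x. (x \<bullet> u, x \<bullet> v + j * (x \<bullet> u)))) B
        = emeasure (R D) (H D \<inter> {x. (x \<bullet> u, x \<bullet> v + j * (x \<bullet> u)) \<in> B})"
        by (simp add: emeasure_distr[OF me B] e2)
      also have "\<dots> = emeasure lborel (H D \<inter> {x. (x \<bullet> u, x \<bullet> v + j * (x \<bullet> u)) \<in> B})"
        unfolding R_def using D by (subst emeasure_restrict_space) auto
      also have "\<dots> = ennreal (measure lebesgue (H D \<inter> {x. (x \<bullet> u, x \<bullet> v + j * (x \<bullet> u)) \<in> B}))"
        using f S by (simp add: emeasure_eq_ennreal_measure)
      finally show ?thesis unfolding e .
    qed
    have "distr (R D1) (borel \<Otimes>\<^sub>M borel) (\<lambda>x. (x \<bullet> u, x \<bullet> v + 0 * (x \<bullet> u))) = distr (R D0) (borel \<Otimes>\<^sub>M borel) (\<lambda>x. (x \<bullet> u, x \<bullet> v + k * (x \<bullet> u)))"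
    proof (rule measure_eqI)
      fix B assume "B \<in> sets (distr (R D1) (borel \<Otimes>\<^sub>M borel) (\<lambda>x. (x \<bullet> u, x \<bullet> v + 0 * (x \<bullet> u))))"
      hence B: "B \<in> sets (borel \<Otimes>\<^sub>M borel)" by simp
      have "emeasure (distr (R D1) (borel \<Otimes>\<^sub>M borel) (\<lambda>x. (x \<bullet> u, x \<bullet> v + 0 * (x \<bullet> u)))) B
         = ennreal (measure lebesgue {x \<in> D1. 0 < x \<bullet> u \<and> (x \<bullet> u, x \<bullet> v + 0 * (x \<bullet> u)) \<in> B})"
        by (rule dist[OF B hm(2) fin(2)])
      also have "\<dots> = ennreal (measure lebesgue {x \<in> D0. 0 < x \<bullet> u \<and> (x \<bullet> u, x \<bullet> v + k * (x \<bullet> u)) \<in> B})"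
        using k B by simp
      also have "\<dots> = emeasure (distr (R D0) (borel \<Otimes>\<^sub>M borel) (\<lambda>x. (x \<bullet> u, x \<bullet> v + k * (x \<bullet> u)))) B"
        by (rule dist[OF B hm(1) fin(1), symmetric])
      finally show "emeasure (distr (R D1) (borel \<Otimes>\<^sub>M borel) (\<lambda>x. (x \<bullet> u, x \<bullet> v + 0 * (x \<bullet> u)))) B
        = emeasure (distr (R D0) (borel \<Otimes>\<^sub>M borel) (\<lambda>x. (x \<bullet> u, x \<bullet> v + k * (x \<bullet> u)))) B" .
    qed simp
    hence "(LINT y|distr (R D1) (borel \<Otimes>\<^sub>M borel) (\<lambda>x. (x \<bullet> u, x \<bullet> v + 0 * (x \<bullet> u))). snd y)
      = (LINT y|distr (R D0) (borel \<Otimes>\<^sub>M borel) (\<lambda>x. (x \<bullet> u, x \<bullet> v + k * (x \<bullet> u))). snd y)" by simp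
    moreover have sm: "snd \<in> borel_measurable ((borel :: real measure) \<Otimes>\<^sub>M (borel :: real measure))" by measurable
    ultimately have "(LINT x|R D1. x \<bullet> v) = (LINT x|R D0. x \<bullet> v + k * (x \<bullet> u))"
      unfolding integral_distr[OF me sm] by simp
    also have "\<dots> = (LINT x|R D0. x \<bullet> v) + k * (LINT x|R D0. x \<bullet> u)"
      using integrable_inner_left[OF int0] by (subst Bochner_Integration.integral_add) auto
    finally have "(LINT x|R D1. x) \<bullet> v = (LINT x|R D0. x) \<bullet> v + k * m" by (simp add: iin int0 int1 m_def)
    hence "k * m = ((LINT x|R D1. x) - (LINT x|R D0. x)) \<bullet> v" by (simp add: inner_diff_left)
    moreover have "p \<bullet> v = (1/m) * (((LINT x|R D1. x) - (LINT x|R D0. x)) \<bullet> v)"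
      by (simp only: p_def inner_scaleR_left)
    ultimately have "p \<bullet> v = (1/m) * (k * m)" by (simp only:)
    thus ?thesis using m by simp
  qed
  show ?thesis
  proof (rule that[of p])
    fix v and B :: "(real \<times> real) set" assume B: "B \<in> sets (borel \<Otimes>\<^sub>M borel)"
    obtain k where k: "\<forall>B\<in>sets (borel \<Otimes>\<^sub>M borel). measure lebesgue {x \<in> D1. 0 < x \<bullet> u \<and> (x \<bullet> u, x \<bullet> v) \<in> B}
      = measure lebesgue {x \<in> D0. 0 < x \<bullet> u \<and> (x \<bullet> u, x \<bullet> v + k * (x \<bullet> u)) \<in> B}" using law[OF I] by blast
    thus "measure lebesgue {x \<in> D1. 0 < x \<bullet> u \<and> (x \<bullet> u, x \<bullet> v) \<in> B}
      = measure lebesgue {x \<in> D0. 0 < x \<bullet> u \<and> (x \<bullet> u, x \<bullet> v + (p \<bullet> v) * (x \<bullet> u)) \<in> B}"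
      using kp[OF k] B by simp
  next
    \<comment> \<open>For \<open>v = u\<close> a test set that reads only the first coordinate does
      not see the shear, so 0 is an admissible constant, and by \<open>kp\<close> it equals
      \<open>p \<bullet> u\<close>.\<close>
    have "0 = p \<bullet> u"
    proof (rule kp, rule ballI)
      fix B :: "(real \<times> real) set" assume B[measurable]: "B \<in> sets (borel \<Otimes>\<^sub>M borel)"
      define B' where "B' = {y :: real \<times> real. (fst y, fst y) \<in> B}"
      have "{y \<in> space (borel \<Otimes>\<^sub>M borel). (fst y, fst y) \<in> B} \<in> sets (borel \<Otimes>\<^sub>M borel)" by measurable
      hence B': "B' \<in> sets (borel \<Otimes>\<^sub>M borel)" by (simp add: B'_def space_pair_measure)
      obtain k where "\<forall>B\<in>sets (borel \<Otimes>\<^sub>M borel). measure lebesgue {x \<in> D1. 0 < x \<bullet> u \<and> (x \<bullet> u, x \<bullet> u) \<in> B}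
        = measure lebesgue {x \<in> D0. 0 < x \<bullet> u \<and> (x \<bullet> u, x \<bullet> u + k * (x \<bullet> u)) \<in> B}" using law[OF I] by blast
      from this[rule_format, OF B'] show "measure lebesgue {x \<in> D1. 0 < x \<bullet> u \<and> (x \<bullet> u, x \<bullet> u) \<in> B}
        = measure lebesgue {x \<in> D0. 0 < x \<bullet> u \<and> (x \<bullet> u, x \<bullet> u + 0 * (x \<bullet> u)) \<in> B}"
        by (simp add: B'_def)
    qed
    thus "p \<bullet> u = 0" by simp
  qed
qed

text \<open>\<open>D\<close> lies in the closure of its interior, so \<open>1 < g x\<close> at one
  point of the half would persist on a nonempty open subset of \<open>D\<close>. This turns
  statements about null sets into pointwise bounds.\<close>

lemma null_open_part:
  assumes D: "convex D" "interior D \<noteq> {}" "compact D" and g: "continuous_on UNIV g"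
    and z: "measure lebesgue {x \<in> D. 0 < x \<bullet> u \<and> 1 < g x} = 0" and x: "x \<in> D" "0 < x \<bullet> u"
  shows "g x \<le> (1 :: real)"
proof (rule ccontr)
  assume "\<not> g x \<le> 1"
  define U where "U = {x. 0 < x \<bullet> u} \<inter> {x. 1 < g x}"
  have "open {x. 0 < x \<bullet> u}" by (intro open_Collect_less continuous_intros)
  moreover have "open {x. 1 < g x}" using g by (intro open_Collect_less continuous_on_const)
  ultimately have U: "open U" "x \<in> U" unfolding U_def using x \<open>\<not> g x \<le> 1\<close> by auto
  have "x \<in> closure (interior D)" using convex_closure_interior[OF D(1,2)] x closure_subset[of D] by auto
  then obtain y where y: "y \<in> U \<inter> interior D" using open_Int_closure_eq_empty[OF U(1), of "interior D"] U(2) by auto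
  have op: "open (U \<inter> interior D)" using U by auto
  have "bounded {x \<in> D. 0 < x \<bullet> u \<and> 1 < g x}" by (rule bounded_subset[OF compact_imp_bounded[OF D(3)]]) auto
  moreover have "{x \<in> D. 0 < x \<bullet> u \<and> 1 < g x} = D \<inter> U" by (auto simp: U_def)
  ultimately have L: "D \<inter> U \<in> lmeasurable"
    using U D sets.Int[of D borel U] by (intro bounded_set_imp_lmeasurable) (simp_all add: compact_imp_closed borel_closed borel_open)
  have "measure lebesgue (U \<inter> interior D) \<le> measure lebesgue (D \<inter> U)"
    using interior_subset op L by (intro measure_mono_fmeasurable) (auto simp: borel_open)
  hence "measure lebesgue (U \<inter> interior D) = 0" using z \<open>_ = D \<inter> U\<close> measure_nonneg by (metis antisym)
  moreover have "U \<inter> interior D \<in> lmeasurable"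
    using D by (intro lmeasurable_open[OF _ op]) (meson bounded_Int bounded_subset compact_imp_bounded interior_subset)
  ultimately have "negligible (U \<inter> interior D)" by (simp add: negligible_iff_measure0)
  thus False using open_not_negligible[OF op] y by blast
qed

text \<open>Half-planes are sufficient as test sets: \<open>x \<bullet> w \<le> 1\<close> on the
  half of a body means that a half-plane is null for a planar law. The halves thus have the same
  functionals bounded by 1 up to the shear, and no identity between the halves themselves has to be
  established.\<close>

theorem shear:
  assumes int: "interior D0 \<noteq> {}" "interior D1 \<noteq> {}"
    and I: "measure lebesgue {x \<in> D0. 0 < x \<bullet> u} = I" "measure lebesgue {x \<in> D1. 0 < x \<bullet> u} = I"
    "measure lebesgue {x \<in> Dh. 0 < x \<bullet> u} = I" "0 < I"
  obtains p where "p \<bullet> u = 0"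
    "\<And>w. (\<forall>x\<in>D0. 0 < x \<bullet> u \<longrightarrow> x \<bullet> w + (p \<bullet> w) * (x \<bullet> u) \<le> 1) \<longleftrightarrow> (\<forall>x\<in>D1. 0 < x \<bullet> u \<longrightarrow> x \<bullet> w \<le> 1)"
proof -
  obtain p where p: "p \<bullet> u = 0" "\<And>v B. B \<in> sets (borel \<Otimes>\<^sub>M borel) \<Longrightarrow>
      measure lebesgue {x \<in> D1. 0 < x \<bullet> u \<and> (x \<bullet> u, x \<bullet> v) \<in> B}
      = measure lebesgue {x \<in> D0. 0 < x \<bullet> u \<and> (x \<bullet> u, x \<bullet> v + (p \<bullet> v) * (x \<bullet> u)) \<in> B}"
    using law_shear[OF I] by blast
  show ?thesis
  proof (rule that[OF p(1)])
    fix w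
    have B: "(UNIV :: real set) \<times> {1<..} \<in> sets (borel \<Otimes>\<^sub>M (borel :: real measure))" by measurable
    have eq: "measure lebesgue {x \<in> D1. 0 < x \<bullet> u \<and> 1 < x \<bullet> w} = measure lebesgue {x \<in> D0. 0 < x \<bullet> u \<and> 1 < x \<bullet> w + (p \<bullet> w) * (x \<bullet> u)}"
      using p(2)[OF B, of w] by simp
    have cont: "continuous_on UNIV (\<lambda>x. x \<bullet> w)" "continuous_on UNIV (\<lambda>x. x \<bullet> w + (p \<bullet> w) * (x \<bullet> u))"
      by (intro continuous_intros)+
    show "(\<forall>x\<in>D0. 0 < x \<bullet> u \<longrightarrow> x \<bullet> w + (p \<bullet> w) * (x \<bullet> u) \<le> 1) \<longleftrightarrow> (\<forall>x\<in>D1. 0 < x \<bullet> u \<longrightarrow> x \<bullet> w \<le> 1)"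
    proof
      assume "\<forall>x\<in>D0. 0 < x \<bullet> u \<longrightarrow> x \<bullet> w + (p \<bullet> w) * (x \<bullet> u) \<le> 1"
      hence "{x \<in> D0. 0 < x \<bullet> u \<and> 1 < x \<bullet> w + (p \<bullet> w) * (x \<bullet> u)} = {}" using not_less by blast
      hence "measure lebesgue {x \<in> D1. 0 < x \<bullet> u \<and> 1 < x \<bullet> w} = 0" unfolding eq by (simp only: measure_empty)
      thus "\<forall>x\<in>D1. 0 < x \<bullet> u \<longrightarrow> x \<bullet> w \<le> 1"
        using null_open_part[OF convex(2) int(2) compact(2) cont(1)] by blast
    next
      assume "\<forall>x\<in>D1. 0 < x \<bullet> u \<longrightarrow> x \<bullet> w \<le> 1"
      hence "{x \<in> D1. 0 < x \<bullet> u \<and> 1 < x \<bullet> w} = {}" using not_less by blast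
      hence "measure lebesgue {x \<in> D0. 0 < x \<bullet> u \<and> 1 < x \<bullet> w + (p \<bullet> w) * (x \<bullet> u)} = 0" unfolding eq[symmetric] by (simp only: measure_empty)
      thus "\<forall>x\<in>D0. 0 < x \<bullet> u \<longrightarrow> x \<bullet> w + (p \<bullet> w) * (x \<bullet> u) \<le> 1"
        using null_open_part[OF convex(1) int(1) compact(1) cont(2)] by blast
    qed
  qed
qed

end

section \<open>Dual bodies\<close>

text \<open>\<open>polar_at\<close> moved to the origin, so that the half-spaces through 0 cut the
  polars for all centres.\<close>

definition dual :: "'a::euclidean_space \<Rightarrow> 'a set \<Rightarrow> 'a set" where
  "dual z K = {y. \<forall>x\<in>K. y \<bullet> (x - z) \<le> 1}"

definition pvol :: "'a::euclidean_space set \<Rightarrow> 'a \<Rightarrow> real" where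
  "pvol K z = measure lebesgue (dual z K)"

definition hvol :: "'a::euclidean_space \<Rightarrow> 'a set \<Rightarrow> 'a \<Rightarrow> real" where
  "hvol u K z = measure lebesgue {y \<in> dual z K. 0 < y \<bullet> u}"

lemma measure_polar_at: "measure lebesgue (polar_at z K) = pvol K z"
proof -
  have "polar_at z K = (+) z ` dual z K"
  proof (intro set_eqI iffI)
    fix y assume "y \<in> polar_at z K"
    hence "y - z \<in> dual z K" by (simp add: polar_at_def dual_def)
    thus "y \<in> (+) z ` dual z K" by (intro image_eqI[of _ _ "y - z"]) auto
  qed (auto simp: polar_at_def dual_def)
  thus ?thesis by (simp add: pvol_def measure_translation)
qed

lemma dual_eq_INT: "dual z K = (\<Inter>x\<in>K. {y. (x - z) \<bullet> y \<le> 1})"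
  by (auto simp: dual_def inner_commute)

lemma dual_convex: "convex (dual z K)"
  unfolding dual_eq_INT by (intro convex_INT convex_halfspace_le)

lemma dual_closed: "closed (dual z K)"
  unfolding dual_eq_INT by (intro closed_INT ballI closed_halfspace_le)

lemma dual_norm_le:
  assumes "cball z r \<subseteq> K" "0 < r" "y \<in> dual z K" shows "norm y \<le> 1 / r"
proof (cases "y = 0")
  case False
  have "z + (r / norm y) *\<^sub>R y \<in> K" using assms(1,2) False by (auto simp: subset_iff dist_norm)
  hence "y \<bullet> ((r / norm y) *\<^sub>R y) \<le> 1" using assms(3) by (force simp: dual_def)
  hence "r * norm y \<le> 1" using False by (simp add: power2_norm_eq_inner[symmetric] power2_eq_square)
  thus ?thesis using assms(2) by (simp add: field_simps)
qed (use assms in simp)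

lemma dual_superset:
  assumes "K \<subseteq> cball z R" "0 < R" shows "cball 0 (1 / R) \<subseteq> dual z K"
proof
  fix y :: 'a assume y: "y \<in> cball 0 (1 / R)"
  have "y \<bullet> (x - z) \<le> 1" if "x \<in> K" for x
  proof -
    have "norm (x - z) \<le> R" using assms that by (force simp: dist_norm norm_minus_commute)
    moreover have "norm y \<le> 1 / R" using y by simp
    ultimately have "norm y * norm (x - z) \<le> (1 / R) * R" using assms by (intro mult_mono) auto
    thus ?thesis using norm_cauchy_schwarz[of y "x - z"] assms by simp
  qed
  thus "y \<in> dual z K" by (simp add: dual_def)
qed

text \<open>Separating a point at distance at most \<open>d\<close> from \<open>z\<close> yields a long vector of the dual body.\<close>

lemma separation_dual:
  assumes K: "closed K" "convex K" "z \<in> K" and q: "q \<notin> K"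
  obtains y where "y \<in> dual z K" "1 < y \<bullet> (q - z)"
proof -
  obtain a b where ab: "a \<bullet> q < b" "\<And>x. x \<in> K \<Longrightarrow> b < a \<bullet> x"
    using separating_hyperplane_closed_point[OF K(2,1) q] by blast
  define m where "m = a \<bullet> z - b"
  have m: "0 < m" using ab(2)[OF K(3)] by (simp add: m_def)
  define y where "y = (- 1 / m) *\<^sub>R a"
  have yx: "y \<bullet> (x - z) = (a \<bullet> z - a \<bullet> x) / m" for x by (simp add: y_def inner_diff_right diff_divide_distrib)
  show ?thesis
  proof (rule that[of y])
    have "y \<bullet> (x - z) \<le> 1" if "x \<in> K" for x using ab(2)[OF that] m unfolding yx by (simp add: m_def)
    thus "y \<in> dual z K" by (simp add: dual_def)
    show "1 < y \<bullet> (q - z)" using ab(1) m unfolding yx by (simp add: m_def)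
  qed
qed

text \<open>Only functionals with \<open>0 < y \<bullet> u\<close> are tested, so \<open>w\<close>
  can be located only up to a push along \<open>u\<close>. Adding to \<open>K\<close> the ray
  opposite to \<open>u\<close> gives a closed convex set; a functional separating a point from it
  satisfies \<open>0 \<le> y \<bullet> u\<close>, and a small multiple of \<open>u\<close> makes
  this strict.\<close>

lemma bipolar_half:
  assumes K: "compact K" "convex K" "z \<in> K" and u: "u \<noteq> 0"
    and w: "\<And>y. y \<in> dual z K \<Longrightarrow> 0 < y \<bullet> u \<Longrightarrow> y \<bullet> w \<le> 1"
  shows "\<exists>s\<ge>0. z + w + s *\<^sub>R u \<in> K"
proof (rule ccontr)
  assume n: "\<not> ?thesis"
  define K' where "K' = (\<Union>x\<in>K. \<Union>y\<in>(\<lambda>s. (- s) *\<^sub>R u) ` {0..}. {x + y})"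
  have K'I: "x + (- s) *\<^sub>R u \<in> K'" if "x \<in> K" "0 \<le> s" for x s
    using that unfolding K'_def by blast
  have K'E: "\<exists>x s. a = x + (- s) *\<^sub>R u \<and> x \<in> K \<and> 0 \<le> s" if "a \<in> K'" for a
    using that unfolding K'_def by blast
  have "closed ((\<lambda>s. (- s) *\<^sub>R u) ` {0..})"
  proof -
    have "(\<lambda>s. (- s) *\<^sub>R u) ` {0..} = (\<lambda>s. s *\<^sub>R u) ` {..0}"
    proof (intro set_eqI iffI)
      fix x assume "x \<in> (\<lambda>s. (- s) *\<^sub>R u) ` {0..}"
      then obtain s where "x = (- s) *\<^sub>R u" "0 \<le> s" by auto
      thus "x \<in> (\<lambda>s. s *\<^sub>R u) ` {..0}" by (intro image_eqI[of _ _ "- s"]) auto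
    next
      fix x assume "x \<in> (\<lambda>s. s *\<^sub>R u) ` {..0}"
      then obtain s where "x = s *\<^sub>R u" "s \<le> 0" by auto
      thus "x \<in> (\<lambda>s. (- s) *\<^sub>R u) ` {0..}" by (intro image_eqI[of _ _ "- s"]) auto
    qed
    moreover have "closed ((\<lambda>s. s *\<^sub>R u) ` {..0::real})"
      by (rule closed_injective_linear_image) (auto simp: u inj_on_def linear_iff scaleR_add_left)
    ultimately show ?thesis by simp
  qed
  hence cl: "closed K'" unfolding K'_def by (rule compact_closed_sums[OF K(1)])
  have cv: "convex K'"
  proof (rule convexI)
    fix a b :: 'a and l m :: real assume "a \<in> K'" "b \<in> K'" and lm: "0 \<le> l" "0 \<le> m" "l + m = 1"
    then obtain x s x' s' where a: "a = x + (- s) *\<^sub>R u" "x \<in> K" "0 \<le> s" and b: "b = x' + (- s') *\<^sub>R u" "x' \<in> K" "0 \<le> s'"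
      using K'E by blast
    have e: "l *\<^sub>R a + m *\<^sub>R b = (l *\<^sub>R x + m *\<^sub>R x') + (- (l * s + m * s')) *\<^sub>R u"
      unfolding a b by (simp add: algebra_simps)
    show "l *\<^sub>R a + m *\<^sub>R b \<in> K'" unfolding e
      by (rule K'I) (use K(2) a b lm in \<open>simp_all add: convex_def\<close>)
  qed
  have zK: "z \<in> K'" using K'I[OF K(3), of 0] by simp
  have "z + w \<notin> K'"
  proof
    assume "z + w \<in> K'"
    then obtain x s where "z + w = x + (- s) *\<^sub>R u" "x \<in> K" "0 \<le> s" using K'E by blast
    hence "z + w + s *\<^sub>R u \<in> K" "0 \<le> s" by auto
    thus False using n by blast
  qed
  then obtain y where y: "y \<in> dual z K'" "1 < y \<bullet> w" using separation_dual[OF cl cv zK] by (metis add_diff_cancel_left')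
  have yk: "y \<bullet> (x - z) - s * (y \<bullet> u) \<le> 1" if "x \<in> K" "0 \<le> s" for x s
  proof -
    have "x + (- s) *\<^sub>R u \<in> K'" using K'I that by blast
    hence "y \<bullet> (x + (- s) *\<^sub>R u - z) \<le> 1" using y(1) by (simp add: dual_def)
    moreover have "y \<bullet> (x + (- s) *\<^sub>R u - z) = y \<bullet> (x - z) - s * (y \<bullet> u)" by (simp add: inner_simps)
    ultimately show ?thesis by simp
  qed
  have yu: "0 \<le> y \<bullet> u"
  proof (rule ccontr)
    assume "\<not> 0 \<le> y \<bullet> u"
    \<comment> \<open>With this length \<open>s * (y \<bullet> u)\<close> is -2, which contradicts
      \<open>yk\<close> at \<open>x = z\<close>.\<close>
    moreover define s where "s = 2 / (- (y \<bullet> u))"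
    ultimately have "0 \<le> s" "s * (y \<bullet> u) = - 2" by (simp_all add: zero_le_divide_iff)
    thus False using yk[OF K(3), of s] by simp
  qed
  obtain M where M: "0 < M" "\<And>x. x \<in> K \<Longrightarrow> u \<bullet> (x - z) \<le> M"
  proof -
    obtain R where R: "\<And>x. x \<in> K \<Longrightarrow> norm x \<le> R" using compact_imp_bounded[OF K(1)] bounded_iff by metis
    show ?thesis
    proof (rule that[of "norm u * (R + norm z) + 1"])
      have "0 \<le> R" using R[OF K(3)] norm_ge_zero order_trans by blast
      thus "0 < norm u * (R + norm z) + 1" by (intro add_nonneg_pos mult_nonneg_nonneg) auto
      fix x assume "x \<in> K"
      have "u \<bullet> (x - z) \<le> norm u * norm (x - z)" by (rule norm_cauchy_schwarz)
      also have "\<dots> \<le> norm u * (R + norm z)"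
        using norm_triangle_ineq4[of x z] R[OF \<open>x \<in> K\<close>] by (intro mult_left_mono) auto
      finally show "u \<bullet> (x - z) \<le> norm u * (R + norm z) + 1" by simp
    qed
  qed
  \<comment> \<open>Spends half of the surplus \<open>y \<bullet> w - 1\<close>: adding
    \<open>e\<close> times \<open>u\<close> costs at most \<open>e * M\<close> in the normalisation
    and at most \<open>e * \<bar>u \<bullet> w\<bar>\<close> in the value at
    \<open>w\<close>.\<close>
  define e where "e = (y \<bullet> w - 1) / (2 * (M + \<bar>u \<bullet> w\<bar>))"
  have Mu: "0 < M + \<bar>u \<bullet> w\<bar>" using M by simp
  define c where "c = M + \<bar>u \<bullet> w\<bar>"
  have e: "0 < e" "e * (M + \<bar>u \<bullet> w\<bar>) = (y \<bullet> w - 1) / 2"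
    using y(2) Mu unfolding e_def c_def[symmetric] by simp_all
  have eM: "0 < 1 + e * M" using e M by (simp add: add_pos_pos)
  define y' where "y' = (1 / (1 + e * M)) *\<^sub>R (y + e *\<^sub>R u)"
  have "y' \<in> dual z K" unfolding dual_def
  proof (rule CollectI, rule ballI)
    fix x assume x: "x \<in> K"
    have "(y + e *\<^sub>R u) \<bullet> (x - z) \<le> 1 + e * M"
    proof -
      have "e * (u \<bullet> (x - z)) \<le> e * M" using M(2)[OF x] e(1) by (intro mult_left_mono) auto
      moreover have "y \<bullet> (x - z) \<le> 1" using yk[OF x, of 0] by simp
      ultimately show ?thesis unfolding inner_add_left inner_scaleR_left by linarith
    qed
    thus "y' \<bullet> (x - z) \<le> 1" using eM by (simp add: y'_def)
  qed
  moreover have "0 < y' \<bullet> u" using eM e yu u by (simp add: y'_def inner_add_left add_nonneg_pos)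
  ultimately have "y' \<bullet> w \<le> 1" by (rule w)
  hence "y \<bullet> w + e * (u \<bullet> w) \<le> 1 + e * M" using eM by (simp add: y'_def inner_add_left)
  moreover have "- (e * \<bar>u \<bullet> w\<bar>) \<le> e * (u \<bullet> w)" using e by (simp add: abs_if)
  ultimately have "y \<bullet> w \<le> 1 + e * (M + \<bar>u \<bullet> w\<bar>)" unfolding distrib_left by linarith
  thus False using y(2) unfolding e(2) by (simp add: field_simps)
qed

text \<open>Moving the centre by \<open>d\<close> changes the functional \<open>y\<close> by at most
  \<open>norm y * d\<close>, and \<open>norm y \<le> 1 / r\<close>. Dual bodies of nearby centres
  therefore contain each other up to a factor close to 1, which is the source of all continuity in
  the centre.\<close>

lemma dual_perturb:
  assumes "cball z r \<subseteq> K" "0 < r" "dist z z' \<le> d" "y \<in> dual z K"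
  shows "(1 / (1 + d / r)) *\<^sub>R y \<in> dual z' K"
  unfolding dual_def
proof (rule CollectI, rule ballI)
  fix x assume x: "x \<in> K"
  have d: "0 \<le> d" using assms(3) zero_le_dist order_trans by blast
  have "y \<bullet> (z - z') \<le> norm y * norm (z - z')" by (rule norm_cauchy_schwarz)
  also have "\<dots> \<le> (1 / r) * d"
    using dual_norm_le[OF assms(1,2,4)] assms(2,3) by (intro mult_mono) (auto simp: dist_norm)
  finally have "y \<bullet> (x - z') \<le> 1 + d / r"
    using assms(4) x by (force simp: dual_def inner_diff_right)
  moreover have "0 < 1 + d / r" using d assms(2) by (simp add: add_pos_nonneg)
  ultimately show "((1 / (1 + d / r)) *\<^sub>R y) \<bullet> (x - z') \<le> 1" by simp
qed

lemma half_lmeasurable: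
  fixes D :: "'a::euclidean_space set"
  assumes "compact D" shows "{y \<in> D. 0 < y \<bullet> u} \<in> lmeasurable"
proof -
  have o: "open {y :: 'a. 0 < y \<bullet> u}" by (intro open_Collect_less continuous_intros)
  have e: "{y \<in> D. 0 < y \<bullet> u} = D \<inter> {y. 0 < y \<bullet> u}" by auto
  have "bounded {y \<in> D. 0 < y \<bullet> u}" using compact_imp_bounded[OF assms] by (rule bounded_subset) auto
  moreover have "{y \<in> D. 0 < y \<bullet> u} \<in> sets borel"
    unfolding e using assms o by (intro sets.Int) (simp_all add: borel_closed borel_open compact_imp_closed)
  ultimately show ?thesis by (intro bounded_set_imp_lmeasurable) simp_all
qed

section \<open>Polar volume as a function of the centre\<close>

locale convbody =
  fixes K :: "'a::euclidean_space set"
  assumes K: "convex_body K"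
begin

lemma compact: "compact K" and convex: "convex K" and interior_nonempty: "interior K \<noteq> {}" and closed: "closed K"
  using K by (auto simp: convex_body_def compact_imp_closed)

lemma interior_cball:
  assumes "z \<in> interior K" obtains r where "0 < r" "cball z r \<subseteq> K"
  using assms by (meson mem_interior_cball)

lemma dual_compact: "z \<in> interior K \<Longrightarrow> compact (dual z K)"
proof -
  assume "z \<in> interior K"
  then obtain r where r: "0 < r" "cball z r \<subseteq> K" by (rule interior_cball)
  hence "dual z K \<subseteq> cball 0 (1 / r)" using dual_norm_le[OF r(2,1)] by auto
  hence "bounded (dual z K)" by (rule bounded_subset[OF bounded_cball])
  thus ?thesis by (simp add: compact_eq_bounded_closed dual_closed)
qed

lemma uniform_radius:
  obtains R where "0 < R" "\<And>z. z \<in> K \<Longrightarrow> K \<subseteq> cball z R"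
proof -
  obtain M where M: "\<And>x. x \<in> K \<Longrightarrow> norm x \<le> M" using compact_imp_bounded[OF compact] bounded_iff by metis
  show ?thesis
  proof (rule that[of "2 * \<bar>M\<bar> + 1"])
    fix z assume z: "z \<in> K"
    show "K \<subseteq> cball z (2 * \<bar>M\<bar> + 1)"
    proof
      fix x assume "x \<in> K"
      thus "x \<in> cball z (2 * \<bar>M\<bar> + 1)" using M[of x] M[OF z] norm_triangle_ineq4[of z x] by (simp add: dist_norm)
    qed
  qed simp
qed

lemma dual_interior:
  assumes "z \<in> K" shows "0 \<in> interior (dual z K)"
proof -
  obtain R where R: "0 < R" "K \<subseteq> cball z R" using uniform_radius assms by metis
  hence "cball 0 (1 / R) \<subseteq> dual z K" by (intro dual_superset)
  thus ?thesis using R(1) unfolding mem_interior_cball by (intro exI[of _ "1 / R"]) simp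
qed

lemma hvol_measurable:
  assumes "z \<in> interior K" shows "{y \<in> dual z K. 0 < y \<bullet> u} \<in> lmeasurable" "dual z K \<in> lmeasurable"
  using half_lmeasurable[OF dual_compact[OF assms]] lmeasurable_compact[OF dual_compact[OF assms]] by auto

lemma hvol_pos:
  assumes z: "z \<in> interior K" and u: "u \<noteq> 0" shows "0 < hvol u K z"
proof -
  have "0 \<in> interior (dual z K)" using dual_interior z interior_subset by blast
  then obtain e where e: "0 < e" "cball 0 e \<subseteq> dual z K" by (meson mem_interior_cball)
  define W where "W = ball 0 e \<inter> {y :: 'a. 0 < y \<bullet> u}"
  have o: "open W" unfolding W_def by (intro open_Int open_ball open_Collect_less continuous_intros)
  have "(e / (2 * norm u)) *\<^sub>R u \<in> W" using e u by (simp add: W_def)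
  hence "\<not> negligible W" using open_not_negligible[OF o] by blast
  moreover have L: "W \<in> lmeasurable" by (rule lmeasurable_open[OF _ o]) (auto simp: W_def intro: bounded_Int)
  ultimately have "0 < measure lebesgue W" by (simp add: negligible_iff_measure0 zero_less_measure_iff)
  also have "measure lebesgue W \<le> hvol u K z"
    unfolding hvol_def using e L by (intro measure_mono_fmeasurable hvol_measurable[OF z]) (auto simp: W_def)
  finally show ?thesis .
qed

lemma pvol_halves:
  assumes z: "z \<in> interior K" and u: "u \<noteq> 0"
  shows "pvol K z = hvol u K z + hvol (- u) K z"
proof -
  let ?A = "{y \<in> dual z K. 0 < y \<bullet> u}" and ?B = "{y \<in> dual z K. 0 < y \<bullet> (- u)}"
  have n: "negligible {y. u \<bullet> y = 0}" using negligible_hyperplane[of u 0] u by simp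
  have "dual z K - (?A \<union> ?B) \<subseteq> {y. u \<bullet> y = 0}" by (auto simp: inner_commute)
  moreover have "?A \<union> ?B - dual z K = {}" by auto
  ultimately have "negligible (dual z K - (?A \<union> ?B) \<union> (?A \<union> ?B - dual z K))"
    using negligible_subset[OF n] by simp
  hence "measure lebesgue (dual z K) = measure lebesgue (?A \<union> ?B)"
    by (rule measure_negligible_symdiff[OF hvol_measurable(2)[OF z], symmetric])
  also have "\<dots> = measure lebesgue ?A + measure lebesgue ?B"
  proof -
    have "?B - ?A = ?B" by auto
    thus ?thesis using measure_Un2[OF hvol_measurable(1)[OF z, of u] hvol_measurable(1)[OF z, of "- u"]] by (simp only:)
  qed
  finally show ?thesis by (simp add: pvol_def hvol_def)
qed

lemma hvol_perturb:
  assumes "cball z r \<subseteq> K" "0 < r" "dist z z' \<le> d" "z' \<in> interior K"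
  shows "hvol u K z \<le> (1 + d / r) ^ DIM('a) * hvol u K z'"
proof -
  have z: "z \<in> interior K" using assms by (meson mem_interior_cball)
  have d: "0 \<le> d" using assms(3) zero_le_dist order_trans by blast
  define m where "m = 1 + d / r"
  have m: "0 < m" using d assms(2) by (simp add: m_def add_pos_nonneg)
  let ?S = "{y \<in> dual z' K. 0 < y \<bullet> u}"
  have sub: "{y \<in> dual z K. 0 < y \<bullet> u} \<subseteq> (\<lambda>y. m *\<^sub>R y + 0) ` ?S"
  proof
    fix y assume y: "y \<in> {y \<in> dual z K. 0 < y \<bullet> u}"
    hence "(1 / m) *\<^sub>R y \<in> ?S" using dual_perturb[OF assms(1-3), of y] m by (auto simp: m_def)
    moreover have "y = m *\<^sub>R ((1 / m) *\<^sub>R y) + 0" using m by simp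
    ultimately show "y \<in> (\<lambda>y. m *\<^sub>R y + 0) ` ?S" by blast
  qed
  have me: "measure lebesgue ((\<lambda>y. m *\<^sub>R y + 0) ` ?S) = m ^ DIM('a) * measure lebesgue ?S"
    using measure_lebesgue_affine[of m 0 ?S] m by simp
  have "(\<lambda>y. m *\<^sub>R y + 0) ` ?S = {y \<in> (\<lambda>y. m *\<^sub>R y) ` dual z' K. 0 < y \<bullet> u}"
    using m by (auto simp: zero_less_mult_iff)
  hence "(\<lambda>y. m *\<^sub>R y + 0) ` ?S \<in> lmeasurable"
    using half_lmeasurable[OF compact_scaling[OF dual_compact[OF assms(4)]], of m u] by simp
  hence "measure lebesgue {y \<in> dual z K. 0 < y \<bullet> u} \<le> measure lebesgue ((\<lambda>y. m *\<^sub>R y + 0) ` ?S)"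
    using hvol_measurable(1)[OF z] sub by (intro measure_mono_fmeasurable) auto
  thus ?thesis unfolding me by (simp add: hvol_def m_def)
qed

text \<open>A sandwich from \<open>hvol_perturb\<close> in both directions. The radius is halved
  because the ball must fit into \<open>K\<close> around the moved centre as well.\<close>

lemma hvol_continuous: "continuous_on (interior K) (hvol u K)"
proof (rule continuous_at_imp_continuous_on, rule ballI)
  fix z assume z: "z \<in> interior K"
  obtain r where r: "0 < r" "cball z r \<subseteq> K" using z by (rule interior_cball)
  let ?n = "DIM('a)"
  define g where "g z' = (1 + dist z z' / (r/2)) ^ ?n" for z'
  have g1: "1 \<le> g z'" for z' unfolding g_def using r by (intro one_le_power) simp
  have near: "hvol u K z / g z' \<le> hvol u K z' \<and> hvol u K z' \<le> g z' * hvol u K z" if "dist z' z < r/2" for z'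
  proof
    have c: "cball z' (r/2) \<subseteq> K"
    proof
      fix x assume "x \<in> cball z' (r/2)"
      hence "dist z x \<le> r" using that dist_triangle[of z x z'] by (simp add: dist_commute)
      thus "x \<in> K" using r by auto
    qed
    hence z': "z' \<in> interior K" using r by (meson mem_interior_cball half_gt_zero)
    show "hvol u K z' \<le> g z' * hvol u K z"
      unfolding g_def using hvol_perturb[OF c _ _ z, of "dist z z'" u] r by (simp add: dist_commute)
    have c2: "cball z (r/2) \<subseteq> K" using r by (intro order_trans[OF _ r(2)]) auto
    have "hvol u K z \<le> g z' * hvol u K z'"
      unfolding g_def using hvol_perturb[OF c2 _ _ z', of "dist z z'" u] r by simp
    thus "hvol u K z / g z' \<le> hvol u K z'" using g1[of z'] by (simp add: pos_divide_le_eq mult.commute)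
  qed
  have "isCont g z" unfolding g_def by (intro continuous_intros) (use r in auto)
  hence gl: "(g \<longlongrightarrow> 1) (at z)" unfolding isCont_def by (simp add: g_def)
  have ev: "eventually (\<lambda>z'. dist z' z < r/2) (at z)" using r unfolding eventually_at by (intro exI[of _ "r/2"]) simp
  show "isCont (hvol u K) z" unfolding isCont_def
  proof (rule tendsto_sandwich)
    show "eventually (\<lambda>z'. hvol u K z / g z' \<le> hvol u K z') (at z)" using ev by eventually_elim (use near in auto)
    show "eventually (\<lambda>z'. hvol u K z' \<le> g z' * hvol u K z) (at z)" using ev by eventually_elim (use near in auto)
    show "((\<lambda>z'. hvol u K z / g z') \<longlongrightarrow> hvol u K z) (at z)" using tendsto_divide[OF tendsto_const gl] by simp
    show "((\<lambda>z'. g z' * hvol u K z) \<longlongrightarrow> hvol u K z) (at z)" using tendsto_mult[OF gl tendsto_const] by simp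
  qed
qed

end

text \<open>The convex hull of \<open>p\<close> and the ball of radius \<open>\<rho>\<close>
  contains a ball of radius \<open>\<rho>/2\<close> around every point in the first half of the
  segment from 0 to \<open>p\<close>. Centres spaced by \<open>\<rho>\<close> give about
  \<open>norm p / (2 * \<rho>)\<close> disjoint balls, so a far point forces a large volume.\<close>

lemma long_convex_measure:
  fixes D :: "'a::euclidean_space set"
  assumes D: "convex D" "D \<in> lmeasurable" and \<rho>: "0 < \<rho>" "cball 0 \<rho> \<subseteq> D" and p: "p \<in> D"
  shows "norm p \<le> 2 * \<rho> * (measure lebesgue D / measure lebesgue (ball (0::'a) (\<rho>/2)) + 1)"
proof (cases "p = 0")
  case True
  then show ?thesis using \<rho> by (simp add: add_nonneg_nonneg)
next
  case False
  define \<beta> where "\<beta> = measure lebesgue (ball (0::'a) (\<rho>/2))"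
  have \<beta>: "0 < \<beta>" using \<rho> by (simp add: \<beta>_def content_ball_pos)
  define N where "N = nat \<lfloor>norm p / (2 * \<rho>)\<rfloor>"
  have N: "real N \<le> norm p / (2 * \<rho>)" "norm p / (2 * \<rho>) < real N + 1"
    using \<rho> by (auto simp: N_def)
  define c where "c k = (real k * \<rho> / norm p) *\<^sub>R p" for k :: nat
  have sub: "ball (c k) (\<rho>/2) \<subseteq> D" if k: "k < N" for k
  proof
    fix x assume x: "x \<in> ball (c k) (\<rho>/2)"
    define t where "t = real k * \<rho> / norm p"
    have "real k \<le> norm p / (2 * \<rho>)" using N k by simp
    hence t: "0 \<le> t" "t \<le> 1/2" using \<rho> False by (auto simp: t_def field_simps)
    define q where "q = (1 / (1 - t)) *\<^sub>R (x - c k)"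
    have "norm (x - c k) \<le> \<rho>/2" using x by (simp add: dist_norm norm_minus_commute)
    also have "\<dots> \<le> (1 - t) * \<rho>" using t \<rho> mult_right_mono[of "1/2" "1-t" \<rho>] by simp
    finally have "norm (x - c k) \<le> (1 - t) * \<rho>" .
    moreover have "norm q = norm (x - c k) / (1 - t)" using t by (simp only: q_def norm_scaleR) simp
    ultimately have "norm q \<le> \<rho>" using t by (simp add: pos_divide_le_eq mult.commute)
    hence "q \<in> D" using \<rho> by auto
    hence "t *\<^sub>R p + (1 - t) *\<^sub>R q \<in> D" using D(1) p t by (simp add: convex_def)
    moreover have "(1 - t) *\<^sub>R q = x - c k" using t by (simp only: q_def scaleR_scaleR) simp
    moreover have "t *\<^sub>R p = c k" by (simp add: c_def t_def)
    ultimately show "x \<in> D" by simp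
  qed
  have disj: "disjoint_family_on (\<lambda>k. ball (c k) (\<rho>/2)) {..<N}"
    unfolding disjoint_family_on_def
  proof (intro ballI impI)
    fix j k :: nat assume "j \<noteq> k"
    hence jk: "1 \<le> \<bar>real j - real k\<bar>" by linarith
    have "c j - c k = ((real j - real k) * \<rho> / norm p) *\<^sub>R p" by (simp add: c_def algebra_simps diff_divide_distrib)
    hence "dist (c j) (c k) = \<bar>real j - real k\<bar> * \<rho>" using False \<rho> by (simp add: dist_norm abs_mult)
    hence "\<rho> \<le> dist (c j) (c k)" using jk \<rho> mult_right_mono[OF jk, of \<rho>] by simp
    thus "ball (c j) (\<rho>/2) \<inter> ball (c k) (\<rho>/2) = {}" by (intro disjoint_ballI) simp
  qed
  have "real N * \<beta> = (\<Sum>k<N. measure lebesgue (ball (c k) (\<rho>/2)))"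
  proof -
    have "measure lebesgue (ball (c k) (\<rho>/2)) = \<beta>" for k
      using measure_translation[of "c k" "ball 0 (\<rho>/2)"] by (simp add: \<beta>_def ball_translation[symmetric])
    thus ?thesis by simp
  qed
  also have "\<dots> = measure lebesgue (\<Union>k<N. ball (c k) (\<rho>/2))"
  proof (rule measure_finite_Union[symmetric])
    show "emeasure lebesgue (ball (c k) (\<rho>/2)) \<noteq> \<infinity>" for k using fmeasurableD2[OF lmeasurable_ball[of "c k" "\<rho>/2"]] by simp
  qed (use disj in auto)
  also have "\<dots> \<le> measure lebesgue D"
    using sub D(2) by (intro measure_mono_fmeasurable) (auto simp: borel_open)
  finally have "real N \<le> measure lebesgue D / \<beta>" using \<beta> by (simp add: pos_le_divide_eq)
  hence "norm p / (2 * \<rho>) \<le> measure lebesgue D / \<beta> + 1" using N by linarith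
  thus ?thesis using \<rho> by (simp add: \<beta>_def pos_divide_le_eq mult.commute)
qed

context convbody
begin

text \<open>If a point outside \<open>K\<close> is close to the centre, separation yields a long
  vector of the dual body. That body also contains a ball whose radius is independent of the centre,
  so by \<open>long_convex_measure\<close> its volume is large. Bounded polar volume thus keeps the
  centre away from the boundary.\<close>

lemma pvol_bounded_imp_cball:
  obtains d where "0 < d" "\<And>z. z \<in> interior K \<Longrightarrow> pvol K z \<le> M \<Longrightarrow> cball z d \<subseteq> K"
proof -
  obtain R where R: "0 < R" "\<And>z. z \<in> K \<Longrightarrow> K \<subseteq> cball z R" using uniform_radius by metis
  define B where "B = 2 * (1/R) * (\<bar>M\<bar> / measure lebesgue (ball (0::'a) (1/R/2)) + 1)"
  have B: "0 < B" using R by (simp add: B_def add_nonneg_pos)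
  show ?thesis
  proof (rule that[of "1 / B"])
    fix z assume z: "z \<in> interior K" "pvol K z \<le> M"
    hence zK: "z \<in> K" using interior_subset by blast
    show "cball z (1 / B) \<subseteq> K"
    proof (rule ccontr)
      assume "\<not> ?thesis"
      then obtain q where q0: "q \<in> cball z (1 / B)" and q: "q \<notin> K" by blast
      have qd: "dist z q \<le> 1 / B" using q0 by simp
      obtain y where y: "y \<in> dual z K" "1 < y \<bullet> (q - z)" by (rule separation_dual[OF closed convex zK q])
      have "norm y \<le> 2 * (1/R) * (pvol K z / measure lebesgue (ball (0::'a) (1/R/2)) + 1)"
        unfolding pvol_def
        by (rule long_convex_measure[OF dual_convex hvol_measurable(2)[OF z(1)] _ dual_superset[OF R(2)[OF zK] R(1)] y(1)]) (use R in simp)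
      also have "\<dots> \<le> B" unfolding B_def
      proof (rule mult_left_mono)
        have "pvol K z / measure lebesgue (ball (0::'a) (1/R/2)) \<le> \<bar>M\<bar> / measure lebesgue (ball (0::'a) (1/R/2))"
          by (rule divide_right_mono) (use z(2) in simp_all)
        thus "pvol K z / measure lebesgue (ball (0::'a) (1/R/2)) + 1 \<le> \<bar>M\<bar> / measure lebesgue (ball (0::'a) (1/R/2)) + 1" by simp
      qed (use R(1) in simp)
      finally have nB: "norm y \<le> B" .
      have "y \<bullet> (q - z) \<le> norm y * norm (q - z)" by (rule norm_cauchy_schwarz)
      also have "\<dots> \<le> B * (1 / B)" using nB qd B by (intro mult_mono) (auto simp: dist_norm norm_minus_commute)
      finally show False using y(2) B by simp
    qed
  qed (use B in simp)
qed

lemma pvol_pos: "z \<in> interior K \<Longrightarrow> 0 < pvol K z"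
proof -
  assume z: "z \<in> interior K"
  obtain u :: 'a where "u \<noteq> 0" using nonempty_Basis nonzero_Basis by blast
  thus ?thesis using pvol_halves[OF z] hvol_pos[OF z] by (metis add_pos_pos neg_equal_0_iff_equal)
qed

lemma santalo_point:
  obtains s where "s \<in> interior K" "\<And>z. z \<in> interior K \<Longrightarrow> pvol K s \<le> pvol K z"
proof -
  obtain u :: 'a where u: "u \<noteq> 0" using nonempty_Basis nonzero_Basis by blast
  obtain z1 where z1: "z1 \<in> interior K" using interior_nonempty by blast
  obtain d where d: "0 < d" "\<And>z. z \<in> interior K \<Longrightarrow> pvol K z \<le> pvol K z1 \<Longrightarrow> cball z d \<subseteq> K"
    by (rule pvol_bounded_imp_cball[of "pvol K z1"]) blast
  \<comment> \<open>A compact part of the interior that contains every centre with polar volume at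
    most that of \<open>z1\<close>; continuity gives a minimum on it.\<close>
  define Z where "Z = {z. cball z d \<subseteq> K}"
  have ZK: "Z \<subseteq> interior K" using d by (auto simp: Z_def mem_interior_cball)
  have "Z = (\<Inter>v\<in>cball 0 d. (\<lambda>x. x + v) -` K)"
  proof (intro set_eqI iffI)
    fix z assume "z \<in> Z" thus "z \<in> (\<Inter>v\<in>cball 0 d. (\<lambda>x. x + v) -` K)"
      by (auto simp: Z_def subset_iff dist_norm)
  next
    fix z assume z: "z \<in> (\<Inter>v\<in>cball 0 d. (\<lambda>x. x + v) -` K)"
    have "x \<in> K" if "x \<in> cball z d" for x
    proof -
      have "x - z \<in> cball 0 d" using that by (simp add: dist_norm norm_minus_commute)
      hence "z + (x - z) \<in> K" using z by blast
      thus ?thesis by simp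
    qed
    thus "z \<in> Z" by (auto simp: Z_def)
  qed
  moreover have "closed ((\<lambda>x. x + v) -` K)" for v
    by (intro closed_vimage closed continuous_intros)
  ultimately have "closed Z" by (simp add: closed_INT)
  moreover have "bounded Z" using ZK interior_subset compact_imp_bounded[OF compact] bounded_subset by metis
  ultimately have cZ: "compact Z" by (simp add: compact_eq_bounded_closed)
  have "continuous_on (interior K) (\<lambda>z. hvol u K z + hvol (- u) K z)" by (intro continuous_on_add hvol_continuous)
  hence "continuous_on (interior K) (pvol K)" by (rule continuous_on_eq) (simp add: pvol_halves[OF _ u])
  hence "continuous_on Z (pvol K)" using ZK continuous_on_subset by blast
  moreover have "z1 \<in> Z" using d(2)[OF z1] by (simp add: Z_def)
  ultimately obtain s where s: "s \<in> Z" "\<And>z. z \<in> Z \<Longrightarrow> pvol K s \<le> pvol K z"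
    using continuous_attains_inf[OF cZ] by blast
  show ?thesis
  proof (rule that[of s])
    show "s \<in> interior K" using s ZK by blast
    fix z assume z: "z \<in> interior K"
    show "pvol K s \<le> pvol K z"
    proof (cases "pvol K z \<le> pvol K z1")
      case True
      hence "z \<in> Z" using d(2)[OF z] by (simp add: Z_def)
      thus ?thesis using s by blast
    next
      case False
      thus ?thesis using s(2)[OF \<open>z1 \<in> Z\<close>] by linarith
    qed
  qed
qed

end

definition minvol :: "'a::euclidean_space set \<Rightarrow> real" where
  "minvol K = (INF z\<in>interior K. pvol K z)"

lemma minvol_le: "z \<in> interior K \<Longrightarrow> minvol K \<le> pvol K z"
  unfolding minvol_def by (rule cINF_lower) (auto simp: pvol_def intro!: bdd_belowI[of _ 0])

lemma (in convbody) minvol_attained: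
  obtains s where "s \<in> interior K" "pvol K s = minvol K"
proof -
  obtain s where s: "s \<in> interior K" "\<And>z. z \<in> interior K \<Longrightarrow> pvol K s \<le> pvol K z" using santalo_point by blast
  have "pvol K s \<le> minvol K" unfolding minvol_def using s by (intro cINF_greatest) auto
  thus ?thesis using that[of s] s minvol_le[of s K] by auto
qed

lemma (in convbody) volume_product_eq: "volume_product K = measure lebesgue K * minvol K"
proof -
  obtain s where s: "s \<in> interior K" "pvol K s = minvol K" by (rule minvol_attained)
  have "volume_product K = measure lebesgue K * measure lebesgue (polar_at s K)"
    by (rule volume_product_eq_minimum[OF s(1)]) (auto simp: measure_polar_at s(2) intro!: mult_left_mono minvol_le)
  thus ?thesis by (simp add: measure_polar_at s)
qed

lemma (in convbody) minvol_pos: "0 < minvol K"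
  using minvol_attained pvol_pos by metis

section \<open>Fibrewise midpoints\<close>

text \<open>On each line parallel to \<open>u\<close> this is half the Minkowski sum of the two
  chords: \<open>x\<close> is the midpoint of a point of \<open>A\<close> and a point of
  \<open>B\<close> on the line.\<close>

definition mid :: "'a::euclidean_space \<Rightarrow> 'a set \<Rightarrow> 'a set \<Rightarrow> 'a set" where
  "mid u A B = {x. \<exists>s. x + s *\<^sub>R u \<in> A \<and> x - s *\<^sub>R u \<in> B}"

lemma mid_eq_image:
  "mid u A B = (\<lambda>(a, b). (1/2) *\<^sub>R (a + b)) ` (A \<times> B \<inter> {p. fst p - snd p \<in> span {u}})"
proof (intro set_eqI iffI)
  fix x assume "x \<in> mid u A B"
  then obtain s where s: "x + s *\<^sub>R u \<in> A" "x - s *\<^sub>R u \<in> B" by (auto simp: mid_def)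
  have "(x + s *\<^sub>R u) - (x - s *\<^sub>R u) = (2 * s) *\<^sub>R u" by (simp add: scaleR_2 scaleR_add_left[symmetric])
  hence "(x + s *\<^sub>R u) - (x - s *\<^sub>R u) \<in> span {u}" by (auto simp: span_singleton)
  thus "x \<in> (\<lambda>(a, b). (1/2) *\<^sub>R (a + b)) ` (A \<times> B \<inter> {p. fst p - snd p \<in> span {u}})"
    using s by (intro image_eqI[of _ _ "(x + s *\<^sub>R u, x - s *\<^sub>R u)"]) (auto simp: scaleR_2[symmetric])
next
  fix x assume "x \<in> (\<lambda>(a, b). (1/2) *\<^sub>R (a + b)) ` (A \<times> B \<inter> {p. fst p - snd p \<in> span {u}})"
  then obtain a b where ab0: "a \<in> A" "b \<in> B" "a - b \<in> span {u}" "x = (1/2) *\<^sub>R (a + b)" by auto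
  then obtain c where ab: "a \<in> A" "b \<in> B" "a - b = c *\<^sub>R u" "x = (1/2) *\<^sub>R (a + b)" unfolding span_singleton by blast
  have "a = b + c *\<^sub>R u" using ab(3) by (simp add: algebra_simps)
  have "x = (1/2) *\<^sub>R (b + b) + (1/2) *\<^sub>R (c *\<^sub>R u)"
    unfolding ab(4) \<open>a = b + c *\<^sub>R u\<close> scaleR_add_right[symmetric] by (simp only: ac_simps)
  hence xb: "x = b + (c/2) *\<^sub>R u" by (simp only: scaleR_half_double scaleR_scaleR) simp
  have "x + (c/2) *\<^sub>R u = b + (c/2 + c/2) *\<^sub>R u" unfolding xb scaleR_add_left by (simp only: ac_simps)
  hence "x + (c/2) *\<^sub>R u = a" "x - (c/2) *\<^sub>R u = b" using \<open>a = b + c *\<^sub>R u\<close> xb by simp_all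
  thus "x \<in> mid u A B" using ab(1,2) by (auto simp: mid_def)
qed

lemma mid_compact: "compact A \<Longrightarrow> compact B \<Longrightarrow> compact (mid u A B)"
proof -
  assume "compact A" "compact B"
  moreover have "closed {p :: 'a \<times> 'a. fst p - snd p \<in> span {u}}"
  proof -
    have "closed ((\<lambda>p :: 'a \<times> 'a. fst p - snd p) -` span {u})"
      by (intro closed_vimage closed_span continuous_intros)
    thus ?thesis by (simp add: vimage_def)
  qed
  ultimately have "compact (A \<times> B \<inter> {p. fst p - snd p \<in> span {u}})" by (intro compact_Int_closed compact_Times)
  thus ?thesis unfolding mid_eq_image case_prod_beta by (rule compact_continuous_image[rotated]) (intro continuous_intros)
qed

lemma mid_convex: "convex A \<Longrightarrow> convex B \<Longrightarrow> convex (mid u A B)"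
proof (rule convexI)
  fix x y and l m :: real
  assume A: "convex A" and B: "convex B" and xy: "x \<in> mid u A B" "y \<in> mid u A B" and lm: "0 \<le> l" "0 \<le> m" "l + m = 1"
  obtain s t where s: "x + s *\<^sub>R u \<in> A" "x - s *\<^sub>R u \<in> B" and t: "y + t *\<^sub>R u \<in> A" "y - t *\<^sub>R u \<in> B"
    using xy by (auto simp: mid_def)
  have "l *\<^sub>R (x + s *\<^sub>R u) + m *\<^sub>R (y + t *\<^sub>R u) \<in> A" using A s t lm by (simp add: convex_def)
  moreover have "l *\<^sub>R (x + s *\<^sub>R u) + m *\<^sub>R (y + t *\<^sub>R u) = (l *\<^sub>R x + m *\<^sub>R y) + (l * s + m * t) *\<^sub>R u"
    by (simp add: algebra_simps)
  moreover have "l *\<^sub>R (x - s *\<^sub>R u) + m *\<^sub>R (y - t *\<^sub>R u) \<in> B" using B s t lm by (simp add: convex_def)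
  moreover have "l *\<^sub>R (x - s *\<^sub>R u) + m *\<^sub>R (y - t *\<^sub>R u) = (l *\<^sub>R x + m *\<^sub>R y) - (l * s + m * t) *\<^sub>R u"
    by (simp add: algebra_simps)
  ultimately show "l *\<^sub>R x + m *\<^sub>R y \<in> mid u A B" unfolding mid_def by force
qed

text \<open>A shift of the centre along \<open>u\<close> relaxes the constraints on \<open>y\<close>
  with \<open>0 < y \<bullet> u\<close> and tightens those on the opposite side.\<close>

lemma hvol_mono:
  assumes "convbody K" "z \<in> interior K" "z + t *\<^sub>R u \<in> interior K" "0 \<le> t"
  shows "hvol u K z \<le> hvol u K (z + t *\<^sub>R u)" "hvol (- u) K (z + t *\<^sub>R u) \<le> hvol (- u) K z"
proof -
  interpret convbody K by fact
  have *: "hvol v K z \<le> hvol v K (z + t *\<^sub>R v)" if z: "z \<in> interior K" "z + t *\<^sub>R v \<in> interior K" for z v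
    unfolding hvol_def
  proof (intro measure_mono_fmeasurable hvol_measurable[OF z(2)])
    show "{y \<in> dual z K. 0 < y \<bullet> v} \<subseteq> {y \<in> dual (z + t *\<^sub>R v) K. 0 < y \<bullet> v}"
    proof
      fix y assume y: "y \<in> {y \<in> dual z K. 0 < y \<bullet> v}"
      have "y \<bullet> (x - (z + t *\<^sub>R v)) \<le> 1" if "x \<in> K" for x
      proof -
        have "y \<bullet> (x - (z + t *\<^sub>R v)) = y \<bullet> (x - z) - t * (y \<bullet> v)" by (simp add: inner_simps)
        moreover have "0 \<le> t * (y \<bullet> v)" using y assms(4) by simp
        moreover have "y \<bullet> (x - z) \<le> 1" using y that by (simp add: dual_def)
        ultimately show ?thesis by linarith
      qed
      thus "y \<in> {y \<in> dual (z + t *\<^sub>R v) K. 0 < y \<bullet> v}" using y by (simp add: dual_def)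
    qed
  qed (use hvol_measurable[OF z(1)] in auto)
  show "hvol u K z \<le> hvol u K (z + t *\<^sub>R u)" by (rule *[OF assms(2,3)])
  show "hvol (- u) K (z + t *\<^sub>R u) \<le> hvol (- u) K z" using *[of "z + t *\<^sub>R u" "- u"] assms(2,3) by simp
qed

section \<open>Interior of the midpoint body and the balanced shift\<close>

locale midpair =
  fixes u :: "'a::euclidean_space" and A B :: "'a set"
  assumes A: "convbody A" and B: "convbody B" and u: "u \<noteq> 0"
    and common: "\<exists>q s. q + s *\<^sub>R u \<in> interior A \<and> q - s *\<^sub>R u \<in> interior B"
begin

sublocale a: convbody A by (rule A)
sublocale b: convbody B by (rule B)

lemma mid_interiorI:
  assumes "x + s *\<^sub>R u \<in> interior A" "x - s *\<^sub>R u \<in> interior B"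
  shows "x \<in> interior (mid u A B)"
proof (rule interiorI)
  show "open ((\<lambda>x. x + s *\<^sub>R u) -` interior A \<inter> (\<lambda>x. x - s *\<^sub>R u) -` interior B)"
    by (intro open_Int open_vimage open_interior continuous_intros)
  show "(\<lambda>x. x + s *\<^sub>R u) -` interior A \<inter> (\<lambda>x. x - s *\<^sub>R u) -` interior B \<subseteq> mid u A B"
    using interior_subset by (fastforce simp: mid_def)
qed (use assms in auto)

lemma mid_body: "convbody (mid u A B)"
  using mid_compact[OF a.compact b.compact] mid_convex[OF a.convex b.convex] common mid_interiorI
  by (auto simp: convbody_def convex_body_def)

sublocale m: convbody "mid u A B" by (rule mid_body)

text \<open>The segment from the reference point \<open>q\<close> to \<open>z\<close> can be
  continued a little beyond \<open>z\<close> inside the midpoint body. The new end point splits into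
  points of \<open>A\<close> and \<open>B\<close>; shrinking these towards the interior points over
  \<open>q\<close> gives interior points over \<open>z\<close>.\<close>

lemma mid_interiorD:
  assumes z: "z \<in> interior (mid u A B)"
  shows "\<exists>s. z + s *\<^sub>R u \<in> interior A \<and> z - s *\<^sub>R u \<in> interior B"
proof -
  obtain q t where q: "q + t *\<^sub>R u \<in> interior A" "q - t *\<^sub>R u \<in> interior B" using common by blast
  obtain e where e: "0 < e" "cball z e \<subseteq> mid u A B" using z by (rule m.interior_cball)
  define l where "l = e / (norm (z - q) + 1)"
  have l: "0 < l" using e by (simp add: l_def add_nonneg_pos)
  have "l * norm (z - q) \<le> e"
  proof -
    have "e * norm (z - q) \<le> e * (norm (z - q) + 1)" using e by (intro mult_left_mono) auto
    thus ?thesis by (simp add: l_def pos_divide_le_eq add_nonneg_pos)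
  qed
  hence "z + l *\<^sub>R (z - q) \<in> mid u A B" using e l by (auto simp: subset_iff dist_norm)
  then obtain s where s: "z + l *\<^sub>R (z - q) + s *\<^sub>R u \<in> A" "z + l *\<^sub>R (z - q) - s *\<^sub>R u \<in> B" by (auto simp: mid_def)
  define k where "k = l / (1 + l)"
  have k: "0 < k" "k \<le> 1" "1 - k = 1 / (1 + l)" "(1 - k) * l = k" using l by (auto simp: k_def field_simps)
  have z: "(1 - k) *\<^sub>R (z + l *\<^sub>R (z - q)) + k *\<^sub>R q = z"
  proof -
    have "(1 - k) *\<^sub>R (z + l *\<^sub>R (z - q)) + k *\<^sub>R q = (1 - k) *\<^sub>R z + ((1 - k) * l) *\<^sub>R (z - q) + k *\<^sub>R q"
      by (simp add: scaleR_add_right)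
    also have "\<dots> = z" unfolding k(4) by (simp add: algebra_simps)
    finally show ?thesis .
  qed
  let ?s = "(1 - k) * s + k * t"
  have e1: "(z + l *\<^sub>R (z - q) + s *\<^sub>R u) - k *\<^sub>R ((z + l *\<^sub>R (z - q) + s *\<^sub>R u) - (q + t *\<^sub>R u))
      = ((1 - k) *\<^sub>R (z + l *\<^sub>R (z - q)) + k *\<^sub>R q) + ?s *\<^sub>R u"
    by (simp add: algebra_simps)
  have 1: "z + ?s *\<^sub>R u \<in> interior A"
    using mem_interior_convex_shrink[OF a.convex q(1) s(1) k(1,2)] unfolding e1 z .
  have e2: "(z + l *\<^sub>R (z - q) - s *\<^sub>R u) - k *\<^sub>R ((z + l *\<^sub>R (z - q) - s *\<^sub>R u) - (q - t *\<^sub>R u))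
      = ((1 - k) *\<^sub>R (z + l *\<^sub>R (z - q)) + k *\<^sub>R q) - ?s *\<^sub>R u"
    by (simp add: algebra_simps)
  have 2: "z - ?s *\<^sub>R u \<in> interior B"
    using mem_interior_convex_shrink[OF b.convex q(2) s(2) k(1,2)] unfolding e2 z .
  show ?thesis using 1 2 by blast
qed

definition shifts :: "'a \<Rightarrow> real set" where
  "shifts z = {s. z + s *\<^sub>R u \<in> interior A \<and> z - s *\<^sub>R u \<in> interior B}"

text \<open>If the inequality failed for all shifts, then the volumes of the dual bodies would stay bounded
  when the centre in \<open>A\<close> moves upwards, so it could move on forever.\<close>

lemma balance_ge:
  assumes s0: "s0 \<in> shifts z"
  shows "\<exists>s\<in>shifts z. hvol u B (z - s *\<^sub>R u) * hvol (- u) A (z + s *\<^sub>R u)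
     \<le> hvol u A (z + s *\<^sub>R u) * hvol (- u) B (z - s *\<^sub>R u)"
proof (rule ccontr)
  assume "\<not> ?thesis"
  hence lt: "hvol u A (z + s *\<^sub>R u) * hvol (- u) B (z - s *\<^sub>R u) < hvol u B (z - s *\<^sub>R u) * hvol (- u) A (z + s *\<^sub>R u)"
    if "s \<in> shifts z" for s using that by force
  have S: "z + s *\<^sub>R u \<in> interior A" "z - s *\<^sub>R u \<in> interior B" if "s \<in> shifts z" for s
    using that by (auto simp: shifts_def)
  have nu: "- u \<noteq> 0" using u by simp
  define a0 where "a0 = hvol u A (z + s0 *\<^sub>R u)"
  define a1 where "a1 = hvol u B (z - s0 *\<^sub>R u)"
  define b0 where "b0 = hvol (- u) A (z + s0 *\<^sub>R u)"
  define b1 where "b1 = hvol (- u) B (z - s0 *\<^sub>R u)"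
  have p: "0 < a0" "0 < a1" "0 < b0" "0 < b1"
    using S[OF s0] a.hvol_pos b.hvol_pos u nu by (auto simp: a0_def a1_def b0_def b1_def)
  have bound: "pvol A (z + s *\<^sub>R u) \<le> a1 * b0 / b1 + b0 \<and> pvol B (z - s *\<^sub>R u) \<le> a1 + a1 * b0 / a0"
    if s: "s \<in> shifts z" "s0 \<le> s" for s
  proof -
    have e: "z + s *\<^sub>R u = (z + s0 *\<^sub>R u) + (s - s0) *\<^sub>R u" "z - s0 *\<^sub>R u = (z - s *\<^sub>R u) + (s - s0) *\<^sub>R u"
      by (simp_all add: algebra_simps)
    define a0' where "a0' = hvol u A (z + s *\<^sub>R u)"
    define a1' where "a1' = hvol u B (z - s *\<^sub>R u)"
    define b0' where "b0' = hvol (- u) A (z + s *\<^sub>R u)"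
    define b1' where "b1' = hvol (- u) B (z - s *\<^sub>R u)"
    have p': "0 < a0'" "0 < a1'" "0 < b0'" "0 < b1'"
      using S[OF s(1)] a.hvol_pos b.hvol_pos u nu by (auto simp: a0'_def a1'_def b0'_def b1'_def)
    have 1: "a0 \<le> a0'" "b0' \<le> b0"
      using hvol_mono[OF A S(1)[OF s0], of "s - s0" u] S(1)[OF s(1)] s(2) unfolding e(1)[symmetric]
      by (auto simp: a0_def a0'_def b0_def b0'_def)
    have 2: "a1' \<le> a1" "b1 \<le> b1'"
      using hvol_mono[OF B S(2)[OF s(1)], of "s - s0" u] S(2)[OF s0] s(2) unfolding e(2)[symmetric]
      by (auto simp: a1_def a1'_def b1_def b1'_def)
    \<comment> \<open>The assumed inequality bounds the product \<open>a0' * b1'\<close> from above.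
      By monotonicity neither factor falls below its value at \<open>s0\<close>, so each of them is
      bounded from above.\<close>
    have "a0' * b1' < a1' * b0'" using lt[OF s(1)] by (simp add: a0'_def a1'_def b0'_def b1'_def)
    also have "\<dots> \<le> a1 * b0" using 1 2 p p' by (intro mult_mono) auto
    finally have l: "a0' * b1' \<le> a1 * b0" by simp
    have "a0' * b1 \<le> a0' * b1'" using 2 p' by (intro mult_left_mono) auto
    hence "a0' \<le> a1 * b0 / b1" using l p by (simp add: pos_le_divide_eq)
    moreover have "a0 * b1' \<le> a0' * b1'" using 1 p' by (intro mult_right_mono) auto
    hence "b1' \<le> a1 * b0 / a0" using l p by (simp add: pos_le_divide_eq mult.commute)
    ultimately show ?thesis
      using 1 2 a.pvol_halves[OF S(1)[OF s(1)] u] b.pvol_halves[OF S(2)[OF s(1)] u]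
      by (simp add: a0'_def a1'_def b0'_def b1'_def)
  qed
  obtain d0 where d0: "0 < d0" "\<And>z'. z' \<in> interior A \<Longrightarrow> pvol A z' \<le> a1 * b0 / b1 + b0 \<Longrightarrow> cball z' d0 \<subseteq> A"
    using a.pvol_bounded_imp_cball by metis
  obtain d1 where d1: "0 < d1" "\<And>z'. z' \<in> interior B \<Longrightarrow> pvol B z' \<le> a1 + a1 * b0 / a0 \<Longrightarrow> cball z' d1 \<subseteq> B"
    using b.pvol_bounded_imp_cball by metis
  \<comment> \<open>Bounded polar volumes leave balls of fixed radii around both centres, so the
    same step \<open>d\<close> is possible every time.\<close>
  define d where "d = min d0 d1 / (2 * norm u)"
  have d: "0 < d" "d * norm u < d0" "d * norm u < d1" using d0 d1 u by (auto simp: d_def min_def)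
  have step: "s + d \<in> shifts z" if s: "s \<in> shifts z" "s0 \<le> s" for s
  proof -
    have "ball (z + s *\<^sub>R u) d0 \<subseteq> interior A"
      using d0(2)[OF S(1)[OF s(1)]] bound[OF s] by (intro interior_maximal) (auto intro: subset_trans[OF ball_subset_cball])
    moreover have "z + (s + d) *\<^sub>R u \<in> ball (z + s *\<^sub>R u) d0" using d by (simp add: dist_norm scaleR_add_left)
    moreover have "ball (z - s *\<^sub>R u) d1 \<subseteq> interior B"
      using d1(2)[OF S(2)[OF s(1)]] bound[OF s] by (intro interior_maximal) (auto intro: subset_trans[OF ball_subset_cball])
    moreover have "z - (s + d) *\<^sub>R u \<in> ball (z - s *\<^sub>R u) d1" using d by (simp add: dist_norm scaleR_add_left)
    ultimately show ?thesis by (auto simp: shifts_def)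
  qed
  have all: "s0 + real k * d \<in> shifts z" for k
  proof (induction k)
    case (Suc k)
    have "s0 + real k * d + d \<in> shifts z" by (rule step[OF Suc]) (use d in simp)
    thus ?case by (simp add: algebra_simps)
  qed (use s0 in simp)
  obtain R where R: "\<And>x. x \<in> A \<Longrightarrow> norm x \<le> R" using compact_imp_bounded[OF a.compact] bounded_iff by metis
  obtain k :: nat where k: "(R + norm (z + s0 *\<^sub>R u)) / (d * norm u) < real k" using reals_Archimedean2 by blast
  have "z + (s0 + real k * d) *\<^sub>R u \<in> A" using S(1)[OF all[of k]] interior_subset by blast
  hence "norm ((z + s0 *\<^sub>R u) + (real k * d) *\<^sub>R u) \<le> R" using R by (simp add: scaleR_add_left add.assoc)
  hence "norm ((real k * d) *\<^sub>R u) \<le> R + norm (z + s0 *\<^sub>R u)"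
    using norm_triangle_ineq4[of "(z + s0 *\<^sub>R u) + (real k * d) *\<^sub>R u" "z + s0 *\<^sub>R u"] by simp
  hence "real k * (d * norm u) \<le> R + norm (z + s0 *\<^sub>R u)" using d by (simp add: mult.assoc)
  thus False using k d u by (simp add: pos_divide_less_eq)
qed

end

context midpair
begin

lemma midpair_uminus: "midpair (- u) A B"
proof (unfold_locales)
  show "- u \<noteq> 0" using u by simp
  obtain q s where "q + s *\<^sub>R u \<in> interior A" "q - s *\<^sub>R u \<in> interior B" using common by blast
  thus "\<exists>q s. q + s *\<^sub>R (- u) \<in> interior A \<and> q - s *\<^sub>R (- u) \<in> interior B"
    by (intro exI[of _ q] exI[of _ "- s"]) simp
qed

text \<open>\<open>balance_ge\<close> for \<open>u\<close> and for \<open>- u\<close> gives shifts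
  where the difference \<open>\<phi>\<close> is nonnegative and nonpositive. The admissible shifts
  form an interval, on which \<open>\<phi>\<close> is continuous.\<close>

lemma balance:
  assumes z: "z \<in> interior (mid u A B)"
  obtains s where "z + s *\<^sub>R u \<in> interior A" "z - s *\<^sub>R u \<in> interior B"
    "hvol u A (z + s *\<^sub>R u) * hvol (- u) B (z - s *\<^sub>R u) = hvol u B (z - s *\<^sub>R u) * hvol (- u) A (z + s *\<^sub>R u)"
proof -
  interpret n: midpair "- u" A B by (rule midpair_uminus)
  obtain s0 where s0: "s0 \<in> shifts z" using mid_interiorD[OF z] by (auto simp: shifts_def)
  define \<phi> where "\<phi> s = hvol u A (z + s *\<^sub>R u) * hvol (- u) B (z - s *\<^sub>R u) - hvol u B (z - s *\<^sub>R u) * hvol (- u) A (z + s *\<^sub>R u)" for s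
  obtain s1 where s1: "s1 \<in> shifts z" "0 \<le> \<phi> s1" using balance_ge[OF s0] by (auto simp: \<phi>_def)
  have "- s0 \<in> n.shifts z" using s0 by (simp add: n.shifts_def shifts_def)
  then obtain s2 where "s2 \<in> n.shifts z" "hvol (- u) B (z - s2 *\<^sub>R (- u)) * hvol (- (- u)) A (z + s2 *\<^sub>R (- u))
     \<le> hvol (- u) A (z + s2 *\<^sub>R (- u)) * hvol (- (- u)) B (z - s2 *\<^sub>R (- u))" using n.balance_ge by blast
  hence s2: "- s2 \<in> shifts z" "\<phi> (- s2) \<le> 0" by (auto simp: n.shifts_def shifts_def \<phi>_def mult.commute)
  have cv: "convex (shifts z)"
  proof -
    have "shifts z = (\<lambda>s. z + s *\<^sub>R u) -` interior A \<inter> (\<lambda>s. z - s *\<^sub>R u) -` interior B" by (auto simp: shifts_def)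
    moreover have "convex ((\<lambda>s::real. z + s *\<^sub>R v) -` S)" if S: "convex S" for v S
    proof (rule convexI)
      fix x y l m :: real assume xy: "x \<in> (\<lambda>s. z + s *\<^sub>R v) -` S" "y \<in> (\<lambda>s. z + s *\<^sub>R v) -` S" and lm: "0 \<le> l" "0 \<le> m" "l + m = 1"
      have "l *\<^sub>R (z + x *\<^sub>R v) + m *\<^sub>R (z + y *\<^sub>R v) \<in> S" using S xy lm by (simp add: convex_def)
      moreover have "l *\<^sub>R (z + x *\<^sub>R v) + m *\<^sub>R (z + y *\<^sub>R v) = (l + m) *\<^sub>R z + (l * x + m * y) *\<^sub>R v" by (simp add: algebra_simps)
      ultimately show "l *\<^sub>R x + m *\<^sub>R y \<in> (\<lambda>s. z + s *\<^sub>R v) -` S" using lm by simp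
    qed
    from this[of "interior A" u] this[of "interior B" "- u"] have "convex ((\<lambda>s. z + s *\<^sub>R u) -` interior A)" "convex ((\<lambda>s. z - s *\<^sub>R u) -` interior B)"
      using a.convex b.convex by (auto simp: convex_interior)
    ultimately show ?thesis by (simp add: convex_Int)
  qed
  have cont: "continuous_on (shifts z) \<phi>"
  proof -
    have "continuous_on (shifts z) (\<lambda>s. hvol v A (z + s *\<^sub>R u))" for v
      by (rule continuous_on_compose2[OF a.hvol_continuous]) (auto simp: shifts_def intro!: continuous_intros)
    moreover have "continuous_on (shifts z) (\<lambda>s. hvol v B (z - s *\<^sub>R u))" for v
      by (rule continuous_on_compose2[OF b.hvol_continuous]) (auto simp: shifts_def intro!: continuous_intros)
    ultimately show ?thesis unfolding \<phi>_def[abs_def] by (intro continuous_on_diff continuous_on_mult)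
  qed
  have "connected (\<phi> ` shifts z)" by (rule connected_continuous_image[OF cont convex_connected[OF cv]])
  hence "0 \<in> \<phi> ` shifts z" using connectedD_interval[of "\<phi> ` shifts z" "\<phi> (- s2)" "\<phi> s1" 0] s1 s2 by blast
  then obtain s where s: "s \<in> shifts z" "\<phi> s = 0" by auto
  show ?thesis by (rule that[of s]) (use s in \<open>auto simp: shifts_def \<phi>_def\<close>)
qed

text \<open>A point \<open>w\<close> of the midpoint body tests \<open>x\<close> at a point moved by
  \<open>t\<close> along \<open>u\<close> and \<open>y\<close> at one moved by \<open>t\<close>
  against it. The resulting terms \<open>(t - s) * (x \<bullet> u)\<close> and
  \<open>- (t - s) * (y \<bullet> u)\<close> cancel exactly for the harmonic weights. The factor
  \<open>c\<close> may have either sign, so both halves are covered.\<close>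

lemma dual_harmonic:
  assumes x: "x \<in> dual (z + s *\<^sub>R u) A" and y: "y \<in> dual (z - s *\<^sub>R u) B" and ab: "0 < x \<bullet> v" "0 < y \<bullet> v"
    and v: "v = c *\<^sub>R u" "c \<noteq> 0"
  shows "(y \<bullet> v / (x \<bullet> v + y \<bullet> v)) *\<^sub>R x + (x \<bullet> v / (x \<bullet> v + y \<bullet> v)) *\<^sub>R y \<in> dual z (mid u A B)"
  unfolding dual_def
proof (rule CollectI, rule ballI)
  fix w assume "w \<in> mid u A B"
  then obtain t where t: "w + t *\<^sub>R u \<in> A" "w - t *\<^sub>R u \<in> B" by (auto simp: mid_def)
  define a b where "a = x \<bullet> v" and "b = y \<bullet> v"
  have p: "0 < a" "0 < b" "0 < a + b" using ab by (auto simp: a_def b_def)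
  have xu: "x \<bullet> u = a / c" "y \<bullet> u = b / c" using v by (auto simp: a_def b_def)
  have "x \<bullet> (w + t *\<^sub>R u - (z + s *\<^sub>R u)) \<le> 1" using x t by (simp add: dual_def)
  moreover have "x \<bullet> (w + t *\<^sub>R u - (z + s *\<^sub>R u)) = x \<bullet> (w - z) + (t - s) * (x \<bullet> u)" by (simp add: inner_simps algebra_simps)
  ultimately have 1: "x \<bullet> (w - z) + (t - s) * (a / c) \<le> 1" by (simp add: xu)
  have "y \<bullet> (w - t *\<^sub>R u - (z - s *\<^sub>R u)) \<le> 1" using y t by (simp add: dual_def)
  moreover have "y \<bullet> (w - t *\<^sub>R u - (z - s *\<^sub>R u)) = y \<bullet> (w - z) - (t - s) * (y \<bullet> u)" by (simp add: inner_simps algebra_simps)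
  ultimately have 2: "y \<bullet> (w - z) - (t - s) * (b / c) \<le> 1" by (simp add: xu)
  have "b * (x \<bullet> (w - z)) + a * (y \<bullet> (w - z)) \<le> a + b"
    using mult_left_mono[OF 1, of b] mult_left_mono[OF 2, of a] p by (simp add: algebra_simps)
  hence "(b * (x \<bullet> (w - z)) + a * (y \<bullet> (w - z))) / (a + b) \<le> 1" using p by simp
  thus "((y \<bullet> v / (x \<bullet> v + y \<bullet> v)) *\<^sub>R x + (x \<bullet> v / (x \<bullet> v + y \<bullet> v)) *\<^sub>R y) \<bullet> (w - z) \<le> 1"
    by (simp add: inner_add_left a_def b_def add_divide_distrib)
qed

end

section \<open>The harmonic mean inequality and its equality case\<close>

locale cmidpair = midpair u A B for u :: "real ^ 'n" and A B
begin

lemma duals_harmonic_bodies: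
  assumes z: "z \<in> interior (mid u A B)" "z + s *\<^sub>R u \<in> interior A" "z - s *\<^sub>R u \<in> interior B" and v: "v = c *\<^sub>R u" "c \<noteq> 0"
  shows "harmonic_bodies v (dual (z + s *\<^sub>R u) A) (dual (z - s *\<^sub>R u) B) (dual z (mid u A B))"
  by unfold_locales (use dual_convex a.dual_compact b.dual_compact m.dual_compact z v u dual_harmonic in auto)

text \<open>At the balanced shift the halves have the common ratio \<open>\<kappa>\<close>, and by
  homogeneity the harmonic means of the two pairs of halves sum to the harmonic mean of the totals.
  In the last clause both totals are squeezed to \<open>m\<close>; since the ratio is common, the
  corresponding halves are equal too, and the two half-space inequalities must be
  equalities.\<close>

lemma mid_pvol:
  assumes z: "z \<in> interior (mid u A B)"
  obtains s where "z + s *\<^sub>R u \<in> interior A" "z - s *\<^sub>R u \<in> interior B"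
    "2 * pvol A (z + s *\<^sub>R u) * pvol B (z - s *\<^sub>R u) / (pvol A (z + s *\<^sub>R u) + pvol B (z - s *\<^sub>R u)) \<le> pvol (mid u A B) z"
    "\<And>m. m \<le> pvol A (z + s *\<^sub>R u) \<Longrightarrow> m \<le> pvol B (z - s *\<^sub>R u) \<Longrightarrow> pvol (mid u A B) z \<le> m \<Longrightarrow>
      hvol u A (z + s *\<^sub>R u) = hvol u (mid u A B) z \<and> hvol u B (z - s *\<^sub>R u) = hvol u (mid u A B) z"
proof -
  obtain s where s: "z + s *\<^sub>R u \<in> interior A" "z - s *\<^sub>R u \<in> interior B"
    "hvol u A (z + s *\<^sub>R u) * hvol (- u) B (z - s *\<^sub>R u) = hvol u B (z - s *\<^sub>R u) * hvol (- u) A (z + s *\<^sub>R u)"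
    by (rule balance[OF z])
  define a0 a1 b0 b1 where ab: "a0 = hvol u A (z + s *\<^sub>R u)" "a1 = hvol u B (z - s *\<^sub>R u)"
    "b0 = hvol (- u) A (z + s *\<^sub>R u)" "b1 = hvol (- u) B (z - s *\<^sub>R u)"
  define ah bh where abh: "ah = hvol u (mid u A B) z" "bh = hvol (- u) (mid u A B) z"
  have nu: "- u \<noteq> 0" using u by simp
  have p: "0 < a0" "0 < a1" "0 < b0" "0 < b1"
    using s a.hvol_pos b.hvol_pos u nu by (auto simp: ab)
  interpret hp: harmonic_bodies u "dual (z + s *\<^sub>R u) A" "dual (z - s *\<^sub>R u) B" "dual z (mid u A B)"
    by (rule duals_harmonic_bodies[OF z s(1,2), of _ 1]) auto
  interpret hn: harmonic_bodies "- u" "dual (z + s *\<^sub>R u) A" "dual (z - s *\<^sub>R u) B" "dual z (mid u A B)"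
    by (rule duals_harmonic_bodies[OF z s(1,2), of _ "- 1"]) auto
  have 1: "2 * a0 * a1 / (a0 + a1) \<le> ah"
    using hp.halfspace_inequality[of a0 a1] p by (simp add: ab abh hvol_def)
  have 2: "2 * b0 * b1 / (b0 + b1) \<le> bh"
    using hn.halfspace_inequality[of b0 b1] p by (simp add: ab abh hvol_def)
  have cr: "a0 * b1 = a1 * b0" using s(3) by (simp add: ab)
  define \<kappa> where "\<kappa> = b0 / a0"
  have \<kappa>: "b0 = \<kappa> * a0" "b1 = \<kappa> * a1" "0 < \<kappa>" using cr p by (auto simp: \<kappa>_def field_simps)
  have pv: "pvol A (z + s *\<^sub>R u) = a0 + b0" "pvol B (z - s *\<^sub>R u) = a1 + b1" "pvol (mid u A B) z = ah + bh"
    using a.pvol_halves[OF s(1) u] b.pvol_halves[OF s(2) u] m.pvol_halves[OF z u] by (auto simp: ab abh)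
  have e: "2 * (a0 + b0) * (a1 + b1) / ((a0 + b0) + (a1 + b1)) = 2 * a0 * a1 / (a0 + a1) + 2 * b0 * b1 / (b0 + b1)"
  proof -
    define h where "h = 2 * a0 * a1 / (a0 + a1)"
    have e1: "2 * b0 * b1 / (b0 + b1) = \<kappa> * h"
      using \<kappa> p by (simp add: h_def distrib_left[symmetric])
    have "2 * (a0 + b0) * (a1 + b1) / ((a0 + b0) + (a1 + b1)) = ((1 + \<kappa>) * ((1 + \<kappa>) * (2 * a0 * a1))) / ((1 + \<kappa>) * (a0 + a1))"
      unfolding \<kappa>(1,2) by (simp add: algebra_simps)
    also have "\<dots> = (1 + \<kappa>) * h" using \<kappa>(3) by (simp add: h_def)
    finally show ?thesis unfolding e1 h_def[symmetric] by (simp only: distrib_right mult_1_left)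
  qed
  show ?thesis
  proof (rule that[OF s(1,2)])
    show "2 * pvol A (z + s *\<^sub>R u) * pvol B (z - s *\<^sub>R u) / (pvol A (z + s *\<^sub>R u) + pvol B (z - s *\<^sub>R u)) \<le> pvol (mid u A B) z"
      unfolding pv e using 1 2 by linarith
    fix m assume m: "m \<le> pvol A (z + s *\<^sub>R u)" "m \<le> pvol B (z - s *\<^sub>R u)" "pvol (mid u A B) z \<le> m"
    define X Y where XY: "X = a0 + b0" "Y = a1 + b1"
    have le: "m \<le> X" "m \<le> Y" "0 < X" "0 < Y" "2 * X * Y / (X + Y) \<le> m"
      using m p 1 2 e by (auto simp: pv XY)
    have "2 * X * Y \<le> m * (X + Y)" using le by (simp add: pos_divide_le_eq)
    hence l1: "2 * (X * Y) \<le> m * X + m * Y" by (simp only: distrib_left mult.assoc)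
    have l2: "m * X \<le> X * Y" using le mult_right_mono[of m Y X] by (simp add: mult.commute)
    have l3: "m * Y \<le> X * Y" using le by (intro mult_right_mono) auto
    have "m * X = Y * X" "m * Y = X * Y" using l1 l2 l3 by (simp_all only: mult.commute[of Y X])
    hence XYm: "X = m" "Y = m" using le by auto
    hence "(1 + \<kappa>) * a0 = (1 + \<kappa>) * a1" using XY \<kappa> by (simp add: algebra_simps)
    hence a01: "a0 = a1" using \<kappa>(3) by simp
    hence b01: "b0 = b1" using \<kappa> by simp
    have "a0 \<le> ah" "b0 \<le> bh" using 1 2 a01 b01 p by auto
    moreover have "ah + bh \<le> a0 + b0" using m(3) XYm XY pv by simp
    ultimately have "ah = a0" by linarith
    thus "hvol u A (z + s *\<^sub>R u) = hvol u (mid u A B) z \<and> hvol u B (z - s *\<^sub>R u) = hvol u (mid u A B) z"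
      using a01 by (simp add: ab abh)
  qed
qed

theorem minvol_mid: "2 * minvol A * minvol B / (minvol A + minvol B) \<le> minvol (mid u A B)"
proof -
  obtain z where z: "z \<in> interior (mid u A B)" "pvol (mid u A B) z = minvol (mid u A B)" by (rule m.minvol_attained)
  obtain s where s: "z + s *\<^sub>R u \<in> interior A" "z - s *\<^sub>R u \<in> interior B"
    "2 * pvol A (z + s *\<^sub>R u) * pvol B (z - s *\<^sub>R u) / (pvol A (z + s *\<^sub>R u) + pvol B (z - s *\<^sub>R u)) \<le> pvol (mid u A B) z"
    by (rule mid_pvol[OF z(1)]) blast
  define X Y where XY: "X = pvol A (z + s *\<^sub>R u)" "Y = pvol B (z - s *\<^sub>R u)"
  define P Q where PQ: "P = minvol A" "Q = minvol B"
  have le: "P \<le> X" "Q \<le> Y" "0 < P" "0 < Q"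
    using minvol_le[OF s(1)] minvol_le[OF s(2)] a.minvol_pos b.minvol_pos by (auto simp: PQ XY)
  have "2 * P * Q / (P + Q) = 2 / (1 / P + 1 / Q)" using le by (simp add: field_simps)
  also have "\<dots> \<le> 2 / (1 / X + 1 / Y)" using le by (intro divide_left_mono add_mono mult_pos_pos add_pos_pos) (auto intro: frac_le)
  also have "\<dots> = 2 * X * Y / (X + Y)" using le by (simp add: field_simps)
  finally show ?thesis using s(3) z(2) by (simp add: XY PQ)
qed

text \<open>Equality is used for the halves \<open>0 < y \<bullet> u\<close> only.
  \<open>shear\<close> compares the functionals bounded by 1 on them, and
  \<open>bipolar_half\<close> turns this into points of the bodies. The price is an unknown push
  \<open>s\<close> along \<open>u\<close>, with the same sign in both inclusions.\<close>

theorem mid_equality: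
  assumes m: "minvol A = m" "minvol B = m" "minvol (mid u A B) \<le> m"
  obtains p z0 z1 where "p \<bullet> u = 0"
    "\<And>x. x \<in> A \<Longrightarrow> \<exists>s\<ge>0. z1 + ((x - z0) - (p \<bullet> (x - z0)) *\<^sub>R u) + s *\<^sub>R u \<in> B"
    "\<And>x. x \<in> B \<Longrightarrow> \<exists>s\<ge>0. z0 + ((x - z1) + (p \<bullet> (x - z1)) *\<^sub>R u) + s *\<^sub>R u \<in> A"
    "\<exists>c. z0 - z1 = c *\<^sub>R u"
proof -
  obtain z where z: "z \<in> interior (mid u A B)" "pvol (mid u A B) z = minvol (mid u A B)" by (rule m.minvol_attained)
  obtain s where s: "z + s *\<^sub>R u \<in> interior A" "z - s *\<^sub>R u \<in> interior B"
    "\<And>m. m \<le> pvol A (z + s *\<^sub>R u) \<Longrightarrow> m \<le> pvol B (z - s *\<^sub>R u) \<Longrightarrow> pvol (mid u A B) z \<le> m \<Longrightarrow>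
      hvol u A (z + s *\<^sub>R u) = hvol u (mid u A B) z \<and> hvol u B (z - s *\<^sub>R u) = hvol u (mid u A B) z"
    by (rule mid_pvol[OF z(1)]) blast
  define z0 z1 where zz: "z0 = z + s *\<^sub>R u" "z1 = z - s *\<^sub>R u"
  have iz: "z0 \<in> interior A" "z1 \<in> interior B" "z0 \<in> A" "z1 \<in> B" using s interior_subset unfolding zz by blast+
  have h: "hvol u A z0 = hvol u (mid u A B) z" "hvol u B z1 = hvol u (mid u A B) z"
    using s(3)[of m] minvol_le[OF s(1)] minvol_le[OF s(2)] m z(2) by (auto simp: zz)
  interpret hp: harmonic_bodies u "dual z0 A" "dual z1 B" "dual z (mid u A B)"
    unfolding zz by (rule duals_harmonic_bodies[OF z(1) s(1,2), of _ 1]) auto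
  obtain p where p: "p \<bullet> u = 0"
    "\<And>w. (\<forall>x\<in>dual z0 A. 0 < x \<bullet> u \<longrightarrow> x \<bullet> w + (p \<bullet> w) * (x \<bullet> u) \<le> 1) \<longleftrightarrow> (\<forall>x\<in>dual z1 B. 0 < x \<bullet> u \<longrightarrow> x \<bullet> w \<le> 1)"
  proof (rule hp.shear)
    show "interior (dual z0 A) \<noteq> {}" "interior (dual z1 B) \<noteq> {}"
      using a.dual_interior[OF iz(3)] b.dual_interior[OF iz(4)] by auto
    show "measure lebesgue {x \<in> dual z0 A. 0 < x \<bullet> u} = hvol u (mid u A B) z"
      "measure lebesgue {x \<in> dual z1 B. 0 < x \<bullet> u} = hvol u (mid u A B) z"
      "measure lebesgue {x \<in> dual z (mid u A B). 0 < x \<bullet> u} = hvol u (mid u A B) z"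
      using h by (simp_all add: hvol_def)
    show "0 < hvol u (mid u A B) z" by (rule m.hvol_pos[OF z(1) u])
  qed blast
  show ?thesis
  proof (rule that[OF p(1)])
    fix x assume x: "x \<in> A"
    \<comment> \<open>The inverse shear of \<open>x - z0\<close>: as
      \<open>p \<bullet> u = 0\<close>, adding \<open>p \<bullet> w\<close> times \<open>u\<close>
      gives \<open>x - z0\<close> back.\<close>
    define w where "w = (x - z0) - (p \<bullet> (x - z0)) *\<^sub>R u"
    have pw: "p \<bullet> w = p \<bullet> (x - z0)" using p(1) by (simp add: w_def inner_diff_right)
    have "y \<bullet> w + (p \<bullet> w) * (y \<bullet> u) = y \<bullet> (x - z0)" for y
      unfolding pw by (simp add: w_def inner_diff_right)
    hence "\<forall>y\<in>dual z0 A. 0 < y \<bullet> u \<longrightarrow> y \<bullet> w + (p \<bullet> w) * (y \<bullet> u) \<le> 1" using x by (simp add: dual_def)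
    hence "\<forall>y\<in>dual z1 B. 0 < y \<bullet> u \<longrightarrow> y \<bullet> w \<le> 1" using p(2) by blast
    thus "\<exists>s\<ge>0. z1 + ((x - z0) - (p \<bullet> (x - z0)) *\<^sub>R u) + s *\<^sub>R u \<in> B"
      using bipolar_half[OF b.compact b.convex iz(4) u, of w] by (auto simp: w_def)
  next
    fix x assume x: "x \<in> B"
    define w where "w = x - z1"
    have "\<forall>y\<in>dual z1 B. 0 < y \<bullet> u \<longrightarrow> y \<bullet> w \<le> 1" using x by (simp add: dual_def w_def)
    hence "\<forall>y\<in>dual z0 A. 0 < y \<bullet> u \<longrightarrow> y \<bullet> w + (p \<bullet> w) * (y \<bullet> u) \<le> 1" using p(2) by blast
    hence "\<forall>y\<in>dual z0 A. 0 < y \<bullet> u \<longrightarrow> y \<bullet> (w + (p \<bullet> w) *\<^sub>R u) \<le> 1" by (simp add: inner_add_right)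
    thus "\<exists>s\<ge>0. z0 + ((x - z1) + (p \<bullet> (x - z1)) *\<^sub>R u) + s *\<^sub>R u \<in> A"
      using bipolar_half[OF a.compact a.convex iz(3) u, of "w + (p \<bullet> w) *\<^sub>R u"] by (auto simp: w_def)
  next
    show "\<exists>c. z0 - z1 = c *\<^sub>R u" by (intro exI[of _ "2 * s"]) (simp add: zz scaleR_2 scaleR_add_left[symmetric])
  qed
qed

end

section \<open>Steiner symmetrisation\<close>

lemma vec_upd:
  assumes "e \<in> Basis" shows "vec (w(e := t + s)) = vec (w(e := t)) + s *\<^sub>R e"
proof -
  have "vec (w(e := s)) = s *\<^sub>R e + (\<Sum>b\<in>Basis - {e}. w b *\<^sub>R b)" for s
  proof -
    have "vec (w(e := s)) = s *\<^sub>R e + (\<Sum>b\<in>Basis - {e}. (w(e := s)) b *\<^sub>R b)"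
      unfolding vec_def sum.remove[OF finite_Basis assms] by simp
    also have "(\<Sum>b\<in>Basis - {e}. (w(e := s)) b *\<^sub>R b) = (\<Sum>b\<in>Basis - {e}. w b *\<^sub>R b)"
      by (rule sum.cong) auto
    finally show ?thesis .
  qed
  thus ?thesis by (simp add: scaleR_add_left)
qed

text \<open>In contrast to \<open>integral_over_slices\<close>, the coordinate \<open>e\<close> is
  integrated first, so the inner integral is the length of a chord parallel to
  \<open>e\<close>.\<close>

lemma emeasure_by_chords:
  fixes D :: "'a::euclidean_space set"
  assumes D: "D \<in> sets borel" and e: "e \<in> Basis"
  defines "M \<equiv> (\<Pi>\<^sub>M b\<in>Basis - {e}. lborel :: real measure)"
  shows "emeasure lborel D = (\<integral>\<^sup>+w. emeasure lborel {t. vec (w(e := t)) \<in> D} \<partial>M)"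
    and "(\<lambda>w. emeasure lborel {t. vec (w(e := t)) \<in> D}) \<in> borel_measurable M"
    and "\<And>w. {t. vec (w(e := t)) \<in> D} \<in> sets borel"
proof -
  interpret product_sigma_finite "\<lambda>_::'a. lborel :: real measure" ..
  have mv: "vec \<in> measurable (Pi\<^sub>M Basis (\<lambda>_. lborel)) (borel :: 'a measure)"
    unfolding vec_def[abs_def] by measurable
  have ve: "(\<lambda>t. vec (w(e := t))) = (\<lambda>t. vec (w(e := 0)) + t *\<^sub>R e)" for w
  proof
    show "vec (w(e := t)) = vec (w(e := 0)) + t *\<^sub>R e" for t using vec_upd[OF e, of w 0 t] by simp
  qed
  have "(\<lambda>t. vec (w(e := t))) \<in> borel_measurable borel" for w unfolding ve by measurable
  from measurable_sets[OF this D] show ch: "{t. vec (w(e := t)) \<in> D} \<in> sets borel" for w by (simp add: vimage_def)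
  have F: "(\<lambda>w. indicator D (vec w) :: ennreal) \<in> borel_measurable (Pi\<^sub>M Basis (\<lambda>_. lborel))"
    using mv D by simp
  have B: "insert e (Basis - {e}) = Basis" using e by auto
  have em: "emeasure lborel {t. vec (w(e := t)) \<in> D} = (\<integral>\<^sup>+t. indicator D (vec (w(e := t))) \<partial>lborel)" for w
  proof -
    have "(\<integral>\<^sup>+t. indicator D (vec (w(e := t))) \<partial>lborel) = (\<integral>\<^sup>+t. indicator {t. vec (w(e := t)) \<in> D} t \<partial>lborel)"
      by (intro nn_integral_cong) (simp add: indicator_def)
    thus ?thesis using ch[of w] by simp
  qed
  have "emeasure lborel D = (\<integral>\<^sup>+x. indicator D x \<partial>(lborel :: 'a measure))" using D by simp
  also have "\<dots> = (\<integral>\<^sup>+w. indicator D (vec w) \<partial>Pi\<^sub>M Basis (\<lambda>_. lborel))"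
    unfolding lborel_eq[where 'a='a] vec_def[symmetric, abs_def]
    using mv D by (subst nn_integral_distr) (auto simp: vec_def[abs_def])
  also have "\<dots> = (\<integral>\<^sup>+w. \<integral>\<^sup>+t. indicator D (vec (w(e := t))) \<partial>lborel \<partial>M)"
    unfolding M_def using product_nn_integral_insert[of "Basis - {e}" e "\<lambda>w. indicator D (vec w)"] F B by simp
  finally show "emeasure lborel D = (\<integral>\<^sup>+w. emeasure lborel {t. vec (w(e := t)) \<in> D} \<partial>M)" unfolding em .
  have "(\<lambda>w. indicator D (vec w) :: ennreal) \<in> borel_measurable (Pi\<^sub>M (insert e (Basis - {e})) (\<lambda>_. lborel))" using F B by simp
  from measurable_compose[OF measurable_add_dim this]
  have "(\<lambda>(w, t). indicator D (vec (w(e := t))) :: ennreal) \<in> borel_measurable (M \<Otimes>\<^sub>M lborel)"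
    by (simp add: case_prod_beta' M_def)
  thus "(\<lambda>w. emeasure lborel {t. vec (w(e := t)) \<in> D}) \<in> borel_measurable M"
    unfolding em by (intro sigma_finite_measure.borel_measurable_nn_integral sigma_finite_lborel)
qed

definition same_shadow :: "'a::real_vector \<Rightarrow> 'a set \<Rightarrow> 'a set \<Rightarrow> bool" where
  "same_shadow u A B \<longleftrightarrow> (\<forall>x\<in>A. \<exists>s. x + s *\<^sub>R u \<in> B) \<and> (\<forall>x\<in>B. \<exists>s. x + s *\<^sub>R u \<in> A)"

lemma chord_interval:
  fixes D :: "'a::euclidean_space set"
  assumes D: "convex D" "compact D" and e: "e \<in> Basis"
  shows "\<exists>a b. {t. vec (w(e := t)) \<in> D} = {a..b}"
proof -
  define C where "C = {t. vec (w(e := t)) \<in> D}"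
  define p where "p = vec (w(e := 0))"
  have "vec (w(e := t)) = p + t *\<^sub>R e" for t using vec_upd[OF e, of w 0 t] by (simp add: p_def)
  hence C: "C = (\<lambda>t. p + t *\<^sub>R e) -` D" by (simp only: C_def vimage_def)
  have "convex C"
  proof (rule convexI)
    fix x y l m :: real assume xy: "x \<in> C" "y \<in> C" and lm: "0 \<le> l" "0 \<le> m" "l + m = 1"
    have "l *\<^sub>R (p + x *\<^sub>R e) + m *\<^sub>R (p + y *\<^sub>R e) \<in> D"
      by (rule convexD[OF D(1)]) (use xy lm in \<open>simp_all add: C\<close>)
    also have "l *\<^sub>R (p + x *\<^sub>R e) + m *\<^sub>R (p + y *\<^sub>R e) = (l + m) *\<^sub>R p + (l * x + m * y) *\<^sub>R e"
      by (simp add: algebra_simps)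
    finally show "l *\<^sub>R x + m *\<^sub>R y \<in> C" using lm by (simp add: C)
  qed
  moreover have "compact C"
  proof -
    have "closed C" unfolding C using D(2) by (intro closed_vimage compact_imp_closed continuous_intros)
    moreover have "bounded C"
    proof -
      obtain R where R: "\<forall>x\<in>D. norm x \<le> R" using compact_imp_bounded[OF D(2)] unfolding bounded_iff by blast
      have "norm t \<le> R" if t: "t \<in> C" for t
      proof -
        have "vec (w(e := t)) \<bullet> e = t" using vec_inner[OF e, of "w(e := t)"] by simp
        hence "norm t \<le> norm (vec (w(e := t)))" using Basis_le_norm[OF e, of "vec (w(e := t))"] by simp
        also have "\<dots> \<le> R" using t R by (simp add: C_def)
        finally show ?thesis .
      qed
      thus ?thesis by (auto simp: bounded_iff)
    qed
    ultimately show ?thesis by (simp add: compact_eq_bounded_closed)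
  qed
  ultimately show ?thesis unfolding C_def[symmetric] using connected_compact_interval_1[of C] convex_connected[of C] by blast
qed

text \<open>The chord of the midpoint body contains the midpoints of corresponding end points, so
  its length is at least the average of the two lengths. Equal shadows matter because the midpoint
  body has no chord on a line that meets only one of the bodies.\<close>

lemma emeasure_mid_axis:
  fixes A B :: "'a::euclidean_space set"
  assumes A: "convex A" "compact A" and B: "convex B" "compact B" and e: "e \<in> Basis" and sh: "same_shadow e A B"
  shows "emeasure lborel A + emeasure lborel B \<le> 2 * emeasure lborel (mid e A B)"
proof -
  have bor: "A \<in> sets borel" "B \<in> sets borel" "mid e A B \<in> sets borel"
    using A(2) B(2) mid_compact[OF A(2) B(2), of e] by (simp_all add: borel_closed compact_imp_closed)
  define c where "c D w = {t. vec (w(e := t)) \<in> D}" for D :: "'a set" and w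
  note ve = vec_upd[OF e]
  have int: "\<exists>a b. c D w = {a..b}" if "convex D" "compact D" for D w
    unfolding c_def by (rule chord_interval[OF that e])
  have ptw: "emeasure lborel (c A w) + emeasure lborel (c B w) \<le> 2 * emeasure lborel (c (mid e A B) w)" for w
  proof (cases "c A w = {} \<or> c B w = {}")
    case True
    have "c A w = {} \<longleftrightarrow> c B w = {}"
    proof -
      have "\<exists>s. t + s \<in> c B w" if t: "t \<in> c A w" for t
      proof -
        have "vec (w(e := t)) \<in> A" using t by (simp add: c_def)
        then obtain s where "vec (w(e := t)) + s *\<^sub>R e \<in> B" using sh unfolding same_shadow_def by blast
        hence "t + s \<in> c B w" by (simp add: c_def ve)
        thus ?thesis ..
      qed
      moreover have "\<exists>s. t + s \<in> c A w" if t: "t \<in> c B w" for t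
      proof -
        have "vec (w(e := t)) \<in> B" using t by (simp add: c_def)
        then obtain s where "vec (w(e := t)) + s *\<^sub>R e \<in> A" using sh unfolding same_shadow_def by blast
        hence "t + s \<in> c A w" by (simp add: c_def ve)
        thus ?thesis ..
      qed
      ultimately show ?thesis by blast
    qed
    thus ?thesis using True by auto
  next
    case False
    obtain a b where ab: "c A w = {a..b}" using int[OF A] by blast
    obtain a' b' where ab': "c B w = {a'..b'}" using int[OF B] by blast
    have le: "a \<le> b" "a' \<le> b'" using False ab ab' by auto
    have mm: "(s + t) / 2 \<in> c (mid e A B) w" if "s \<in> c A w" "t \<in> c B w" for s t
    proof -
      have "vec (w(e := (s + t) / 2)) + ((s - t) / 2) *\<^sub>R e = vec (w(e := (s + t) / 2 + (s - t) / 2))" by (rule ve[symmetric])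
      also have "(s + t) / 2 + (s - t) / 2 = s" by (simp add: field_simps)
      finally have *: "vec (w(e := (s + t) / 2)) + ((s - t) / 2) *\<^sub>R e = vec (w(e := s))" .
      have 1: "vec (w(e := (s + t) / 2)) + ((s - t) / 2) *\<^sub>R e \<in> A" unfolding * using that by (simp add: c_def)
      have "vec (w(e := (s + t) / 2)) - ((s - t) / 2) *\<^sub>R e = vec (w(e := (s + t) / 2 + - ((s - t) / 2)))"
        unfolding ve[of w "(s+t)/2" "- ((s - t) / 2)"] by (simp only: scaleR_minus_left diff_conv_add_uminus)
      also have "(s + t) / 2 + - ((s - t) / 2) = t" by (simp add: field_simps)
      finally have *: "vec (w(e := (s + t) / 2)) - ((s - t) / 2) *\<^sub>R e = vec (w(e := t))" .
      have 2: "vec (w(e := (s + t) / 2)) - ((s - t) / 2) *\<^sub>R e \<in> B" unfolding * using that by (simp add: c_def)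
      show ?thesis using 1 2 unfolding c_def mid_def by blast
    qed
    have mem: "(a + a') / 2 \<in> c (mid e A B) w" "(b + b') / 2 \<in> c (mid e A B) w"
      using mm[of a a'] mm[of b b'] ab ab' le by auto
    obtain p q where pq: "c (mid e A B) w = {p..q}" using int[OF mid_convex[OF A(1) B(1)] mid_compact[OF A(2) B(2)]] by blast
    have l: "b - a + (b' - a') \<le> 2 * (q - p)" "p \<le> q" using mem unfolding pq by auto
    have "emeasure lborel (c A w) + emeasure lborel (c B w) = ennreal (b - a + (b' - a'))"
      using le unfolding ab ab' by (simp add: ennreal_plus[symmetric] del: ennreal_plus)
    also have "\<dots> \<le> ennreal (2 * (q - p))" using l by (intro ennreal_leI)
    also have "\<dots> = 2 * ennreal (q - p)" using ennreal_mult[of 2 "q - p"] l by simp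
    also have "\<dots> = 2 * emeasure lborel (c (mid e A B) w)" unfolding pq using l by simp
    finally show ?thesis .
  qed
  define M where "M = (\<Pi>\<^sub>M b\<in>Basis - {e}. lborel :: real measure)"
  have ch: "emeasure lborel D = (\<integral>\<^sup>+w. emeasure lborel (c D w) \<partial>M)" "(\<lambda>w. emeasure lborel (c D w)) \<in> borel_measurable M"
    if D: "D \<in> sets borel" for D
    using emeasure_by_chords(1,2)[OF D e] unfolding M_def c_def by this
  have "emeasure lborel A + emeasure lborel B = (\<integral>\<^sup>+w. emeasure lborel (c A w) + emeasure lborel (c B w) \<partial>M)"
    unfolding ch(1)[OF bor(1)] ch(1)[OF bor(2)] by (rule nn_integral_add[OF ch(2)[OF bor(1)] ch(2)[OF bor(2)], symmetric])
  also have "\<dots> \<le> (\<integral>\<^sup>+w. 2 * emeasure lborel (c (mid e A B) w) \<partial>M)" by (intro nn_integral_mono ptw)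
  also have "\<dots> = 2 * emeasure lborel (mid e A B)"
    unfolding ch(1)[OF bor(3)] by (rule nn_integral_cmult[OF ch(2)[OF bor(3)]])
  finally show ?thesis .
qed

lemma mid_linear_image:
  assumes f: "linear f" "inj f" "surj f" shows "mid (f u) (f ` A) (f ` B) = f ` mid u A B"
proof (intro set_eqI iffI)
  fix y assume "y \<in> mid (f u) (f ` A) (f ` B)"
  then obtain s where s: "y + s *\<^sub>R f u \<in> f ` A" "y - s *\<^sub>R f u \<in> f ` B" by (auto simp: mid_def)
  obtain x where x: "y = f x" using f(3) by (meson surjD)
  have "f (x + s *\<^sub>R u) \<in> f ` A" "f (x - s *\<^sub>R u) \<in> f ` B"
    using s by (simp_all add: x linear_add[OF f(1)] linear_diff[OF f(1)] linear_scale[OF f(1)])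
  hence "x + s *\<^sub>R u \<in> A" "x - s *\<^sub>R u \<in> B" using f(2) by (auto simp: inj_image_mem_iff)
  thus "y \<in> f ` mid u A B" unfolding x mid_def by blast
next
  fix y assume "y \<in> f ` mid u A B"
  then obtain x s where x: "y = f x" "x + s *\<^sub>R u \<in> A" "x - s *\<^sub>R u \<in> B" by (auto simp: mid_def)
  have "f x + s *\<^sub>R f u = f (x + s *\<^sub>R u)" "f x - s *\<^sub>R f u = f (x - s *\<^sub>R u)"
    by (simp_all add: linear_add[OF f(1)] linear_diff[OF f(1)] linear_scale[OF f(1)])
  thus "y \<in> mid (f u) (f ` A) (f ` B)" unfolding mid_def x(1) using x(2,3) by (auto intro!: exI[of _ s])
qed

lemma measure_mid_ge:
  fixes A B :: "(real ^ 'n) set"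
  assumes A: "convex A" "compact A" and B: "convex B" "compact B" and u: "u \<noteq> 0" and sh: "same_shadow u A B"
  shows "measure lebesgue A + measure lebesgue B \<le> 2 * measure lebesgue (mid u A B)"
proof -
  obtain e :: "real ^ 'n" where e: "e \<in> Basis" using nonempty_Basis by blast
  have "\<exists>g :: real ^ 'n \<Rightarrow> real ^ 'n. linear g \<and> bij g \<and> (\<forall>b\<in>{e}. g b = (\<lambda>_. u) b)"
    by (rule linear_bij_extension) (use e u in auto)
  then obtain g :: "real ^ 'n \<Rightarrow> real ^ 'n" where g: "linear g" "bij g" "g e = u" by auto
  define f where "f = inv g"
  have f: "linear f" "bij f" "f u = e"
    using inj_linear_imp_inv_linear[OF g(1) bij_is_inj[OF g(2)]] bij_imp_bij_inv[OF g(2)]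
      inv_f_eq[OF bij_is_inj[OF g(2)] g(3)] by (simp_all add: f_def)
  obtain c where c: "scales f c" using linear_scales[OF f(1) bij_is_surj[OF f(2)]] by blast
  hence c0: "0 < c" by (simp add: scales_def)
  have cont: "continuous_on S f" for S using f(1) by (simp add: linear_continuous_on linear_conv_bounded_linear)
  have fA: "convex (f ` A)" "compact (f ` A)" "convex (f ` B)" "compact (f ` B)"
    using A B convex_linear_image[OF f(1)] compact_continuous_image[OF cont] by blast+
  have "same_shadow e (f ` A) (f ` B)"
    unfolding same_shadow_def
  proof (intro conjI ballI)
    fix y assume "y \<in> f ` A"
    then obtain x s where x: "y = f x" "x + s *\<^sub>R u \<in> B" using sh unfolding same_shadow_def by blast
    have "y + s *\<^sub>R e = f (x + s *\<^sub>R u)" "x + s *\<^sub>R u \<in> B" using x f(3) by (simp_all add: linear_add[OF f(1)] linear_scale[OF f(1)])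
    hence "y + s *\<^sub>R e \<in> f ` B" by (rule image_eqI)
    thus "\<exists>s. y + s *\<^sub>R e \<in> f ` B" by blast
  next
    fix y assume "y \<in> f ` B"
    then obtain x s where x: "y = f x" "x + s *\<^sub>R u \<in> A" using sh unfolding same_shadow_def by blast
    have "y + s *\<^sub>R e = f (x + s *\<^sub>R u)" "x + s *\<^sub>R u \<in> A" using x f(3) by (simp_all add: linear_add[OF f(1)] linear_scale[OF f(1)])
    hence "y + s *\<^sub>R e \<in> f ` A" by (rule image_eqI)
    thus "\<exists>s. y + s *\<^sub>R e \<in> f ` A" by blast
  qed
  from emeasure_mid_axis[OF fA e this]
  have "emeasure lborel (f ` A) + emeasure lborel (f ` B) \<le> 2 * emeasure lborel (f ` mid u A B)"
    unfolding mid_linear_image[OF f(1) bij_is_inj[OF f(2)] bij_is_surj[OF f(2)], of u A B, unfolded f(3)] by this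
  moreover have em: "emeasure lborel (f ` D) = ennreal (c * measure lebesgue D)" if "compact D" for D
  proof -
    have b: "D \<in> sets borel" using that by (simp add: borel_closed compact_imp_closed)
    have "emeasure lborel D < \<infinity>" using compact_imp_bounded[OF that] by (rule emeasure_bounded_finite)
    hence "emeasure lborel D = ennreal (measure lebesgue D)" using b by (simp add: emeasure_eq_ennreal_measure)
    thus ?thesis using scales_image(2)[OF c f(2) b] c0 by (simp add: ennreal_mult)
  qed
  ultimately have "ennreal (c * measure lebesgue A) + ennreal (c * measure lebesgue B) \<le> 2 * ennreal (c * measure lebesgue (mid u A B))"
    unfolding em[OF A(2)] em[OF B(2)] em[OF mid_compact[OF A(2) B(2)]] by blast
  hence "ennreal (c * measure lebesgue A + c * measure lebesgue B) \<le> ennreal (2 * (c * measure lebesgue (mid u A B)))"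
    unfolding ennreal_mult'[of 2 "c * measure lebesgue (mid u A B)", simplified]
    using c0 by (subst ennreal_plus) auto
  hence "c * measure lebesgue A + c * measure lebesgue B \<le> 2 * (c * measure lebesgue (mid u A B))"
    by (rule ennreal_le_iff[THEN iffD1, rotated]) (use c0 in auto)
  hence "c * (measure lebesgue A + measure lebesgue B) \<le> c * (2 * measure lebesgue (mid u A B))"
    by (simp only: distrib_left mult.left_commute)
  thus ?thesis using c0 by (simp only: mult_le_cancel_left_pos)
qed

section \<open>Orthogonal reflections\<close>

definition refl :: "'a::euclidean_space \<Rightarrow> 'a \<Rightarrow> 'a" where
  "refl u x = x - (2 * (x \<bullet> u) / (u \<bullet> u)) *\<^sub>R u"

lemma refl_linear: "linear (refl u)"
  by (rule linearI) (simp_all add: refl_def inner_add_left algebra_simps add_divide_distrib)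

lemma refl_refl: "u \<noteq> 0 \<Longrightarrow> refl u (refl u x) = x"
  by (simp add: refl_def inner_diff_left algebra_simps scaleR_add_left[symmetric])

lemma refl_self: "u \<noteq> 0 \<Longrightarrow> refl u u = - u"
  by (simp add: refl_def scaleR_2)

lemma refl_inner: "refl u x \<bullet> y = x \<bullet> refl u y"
  by (simp add: refl_def inner_diff_left inner_diff_right inner_commute)

lemma refl_bij: "u \<noteq> 0 \<Longrightarrow> bij (refl u)"
  by (rule bij_betw_byWitness[where f'="refl u"]) (auto simp: refl_refl)

lemma refl_continuous: "continuous_on S (refl u)"
  using refl_linear[of u] by (simp add: linear_continuous_on linear_conv_bounded_linear)

text \<open>Applied twice the map is the identity and the factor \<open>c * c\<close>, and the unit
  ball has finite positive volume. This covers oblique as well as orthogonal reflections without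
  computing a determinant.\<close>

lemma scales_involution:
  fixes f :: "'a::euclidean_space \<Rightarrow> 'a"
  assumes f: "scales f c" and inv: "\<And>x. f (f x) = x" shows "c = 1"
proof -
  have c: "0 < c" using f by (simp add: scales_def)
  have "f \<circ> f = id" using inv by auto
  hence s: "scales (id :: 'a \<Rightarrow> 'a) (c * c)" using scales_comp[OF f f] by simp
  let ?F = "indicator (ball 0 1) :: 'a \<Rightarrow> ennreal"
  have "(\<integral>\<^sup>+x. ?F x \<partial>lborel) = ennreal (c * c) * (\<integral>\<^sup>+x. ?F (id x) \<partial>lborel)"
  proof -
    have "?F \<in> borel_measurable borel" by (simp add: borel_measurable_indicator)
    thus ?thesis using s unfolding scales_def by blast
  qed
  hence e: "emeasure lborel (ball (0 :: 'a) 1) = ennreal (c * c) * emeasure lborel (ball (0 :: 'a) 1)" by simp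
  have fin: "emeasure lborel (ball (0 :: 'a) 1) = ennreal (measure lborel (ball (0 :: 'a) 1))"
    using emeasure_lborel_ball_finite[of "0 :: 'a" 1] by (simp add: emeasure_eq_ennreal_measure)
  have p: "0 < measure lborel (ball (0 :: 'a) 1)" using content_ball_pos[of 1 "0 :: 'a"] by simp
  have "ennreal (measure lborel (ball (0 :: 'a) 1)) = ennreal (c * c * measure lborel (ball (0 :: 'a) 1))"
    using e unfolding fin using c p by (subst ennreal_mult) auto
  hence "c * c * measure lborel (ball (0 :: 'a) 1) = 1 * measure lborel (ball (0 :: 'a) 1)"
    using p c by (subst (asm) ennreal_inj) auto
  hence "c * c = 1" using p by (simp only: mult_cancel_right) auto
  thus ?thesis using c by (simp add: square_eq_1_iff)
qed

lemma refl_scales: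
  fixes u :: "real ^ 'n" assumes "u \<noteq> 0" shows "scales (refl u) 1"
proof -
  obtain c where c: "scales (refl u) c" using linear_scales[OF refl_linear bij_is_surj[OF refl_bij[OF assms]]] by blast
  have "c = 1" by (rule scales_involution[OF c refl_refl[OF assms]])
  thus ?thesis using c by simp
qed

lemma refl_measure:
  fixes u :: "real ^ 'n" assumes "u \<noteq> 0" "S \<in> sets borel"
  shows "measure lebesgue (refl u ` S) = measure lebesgue S"
proof -
  have "measure lebesgue (refl u ` S) = 1 * measure lebesgue S"
    by (rule scales_image(3)[OF refl_scales refl_bij]) fact+
  thus ?thesis by simp
qed

lemma refl_image_eq:
  assumes "u \<noteq> 0" shows "refl u ` S = refl u -` S"
proof (intro set_eqI iffI)
  fix y assume "y \<in> refl u -` S"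
  hence "refl u (refl u y) \<in> refl u ` S" by simp
  thus "y \<in> refl u ` S" by (simp only: refl_refl[OF assms])
qed (auto simp: refl_refl[OF assms])

lemma refl_interior:
  assumes "u \<noteq> 0" shows "interior (refl u ` S) = refl u ` interior S"
proof -
  have b: "bij (refl u)" by (rule refl_bij[OF assms])
  show ?thesis by (rule interior_bijective_linear_image[OF refl_linear b])
qed

lemma refl_convbody:
  assumes "convbody K" "u \<noteq> 0" shows "convbody (refl u ` K)"
proof -
  interpret convbody K by fact
  show ?thesis unfolding convbody_def convex_body_def
    using compact_continuous_image[OF refl_continuous[of _ u] compact] convex_linear_image[OF refl_linear[of u] convex] interior_nonempty
    unfolding refl_interior[OF assms(2)] by simp
qed

lemma refl_dual:
  assumes u: "u \<noteq> 0" shows "dual (refl u z) (refl u ` K) = refl u ` dual z K"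
proof (rule set_eqI)
  fix y
  have "y \<in> refl u ` dual z K \<longleftrightarrow> refl u y \<in> dual z K" unfolding refl_image_eq[OF u] by simp
  also have "\<dots> \<longleftrightarrow> (\<forall>x\<in>K. y \<bullet> (refl u x - refl u z) \<le> 1)"
    by (simp only: dual_def mem_Collect_eq refl_inner linear_diff[OF refl_linear])
  also have "\<dots> \<longleftrightarrow> y \<in> dual (refl u z) (refl u ` K)" by (simp add: dual_def)
  finally show "y \<in> dual (refl u z) (refl u ` K) \<longleftrightarrow> y \<in> refl u ` dual z K" by simp
qed

lemma refl_minvol:
  fixes K :: "(real ^ 'n) set"
  assumes "u \<noteq> 0" shows "minvol (refl u ` K) = minvol K"
proof -
  have "pvol (refl u ` K) (refl u z) = pvol K z" for z
    unfolding pvol_def refl_dual[OF assms] by (rule refl_measure[OF assms]) (simp add: borel_closed dual_closed)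
  thus ?thesis unfolding minvol_def refl_interior[OF assms] by (simp add: image_image)
qed

lemma same_shadow_refl: "same_shadow u K (refl u ` K)"
  unfolding same_shadow_def
proof (intro conjI ballI)
  fix x assume x: "x \<in> K"
  have "x + (- (2 * (x \<bullet> u) / (u \<bullet> u))) *\<^sub>R u \<in> refl u ` K" by (rule image_eqI[OF _ x]) (simp add: refl_def)
  thus "\<exists>s. x + s *\<^sub>R u \<in> refl u ` K" by blast
next
  fix x assume "x \<in> refl u ` K"
  then obtain y where y: "x = y - (2 * (y \<bullet> u) / (u \<bullet> u)) *\<^sub>R u" "y \<in> K" unfolding refl_def by (rule imageE)
  have "x + (2 * (y \<bullet> u) / (u \<bullet> u)) *\<^sub>R u = y" unfolding y(1) by simp
  hence "x + (2 * (y \<bullet> u) / (u \<bullet> u)) *\<^sub>R u \<in> K" using y(2) by simp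
  thus "\<exists>s. x + s *\<^sub>R u \<in> K" by blast
qed

lemma same_shadow_mid:
  assumes "same_shadow u A B" shows "same_shadow u A (mid u A B)"
  unfolding same_shadow_def
proof (intro conjI ballI)
  fix x assume x: "x \<in> A"
  then obtain s where s: "x + s *\<^sub>R u \<in> B" using assms by (auto simp: same_shadow_def)
  have "(x + (s/2) *\<^sub>R u) + (- (s/2)) *\<^sub>R u \<in> A" "(x + (s/2) *\<^sub>R u) - (- (s/2)) *\<^sub>R u \<in> B"
    using x s by (simp_all add: add.assoc scaleR_add_left[symmetric])
  hence "x + (s/2) *\<^sub>R u \<in> mid u A B" unfolding mid_def by blast
  thus "\<exists>s. x + s *\<^sub>R u \<in> mid u A B" by blast
qed (auto simp: mid_def)

text \<open>Take interior points \<open>a\<close> of \<open>A\<close> and \<open>b\<close> of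
  \<open>B\<close>. Averaging \<open>a\<close> with a point of \<open>A\<close> on the line through
  \<open>b\<close>, and \<open>b\<close> with a point of \<open>B\<close> on the line through
  \<open>a\<close>, gives interior points of the two bodies on one common line parallel to
  \<open>u\<close>.\<close>

lemma midpair_same_shadow:
  assumes A: "convbody A" and B: "convbody B" and u: "u \<noteq> 0" and sh: "same_shadow u A B"
  shows "midpair u A B"
proof -
  interpret a: convbody A by fact
  interpret b: convbody B by fact
  obtain a b where ab: "a \<in> interior A" "b \<in> interior B" using a.interior_nonempty b.interior_nonempty by blast
  obtain s t where s: "a + s *\<^sub>R u \<in> B" and t: "b + t *\<^sub>R u \<in> A"
    using ab interior_subset sh unfolding same_shadow_def by blast
  have 1: "(b + t *\<^sub>R u) - (1/2) *\<^sub>R ((b + t *\<^sub>R u) - a) \<in> interior A"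
    by (rule mem_interior_convex_shrink[OF a.convex ab(1) t]) auto
  have 2: "(a + s *\<^sub>R u) - (1/2) *\<^sub>R ((a + s *\<^sub>R u) - b) \<in> interior B"
    by (rule mem_interior_convex_shrink[OF b.convex ab(2) s]) auto
  define q where "q = (1/2) *\<^sub>R (a + b) + ((s + t)/4) *\<^sub>R u"
  have half: "x = (1/2) *\<^sub>R x + (1/2) *\<^sub>R x" for x :: 'a by (simp add: scaleR_add_left[symmetric])
  have "(b + t *\<^sub>R u) - (1/2) *\<^sub>R ((b + t *\<^sub>R u) - a) = (1/2) *\<^sub>R (a + b) + (t/2) *\<^sub>R u"
    by (subst half[of "b + t *\<^sub>R u"]) (simp add: algebra_simps)
  also have "\<dots> = q + ((t - s)/4) *\<^sub>R u" unfolding q_def add.assoc scaleR_add_left[symmetric] by (simp add: field_simps)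
  finally have 3: "q + ((t - s)/4) *\<^sub>R u \<in> interior A" using 1 by simp
  have "(a + s *\<^sub>R u) - (1/2) *\<^sub>R ((a + s *\<^sub>R u) - b) = (1/2) *\<^sub>R (a + b) + (s/2) *\<^sub>R u"
    by (subst half[of "a + s *\<^sub>R u"]) (simp add: algebra_simps)
  also have "\<dots> = q - ((t - s)/4) *\<^sub>R u" unfolding q_def add_diff_eq[symmetric] scaleR_diff_left[symmetric] by (simp add: field_simps)
  finally have 4: "q - ((t - s)/4) *\<^sub>R u \<in> interior B" using 2 by simp
  show ?thesis using A B u 3 4 by unfold_locales (auto simp: convbody_def)
qed

text \<open>Index 0 is the Steiner symmetral: half the sum of a chord and its mirror image is the
  centred chord of the same length. Every step halves the bound on the displacement from
  \<open>K\<close>, so the index counts from the symmetral towards \<open>K\<close>.\<close>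

primrec steiner_path :: "'a::euclidean_space \<Rightarrow> 'a set \<Rightarrow> nat \<Rightarrow> 'a set" where
  "steiner_path u K 0 = mid u K (refl u ` K)"
| "steiner_path u K (Suc k) = mid u K (steiner_path u K k)"

locale cconvbody = convbody K for K :: "(real ^ 'n) set"
begin

lemma steiner_path_props:
  assumes u: "u \<noteq> 0"
  shows "convbody (steiner_path u K k) \<and> same_shadow u K (steiner_path u K k) \<and> measure lebesgue K \<le> measure lebesgue (steiner_path u K k)"
proof (induction k)
  case 0
  have R: "convbody (refl u ` K)" by (rule refl_convbody[OF convbody_axioms u])
  interpret m: midpair u K "refl u ` K" by (rule midpair_same_shadow[OF convbody_axioms R u same_shadow_refl])
  have "measure lebesgue K + measure lebesgue (refl u ` K) \<le> 2 * measure lebesgue (mid u K (refl u ` K))"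
    by (rule measure_mid_ge[OF convex compact m.b.convex m.b.compact u same_shadow_refl])
  moreover have "measure lebesgue (refl u ` K) = measure lebesgue K" by (rule refl_measure[OF u]) (simp add: borel_closed closed)
  ultimately show ?case using m.mid_body same_shadow_mid[OF same_shadow_refl] by simp
next
  case (Suc k)
  interpret m: midpair u K "steiner_path u K k" by (rule midpair_same_shadow) (use Suc u convbody_axioms in auto)
  have "measure lebesgue K + measure lebesgue (steiner_path u K k) \<le> 2 * measure lebesgue (mid u K (steiner_path u K k))"
    by (rule measure_mid_ge[OF convex compact m.b.convex m.b.compact u]) (use Suc in auto)
  thus ?case using m.mid_body same_shadow_mid Suc by auto
qed

lemma steiner_path_close:
  assumes u: "u \<noteq> 0" and M: "\<And>x. x \<in> K \<Longrightarrow> \<bar>x \<bullet> u\<bar> / (u \<bullet> u) \<le> M"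
  shows "(\<forall>x\<in>steiner_path u K k. \<exists>s. x + s *\<^sub>R u \<in> K \<and> \<bar>s\<bar> \<le> M / 2 ^ k)
    \<and> (\<forall>x\<in>K. \<exists>s. x + s *\<^sub>R u \<in> steiner_path u K k \<and> \<bar>s\<bar> \<le> M / 2 ^ k)"
proof (induction k)
  case 0
  have uu: "0 < u \<bullet> u" using u by simp
  show ?case
  proof (intro conjI ballI)
    fix x assume "x \<in> steiner_path u K 0"
    then obtain s where s: "x + s *\<^sub>R u \<in> K" "x - s *\<^sub>R u \<in> refl u ` K" by (auto simp: mid_def)
    have "refl u (x - s *\<^sub>R u) \<in> K" using s(2) refl_refl[OF u] by auto
    hence 1: "\<bar>refl u (x - s *\<^sub>R u) \<bullet> u\<bar> / (u \<bullet> u) \<le> M" by (rule M)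
    have "refl u (x - s *\<^sub>R u) \<bullet> u = - ((x - s *\<^sub>R u) \<bullet> u)" by (simp add: refl_inner refl_self[OF u])
    hence 1: "\<bar>(x - s *\<^sub>R u) \<bullet> u\<bar> / (u \<bullet> u) \<le> M" using 1 by simp
    have 2: "\<bar>(x + s *\<^sub>R u) \<bullet> u\<bar> / (u \<bullet> u) \<le> M" by (rule M[OF s(1)])
    \<comment> \<open>\<open>s\<close> is half the difference of the heights of a point of
      \<open>K\<close> and a point of its mirror image, each at most \<open>M\<close> in absolute
      value.\<close>
    have "2 * s = (x + s *\<^sub>R u) \<bullet> u / (u \<bullet> u) - (x - s *\<^sub>R u) \<bullet> u / (u \<bullet> u)"
      using uu by (simp add: diff_divide_distrib[symmetric] inner_add_left inner_diff_left)
    moreover have "\<bar>(x + s *\<^sub>R u) \<bullet> u / (u \<bullet> u)\<bar> \<le> M" "\<bar>(x - s *\<^sub>R u) \<bullet> u / (u \<bullet> u)\<bar> \<le> M"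
      using 1 2 uu by (simp_all only: abs_divide abs_of_pos)
    ultimately have "\<bar>2 * s\<bar> \<le> 2 * M" by linarith
    thus "\<exists>s. x + s *\<^sub>R u \<in> K \<and> \<bar>s\<bar> \<le> M / 2 ^ 0" using s(1) by auto
  next
    fix x assume x: "x \<in> K"
    define r where "r = x \<bullet> u / (u \<bullet> u)"
    have "(x + (- r) *\<^sub>R u) + r *\<^sub>R u \<in> K" using x by simp
    moreover have "(x + (- r) *\<^sub>R u) - r *\<^sub>R u = refl u x" by (simp add: refl_def r_def scaleR_2 scaleR_add_left[symmetric] field_simps)
    hence "(x + (- r) *\<^sub>R u) - r *\<^sub>R u \<in> refl u ` K" using x by simp
    ultimately have "x + (- r) *\<^sub>R u \<in> steiner_path u K 0" unfolding steiner_path.simps mid_def by blast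
    moreover have "\<bar>- r\<bar> \<le> M / 2 ^ 0" using M[OF x] uu by (simp add: r_def)
    ultimately show "\<exists>s. x + s *\<^sub>R u \<in> steiner_path u K 0 \<and> \<bar>s\<bar> \<le> M / 2 ^ 0" by blast
  qed
next
  case (Suc k)
  show ?case
  proof (intro conjI ballI)
    fix x assume "x \<in> steiner_path u K (Suc k)"
    then obtain s where s: "x + s *\<^sub>R u \<in> K" "x - s *\<^sub>R u \<in> steiner_path u K k" by (auto simp: mid_def)
    obtain t where t: "(x - s *\<^sub>R u) + t *\<^sub>R u \<in> K" "\<bar>t\<bar> \<le> M / 2 ^ k" using Suc s(2) by blast
    \<comment> \<open>The midpoint of two points of \<open>K\<close> on the line through
      \<open>x\<close>. The displacements by \<open>s\<close> cancel, and half of \<open>t\<close>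
      remains.\<close>
    have "(1/2) *\<^sub>R (x + s *\<^sub>R u) + (1/2) *\<^sub>R ((x - s *\<^sub>R u) + t *\<^sub>R u) \<in> K"
      using convex s(1) t(1) by (intro convexD) auto
    also have "(1/2) *\<^sub>R (x + s *\<^sub>R u) + (1/2) *\<^sub>R ((x - s *\<^sub>R u) + t *\<^sub>R u) = (1/2) *\<^sub>R (x + x) + (t/2) *\<^sub>R u"
      by (simp add: algebra_simps)
    finally have "x + (t/2) *\<^sub>R u \<in> K" by (simp only: scaleR_half_double)
    moreover have "\<bar>t/2\<bar> \<le> M / 2 ^ Suc k" using t(2) by (simp add: field_simps)
    ultimately show "\<exists>s. x + s *\<^sub>R u \<in> K \<and> \<bar>s\<bar> \<le> M / 2 ^ Suc k" by blast
  next
    fix x assume x: "x \<in> K"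
    obtain t where t: "x + t *\<^sub>R u \<in> steiner_path u K k" "\<bar>t\<bar> \<le> M / 2 ^ k" using Suc x by blast
    have "(x + (t/2) *\<^sub>R u) + (- (t/2)) *\<^sub>R u \<in> K" using x by (simp add: add.assoc scaleR_add_left[symmetric])
    moreover have "(x + (t/2) *\<^sub>R u) - (- (t/2)) *\<^sub>R u \<in> steiner_path u K k"
      using t(1) by (simp add: add.assoc scaleR_add_left[symmetric])
    ultimately have "x + (t/2) *\<^sub>R u \<in> steiner_path u K (Suc k)" unfolding steiner_path.simps mid_def by blast
    moreover have "\<bar>t/2\<bar> \<le> M / 2 ^ Suc k" using t(2) by (simp add: field_simps)
    ultimately show "\<exists>s. x + s *\<^sub>R u \<in> steiner_path u K (Suc k) \<and> \<bar>s\<bar> \<le> M / 2 ^ Suc k" by blast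
  qed
qed

text \<open>No body of the path has smaller volume than \<open>K\<close>, so beyond \<open>N\<close>
  the bound on the volume product passes to \<open>minvol\<close>. From there the induction runs
  down to index 0, cancelling the harmonic mean at each step.\<close>

lemma minvol_steiner_le:
  assumes u: "u \<noteq> 0" and ev: "\<And>k. N \<le> k \<Longrightarrow> volume_product (steiner_path u K k) \<le> volume_product K"
  shows "minvol (steiner_path u K 0) \<le> minvol K"
proof -
  have mK: "0 < measure lebesgue K"
    using interior_nonempty compact lmeasurable_compact[OF compact]
      negligible_convex_interior[OF convex] by (simp add: negligible_iff_measure zero_less_measure_iff)
  have top: "minvol (steiner_path u K k) \<le> minvol K" if "N \<le> k" for k
  proof -
    interpret L: convbody "steiner_path u K k" using steiner_path_props[OF u, of k] by simp
    have "measure lebesgue K * minvol (steiner_path u K k) \<le> measure lebesgue (steiner_path u K k) * minvol (steiner_path u K k)"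
      using steiner_path_props[OF u, of k] L.minvol_pos by (intro mult_right_mono) auto
    also have "\<dots> \<le> measure lebesgue K * minvol K" using ev[OF that] by (simp add: L.volume_product_eq volume_product_eq)
    finally show ?thesis using mK by simp
  qed
  have step: "minvol (steiner_path u K k) \<le> minvol K" if "minvol (steiner_path u K (Suc k)) \<le> minvol K" for k
  proof -
    interpret L: convbody "steiner_path u K k" using steiner_path_props[OF u, of k] by simp
    interpret m: midpair u K "steiner_path u K k" by (rule midpair_same_shadow) (use steiner_path_props[OF u, of k] u convbody_axioms in auto)
    interpret c: cmidpair u K "steiner_path u K k" ..
    define P Q where PQ: "P = minvol K" "Q = minvol (steiner_path u K k)"
    have p: "0 < P" "0 < Q" using minvol_pos L.minvol_pos by (auto simp: PQ)
    have "2 * P * Q / (P + Q) \<le> P" using c.minvol_mid that by (simp add: PQ)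
    hence "2 * P * Q \<le> P * (P + Q)" using p by (simp add: pos_divide_le_eq)
    hence "P * (2 * Q) \<le> P * (P + Q)" by (simp add: mult_ac)
    hence "2 * Q \<le> P + Q" using p by (simp only: mult_le_cancel_left_pos)
    thus ?thesis by (simp add: PQ)
  qed
  have "minvol (steiner_path u K (N - j)) \<le> minvol K" if "j \<le> N" for j
    using that
  proof (induction j)
    case (Suc j)
    have "N - j = Suc (N - Suc j)" using Suc.prems by simp
    thus ?case using Suc step[of "N - Suc j"] by simp
  qed (use top in simp)
  from this[of N] show ?thesis by simp
qed

text \<open>The map is the shear from \<open>mid_equality\<close> combined with the mirror
  reflection. Of the two inclusions with a push along \<open>u\<close>, the first is reflected back
  into \<open>K\<close> and becomes a push by \<open>s\<close> against \<open>u\<close>; the second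
  stays a push by \<open>t\<close> along \<open>u\<close>. The image of \<open>x\<close> lies
  between these two points of \<open>K\<close> on one line, so it belongs to
  \<open>K\<close>.\<close>

theorem affine_reflection:
  assumes u: "u \<noteq> 0" and ev: "\<And>k. N \<le> k \<Longrightarrow> volume_product (steiner_path u K k) \<le> volume_product K"
  shows "\<exists>q d. q \<bullet> u = - 2 \<and> (\<forall>x\<in>K. x + (q \<bullet> x + d) *\<^sub>R u \<in> K)"
proof -
  have uu: "0 < u \<bullet> u" using u by simp
  have R: "convbody (refl u ` K)" by (rule refl_convbody[OF convbody_axioms u])
  interpret m: midpair u K "refl u ` K" by (rule midpair_same_shadow[OF convbody_axioms R u same_shadow_refl])
  interpret c: cmidpair u K "refl u ` K" ..
  have le: "minvol (mid u K (refl u ` K)) \<le> minvol K" using minvol_steiner_le[OF u ev] by simp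
  obtain p z0 z1 where p: "p \<bullet> u = 0"
    and up: "\<And>x. x \<in> K \<Longrightarrow> \<exists>s\<ge>0. z1 + ((x - z0) - (p \<bullet> (x - z0)) *\<^sub>R u) + s *\<^sub>R u \<in> refl u ` K"
    and down: "\<And>x. x \<in> refl u ` K \<Longrightarrow> \<exists>s\<ge>0. z0 + ((x - z1) + (p \<bullet> (x - z1)) *\<^sub>R u) + s *\<^sub>R u \<in> K"
    and zz: "\<exists>c. z0 - z1 = c *\<^sub>R u"
    by (rule c.mid_equality[OF refl refl_minvol[OF u] le]) blast
  obtain c where c: "z0 - z1 = c *\<^sub>R u" using zz by blast
  hence z1: "z1 = z0 - c *\<^sub>R u" by (simp add: algebra_simps)
  \<comment> \<open>Since \<open>p\<close> is orthogonal to \<open>u\<close>, this gives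
    \<open>q \<bullet> u = - 2\<close>, the condition for the affine map to be an involution
    reversing \<open>u\<close>.\<close>
  define q where "q = p - (2 / (u \<bullet> u)) *\<^sub>R u"
  define d where "d = c - p \<bullet> z0"
  have qx: "q \<bullet> x + d = c + p \<bullet> (x - z0) - 2 * (x \<bullet> u) / (u \<bullet> u)" for x
    by (simp add: q_def d_def inner_diff_left inner_diff_right inner_commute)
  have "x + (q \<bullet> x + d) *\<^sub>R u \<in> K" if x: "x \<in> K" for x
  proof -
    obtain s where s: "0 \<le> s" "z1 + ((x - z0) - (p \<bullet> (x - z0)) *\<^sub>R u) + s *\<^sub>R u \<in> refl u ` K" using up[OF x] by blast
    define y where "y = z1 + ((x - z0) - (p \<bullet> (x - z0)) *\<^sub>R u) + s *\<^sub>R u"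
    have y: "y = x + (s - c - p \<bullet> (x - z0)) *\<^sub>R u" by (simp add: y_def z1 algebra_simps)
    have "refl u y \<in> K" using s(2) refl_refl[OF u] by (auto simp: y_def)
    also have "refl u y = refl u x - (s - c - p \<bullet> (x - z0)) *\<^sub>R u"
      unfolding y by (simp add: linear_add[OF refl_linear] linear_scale[OF refl_linear] refl_self[OF u])
    also have "\<dots> = x + (q \<bullet> x + d - s) *\<^sub>R u"
      unfolding qx refl_def by (simp add: algebra_simps)
    finally have 1: "x + (q \<bullet> x + d - s) *\<^sub>R u \<in> K" .
    have rx: "refl u x \<in> refl u ` K" using x by simp
    obtain t where t: "0 \<le> t" "z0 + ((refl u x - z1) + (p \<bullet> (refl u x - z1)) *\<^sub>R u) + t *\<^sub>R u \<in> K" using down[OF rx] by blast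
    have "p \<bullet> (refl u x - z1) = p \<bullet> (x - z0)"
      using p by (simp add: z1 refl_def inner_diff_right inner_add_right)
    hence "z0 + ((refl u x - z1) + (p \<bullet> (refl u x - z1)) *\<^sub>R u) + t *\<^sub>R u = x + (q \<bullet> x + d + t) *\<^sub>R u"
      unfolding qx by (simp add: z1 refl_def algebra_simps)
    hence 2: "x + (q \<bullet> x + d + t) *\<^sub>R u \<in> K" using t(2) by simp
    show ?thesis
    proof (cases "s + t = 0")
      case True
      hence "s = 0" using s t by simp
      thus ?thesis using 1 by simp
    next
      case False
      hence st: "0 < s + t" using s t by simp
      have "(t / (s + t)) *\<^sub>R (x + (q \<bullet> x + d - s) *\<^sub>R u) + (s / (s + t)) *\<^sub>R (x + (q \<bullet> x + d + t) *\<^sub>R u) \<in> K"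
        using convex 1 2 s(1) t(1) st by (intro convexD) (auto simp: add_divide_distrib[symmetric])
      also have "(t / (s + t)) *\<^sub>R (x + (q \<bullet> x + d - s) *\<^sub>R u) + (s / (s + t)) *\<^sub>R (x + (q \<bullet> x + d + t) *\<^sub>R u)
         = (t / (s + t) + s / (s + t)) *\<^sub>R (x + (q \<bullet> x + d) *\<^sub>R u) + (- (t / (s + t)) * s + (s / (s + t)) * t) *\<^sub>R u"
        by (simp only: scaleR_add_right scaleR_add_left scaleR_diff_left scaleR_scaleR right_diff_distrib distrib_left) (simp add: algebra_simps)
      also have "t / (s + t) + s / (s + t) = 1" using st by (simp add: add_divide_distrib[symmetric])
      also have "- (t / (s + t)) * s + (s / (s + t)) * t = 0" by simp
      finally show ?thesis by simp
    qed
  qed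
  moreover have "q \<bullet> u = - 2" using p uu by (simp add: q_def inner_diff_left)
  ultimately show ?thesis by blast
qed

end

section \<open>Bodies with an affine reflection in every direction\<close>

locale scalar_product =
  fixes B :: "'a::euclidean_space \<Rightarrow> 'a \<Rightarrow> real"
  assumes lin: "linear (B v)" and sym: "B v w = B w v" and pos: "v \<noteq> 0 \<Longrightarrow> 0 < B v v"
begin

lemma sum_right: "B v (\<Sum>b\<in>S. c b *\<^sub>R f b) = (\<Sum>b\<in>S. c b * B v (f b))"
  by (simp add: linear_sum[OF lin] linear_scale[OF lin])

lemma sum_left: "B (\<Sum>b\<in>S. c b *\<^sub>R f b) w = (\<Sum>b\<in>S. c b * B (f b) w)"
  unfolding sym[of _ w] sum_right ..

text \<open>Gram-Schmidt. Indexing by subsets of \<open>Basis\<close> keeps the number of vectors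
  below the dimension before each extension, so a vector outside their span exists.\<close>

lemma orthonormal_system:
  assumes "S \<subseteq> Basis"
  shows "\<exists>f :: 'a \<Rightarrow> 'a. \<forall>b\<in>S. \<forall>c\<in>S. B (f b) (f c) = (if b = c then 1 else 0)"
proof -
  have "finite S" using assms finite_Basis finite_subset by blast
  thus ?thesis using assms
  proof (induction S rule: finite_induct)
    case (insert e S)
    then obtain f :: "'a \<Rightarrow> 'a" where f: "\<forall>b\<in>S. \<forall>c\<in>S. B (f b) (f c) = (if b = c then 1 else 0)" by blast
    have "dim (f ` S) \<le> card (f ` S)" using insert by (intro dim_le_card') simp
    also have "\<dots> \<le> card S" by (rule card_image_le[OF insert.hyps(1)])
    also have "\<dots> < card (insert e S)" using insert by simp
    also have "\<dots> \<le> DIM('a)" by (rule card_mono[OF finite_Basis insert.prems])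
    finally have "span (f ` S) \<noteq> UNIV" by (metis dim_UNIV dim_span less_irrefl)
    then obtain x where x: "x \<notin> span (f ` S)" by blast
    define y where "y = x - (\<Sum>b\<in>S. B x (f b) *\<^sub>R f b)"
    have "(\<Sum>b\<in>S. B x (f b) *\<^sub>R f b) \<in> span (f ` S)" by (intro span_sum span_scale span_base) auto
    hence "y \<noteq> 0" using x unfolding y_def by auto
    hence py: "0 < B y y" by (rule pos)
    have orth: "B (f c) y = 0" if c: "c \<in> S" for c
    proof -
      have "B (f c) y = B (f c) x - (\<Sum>b\<in>S. B x (f b) * B (f c) (f b))"
        unfolding y_def by (simp add: linear_diff[OF lin] sum_right)
      also have "(\<Sum>b\<in>S. B x (f b) * B (f c) (f b)) = (\<Sum>b\<in>S. if b = c then B x (f b) else 0)"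
        using f c by (intro sum.cong) auto
      also have "\<dots> = B x (f c)" using c insert.hyps(1) by (simp add: sum.delta)
      finally show ?thesis using sym[of x "f c"] by simp
    qed
    define g where "g = f(e := (1 / sqrt (B y y)) *\<^sub>R y)"
    have ge: "g e = (1 / sqrt (B y y)) *\<^sub>R y" and gS: "c \<in> S \<Longrightarrow> g c = f c" for c
      using insert.hyps(2) by (auto simp: g_def)
    have scale2: "B (k *\<^sub>R v) w = k * B v w" for k v w
      using linear_scale[OF lin, of w k v] sym[of w v] sym[of w "k *\<^sub>R v"] by simp
    have ee: "B (g e) (g e) = 1"
      unfolding ge scale2 linear_scale[OF lin] using py by (simp add: field_simps)
    have ce: "B (g c) (g e) = 0" "B (g e) (g c) = 0" if c: "c \<in> S" for c
      using orth[OF c] sym[of y "f c"] unfolding ge gS[OF c] scale2 linear_scale[OF lin] by simp_all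
    have "B (g b) (g c) = (if b = c then 1 else 0)" if b: "b \<in> insert e S" and c: "c \<in> insert e S" for b c
      using b c ee ce f gS insert.hyps(2) by auto
    thus ?case by blast
  qed simp
qed

lemma orthogonalisation:
  "\<exists>T :: 'a \<Rightarrow> 'a. linear T \<and> bij T \<and> (\<forall>v w. B (T v) (T w) = v \<bullet> w)"
proof -
  obtain f :: "'a \<Rightarrow> 'a" where f: "\<forall>b\<in>Basis. \<forall>c\<in>Basis. B (f b) (f c) = (if b = c then 1 else 0)"
    using orthonormal_system[OF order_refl] by blast
  define T where "T v = (\<Sum>b\<in>Basis. (v \<bullet> b) *\<^sub>R f b)" for v
  have T: "linear T" unfolding T_def
    by (rule linearI) (simp_all add: inner_add_left scaleR_add_left sum.distrib scaleR_sum_right)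
  have BT: "B (T v) (T w) = v \<bullet> w" for v w
  proof -
    have "B (T v) (T w) = (\<Sum>b\<in>Basis. (v \<bullet> b) * (\<Sum>c\<in>Basis. (w \<bullet> c) * B (f b) (f c)))"
      unfolding T_def sum_left by (simp only: sum_right)
    also have "\<dots> = (\<Sum>b\<in>Basis. (v \<bullet> b) * (w \<bullet> b))"
    proof (rule sum.cong[OF refl])
      fix b :: 'a assume b: "b \<in> Basis"
      have "(\<Sum>c\<in>Basis. (w \<bullet> c) * B (f b) (f c)) = (\<Sum>c\<in>Basis. if c = b then w \<bullet> c else 0)"
        using f b by (intro sum.cong) auto
      also have "\<dots> = w \<bullet> b" using b by (simp add: sum.delta)
      finally show "(v \<bullet> b) * (\<Sum>c\<in>Basis. (w \<bullet> c) * B (f b) (f c)) = (v \<bullet> b) * (w \<bullet> b)" by simp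
    qed
    also have "\<dots> = v \<bullet> w" by (rule euclidean_inner[symmetric])
    finally show ?thesis .
  qed
  have "v = 0" if "T v = 0" for v
  proof -
    have "v \<bullet> v = B 0 0" using BT[of v v] that by simp
    also have "\<dots> = 0" by (rule linear_0[OF lin])
    finally show ?thesis by simp
  qed
  hence "inj T" by (simp add: linear_injective_0[OF T])
  hence "bij T" using linear_injective_imp_surjective[OF T] by (simp add: bij_def)
  thus ?thesis using T BT by blast
qed

end

text \<open>Let \<open>p\<close> have the largest norm in \<open>M\<close>. For each other
  \<open>y\<close> of the same norm the reflection along \<open>p - y\<close> maps \<open>p\<close>
  to \<open>y\<close>, so \<open>M\<close> contains the whole sphere, and segments between antipodal
  points fill the ball.\<close>

lemma ball_if_all_reflections:
  fixes M :: "'a::euclidean_space set"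
  assumes M: "convex M" "compact M" "M \<noteq> {}" and r: "\<And>w x. w \<noteq> 0 \<Longrightarrow> x \<in> M \<Longrightarrow> refl w x \<in> M"
  shows "\<exists>\<rho>\<ge>0. M = cball 0 \<rho>"
proof -
  obtain p where p: "p \<in> M" "\<And>x. x \<in> M \<Longrightarrow> norm x \<le> norm p"
    using continuous_attains_sup[OF M(2,3), of norm] continuous_on_norm_id by blast
  have sph: "y \<in> M" if y: "norm y = norm p" for y
  proof (cases "y = p")
    case False
    have nn: "y \<bullet> y = p \<bullet> p" using y by (simp add: norm_eq)
    have e1: "(p - y) \<bullet> (p - y) = 2 * (p \<bullet> (p - y))"
      using nn by (simp add: inner_diff_left inner_diff_right inner_commute)
    have e2: "(p - y) \<bullet> (p - y) \<noteq> 0" using False by (simp only: inner_eq_zero_iff right_minus_eq) blast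
    have "2 * (p \<bullet> (p - y)) / ((p - y) \<bullet> (p - y)) = 1" unfolding e1[symmetric] by (rule divide_self[OF e2])
    hence "refl (p - y) p = p - 1 *\<^sub>R (p - y)" by (simp only: refl_def)
    hence "refl (p - y) p = y" by simp
    thus ?thesis using r[of "p - y" p] p(1) False by simp
  qed (use p in simp)
  have "z \<in> M" if z: "norm z \<le> norm p" for z
  proof -
    have "\<exists>y l. norm y = norm p \<and> z = l *\<^sub>R y \<and> 0 \<le> l \<and> l \<le> 1"
    proof (cases "z = 0")
      case True thus ?thesis by (intro exI[of _ p] exI[of _ 0]) simp
    next
      case False
      thus ?thesis using z
        by (intro exI[of _ "(norm p / norm z) *\<^sub>R z"] exI[of _ "norm z / norm p"]) auto
    qed
    then obtain y l where y: "norm y = norm p" "z = l *\<^sub>R y" "0 \<le> l" "l \<le> 1" by blast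
    have "((1 + l) / 2) *\<^sub>R y + ((1 - l) / 2) *\<^sub>R (- y) \<in> M"
      using y sph[of y] sph[of "- y"] by (intro convexD[OF M(1)]) (auto simp: field_simps)
    also have "((1 + l) / 2) *\<^sub>R y + ((1 - l) / 2) *\<^sub>R (- y) = ((1 + l) / 2 - (1 - l) / 2) *\<^sub>R y"
      by (simp only: scaleR_minus_right scaleR_diff_left add_uminus_conv_diff)
    also have "(1 + l) / 2 - (1 - l) / 2 = l" by (simp add: field_simps)
    finally show ?thesis using y by simp
  qed
  hence "M = cball 0 (norm p)" using p(2) by auto
  thus ?thesis using norm_ge_zero[of p] by blast
qed

lemma adjoint_bij:
  fixes T :: "'a::euclidean_space \<Rightarrow> 'a"
  assumes T: "linear T" "bij T" shows "linear (adjoint T)" "bij (adjoint T)"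
proof -
  show S: "linear (adjoint T)" by (rule adjoint_linear[OF T(1)])
  have "x = 0" if x: "adjoint T x = 0" for x
  proof -
    obtain y where "x = T y" using bij_is_surj[OF T(2)] by (rule surjE)
    hence "x \<bullet> x = y \<bullet> adjoint T x" using adjoint_works[OF T(1), of y x] by simp
    thus ?thesis using x by simp
  qed
  hence "inj (adjoint T)" by (simp add: linear_injective_0[OF S])
  thus "bij (adjoint T)" using linear_injective_imp_surjective[OF S] by (simp add: bij_def)
qed

lemma scales_1_distr:
  assumes "scales f 1" shows "distr lborel borel f = (lborel :: ('a::euclidean_space) measure)"
proof (rule measure_eqI)
  have f: "linear f" using assms by (simp add: scales_def)
  fix A :: "'a set" assume "A \<in> sets (distr lborel borel f)"
  hence A: "A \<in> sets borel" by simp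
  have fA: "f -` A \<in> sets borel" using measurable_sets[OF linear_borel[OF f] A] by simp
  have i: "indicator A \<in> borel_measurable (borel :: 'a measure)" using A by (rule borel_measurable_indicator)
  have "(\<integral>\<^sup>+x. indicator A x \<partial>lborel) = ennreal 1 * (\<integral>\<^sup>+x. indicator A (f x) \<partial>(lborel :: 'a measure))"
    using assms i unfolding scales_def by blast
  also have "(\<integral>\<^sup>+x. indicator A (f x) \<partial>(lborel :: 'a measure)) = (\<integral>\<^sup>+x. indicator (f -` A) x \<partial>lborel)"
    by (intro nn_integral_cong) (simp add: indicator_def)
  finally have "emeasure lborel A = emeasure lborel (f -` A)" using A fA by simp
  thus "emeasure (distr lborel borel f) A = emeasure lborel A"
    using A linear_borel[OF f] by (subst emeasure_distr) auto
qed simp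

section \<open>Centroid and inertia form of a body\<close>

context cconvbody
begin

definition integ :: "(real ^ 'n \<Rightarrow> 'b::euclidean_space) \<Rightarrow> 'b" where
  "integ h = (LINT x|lborel. indicator K x *\<^sub>R h x)"

lemma integ_integrable: "continuous_on UNIV h \<Longrightarrow> integrable lborel (\<lambda>x. indicator K x *\<^sub>R h x)"
  for h :: "real ^ 'n \<Rightarrow> 'b::euclidean_space"
  by (rule borel_integrable_compact[OF compact continuous_on_subset[OF _ subset_UNIV]])

lemma integ_add: "continuous_on UNIV h \<Longrightarrow> continuous_on UNIV h' \<Longrightarrow> integ (\<lambda>x. h x + h' x) = integ h + integ h'"
  for h :: "real ^ 'n \<Rightarrow> 'b::euclidean_space"
  unfolding integ_def scaleR_add_right by (rule Bochner_Integration.integral_add) (rule integ_integrable; assumption)+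

lemma integ_scale: "integ (\<lambda>x. h x *\<^sub>R v) = integ h *\<^sub>R v" if "continuous_on UNIV h"
  for h :: "real ^ 'n \<Rightarrow> real" and v :: "'b::euclidean_space"
proof -
  have "integ (\<lambda>x. h x *\<^sub>R v) = (LINT x|lborel. (indicator K x *\<^sub>R h x) *\<^sub>R v)" unfolding integ_def by simp
  also have "\<dots> = integ h *\<^sub>R v" unfolding integ_def using integ_integrable[OF that] by (intro integral_scaleR_left) blast
  finally show ?thesis .
qed

lemma integ_inner: "integ (\<lambda>x. v \<bullet> h x) = v \<bullet> integ h" if "continuous_on UNIV h"
  for h :: "real ^ 'n \<Rightarrow> 'b::euclidean_space"
proof -
  have "integ (\<lambda>x. v \<bullet> h x) = (LINT x|lborel. v \<bullet> (indicator K x *\<^sub>R h x))" unfolding integ_def by simp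
  also have "\<dots> = v \<bullet> integ h" unfolding integ_def using integ_integrable[OF that] by (intro integral_inner_right) blast
  finally show ?thesis .
qed

lemma integ_one: "integ (\<lambda>_. 1 :: real) = measure lebesgue K" "0 < measure lebesgue K"
proof -
  show "integ (\<lambda>_. 1 :: real) = measure lebesgue K" unfolding integ_def using closed by (simp add: borel_closed)
  show "0 < measure lebesgue K" using interior_nonempty lmeasurable_compact[OF compact]
      negligible_convex_interior[OF convex] by (simp add: negligible_iff_measure zero_less_measure_iff)
qed

definition centroid :: "real ^ 'n" where "centroid = (1 / measure lebesgue K) *\<^sub>R integ (\<lambda>x. x)"

definition inertia :: "real ^ 'n \<Rightarrow> real ^ 'n \<Rightarrow> real" where
  "inertia v w = integ (\<lambda>x. ((x - centroid) \<bullet> v) * ((x - centroid) \<bullet> w))"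

lemma inertia_cont: "continuous_on UNIV (\<lambda>x. ((x - centroid) \<bullet> v) * ((x - centroid) \<bullet> w))"
  by (intro continuous_intros)

text \<open>Definiteness is where the interior of \<open>K\<close> enters: a vanishing value would
  put almost all of \<open>K\<close> into one hyperplane.\<close>

lemma inertia_scalar_product: "scalar_product inertia"
proof (rule scalar_product.intro)
  show "inertia v w = inertia w v" for v w unfolding inertia_def by (simp add: mult.commute)
  show "linear (inertia v)" for v
  proof (rule linearI)
    fix a b :: "real ^ 'n" and c :: real
    show "inertia v (a + b) = inertia v a + inertia v b"
      unfolding inertia_def inner_add_right distrib_left by (rule integ_add[OF inertia_cont inertia_cont])
    have "inertia v (c *\<^sub>R a) = integ (\<lambda>x. (((x - centroid) \<bullet> v) * ((x - centroid) \<bullet> a)) *\<^sub>R c)"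
      unfolding inertia_def by (simp add: mult_ac)
    also have "\<dots> = c *\<^sub>R inertia v a" unfolding integ_scale[OF inertia_cont] by (simp add: inertia_def)
    finally show "inertia v (c *\<^sub>R a) = c *\<^sub>R inertia v a" .
  qed
  fix v :: "real ^ 'n" assume v: "v \<noteq> 0"
  let ?h = "\<lambda>x. indicator K x *\<^sub>R (((x - centroid) \<bullet> v) * ((x - centroid) \<bullet> v)) :: real"
  have nn: "0 \<le> ?h x" for x by (simp add: indicator_def)
  have "0 \<le> inertia v v" unfolding inertia_def integ_def by (intro Bochner_Integration.integral_nonneg nn)
  moreover have "inertia v v \<noteq> 0"
  proof
    assume "inertia v v = 0"
    hence "AE x in lborel. ?h x = 0"
      using integral_nonneg_eq_0_iff_AE[OF integ_integrable[OF inertia_cont, of v v]] nn unfolding inertia_def integ_def by simp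
    then obtain Z where Z: "Z \<in> null_sets lborel" "{x. ?h x \<noteq> 0} \<subseteq> Z" unfolding eventually_ae_filter by auto
    have "negligible Z" using Z(1) null_sets_completionI by (auto simp: negligible_iff_null_sets)
    hence "negligible {x. ?h x \<noteq> 0}" using Z(2) by (rule negligible_subset)
    moreover have "negligible {x. v \<bullet> x = v \<bullet> centroid}" using v by (rule negligible_hyperplane[OF disjI1])
    ultimately have "negligible ({x. ?h x \<noteq> 0} \<union> {x. v \<bullet> x = v \<bullet> centroid})" by (rule negligible_Un)
    hence "negligible (interior K)"
    proof (rule negligible_subset)
      show "interior K \<subseteq> {x. ?h x \<noteq> 0} \<union> {x. v \<bullet> x = v \<bullet> centroid}"
      proof
        fix x assume "x \<in> interior K"
        hence "x \<in> K" using interior_subset by blast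
        thus "x \<in> {x. ?h x \<noteq> 0} \<union> {x. v \<bullet> x = v \<bullet> centroid}"
          by (cases "v \<bullet> x = v \<bullet> centroid") (simp_all add: inner_diff_right inner_commute[of _ v])
      qed
    qed
    thus False using open_not_negligible[OF open_interior interior_nonempty] by blast
  qed
  ultimately show "0 < inertia v v" by simp
qed

text \<open>The affine map is an involution, hence preserves volume, and it maps \<open>K\<close>
  onto itself, so integrals over \<open>K\<close> are invariant under it. For the integrand
  \<open>q \<bullet> x\<close> this says that the centroid is fixed. For the quadratic integrand it
  says that the inertia form is invariant under the adjoint of the linear part
  \<open>N\<close>.\<close>

lemma reflection_centroid:
  assumes q: "q \<bullet> u = - 2" and K: "\<And>x. x \<in> K \<Longrightarrow> x + (q \<bullet> x + d) *\<^sub>R u \<in> K"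
  shows "q \<bullet> centroid + d = 0"
    and "inertia v w = inertia (v + (u \<bullet> v) *\<^sub>R q) (w + (u \<bullet> w) *\<^sub>R q)"
proof -
  define N where "N x = x + (q \<bullet> x) *\<^sub>R u" for x
  define f where "f x = x + (q \<bullet> x + d) *\<^sub>R u" for x
  have f: "f x = d *\<^sub>R u + N x" for x by (simp add: f_def N_def algebra_simps)
  have N: "linear N" unfolding N_def by (rule linearI) (simp_all add: inner_add_right algebra_simps)
  have NN: "N (N x) = x" for x by (simp add: N_def inner_add_right q algebra_simps)
  have ff: "f (f x) = x" for x by (simp add: f_def inner_add_right q algebra_simps)
  have "surj N" by (rule surjI[of N N]) (rule NN)
  then obtain c where c: "scales N c" using linear_scales[OF N] by blast
  have "c = 1" by (rule scales_involution[OF c NN])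
  hence d: "distr lborel borel N = lborel" using c scales_1_distr by blast
  have Nm: "N \<in> borel_measurable borel" by (rule linear_borel[OF N])
  have fm: "f \<in> borel_measurable borel" unfolding f[abs_def] using Nm by measurable
  \<comment> \<open>Only the inclusion of the image in \<open>K\<close> is assumed; the involution
    supplies the converse.\<close>
  have inK: "indicator K (f x) = (indicator K x :: real)" for x
    using K[of x, folded f_def] K[of "f x", folded f_def] ff by (auto simp: indicator_def)
  have inv: "integ (\<lambda>x. h (f x)) = integ h" if h: "continuous_on UNIV h" for h :: "real ^ 'n \<Rightarrow> 'b::euclidean_space"
  proof -
    have "distr lborel borel f = distr (distr lborel borel N) borel (\<lambda>x. d *\<^sub>R u + x)"
      using Nm by (subst distr_distr) (auto simp: comp_def f[abs_def])
    also have "\<dots> = lborel" unfolding d by (rule lborel_distr_plus)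
    finally have D: "distr lborel borel f = lborel" .
    have "integ h = (LINT x|distr lborel borel f. indicator K x *\<^sub>R h x)" unfolding integ_def D ..
    also have "\<dots> = (LINT x|lborel. indicator K (f x) *\<^sub>R h (f x))"
      using fm borel_measurable_integrable[OF integ_integrable[OF h]] by (intro integral_distr) auto
    finally show ?thesis unfolding inK integ_def by simp
  qed
  have c1: "continuous_on UNIV (\<lambda>x :: real ^ 'n. x)" by (rule continuous_on_id)
  have c0: "continuous_on UNIV (\<lambda>x :: real ^ 'n. 1 :: real)" "continuous_on UNIV (\<lambda>x :: real ^ 'n. q \<bullet> x)" by (intro continuous_intros)+
  have ic: "integ (\<lambda>x. x) = measure lebesgue K *\<^sub>R centroid" using integ_one(2) by (simp add: centroid_def)
  have "integ (\<lambda>x. q \<bullet> f x) = integ (\<lambda>x. q \<bullet> x)" by (rule inv[OF c0(2)])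
  moreover have "integ (\<lambda>x. q \<bullet> f x) = integ (\<lambda>x. (q \<bullet> x) *\<^sub>R (- 1) + 1 *\<^sub>R (- 2 * d))"
    by (simp add: f_def inner_add_right q algebra_simps)
  moreover have "integ (\<lambda>x. (q \<bullet> x) *\<^sub>R (- 1) + 1 *\<^sub>R (- 2 * d)) = integ (\<lambda>x. q \<bullet> x) *\<^sub>R (- 1) + measure lebesgue K *\<^sub>R (- 2 * d)"
    unfolding integ_scale[OF c0(2), symmetric] integ_one(1)[symmetric] integ_scale[OF c0(1), symmetric]
    by (rule integ_add) (intro continuous_intros)+
  moreover have "integ (\<lambda>x. q \<bullet> x) = measure lebesgue K * (q \<bullet> centroid)" unfolding integ_inner[OF c1] ic by simp
  ultimately have "measure lebesgue K * (q \<bullet> centroid + d) = 0" by (simp add: algebra_simps)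
  thus qc: "q \<bullet> centroid + d = 0" using integ_one(2) by simp
  have "f x - centroid = N (x - centroid)" for x
  proof -
    have "f centroid = centroid" using qc by (simp add: f_def)
    hence "f x - centroid = f x - f centroid" by simp
    also have "\<dots> = N (x - centroid)" by (simp add: f linear_diff[OF N])
    finally show ?thesis .
  qed
  moreover have "N x \<bullet> v = x \<bullet> (v + (u \<bullet> v) *\<^sub>R q)" for x v by (simp add: N_def inner_add_left inner_add_right inner_commute)
  ultimately have e: "(f x - centroid) \<bullet> v = (x - centroid) \<bullet> (v + (u \<bullet> v) *\<^sub>R q)" for x v by simp
  have "inertia v w = integ (\<lambda>x. ((f x - centroid) \<bullet> v) * ((f x - centroid) \<bullet> w))"
    unfolding inertia_def by (rule inv[OF inertia_cont, symmetric])
  thus "inertia v w = inertia (v + (u \<bullet> v) *\<^sub>R q) (w + (u \<bullet> w) *\<^sub>R q)" unfolding e inertia_def .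
qed

text \<open>\<open>T\<close> carries the standard scalar product to the inertia form. Invariance of
  the form forces \<open>q\<close> to be a multiple of \<open>T (S u)\<close>, where
  \<open>S\<close> is the adjoint of \<open>T\<close>. In the coordinates
  \<open>S (x - centroid)\<close> the affine reflection along \<open>u\<close> is therefore the
  orthogonal one along \<open>S u\<close>, and as \<open>S\<close> is onto, all directions
  occur.\<close>

theorem ellipsoid_if_all_reflections:
  assumes r: "\<And>u. u \<noteq> 0 \<Longrightarrow> \<exists>q d. q \<bullet> u = - 2 \<and> (\<forall>x\<in>K. x + (q \<bullet> x + d) *\<^sub>R u \<in> K)"
  shows "ellipsoid K"
proof -
  interpret scalar_product inertia by (rule inertia_scalar_product)
  obtain T :: "real ^ 'n \<Rightarrow> real ^ 'n" where T: "linear T" "bij T" "\<forall>v w. inertia (T v) (T w) = v \<bullet> w"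
    using orthogonalisation by blast
  define S where "S = adjoint T"
  have S: "linear S" "bij S" using adjoint_bij[OF T(1,2)] by (auto simp: S_def)
  have adj: "S x \<bullet> y = x \<bullet> T y" for x y using adjoint_works[OF T(1), of y x] by (simp add: S_def inner_commute)
  define M where "M = (\<lambda>x. S (x - centroid)) ` K"
  have cS: "continuous_on A S" for A using S(1) by (simp add: linear_continuous_on linear_conv_bounded_linear)
  have M: "M = S ` ((\<lambda>x. x - centroid) ` K)" by (simp add: M_def image_image)
  have "convex M" unfolding M by (intro convex_linear_image[OF S(1)] convex_translation_subtract convex)
  moreover have "compact M" unfolding M
    by (intro compact_continuous_image[OF cS] compact_translation_subtract compact)
  moreover have "M \<noteq> {}" using interior_nonempty interior_subset by (auto simp: M_def)
  moreover have "refl w y \<in> M" if w: "w \<noteq> 0" and y: "y \<in> M" for w y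
  proof -
    obtain x where x: "x \<in> K" "y = S (x - centroid)" using y by (auto simp: M_def)
    obtain u where u: "w = S u" using bij_is_surj[OF S(2)] by (rule surjE)
    have "u \<noteq> 0" using w u linear_0[OF S(1)] by auto
    then obtain q d where q: "q \<bullet> u = - 2" "\<forall>x\<in>K. x + (q \<bullet> x + d) *\<^sub>R u \<in> K" using r by blast
    have qc: "q \<bullet> centroid + d = 0" and inv: "\<And>v w. inertia v w = inertia (v + (u \<bullet> v) *\<^sub>R q) (w + (u \<bullet> w) *\<^sub>R q)"
      using reflection_centroid[OF q(1)] q(2) by blast+
    have ex: "inertia (v + a *\<^sub>R q) (w + b *\<^sub>R q) = inertia v w + b * inertia v q + a * inertia q w + a * b * inertia q q" for v w a b
    proof -
      have "inertia (v + a *\<^sub>R q) w = inertia v w + a * inertia q w" for w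
        unfolding sym[of _ w] by (simp add: linear_add[OF lin] linear_scale[OF lin])
      thus ?thesis by (simp add: linear_add[OF lin] linear_scale[OF lin] algebra_simps)
    qed
    \<comment> \<open>Obtained by solving the invariance identity for the pair \<open>v\<close>,
      \<open>u\<close> for \<open>inertia v q\<close>.\<close>
    define k where "k = - (inertia q u / (u \<bullet> u) + inertia q q)"
    have uu: "u \<bullet> u \<noteq> 0" using \<open>u \<noteq> 0\<close> by simp
    have k: "inertia v q = k * (u \<bullet> v)" for v
    proof -
      have "0 = (u \<bullet> u) * inertia v q + (u \<bullet> v) * inertia q u + (u \<bullet> v) * (u \<bullet> u) * inertia q q"
        using inv[of v u] unfolding ex by simp
      hence "(u \<bullet> u) * inertia v q = - ((u \<bullet> v) * inertia q u) - (u \<bullet> u) * ((u \<bullet> v) * inertia q q)" by (simp add: algebra_simps)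
      also have "(u \<bullet> v) * inertia q u = (u \<bullet> u) * ((inertia q u / (u \<bullet> u)) * (u \<bullet> v))" using uu by simp
      also have "- ((u \<bullet> u) * ((inertia q u / (u \<bullet> u)) * (u \<bullet> v))) - (u \<bullet> u) * ((u \<bullet> v) * inertia q q) = (u \<bullet> u) * (k * (u \<bullet> v))"
        unfolding k_def by (simp only: minus_mult_left[symmetric]) (simp add: algebra_simps)
      finally have "(u \<bullet> u) * inertia v q = (u \<bullet> u) * (k * (u \<bullet> v))" .
      thus ?thesis using uu by simp
    qed
    obtain p where p: "q = T p" using bij_is_surj[OF T(2)] by (rule surjE)
    have "x \<bullet> p = x \<bullet> (k *\<^sub>R S u)" for x
      using T(3) k[of "T x"] adj[of u x] by (simp add: p inner_commute)
    hence "p = k *\<^sub>R S u" using vector_eq_rdot[of p "k *\<^sub>R S u"] by (simp add: inner_commute)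
    hence qp: "q = k *\<^sub>R T (S u)" by (simp add: p linear_scale[OF T(1)])
    have qx: "q \<bullet> x = k * (S x \<bullet> w)" for x unfolding qp u adj by (simp add: inner_commute)
    have kw: "k * (w \<bullet> w) = - 2" using qx[of u] q(1) u by simp
    hence kk: "k = - 2 / (w \<bullet> w)" using w by (simp add: field_simps)
    have d: "d = - (q \<bullet> centroid)" using qc by simp
    have "S (x + (q \<bullet> x + d) *\<^sub>R u - centroid) = S (x - centroid + (q \<bullet> (x - centroid)) *\<^sub>R u)"
      unfolding d by (simp add: inner_diff_right algebra_simps)
    also have "\<dots> = y + (k * (y \<bullet> w)) *\<^sub>R w" unfolding linear_add[OF S(1)] linear_scale[OF S(1)] qx x(2) u ..
    also have "\<dots> = refl w y" by (simp add: refl_def kk)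
    finally have "refl w y = S (x + (q \<bullet> x + d) *\<^sub>R u - centroid)" ..
    thus ?thesis using q(2) x(1) unfolding M_def by blast
  qed
  ultimately obtain \<rho> where \<rho>: "0 \<le> \<rho>" "M = cball 0 \<rho>" using ball_if_all_reflections by blast
  define V where "V = inv S"
  have V: "linear V" "bij V" "\<And>x. V (S x) = x"
    using inj_linear_imp_inv_linear[OF S(1) bij_is_inj[OF S(2)]] bij_imp_bij_inv[OF S(2)] inv_f_f[OF bij_is_inj[OF S(2)]]
    unfolding V_def by blast+
  have "(\<lambda>y. V y + centroid) ` M = K" unfolding M_def image_image V(3) by simp
  hence KM: "(\<lambda>y. V y + centroid) ` cball 0 \<rho> = K" unfolding \<rho>(2) .
  have "\<rho> \<noteq> 0"
  proof
    assume "\<rho> = 0"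
    hence "{V 0 + centroid} = K" using KM by simp
    hence "interior {V 0 + centroid} \<noteq> {}" using interior_nonempty by (rule ssubst)
    thus False by simp
  qed
  hence \<rho>0: "0 < \<rho>" using \<rho>(1) by simp
  have "(\<lambda>x. \<rho> *\<^sub>R x) ` cball (0 :: real ^ 'n) 1 = cball 0 \<rho>"
    using cball_scale[of \<rho> "0 :: real ^ 'n" 1] \<rho>0 by simp
  hence "(\<lambda>y. V y + centroid) ` ((\<lambda>x. \<rho> *\<^sub>R x) ` cball 0 1) = K" using KM by (rule ssubst)
  hence "K = (\<lambda>x. V (\<rho> *\<^sub>R x) + centroid) ` cball 0 1" unfolding image_image by (rule HOL.sym)
  moreover have "linear (\<lambda>x. V (\<rho> *\<^sub>R x))"
    by (rule linearI) (simp_all add: linear_add[OF V(1)] linear_scale[OF V(1)] algebra_simps)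
  moreover have "bij (\<lambda>x. V (\<rho> *\<^sub>R x))"
  proof -
    have "bij (\<lambda>x :: real ^ 'n. \<rho> *\<^sub>R x)" using \<rho>0
      by (intro bij_betw_byWitness[where f' = "\<lambda>x. (1 / \<rho>) *\<^sub>R x"]) auto
    from bij_comp[OF this V(2)] show ?thesis by (simp add: comp_def)
  qed
  ultimately show ?thesis unfolding ellipsoid_def by blast
qed

end

section \<open>The inequality of Blaschke and Santalo\<close>

lemma marg_depends:
  assumes "\<And>w w'. (\<And>i. i \<in> I \<Longrightarrow> w i = w' i) \<Longrightarrow> f w = f w'" and "\<And>i. i \<in> I - set is \<Longrightarrow> w i = w' i"
  shows "marg is f w = marg is f w'"
  using assms
proof (induction "is" arbitrary: I f)
  case Nil
  show ?case unfolding marg.simps by (rule Nil(1)) (use Nil(2) in simp)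
next
  case (Cons i "is")
  have m: "marg1 i f v = marg1 i f v'" if v: "\<And>j. j \<in> I - {i} \<Longrightarrow> v j = v' j" for v v'
  proof -
    have "f (v(i := t)) = f (v'(i := t))" for t by (rule Cons.prems(1)) (use v in auto)
    thus ?thesis by (simp add: marg1_def)
  qed
  show ?case unfolding marg.simps
  proof (rule Cons.IH[where I = "I - {i}"])
    show "marg1 i f v = marg1 i f v'" if "\<And>j. j \<in> I - {i} \<Longrightarrow> v j = v' j" for v v' by (rule m) (rule that)
    show "w j = w' j" if "j \<in> I - {i} - set is" for j using Cons.prems(2)[of j] that by simp
  qed
qed

text \<open>All coordinates are integrated, so the base point \<open>w\<close> is free. This is
  convenient because \<open>marg_geometric\<close> changes the base point along with the
  functions.\<close>

lemma measure_marg: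
  fixes D :: "'a::euclidean_space set"
  assumes D: "convex D" "compact D" and L: "distinct is" "set is = Basis"
  shows "measure lebesgue D = marg is (bfun D) w"
proof -
  have b: "bounded D" "D \<in> sets borel" using D by (auto simp: compact_imp_bounded compact_imp_closed borel_closed)
  have lc: "lcfun Basis (bfun D)" by (rule lcfun_bfun[OF D(1) b(1)])
  have "emeasure lborel D = (\<integral>\<^sup>+x. indicator D x \<partial>lborel)" using b(2) by simp
  also have "\<dots> = nmarg is (\<lambda>w. indicator D (vec w)) (\<lambda>_. undefined)"
    by (rule nn_integral_lborel_nmarg[OF L borel_measurable_indicator[OF b(2)]])
  also have "(\<lambda>w. indicator D (vec w)) = (\<lambda>w. 1 * ennreal (bfun D w))"
    by (intro ext) (simp add: bfun_def ennreal_indicator)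
  also have "nmarg is \<dots> (\<lambda>_. undefined) = 1 * ennreal (marg is (bfun D) (\<lambda>_. undefined))"
    by (subst nmarg_marg[OF lc L(1)]) (simp_all add: L(2))
  finally have e: "emeasure lborel D = ennreal (marg is (bfun D) (\<lambda>_. undefined))" by simp
  have "lcfun (Basis - set is) (marg is (bfun D))" by (rule lcfun_marg[OF lc L(1)]) (simp add: L(2))
  hence "0 \<le> marg is (bfun D) (\<lambda>_. undefined)" by (simp add: lcfun_def)
  hence "measure lborel D = marg is (bfun D) (\<lambda>_. undefined)" using e by (simp add: measure_def)
  also have "\<dots> = marg is (bfun D) w"
  proof (rule marg_depends[where I = Basis])
    show "bfun D v = bfun D v'" if "\<And>i. i \<in> Basis \<Longrightarrow> v i = v' i" for v v'
    proof -
      have "vec v = vec v'" unfolding vec_def using that by (intro sum.cong) auto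
      thus ?thesis by (simp add: bfun_def)
    qed
  qed (simp add: L(2))
  finally show ?thesis using b(2) by simp
qed

section \<open>Bodies symmetric in the coordinate hyperplanes\<close>

lemma refl_zero: "refl u 0 = 0"
  by (simp add: refl_def)

lemma refl_Basis: "b \<in> Basis \<Longrightarrow> refl b x = x - (2 * (x \<bullet> b)) *\<^sub>R b"
  by (simp add: refl_def inner_same_Basis)

lemma refl_Basis_inner:
  assumes "b \<in> Basis" "c \<in> Basis" shows "refl b x \<bullet> c = (if c = b then - (x \<bullet> c) else x \<bullet> c)"
  using assms by (simp add: refl_Basis inner_diff_left inner_Basis)

lemma refl_eq_image:
  assumes "u \<noteq> 0" "refl u ` U \<subseteq> U" shows "refl u ` U = U"
proof
  show "U \<subseteq> refl u ` U"
  proof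
    fix x assume "x \<in> U"
    hence "refl u (refl u x) \<in> refl u ` U" using assms(2) by blast
    thus "x \<in> refl u ` U" by (simp only: refl_refl[OF assms(1)])
  qed
qed (rule assms(2))

lemma bfun_even:
  fixes U :: "'a::euclidean_space set"
  assumes "\<And>b. b \<in> Basis \<Longrightarrow> refl b ` U \<subseteq> U" shows "even_in Basis (bfun U)"
  unfolding even_in_def
proof (intro ballI allI)
  fix i :: 'a and w t assume i: "i \<in> Basis"
  have v: "vec (w(i := - s)) = refl i (vec (w(i := s)))" for s
    by (rule euclidean_eqI) (auto simp: refl_Basis_inner[OF i] vec_inner)
  have *: "vec (w(i := - s)) \<in> U" if "vec (w(i := s)) \<in> U" for s
    unfolding v using assms[OF i] that by blast
  have "vec (w(i := - t)) \<in> U \<longleftrightarrow> vec (w(i := t)) \<in> U"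
    using *[of t] *[of "- t"] by auto
  thus "bfun U (w(i := - t)) = bfun U (w(i := t))" by (simp add: bfun_def indicator_def)
qed

text \<open>Averaging an interior point with its mirror image makes one coordinate vanish and keeps
  the zeros already obtained.\<close>

lemma unconditional_zero_interior:
  fixes U :: "'a::euclidean_space set"
  assumes U: "convbody U" and r: "\<And>b. b \<in> Basis \<Longrightarrow> refl b ` U \<subseteq> U"
  shows "0 \<in> interior U"
proof -
  interpret convbody U by fact
  have ri: "refl b ` interior U \<subseteq> interior U" if b: "b \<in> Basis" for b
    using refl_interior[of b U] interior_mono[OF r[OF b]] b nonzero_Basis by metis
  have ex: "\<exists>x\<in>interior U. \<forall>b\<in>S. x \<bullet> b = 0" if "finite S" "S \<subseteq> Basis" for S
    using that
  proof (induction S rule: finite_induct)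
    case empty
    then show ?case using interior_nonempty by auto
  next
    case (insert b S)
    then obtain x where x: "x \<in> interior U" "\<forall>c\<in>S. x \<bullet> c = 0" by auto
    have b: "b \<in> Basis" using insert by simp
    have "(1/2) *\<^sub>R x + (1/2) *\<^sub>R refl b x \<in> interior U"
      using x ri[OF b] by (intro convexD[OF convex_interior[OF convex]]) auto
    moreover have "((1/2) *\<^sub>R x + (1/2) *\<^sub>R refl b x) \<bullet> c = 0" if c: "c \<in> insert b S" for c
    proof -
      have "c \<in> Basis" using c insert by auto
      thus ?thesis using refl_Basis_inner[OF b, of c x] x(2) c by (auto simp: inner_add_left split: if_splits)
    qed
    ultimately show ?case by blast
  qed
  obtain x where "x \<in> interior U" "\<forall>b\<in>Basis. x \<bullet> b = 0" using ex[OF finite_Basis order_refl] by blast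
  thus ?thesis by (simp add: euclidean_all_zero_iff)
qed

text \<open>For points of \<open>U\<close> and of its dual body with positive coordinates, the
  coordinatewise geometric mean has squared norm equal to their scalar product, hence at most 1, and
  lies in the unit ball. The indicators of \<open>U\<close>, of the dual body and of the ball thus
  satisfy the hypothesis of \<open>marg_geometric\<close>.\<close>

lemma unconditional_santalo:
  fixes U :: "'a::euclidean_space set"
  assumes U: "convbody U" and r: "\<And>b. b \<in> Basis \<Longrightarrow> refl b ` U \<subseteq> U"
  shows "measure lebesgue U * pvol U 0 \<le> (measure lebesgue (cball (0 :: 'a) 1))\<^sup>2"
proof -
  interpret convbody U by fact
  have z: "0 \<in> interior U" by (rule unconditional_zero_interior[OF U r])
  obtain L :: "'a list" where L: "set L = Basis" "distinct L" using finite_distinct_list[OF finite_Basis] by blast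
  let ?B = "cball (0 :: 'a) 1" and ?D = "dual 0 U"
  have rD: "refl b ` ?D \<subseteq> ?D" if b: "b \<in> Basis" for b
  proof -
    have b0: "b \<noteq> 0" using b by auto
    show ?thesis using refl_dual[OF b0, of 0 U] refl_eq_image[OF b0 r[OF b]] by (simp add: refl_zero)
  qed
  have rB: "refl b ` ?B \<subseteq> ?B" if b: "b \<in> Basis" for b
  proof -
    have "norm (refl b x) = norm x" for x
    proof -
      have "b \<noteq> 0" using b by auto
      hence "refl b x \<bullet> refl b x = x \<bullet> x" by (simp add: refl_inner refl_refl)
      thus ?thesis by (simp add: norm_eq)
    qed
    thus ?thesis by auto
  qed
  have geo: "sqrt (bfun U w * bfun ?D w') \<le> bfun ?B (\<lambda>i. sqrt (w i * w' i))"
    if p: "\<And>i. i \<in> Basis \<Longrightarrow> 0 < w i \<and> 0 < w' i" for w w'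
  proof (cases "vec w \<in> U \<and> vec w' \<in> ?D")
    case True
    let ?v = "vec (\<lambda>i. sqrt (w i * w' i)) :: 'a"
    have "?v \<bullet> ?v = (\<Sum>b\<in>Basis. (?v \<bullet> b) * (?v \<bullet> b))" by (rule euclidean_inner)
    also have "\<dots> = (\<Sum>b\<in>Basis. (vec w' \<bullet> b) * (vec w \<bullet> b))"
    proof (rule sum.cong)
      fix b :: 'a assume b: "b \<in> Basis"
      have "0 < w b * w' b" using p[OF b] by simp
      thus "(?v \<bullet> b) * (?v \<bullet> b) = (vec w' \<bullet> b) * (vec w \<bullet> b)" unfolding vec_inner[OF b] by (simp add: mult.commute)
    qed simp
    also have "\<dots> = vec w' \<bullet> vec w" by (rule euclidean_inner[symmetric])
    also have "\<dots> \<le> 1" using True by (simp add: dual_def)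
    finally have "norm ?v \<le> 1" by (simp add: norm_eq_sqrt_inner)
    thus ?thesis using True by (simp add: bfun_def)
  qed (auto simp: bfun_def)
  have "sqrt (marg L (bfun U) (\<lambda>_. 1) * marg L (bfun ?D) (\<lambda>_. 1)) \<le> marg L (bfun ?B) (\<lambda>i. sqrt (1 * 1))"
  proof (rule marg_geometric[where I = Basis])
    show "lcfun Basis (bfun U)" "lcfun Basis (bfun ?D)" "lcfun Basis (bfun ?B)"
      using convex compact dual_convex dual_compact[OF z] by (auto intro!: lcfun_bfun compact_imp_bounded)
    show "even_in Basis (bfun U)" by (rule bfun_even) (rule r)
    show "even_in Basis (bfun ?D)" by (rule bfun_even) (rule rD)
    show "even_in Basis (bfun ?B)" by (rule bfun_even) (rule rB)
  qed (use L geo in auto)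
  hence s: "sqrt (measure lebesgue U * pvol U 0) \<le> measure lebesgue ?B"
    using measure_marg[OF convex compact L(2,1)] measure_marg[OF dual_convex dual_compact[OF z] L(2,1)]
      measure_marg[OF convex_cball compact_cball L(2,1)] unfolding pvol_def by metis
  have "(sqrt (measure lebesgue U * pvol U 0))\<^sup>2 \<le> (measure lebesgue ?B)\<^sup>2" by (rule power_mono[OF s]) (simp add: pvol_def)
  thus ?thesis by (simp add: pvol_def)
qed

text \<open>Symmetrising along a new axis keeps the earlier symmetries, because reflections along
  different basis vectors commute and fix each other's vector. Volume and \<open>minvol\<close>
  separately do not decrease: the two bodies averaged have equal \<open>minvol\<close>, so the
  harmonic mean is that value.\<close>

lemma unconditional_body:
  fixes K :: "(real ^ 'n) set"
  assumes K: "convbody K" and S: "finite S" "S \<subseteq> Basis"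
  shows "\<exists>U :: (real ^ 'n) set. convbody U \<and> (\<forall>b\<in>S. refl b ` U \<subseteq> U) \<and> volume_product K \<le> volume_product U"
  using S
proof (induction S rule: finite_induct)
  case empty
  show ?case by (rule exI[of _ K]) (use K in simp)
next
  case (insert e S)
  obtain V :: "(real ^ 'n) set" where V: "convbody V" "\<forall>b\<in>S. refl b ` V \<subseteq> V" "volume_product K \<le> volume_product V"
    using insert.IH insert.prems by auto
  have e: "e \<in> Basis" and e0: "e \<noteq> 0" using insert by auto
  interpret v: convbody V by (rule V(1))
  have R: "convbody (refl e ` V)" by (rule refl_convbody[OF V(1) e0])
  interpret m: midpair e V "refl e ` V" by (rule midpair_same_shadow[OF V(1) R e0 same_shadow_refl])
  interpret c: cmidpair e V "refl e ` V" ..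
  define U where "U = mid e V (refl e ` V)"
  interpret u: convbody U unfolding U_def by (rule m.mid_body)
  have m0: "0 < minvol V" by (rule v.minvol_pos)
  have "2 * minvol V * minvol V / (minvol V + minvol V) \<le> minvol U"
    using c.minvol_mid unfolding refl_minvol[OF e0] U_def .
  also have "2 * minvol V * minvol V / (minvol V + minvol V) = minvol V" using m0 by (simp add: field_simps)
  finally have mv: "minvol V \<le> minvol U" .
  have "measure lebesgue V + measure lebesgue (refl e ` V) \<le> 2 * measure lebesgue U"
    unfolding U_def by (rule measure_mid_ge[OF v.convex v.compact m.b.convex m.b.compact e0 same_shadow_refl])
  moreover have "measure lebesgue (refl e ` V) = measure lebesgue V" by (rule refl_measure[OF e0 borel_closed[OF v.closed]])
  ultimately have "measure lebesgue V \<le> measure lebesgue U" by simp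
  hence "volume_product V \<le> volume_product U"
    unfolding v.volume_product_eq u.volume_product_eq using mv m0 by (intro mult_mono) auto
  hence vp: "volume_product K \<le> volume_product U" using V(3) by simp
  have inv: "refl b x \<in> U" if b: "b \<in> insert e S" and x: "x \<in> U" for b x
  proof -
    obtain s v where s: "x + s *\<^sub>R e \<in> V" "x - s *\<^sub>R e = refl e v" "v \<in> V" using x unfolding U_def mid_def by auto
    have v: "refl e (x - s *\<^sub>R e) = v" unfolding s(2) by (rule refl_refl[OF e0])
    show ?thesis
    proof (cases "b = e")
      case True
      have "refl e x + s *\<^sub>R e = refl e (x - s *\<^sub>R e)"
        by (simp add: linear_diff[OF refl_linear] linear_scale[OF refl_linear] refl_self[OF e0])
      hence 1: "refl e x + s *\<^sub>R e \<in> V" using v s(3) by simp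
      have "refl e x - s *\<^sub>R e = refl e (x + s *\<^sub>R e)"
        by (simp add: linear_add[OF refl_linear] linear_scale[OF refl_linear] refl_self[OF e0])
      hence "refl e x - s *\<^sub>R e \<in> refl e ` V" using s(1) by simp
      thus ?thesis using 1 unfolding U_def mid_def True by blast
    next
      case False
      hence bS: "b \<in> S" and bB: "b \<in> Basis" using b insert.prems by auto
      have be: "refl b e = e" using False e bB by (simp add: refl_Basis inner_Basis)
      have "refl b x + s *\<^sub>R e = refl b (x + s *\<^sub>R e)"
        by (simp add: linear_add[OF refl_linear] linear_scale[OF refl_linear] be)
      hence 1: "refl b x + s *\<^sub>R e \<in> V" using s(1) V(2) bS by auto
      have "refl b x - s *\<^sub>R e = refl b (x - s *\<^sub>R e)"
        by (simp add: linear_diff[OF refl_linear] linear_scale[OF refl_linear] be)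
      also have "\<dots> = refl b (refl e v)" by (simp only: s(2))
      also have "\<dots> = refl e (refl b v)"
        using False e bB by (simp add: refl_Basis inner_Basis inner_diff_left algebra_simps)
      finally have "refl b x - s *\<^sub>R e \<in> refl e ` V" using s(3) V(2) bS by auto
      thus ?thesis using 1 unfolding U_def mid_def by blast
    qed
  qed
  show ?case using u.convbody_axioms vp inv by (intro exI[of _ U]) blast
qed

theorem blaschke_santalo:
  fixes K :: "(real ^ 'n) set"
  assumes K: "convex_body K"
  shows "volume_product K \<le> (measure lebesgue (cball (0 :: real ^ 'n) 1))\<^sup>2"
proof -
  have "convbody K" using K by (simp add: convbody_def)
  then obtain U :: "(real ^ 'n) set" where U: "convbody U" "\<forall>b\<in>Basis. refl b ` U \<subseteq> U" "volume_product K \<le> volume_product U"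
    using unconditional_body[OF _ finite_Basis order_refl] by blast
  interpret u: convbody U by (rule U(1))
  have r: "\<And>b. b \<in> Basis \<Longrightarrow> refl b ` U \<subseteq> U" using U(2) by blast
  have "volume_product U \<le> measure lebesgue U * pvol U 0"
    unfolding u.volume_product_eq by (intro mult_left_mono minvol_le unconditional_zero_interior[OF U(1) r]) auto
  also have "\<dots> \<le> (measure lebesgue (cball (0 :: real ^ 'n) 1))\<^sup>2" by (rule unconditional_santalo[OF U(1) r])
  finally show ?thesis using U(3) by simp
qed

text \<open>The dual body of the unit ball at \<open>w\<close> is given by
  \<open>norm y \<le> 1 + y \<bullet> w\<close>. It is an ellipsoid of revolution with a focus at 0
  and eccentricity \<open>norm w\<close>. The point in the statement is its centre, and its smallest
  semi-axis \<open>1 / sqrt (1 - (norm w)^2)\<close> is at least 1, so a unit ball fits around the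
  centre.\<close>

lemma ball_subset_dual_ball:
  fixes w :: "'a::euclidean_space"
  assumes w: "norm w < 1"
  shows "cball ((1 / (1 - (norm w)\<^sup>2)) *\<^sub>R w) 1 \<subseteq> dual w (cball 0 1)"
proof
  define s where "s = (norm w)\<^sup>2"
  have s: "0 \<le> s" "s < 1" "w \<bullet> w = s"
    using abs_square_less_1[of "norm w"] w by (simp_all add: s_def power2_norm_eq_inner)
  fix y assume "y \<in> cball ((1 / (1 - (norm w)\<^sup>2)) *\<^sub>R w) 1"
  hence y: "norm (y - (1 / (1 - s)) *\<^sub>R w) \<le> 1" by (simp add: dist_norm norm_minus_commute s_def)
  define p where "p = y \<bullet> w"
  define k where "k = 1 / (1 - s)"
  have k: "1 \<le> k" "k * (1 - s) = 1" using s by (auto simp: k_def)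
  have "(norm (y - k *\<^sub>R w))\<^sup>2 \<le> 1" using y by (simp add: k_def power_le_one)
  hence "y \<bullet> y - 2 * k * p + k * k * s \<le> 1"
    unfolding power2_norm_eq_inner by (simp add: inner_diff_left inner_diff_right inner_commute p_def s(3) algebra_simps)
  hence yy: "y \<bullet> y \<le> 1 + 2 * k * p - k * k * s" by simp
  have ks: "k * s = k - 1" using k(2) by (simp add: algebra_simps)
  have "(1 + p)\<^sup>2 - (1 + 2 * k * p - k * k * s) = (p - k * s)\<^sup>2 + k * s * (k - k * s)"
    unfolding mult.assoc[of k k s] ks by (simp add: power2_eq_square algebra_simps)
  also have "\<dots> = (p - k * s)\<^sup>2 + k * s" unfolding ks by simp
  also have "0 \<le> \<dots>" using s k by simp
  finally have sq: "(norm y)\<^sup>2 \<le> (1 + p)\<^sup>2" using yy by (simp add: power2_norm_eq_inner)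
  \<comment> \<open>The squared inequality \<open>sq\<close> also admits a negative
    \<open>1 + p\<close>; this estimate excludes it.\<close>
  have "\<bar>(y - k *\<^sub>R w) \<bullet> w\<bar> \<le> norm (y - k *\<^sub>R w) * norm w" by (rule Cauchy_Schwarz_ineq2)
  also have "\<dots> \<le> 1 * 1" using y w by (intro mult_mono) (auto simp: k_def)
  finally have "- 1 \<le> p - k * s" by (simp add: inner_diff_left p_def s(3))
  hence "0 \<le> 1 + p" using s k by (simp add: ks)
  hence ny: "norm y \<le> 1 + p" using sq by (simp add: power2_le_iff_abs_le)
  have "y \<bullet> (x - w) \<le> 1" if "x \<in> cball 0 1" for x
  proof -
    have "y \<bullet> x \<le> norm y * norm x" by (rule norm_cauchy_schwarz)
    also have "\<dots> \<le> norm y * 1" using that by (intro mult_left_mono) auto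
    finally show ?thesis using ny by (simp add: inner_diff_right p_def)
  qed
  thus "y \<in> dual w (cball 0 1)" by (simp add: dual_def)
qed

lemma unit_ball_convbody: "convbody (cball (0 :: 'a::euclidean_space) 1)"
  by (simp add: convbody_def convex_body_def)

text \<open>\<open>T\<close> multiplies the volume of the ball by \<open>k\<close>, and the adjoint
  maps the dual body of \<open>E\<close> onto a dual body of the ball with the same factor. The
  factors cancel, which leaves the unit ball with an arbitrary interior centre
  \<open>w\<close>.\<close>

lemma ellipsoid_volume_product:
  fixes E :: "(real ^ 'n) set"
  assumes E: "convex_body E" "ellipsoid E"
  shows "(measure lebesgue (cball (0 :: real ^ 'n) 1))\<^sup>2 \<le> volume_product E"
proof -
  let ?B = "cball (0 :: real ^ 'n) 1"
  interpret convbody E using E(1) by (simp add: convbody_def)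
  interpret b: convbody ?B by (rule unit_ball_convbody)
  obtain T :: "real ^ 'n \<Rightarrow> real ^ 'n" and c where T: "linear T" "bij T" "E = (\<lambda>x. T x + c) ` ?B"
    using E(2) unfolding ellipsoid_def by blast
  have ET: "E = (\<lambda>x. c + x) ` (T ` ?B)" unfolding T(3) by (simp add: image_image add.commute)
  obtain k where k: "scales T k" "scales (adjoint T) k" using linear_scales[OF T(1) bij_is_surj[OF T(2)]] by blast
  have k0: "0 < k" using k by (simp add: scales_def)
  obtain z where z: "z \<in> interior E" "pvol E z = minvol E" by (rule minvol_attained)
  have "interior E = (\<lambda>x. c + x) ` (T ` interior ?B)"
    unfolding ET interior_translation interior_bijective_linear_image[OF T(1,2)] ..
  then obtain w where w: "norm w < 1" "z = c + T w" using z(1) by auto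
  have "measure lebesgue E = measure lebesgue (T ` ?B)" unfolding ET by (rule measure_translation)
  also have "\<dots> = k * measure lebesgue ?B" by (rule scales_image(3)[OF k(1) T(2)]) simp
  finally have mE: "measure lebesgue E = k * measure lebesgue ?B" .
  note aT = adjoint_bij[OF T(1,2)]
  have "adjoint T ` dual z E = dual w ?B"
  proof -
    have "y \<in> dual z E \<longleftrightarrow> adjoint T y \<in> dual w ?B" for y
    proof -
      have "y \<bullet> ((T x + c) - z) = adjoint T y \<bullet> (x - w)" for x
        using adjoint_works[OF T(1), of "x - w" y] by (simp add: w(2) linear_diff[OF T(1)] inner_commute)
      thus ?thesis unfolding dual_def T(3) by simp
    qed
    thus ?thesis using aT(2) by (auto simp: bij_def surj_def image_iff) metis
  qed
  hence "measure lebesgue (dual w ?B) = k * pvol E z"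
    using scales_image(3)[OF k(2) aT(2) borel_closed[OF dual_closed], of z E] by (simp add: pvol_def)
  moreover have "measure lebesgue ?B \<le> measure lebesgue (dual w ?B)"
  proof -
    have "measure lebesgue ?B = measure lebesgue (cball ((1 / (1 - (norm w)\<^sup>2)) *\<^sub>R w) 1)" by (simp add: content_cball)
    also have "\<dots> \<le> measure lebesgue (dual w ?B)"
      using w(1) by (intro measure_mono_fmeasurable ball_subset_dual_ball b.hvol_measurable(2)) auto
    finally show ?thesis .
  qed
  ultimately have "measure lebesgue ?B * measure lebesgue ?B \<le> measure lebesgue ?B * (k * minvol E)"
    unfolding z(2) by (intro mult_left_mono) auto
  thus ?thesis unfolding volume_product_eq mE by (simp add: power2_eq_square mult_ac)
qed

section \<open>Local maximizers\<close>

text \<open>A common substitute for the two metrics: small \<open>\<delta>\<close> makes either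
  distance small, so the convergence of the symmetrals is examined only once.\<close>

definition mutually_close :: "real \<Rightarrow> 'a::euclidean_space set \<Rightarrow> 'a set \<Rightarrow> bool" where
  "mutually_close \<delta> K L \<longleftrightarrow> (\<forall>x\<in>K. \<exists>y\<in>L. dist x y \<le> \<delta>) \<and> (\<forall>y\<in>L. \<exists>x\<in>K. dist x y \<le> \<delta>)"

lemma hausdorff_distance_le:
  assumes "mutually_close \<delta> K L" "0 \<le> \<delta>" shows "hausdorff_distance K L \<le> \<delta>"
  unfolding hausdorff_distance_def
proof (rule cInf_lower)
  have "x \<in> L + cball 0 \<delta>" if "y \<in> L" "dist x y \<le> \<delta>" for x y :: 'a and L
  proof -
    have "x - y \<in> cball 0 \<delta>" using that(2) by (simp add: dist_norm norm_minus_commute)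
    from set_plus_intro[OF that(1) this] show ?thesis by simp
  qed
  moreover have "x \<in> L + cball 0 \<delta>" if "y \<in> L" "dist y x \<le> \<delta>" for x y :: 'a and L
    using calculation[OF that(1)] that(2) by (simp add: dist_commute)
  ultimately show "\<delta> \<in> {r. 0 \<le> r \<and> K \<subseteq> L + cball 0 r \<and> L \<subseteq> K + cball 0 r}"
    using assms unfolding mutually_close_def by (simp add: subset_iff) blast
qed (auto intro!: bdd_belowI[of _ 0])

text \<open>A point \<open>q\<close> of the smaller ball outside \<open>L\<close> would be separated
  from \<open>L\<close>. Moved by \<open>\<delta>\<close> away from \<open>L\<close> it is still in
  \<open>K\<close>, and its neighbour in \<open>L\<close> would lie on the wrong side of the
  hyperplane.\<close>

lemma cball_in_close:
  assumes L: "convex L" "closed L" and mc: "mutually_close \<delta> K L" "0 \<le> \<delta>" and K: "cball x0 r \<subseteq> K"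
  shows "cball x0 (r - \<delta>) \<subseteq> L"
proof
  fix q assume q: "q \<in> cball x0 (r - \<delta>)"
  show "q \<in> L"
  proof (rule ccontr)
    assume "q \<notin> L"
    then obtain a b where ab: "a \<bullet> q < b" "\<And>x. x \<in> L \<Longrightarrow> b < a \<bullet> x"
      using separating_hyperplane_closed_point[OF L] by metis
    define p where "p = q - (\<delta> / norm a) *\<^sub>R a"
    have np: "dist q p \<le> \<delta>" using mc(2) by (cases "a = 0") (auto simp: p_def dist_norm)
    have "dist x0 p \<le> r" using q np dist_triangle[of x0 p q] by simp
    hence "p \<in> K" using K by auto
    then obtain l where l: "l \<in> L" "dist p l \<le> \<delta>" using mc(1) by (auto simp: mutually_close_def)
    have "a \<bullet> p = a \<bullet> q - \<delta> * norm a"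
      by (cases "a = 0") (auto simp: p_def inner_diff_right power2_norm_eq_inner[symmetric] power2_eq_square)
    moreover have "a \<bullet> (l - p) \<le> norm a * \<delta>"
    proof -
      have "a \<bullet> (l - p) \<le> norm a * norm (l - p)" by (rule norm_cauchy_schwarz)
      also have "\<dots> \<le> norm a * \<delta>" using l(2) by (intro mult_left_mono) (auto simp: dist_norm norm_minus_commute)
      finally show ?thesis .
    qed
    ultimately have "a \<bullet> l \<le> a \<bullet> q" by (simp add: inner_diff_right mult.commute)
    thus False using ab(1) ab(2)[OF l(1)] by simp
  qed
qed

lemma enlarge:
  fixes x0 :: "'a::euclidean_space"
  assumes L: "convex L" "cball x0 r \<subseteq> L" and r: "0 < r" and \<delta>: "0 \<le> \<delta>" and y: "y \<in> L" "dist x y \<le> \<delta>"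
  shows "\<exists>v\<in>L. x - x0 = (1 + \<delta> / r) *\<^sub>R (v - x0)"
proof -
  define t where "t = 1 + \<delta> / r"
  have t: "1 \<le> t" using r \<delta> by (simp add: t_def)
  show ?thesis
  proof (cases "\<delta> = 0")
    case True
    thus ?thesis using y by (intro bexI[of _ y]) auto
  next
    case False
    hence d: "0 < \<delta>" using \<delta> by simp
    \<comment> \<open>The excess \<open>x - y\<close> rescaled to length at most \<open>r\<close>,
      so that \<open>b\<close> lies in the inscribed ball. The point sought is the combination of
      \<open>y\<close> and \<open>b\<close> with weights \<open>1 / t\<close> and
      \<open>1 - 1 / t\<close>.\<close>
    define b where "b = x0 + (r / \<delta>) *\<^sub>R (x - y)"
    have "norm ((r / \<delta>) *\<^sub>R (x - y)) \<le> (r / \<delta>) * \<delta>"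
      unfolding norm_scaleR using y(2) r d by (intro mult_mono) (auto simp: dist_norm)
    hence "norm ((r / \<delta>) *\<^sub>R (x - y)) \<le> r" using d by simp
    hence "b \<in> L" using L(2) by (auto simp: b_def dist_norm)
    have sum1: "1 / t + (1 - 1 / t) = 1" by simp
    have v: "(1 / t) *\<^sub>R y + (1 - 1 / t) *\<^sub>R b \<in> L"
      using t by (intro convexD[OF L(1) y(1) \<open>b \<in> L\<close>]) (auto simp: field_simps)
    have "t * (1 - 1 / t) = \<delta> / r" using t by (simp add: right_diff_distrib t_def)
    hence "t *\<^sub>R ((1 - 1 / t) *\<^sub>R (b - x0)) = (\<delta> / r * (r / \<delta>)) *\<^sub>R (x - y)"
      by (simp only: b_def add_diff_cancel_left' scaleR_scaleR mult.assoc[symmetric])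
    also have "\<delta> / r * (r / \<delta>) = 1" using d r by simp
    finally have e: "t *\<^sub>R ((1 - 1 / t) *\<^sub>R (b - x0)) = x - y" by simp
    have "t *\<^sub>R (((1 / t) *\<^sub>R y + (1 - 1 / t) *\<^sub>R b) - x0) = t *\<^sub>R ((1 / t) *\<^sub>R (y - x0)) + t *\<^sub>R ((1 - 1 / t) *\<^sub>R (b - x0))"
      unfolding scaleR_add_right[symmetric] by (rule arg_cong[of _ _ "(*\<^sub>R) t"]) (simp add: algebra_simps)
    also have "\<dots> = x - x0" unfolding e using t by simp
    finally show ?thesis using v unfolding t_def[symmetric] by (intro bexI[OF _ v]) simp
  qed
qed

text \<open>\<open>T\<close> is the dilation by
  \<open>r / (r - \<delta>) = 1 + \<delta> / (r - \<delta>)\<close>, the factor that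
  \<open>enlarge\<close> requires for \<open>L\<close> with its ball of radius
  \<open>r - \<delta>\<close>. The reverse inclusion contributes \<open>1 + \<delta> / r\<close>, as
  \<open>K\<close> contains a ball of radius \<open>r\<close>; the product of the factors is the
  bound.\<close>

lemma banach_mazur_distance_le:
  assumes K: "convex K" and L: "convex L" "closed L" and mc: "mutually_close \<delta> K L"
    and r: "cball x0 r \<subseteq> K" "0 \<le> \<delta>" "\<delta> < r"
  shows "banach_mazur_distance K L \<le> (r + \<delta>) / (r - \<delta>)"
  unfolding banach_mazur_distance_def
proof (rule cInf_lower)
  define a where "a = r / (r - \<delta>)"
  have a: "0 < a" "a = 1 + \<delta> / (r - \<delta>)" "(r + \<delta>) / (r - \<delta>) = a * (1 + \<delta> / r)" using r by (auto simp: a_def field_simps)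
  let ?T = "\<lambda>x :: 'a. a *\<^sub>R x"
  have T: "linear ?T" by (rule linearI) (auto simp: algebra_simps)
  have bT: "bij ?T" using a(1) by (intro bij_betw_byWitness[where f' = "\<lambda>x. (1 / a) *\<^sub>R x"]) auto
  have rL: "cball x0 (r - \<delta>) \<subseteq> L" by (rule cball_in_close[OF L mc r(2,1)])
  have 1: "(\<lambda>u. u - x0) ` K \<subseteq> ?T ` (\<lambda>v. v - x0) ` L"
  proof (intro subsetI)
    fix w assume "w \<in> (\<lambda>u. u - x0) ` K"
    then obtain x where x: "x \<in> K" "w = x - x0" by blast
    then obtain y where y: "y \<in> L" "dist x y \<le> \<delta>" using mc by (auto simp: mutually_close_def)
    obtain v where v: "v \<in> L" "x - x0 = a *\<^sub>R (v - x0)" using enlarge[OF L(1) rL _ r(2) y] r(3) unfolding a(2) by auto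
    thus "w \<in> ?T ` (\<lambda>v. v - x0) ` L" unfolding x(2) by blast
  qed
  have 2: "?T ` (\<lambda>v. v - x0) ` L \<subseteq> (\<lambda>u. ((r + \<delta>) / (r - \<delta>)) *\<^sub>R (u - x0)) ` K"
  proof (intro subsetI)
    fix w assume "w \<in> ?T ` (\<lambda>v. v - x0) ` L"
    then obtain x where x: "x \<in> L" "w = a *\<^sub>R (x - x0)" by blast
    then obtain y where y: "y \<in> K" "dist x y \<le> \<delta>" using mc by (auto simp: mutually_close_def dist_commute)
    obtain v where v: "v \<in> K" "x - x0 = (1 + \<delta> / r) *\<^sub>R (v - x0)" using enlarge[OF K r(1) _ r(2) y] r(2,3) by auto
    show "w \<in> (\<lambda>u. ((r + \<delta>) / (r - \<delta>)) *\<^sub>R (u - x0)) ` K"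
      by (rule image_eqI[OF _ v(1)]) (simp only: x(2) v(2) a(3) scaleR_scaleR)
  qed
  have "1 \<le> (r + \<delta>) / (r - \<delta>)" using r by (simp add: field_simps)
  thus "(r + \<delta>) / (r - \<delta>) \<in> {t. 1 \<le> t \<and> (\<exists>x y T. linear T \<and> bij T \<and>
            (\<lambda>u. u - x) ` K \<subseteq> T ` (\<lambda>v. v - y) ` L \<and>
            T ` (\<lambda>v. v - y) ` L \<subseteq> (\<lambda>u. t *\<^sub>R (u - x)) ` K)}"
    using T bT 1 2 by (intro CollectI conjI exI[of _ x0] exI[of _ ?T])
qed (auto intro!: bdd_belowI[of _ 1])

context cconvbody
begin

lemma steiner_path_mutually_close:
  assumes u: "u \<noteq> 0" and \<delta>: "0 < \<delta>"
  shows "\<exists>N. \<forall>k\<ge>N. mutually_close \<delta> K (steiner_path u K k)"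
proof -
  obtain R where R: "0 < R" "\<And>x. x \<in> K \<Longrightarrow> norm x \<le> R"
    using compact_imp_bounded[OF compact] bounded_pos by metis
  define M where "M = R * norm u / (u \<bullet> u)"
  have M: "\<bar>x \<bullet> u\<bar> / (u \<bullet> u) \<le> M" if "x \<in> K" for x
  proof -
    have "\<bar>x \<bullet> u\<bar> \<le> norm x * norm u" by (rule Cauchy_Schwarz_ineq2)
    also have "\<dots> \<le> R * norm u" using R(2)[OF that] by (intro mult_right_mono) auto
    finally show ?thesis unfolding M_def by (intro divide_right_mono) auto
  qed
  have "(\<lambda>k. M * norm u * (1 / 2) ^ k) \<longlonglongrightarrow> M * norm u * 0" by (intro tendsto_intros) simp
  hence "\<forall>\<^sub>F k in sequentially. M * norm u * (1 / 2) ^ k < \<delta>" using \<delta> by (intro order_tendstoD) auto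
  then obtain N where N: "\<And>k. N \<le> k \<Longrightarrow> M * norm u * (1 / 2) ^ k < \<delta>" by (auto simp: eventually_sequentially)
  have "mutually_close \<delta> K (steiner_path u K k)" if k: "N \<le> k" for k
  proof -
    have c: "dist x (x + s *\<^sub>R u) \<le> \<delta>" "dist (x + s *\<^sub>R u) x \<le> \<delta>" if "\<bar>s\<bar> \<le> M / 2 ^ k" for x s
    proof -
      have "\<bar>s\<bar> * norm u \<le> (M / 2 ^ k) * norm u" using that by (rule mult_right_mono) simp
      also have "\<dots> = M * norm u * (1 / 2) ^ k" by (simp add: power_one_over)
      finally have "\<bar>s\<bar> * norm u \<le> \<delta>" using N[OF k] by simp
      thus "dist x (x + s *\<^sub>R u) \<le> \<delta>" "dist (x + s *\<^sub>R u) x \<le> \<delta>" by (simp_all add: dist_norm)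
    qed
    show ?thesis unfolding mutually_close_def using steiner_path_close[OF u M, of k] c by blast
  qed
  thus ?thesis by blast
qed

lemma ellipsoid_if_local_maximum:
  assumes \<delta>: "0 < \<delta>" and max: "\<And>L. convex_body L \<Longrightarrow> mutually_close \<delta> K L \<Longrightarrow> volume_product L \<le> volume_product K"
  shows "ellipsoid K"
proof (rule ellipsoid_if_all_reflections)
  fix u :: "real ^ 'n" assume u: "u \<noteq> 0"
  obtain N where N: "\<forall>k\<ge>N. mutually_close \<delta> K (steiner_path u K k)" using steiner_path_mutually_close[OF u \<delta>] by blast
  show "\<exists>q d. q \<bullet> u = - 2 \<and> (\<forall>x\<in>K. x + (q \<bullet> x + d) *\<^sub>R u \<in> K)"
  proof (rule affine_reflection[OF u])
    fix k assume "N \<le> k"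
    thus "volume_product (steiner_path u K k) \<le> volume_product K"
      using steiner_path_props[OF u, of k] N by (intro max) (auto simp: convbody_def)
  qed
qed

end

theorem theorem2:
  fixes K :: "(real ^ 'n) set"
  assumes "convex_body K"
  shows "(hausdorff_local_maximizer K \<longleftrightarrow> ellipsoid K) \<and>
         (banach_mazur_local_maximizer K \<longleftrightarrow> ellipsoid K)"
proof -
  interpret convbody K using assms by (simp add: convbody_def)
  interpret cconvbody K ..
  have max: "volume_product L \<le> volume_product K" if "ellipsoid K" "convex_body L" for L :: "(real ^ 'n) set"
    using blaschke_santalo[OF that(2)] ellipsoid_volume_product[OF assms that(1)] by simp
  have "ellipsoid K" if h: "hausdorff_local_maximizer K"
  proof -
    obtain \<epsilon> where \<epsilon>: "0 < \<epsilon>" "\<And>L. convex_body L \<Longrightarrow> hausdorff_distance K L < \<epsilon> \<Longrightarrow> volume_product L \<le> volume_product K"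
      using h unfolding hausdorff_local_maximizer_def by blast
    show ?thesis
    proof (rule ellipsoid_if_local_maximum[of "\<epsilon> / 2"])
      fix L assume L: "convex_body L" "mutually_close (\<epsilon> / 2) K L"
      have "hausdorff_distance K L \<le> \<epsilon> / 2" by (rule hausdorff_distance_le[OF L(2)]) (use \<epsilon>(1) in simp)
      thus "volume_product L \<le> volume_product K" using \<epsilon> L(1) by simp
    qed (use \<epsilon>(1) in simp)
  qed
  moreover have "ellipsoid K" if b: "banach_mazur_local_maximizer K"
  proof -
    obtain \<epsilon> where \<epsilon>: "0 < \<epsilon>" "\<And>L. convex_body L \<Longrightarrow> banach_mazur_distance K L < 1 + \<epsilon> \<Longrightarrow> volume_product L \<le> volume_product K"
      using b unfolding banach_mazur_local_maximizer_def by blast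
    obtain x0 where "x0 \<in> interior K" using interior_nonempty by blast
    then obtain r where r: "0 < r" "cball x0 r \<subseteq> K" by (rule interior_cball)
    \<comment> \<open>The goal \<open>(r + \<delta>) / (r - \<delta>) < 1 + \<epsilon>\<close>
      amounts to \<open>\<delta> * (2 + \<epsilon>) < \<epsilon> * r\<close>; writing 3 in place of
      2 makes the inequality strict.\<close>
    define \<delta> where "\<delta> = \<epsilon> * r / (3 + \<epsilon>)"
    have \<delta>: "0 < \<delta>" "\<delta> * (3 + \<epsilon>) = \<epsilon> * r" using \<epsilon>(1) r(1) by (auto simp: \<delta>_def)
    have "\<delta> * (3 + \<epsilon>) < r * (3 + \<epsilon>)" unfolding \<delta>(2) using r(1) \<epsilon>(1) by (simp add: algebra_simps)
    hence \<delta>r: "\<delta> < r" using \<epsilon>(1) by simp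
    have "r + \<delta> < (1 + \<epsilon>) * (r - \<delta>)" using \<delta> by (simp add: algebra_simps)
    hence t: "(r + \<delta>) / (r - \<delta>) < 1 + \<epsilon>" using \<delta>r by (simp add: pos_divide_less_eq)
    show ?thesis
    proof (rule ellipsoid_if_local_maximum[OF \<delta>(1)])
      fix L assume L: "convex_body L" "mutually_close \<delta> K L"
      have cl: "convex L" "closed L" using L(1) by (auto simp: convex_body_def compact_imp_closed)
      have "banach_mazur_distance K L \<le> (r + \<delta>) / (r - \<delta>)"
        by (rule banach_mazur_distance_le[OF convex cl L(2) r(2) less_imp_le[OF \<delta>(1)] \<delta>r])
      thus "volume_product L \<le> volume_product K" using \<epsilon>(2)[OF L(1)] t by simp
    qed
  qed
  \<comment> \<open>The maximum is global, so any positive radius serves as the witness.\<close>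
  moreover have "hausdorff_local_maximizer K" "banach_mazur_local_maximizer K" if "ellipsoid K"
    using max[OF that] unfolding hausdorff_local_maximizer_def banach_mazur_local_maximizer_def
    by (auto intro!: exI[of _ "1 :: real"])
  ultimately show ?thesis by blast
qed

end
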